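(* Let $H$ be a finite-dimensional semisimple and cosemisimple Hopf algebra over a field $\Bbbk$, $V$ a left-left Yetter--Drinfeld module over $H$ with finite-dimensional Nichols algebra $B=B(V)$, and $A=B(V)\#H$ the bosonisation. There is a natural isomorphism $$\mathrm{Bit}_A^A(\mathrm{Inf}_H^A(X),N)\cong\mathrm{Bit}_H^H(X,\langle N\rangle),\qquad X\in\mathsf{Mod}_H^H,\quad N\in{}_A\mathsf{YD}.$$
   Context: **Yetter--Drinfeld modules.** For a Hopf algebra $K$, ${}_K\mathsf{YD}$ is the category of left-left Yetter--Drinfeld modules: left $K$-modules and left $K$-comodules $N$ (coaction $n\mapsto n_{|-1|}\otimes n_{|0|}$) with $(h\bullet n)_{|-1|}\otimes(h\bullet n)_{|0|}=h_{(1)}n_{|-1|}S(h_{(3)})\otimes h_{(2)}\bullet n_{|0|}$. It is a braided monoidal category. **Nichols algebra.** $B(V)=\bigoplus_{n\ge0}B_n(V)$ is the graded Hopf algebra in the braided category ${}_H\mathsf{YD}$ (unique up to isomorphism) with $B_0(V)=\Bbbk$ the trivial Yetter--Drinfeld module, generated as an algebra by $B_1(V)\cong V$, and with space of primitive elements equal to $B_1(V)$. **Bosonisation.** $A=B\#H$ is $B\otimes H$ with $(b\#g)(d\#h)=b(g_{(1)}\bullet d)\#g_{(2)}h$ and $\Delta(b\#g)=b_{(1)}\#(b_{(2)})_{|-1|}g_{(1)}\otimes(b_{(2)})_{|0|}\#g_{(2)}$. There are Hopf algebra maps $\iota:H\to A$, $h\mapsto1\#h$, and $\pi:A\to H$,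 $b\#h\mapsto\varepsilon(b)h$, with $\pi\iota=\mathrm{id}$. **Bitensor products.** $\mathsf{Mod}_K^K$ is the category of vector spaces that are right $K$-modules and right $K$-comodules, with no compatibility. For $X\in\mathsf{Mod}_K^K$ and a left-left module-comodule $N$ over $K$, $\mathrm{Bit}_K^K(X,N)$ is the image of the composite $X\square_KN\hookrightarrow X\otimes N\twoheadrightarrow X\otimes_KN$ of the inclusion of the cotensor product and the projection to the tensor product over $K$. **Inflation.** $\mathrm{Inf}_H^A(X)\in\mathsf{Mod}_A^A$ is $X$ with action $x\cdot a=x\triangleleft\pi(a)$ and coaction $x\mapsto x_{[0]}\otimes\iota(x_{[1]})$. **The functor $\langle-\rangle:{}_A\mathsf{YD}\to{}_H\mathsf{YD}$.** For $(N,\bullet,\delta)\in{}_A\mathsf{YD}$, $\mathrm{Res}_H^A(N)\in{}_H\mathsf{YD}$ is $N$ with action restricted along $\iota$ and coaction $n\mapsto\pi(n_{|-1|})\otimes n_{|0|}$. Let $N^{\mathrm{co}H}=\{n\in N\mid\delta(n)\in\iota(H)\otimes N\}$ and $B^+N$ the span of all $b\bullet n$ with $b\in\ker\varepsilon_B$ ($b$ identified with $b\#1$), $n\in N$; both are sub-Yetter--Drinfeld modules of $\mathrm{Res}_H^A(N)$. $\langle N\rangle:=N^{\mathrm{co}H}/(N^{\mathrm{co}H}\cap B^+N)$. *)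

theory Defs
  imports "Jordan_Normal_Form.Missing_VectorSpace" "HOL-Algebra.AbelCoset"
begin

text \<open>
  Vector spaces are module records with explicit carriers over a field record \<open>K\<close>. The \<open>mult\<close> and
  \<open>one\<close> components of such a record are meaningful only where an algebra is intended.
\<close>

record ('k, 'h) hopf_data = "('k, 'h) module" +
  comult :: "'h \<Rightarrow> ('h \<times> 'h \<Rightarrow> 'k) set"
  counit :: "'h \<Rightarrow> 'k"
  antipode :: "'h \<Rightarrow> 'h"

record ('k, 'h, 'n) lmodcomod = "('k, 'n) module" +
  lact :: "'h \<Rightarrow> 'n \<Rightarrow> 'n"
  lcoact :: "'n \<Rightarrow> ('h \<times> 'n \<Rightarrow> 'k) set"

record ('k, 'h, 'x) rmodcomod = "('k, 'x) module" +
  ract :: "'x \<Rightarrow> 'h \<Rightarrow> 'x"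
  rcoact :: "'x \<Rightarrow> ('x \<times> 'h \<Rightarrow> 'k) set"

record ('k, 'h, 'b) braided_hopf_data = "('k, 'h, 'b) lmodcomod" +
  bcomult :: "'b \<Rightarrow> ('b \<times> 'b \<Rightarrow> 'k) set"
  bcounit :: "'b \<Rightarrow> 'k"
  bantipode :: "'b \<Rightarrow> 'b"


context
  fixes K :: "'k ring"
begin

subsection \<open>Quotients and tensor products of vector spaces\<close>

definition ground :: "('k, 'k) module" where
  "ground = \<lparr>carrier = carrier K, mult = mult K, one = \<one>\<^bsub>K\<^esub>, zero = \<zero>\<^bsub>K\<^esub>, add = add K, smult = mult K\<rparr>"

text \<open>The map into cosets of \<open>W\<close> in \<open>V\<close> induced by a map \<open>f\<close> into \<open>V\<close>; the union is over equal
  cosets if the induced map is well defined.\<close>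
definition induced :: "('k, 'v, 'z) module_scheme \<Rightarrow> 'v set \<Rightarrow> ('u \<Rightarrow> 'v) \<Rightarrow> 'u set \<Rightarrow> 'v set" where
  "induced V W f C = (\<Union>u\<in>C. W +>\<^bsub>V\<^esub> f u)"

definition quotient_space :: "('k, 'v, 'z) module_scheme \<Rightarrow> 'v set \<Rightarrow> ('k, 'v set) module" where
  "quotient_space V W = \<lparr>carrier = a_rcosets\<^bsub>V\<^esub> W, mult = (\<lambda>_ _. W), one = W, zero = W,
     add = (\<lambda>C D. C <+>\<^bsub>V\<^esub> D), smult = (\<lambda>c. induced V W (\<lambda>v. c \<odot>\<^bsub>V\<^esub> v))\<rparr>"

definition free_space :: "'s set \<Rightarrow> ('k, 's \<Rightarrow> 'k) module" where
  "free_space S = \<lparr>carrier = {f. range f \<subseteq> carrier K \<and> finite {s. f s \<noteq> \<zero>\<^bsub>K\<^esub>} \<and> {s. f s \<noteq> \<zero>\<^bsub>K\<^esub>} \<subseteq> S},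
     mult = (\<lambda>_ _ _. \<zero>\<^bsub>K\<^esub>), one = (\<lambda>_. \<zero>\<^bsub>K\<^esub>), zero = (\<lambda>_. \<zero>\<^bsub>K\<^esub>),
     add = (\<lambda>f g s. f s \<oplus>\<^bsub>K\<^esub> g s), smult = (\<lambda>c f s. c \<otimes>\<^bsub>K\<^esub> f s)\<rparr>"

definition basis_vector :: "'s \<Rightarrow> 's \<Rightarrow> 'k" where
  "basis_vector s = (\<lambda>t. if t = s then \<one>\<^bsub>K\<^esub> else \<zero>\<^bsub>K\<^esub>)"

definition tensor_rel ::
  "('k, 'v, 'y) module_scheme \<Rightarrow> ('k, 'w, 'z) module_scheme \<Rightarrow> ('v \<times> 'w \<Rightarrow> 'k) set" where
  "tensor_rel V W = (let F = free_space (carrier V \<times> carrier W); e = (\<lambda>x y. basis_vector (x, y)) in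
     module.span K F
      ({e (x \<oplus>\<^bsub>V\<^esub> x') y \<ominus>\<^bsub>F\<^esub> (e x y \<oplus>\<^bsub>F\<^esub> e x' y) | x x' y.
          x \<in> carrier V \<and> x' \<in> carrier V \<and> y \<in> carrier W} \<union>
       {e x (y \<oplus>\<^bsub>W\<^esub> y') \<ominus>\<^bsub>F\<^esub> (e x y \<oplus>\<^bsub>F\<^esub> e x y') | x y y'.
          x \<in> carrier V \<and> y \<in> carrier W \<and> y' \<in> carrier W} \<union>
       {e (c \<odot>\<^bsub>V\<^esub> x) y \<ominus>\<^bsub>F\<^esub> c \<odot>\<^bsub>F\<^esub> e x y | c x y.
          c \<in> carrier K \<and> x \<in> carrier V \<and> y \<in> carrier W} \<union>
       {e x (c \<odot>\<^bsub>W\<^esub> y) \<ominus>\<^bsub>F\<^esub> c \<odot>\<^bsub>F\<^esub> e x y | c x y.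
          c \<in> carrier K \<and> x \<in> carrier V \<and> y \<in> carrier W}))"

definition tensor ::
  "('k, 'v, 'y) module_scheme \<Rightarrow> ('k, 'w, 'z) module_scheme \<Rightarrow> ('k, ('v \<times> 'w \<Rightarrow> 'k) set) module" where
  "tensor V W = quotient_space (free_space (carrier V \<times> carrier W)) (tensor_rel V W)"

definition tens ::
  "('k, 'v, 'y) module_scheme \<Rightarrow> ('k, 'w, 'z) module_scheme \<Rightarrow> 'v \<Rightarrow> 'w \<Rightarrow> ('v \<times> 'w \<Rightarrow> 'k) set" where
  "tens V W x y = tensor_rel V W +>\<^bsub>free_space (carrier V \<times> carrier W)\<^esub> basis_vector (x, y)"

text \<open>
  \<open>tlift U t \<beta>\<close> is the value at the tensor \<open>t\<close> of the linear map into \<open>U\<close> induced by the bilinear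
  map \<open>\<beta>\<close>; it renders Sweedler notation: for \<open>t = \<Sum> x\<^sub>i \<otimes> y\<^sub>i\<close> it is \<open>\<Sum> \<beta> x\<^sub>i y\<^sub>i\<close>.
  Every representative of \<open>t\<close> yields the same value, so the description is of a unique element.
\<close>
definition tlift ::
  "('k, 'u, 'z) module_scheme \<Rightarrow> ('v \<times> 'w \<Rightarrow> 'k) set \<Rightarrow> ('v \<Rightarrow> 'w \<Rightarrow> 'u) \<Rightarrow> 'u" where
  "tlift U t \<beta> = (THE u. \<exists>f\<in>t. u = (\<Oplus>\<^bsub>U\<^esub>p\<in>{p. f p \<noteq> \<zero>\<^bsub>K\<^esub>}. f p \<odot>\<^bsub>U\<^esub> \<beta> (fst p) (snd p)))"

definition tensor3 where "tensor3 U V W = tensor U (tensor V W)"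

definition tens3 where "tens3 U V W x y z = tens U (tensor V W) x (tens V W y z)"

definition subtensor where
  "subtensor V W A B = module.span K (tensor V W) {tens V W a b | a b. a \<in> A \<and> b \<in> B}"


subsection \<open>Hopf algebras\<close>

definition k_algebra :: "('k, 'a, 'z) module_scheme \<Rightarrow> bool" where
  "k_algebra A \<longleftrightarrow> vectorspace K A \<and> ring A \<and>
     (\<forall>c\<in>carrier K. \<forall>x\<in>carrier A. \<forall>y\<in>carrier A.
        (c \<odot>\<^bsub>A\<^esub> x) \<otimes>\<^bsub>A\<^esub> y = c \<odot>\<^bsub>A\<^esub> (x \<otimes>\<^bsub>A\<^esub> y) \<and> x \<otimes>\<^bsub>A\<^esub> (c \<odot>\<^bsub>A\<^esub> y) = c \<odot>\<^bsub>A\<^esub> (x \<otimes>\<^bsub>A\<^esub> y))"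

definition k_coalgebra ::
  "('k, 'c, 'z) module_scheme \<Rightarrow> ('c \<Rightarrow> ('c \<times> 'c \<Rightarrow> 'k) set) \<Rightarrow> ('c \<Rightarrow> 'k) \<Rightarrow> bool" where
  "k_coalgebra C \<Delta> \<epsilon> \<longleftrightarrow> linear_map K C (tensor C C) \<Delta> \<and> linear_map K C ground \<epsilon> \<and>
     (\<forall>x\<in>carrier C.
        tlift (tensor3 C C C) (\<Delta> x) (\<lambda>a b. tlift (tensor3 C C C) (\<Delta> a) (\<lambda>a1 a2. tens3 C C C a1 a2 b)) =
        tlift (tensor3 C C C) (\<Delta> x) (\<lambda>a b. tlift (tensor3 C C C) (\<Delta> b) (\<lambda>b1 b2. tens3 C C C a b1 b2)) \<and>
        tlift C (\<Delta> x) (\<lambda>a b. \<epsilon> a \<odot>\<^bsub>C\<^esub> b) = x \<and>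
        tlift C (\<Delta> x) (\<lambda>a b. \<epsilon> b \<odot>\<^bsub>C\<^esub> a) = x)"

definition hopf_algebra :: "('k, 'h) hopf_data \<Rightarrow> bool" where
  "hopf_algebra H \<longleftrightarrow> k_algebra H \<and> k_coalgebra H (comult H) (counit H) \<and>
     (\<forall>x\<in>carrier H. \<forall>y\<in>carrier H.
        comult H (x \<otimes>\<^bsub>H\<^esub> y) =
          tlift (tensor H H) (comult H x) (\<lambda>x1 x2. tlift (tensor H H) (comult H y) (\<lambda>y1 y2.
            tens H H (x1 \<otimes>\<^bsub>H\<^esub> y1) (x2 \<otimes>\<^bsub>H\<^esub> y2))) \<and>
        counit H (x \<otimes>\<^bsub>H\<^esub> y) = counit H x \<otimes>\<^bsub>K\<^esub> counit H y) \<and>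
     comult H \<one>\<^bsub>H\<^esub> = tens H H \<one>\<^bsub>H\<^esub> \<one>\<^bsub>H\<^esub> \<and> counit H \<one>\<^bsub>H\<^esub> = \<one>\<^bsub>K\<^esub> \<and>
     linear_map K H H (antipode H) \<and>
     (\<forall>x\<in>carrier H.
        tlift H (comult H x) (\<lambda>a b. antipode H a \<otimes>\<^bsub>H\<^esub> b) = counit H x \<odot>\<^bsub>H\<^esub> \<one>\<^bsub>H\<^esub> \<and>
        tlift H (comult H x) (\<lambda>a b. a \<otimes>\<^bsub>H\<^esub> antipode H b) = counit H x \<odot>\<^bsub>H\<^esub> \<one>\<^bsub>H\<^esub>)"


subsection \<open>Modules and comodules\<close>

definition left_module :: "('k, 'h) hopf_data \<Rightarrow> ('k, 'h, 'n, 'z) lmodcomod_scheme \<Rightarrow> bool" where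
  "left_module H N \<longleftrightarrow> vectorspace K N \<and>
     (\<forall>h\<in>carrier H. linear_map K N N (lact N h)) \<and>
     (\<forall>n\<in>carrier N. linear_map K H N (\<lambda>h. lact N h n) \<and> lact N \<one>\<^bsub>H\<^esub> n = n) \<and>
     (\<forall>g\<in>carrier H. \<forall>h\<in>carrier H. \<forall>n\<in>carrier N. lact N (g \<otimes>\<^bsub>H\<^esub> h) n = lact N g (lact N h n))"

definition left_comodule :: "('k, 'h) hopf_data \<Rightarrow> ('k, 'h, 'n, 'z) lmodcomod_scheme \<Rightarrow> bool" where
  "left_comodule H N \<longleftrightarrow> linear_map K N (tensor H N) (lcoact N) \<and>
     (\<forall>n\<in>carrier N.
        tlift (tensor3 H H N) (lcoact N n) (\<lambda>h m. tlift (tensor3 H H N) (comult H h) (\<lambda>h1 h2.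
          tens3 H H N h1 h2 m)) =
        tlift (tensor3 H H N) (lcoact N n) (\<lambda>h m. tlift (tensor3 H H N) (lcoact N m) (\<lambda>g m'.
          tens3 H H N h g m')) \<and>
        tlift N (lcoact N n) (\<lambda>h m. counit H h \<odot>\<^bsub>N\<^esub> m) = n)"

definition right_module :: "('k, 'h) hopf_data \<Rightarrow> ('k, 'h, 'x, 'z) rmodcomod_scheme \<Rightarrow> bool" where
  "right_module H X \<longleftrightarrow> vectorspace K X \<and>
     (\<forall>h\<in>carrier H. linear_map K X X (\<lambda>x. ract X x h)) \<and>
     (\<forall>x\<in>carrier X. linear_map K H X (ract X x) \<and> ract X x \<one>\<^bsub>H\<^esub> = x) \<and>
     (\<forall>g\<in>carrier H. \<forall>h\<in>carrier H. \<forall>x\<in>carrier X. ract X x (g \<otimes>\<^bsub>H\<^esub> h) = ract X (ract X x g) h)"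

definition right_comodule :: "('k, 'h) hopf_data \<Rightarrow> ('k, 'h, 'x, 'z) rmodcomod_scheme \<Rightarrow> bool" where
  "right_comodule H X \<longleftrightarrow> linear_map K X (tensor X H) (rcoact X) \<and>
     (\<forall>x\<in>carrier X.
        tlift (tensor3 X H H) (rcoact X x) (\<lambda>y h. tlift (tensor3 X H H) (rcoact X y) (\<lambda>y' g.
          tens3 X H H y' g h)) =
        tlift (tensor3 X H H) (rcoact X x) (\<lambda>y h. tlift (tensor3 X H H) (comult H h) (\<lambda>h1 h2.
          tens3 X H H y h1 h2)) \<and>
        tlift X (rcoact X x) (\<lambda>y h. counit H h \<odot>\<^bsub>X\<^esub> y) = x)"

definition right_modcomod :: "('k, 'h) hopf_data \<Rightarrow> ('k, 'h, 'x, 'z) rmodcomod_scheme \<Rightarrow> bool" where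
  "right_modcomod H X \<longleftrightarrow> right_module H X \<and> right_comodule H X"

definition right_modcomod_hom ::
  "('k, 'h) hopf_data \<Rightarrow> ('k, 'h, 'x, 'y) rmodcomod_scheme \<Rightarrow> ('k, 'h, 'w, 'z) rmodcomod_scheme
    \<Rightarrow> ('x \<Rightarrow> 'w) \<Rightarrow> bool" where
  "right_modcomod_hom H X Y f \<longleftrightarrow> linear_map K X Y f \<and>
     (\<forall>x\<in>carrier X. \<forall>h\<in>carrier H. f (ract X x h) = ract Y (f x) h) \<and>
     (\<forall>x\<in>carrier X. rcoact Y (f x) = tlift (tensor Y H) (rcoact X x) (\<lambda>x' h. tens Y H (f x') h))"

definition left_submodule ::
  "('k, 'h) hopf_data \<Rightarrow> ('k, 'h, 'n, 'z) lmodcomod_scheme \<Rightarrow> 'n set \<Rightarrow> bool" where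
  "left_submodule H N W \<longleftrightarrow> subspace K W N \<and> (\<forall>h\<in>carrier H. \<forall>w\<in>W. lact N h w \<in> W)"

definition left_subcomodule ::
  "('k, 'h) hopf_data \<Rightarrow> ('k, 'h, 'n, 'z) lmodcomod_scheme \<Rightarrow> 'n set \<Rightarrow> bool" where
  "left_subcomodule H N W \<longleftrightarrow> subspace K W N \<and> (\<forall>w\<in>W. lcoact N w \<in> subtensor H N (carrier H) W)"

definition semisimple_module :: "('k, 'h) hopf_data \<Rightarrow> ('k, 'h, 'n, 'z) lmodcomod_scheme \<Rightarrow> bool" where
  "semisimple_module H N \<longleftrightarrow> (\<forall>W. left_submodule H N W \<longrightarrow>
     (\<exists>U. left_submodule H N U \<and> W \<inter> U = {\<zero>\<^bsub>N\<^esub>} \<and> W <+>\<^bsub>N\<^esub> U = carrier N))"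

definition semisimple_comodule :: "('k, 'h) hopf_data \<Rightarrow> ('k, 'h, 'n, 'z) lmodcomod_scheme \<Rightarrow> bool" where
  "semisimple_comodule H N \<longleftrightarrow> (\<forall>W. left_subcomodule H N W \<longrightarrow>
     (\<exists>U. left_subcomodule H N U \<and> W \<inter> U = {\<zero>\<^bsub>N\<^esub>} \<and> W <+>\<^bsub>N\<^esub> U = carrier N))"

definition regular :: "('k, 'h) hopf_data \<Rightarrow> ('k, 'h, 'h) lmodcomod" where
  "regular H = \<lparr>carrier = carrier H, mult = mult H, one = \<one>\<^bsub>H\<^esub>, zero = \<zero>\<^bsub>H\<^esub>, add = add H, smult = smult H,
     lact = mult H, lcoact = comult H\<rparr>"

definition semisimple :: "('k, 'h) hopf_data \<Rightarrow> bool" where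
  "semisimple H \<longleftrightarrow> semisimple_module H (regular H)"

definition cosemisimple :: "('k, 'h) hopf_data \<Rightarrow> bool" where
  "cosemisimple H \<longleftrightarrow> semisimple_comodule H (regular H)"


subsection \<open>Yetter--Drinfeld modules\<close>

definition yd_module :: "('k, 'h) hopf_data \<Rightarrow> ('k, 'h, 'n, 'z) lmodcomod_scheme \<Rightarrow> bool" where
  "yd_module H N \<longleftrightarrow> left_module H N \<and> left_comodule H N \<and>
     (\<forall>h\<in>carrier H. \<forall>n\<in>carrier N. lcoact N (lact N h n) =
        tlift (tensor H N) (comult H h) (\<lambda>h1 h'. tlift (tensor H N) (comult H h') (\<lambda>h2 h3.
          tlift (tensor H N) (lcoact N n) (\<lambda>a m.
            tens H N ((h1 \<otimes>\<^bsub>H\<^esub> a) \<otimes>\<^bsub>H\<^esub> antipode H h3) (lact N h2 m)))))"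

definition yd_hom ::
  "('k, 'h) hopf_data \<Rightarrow> ('k, 'h, 'm, 'y) lmodcomod_scheme \<Rightarrow> ('k, 'h, 'n, 'z) lmodcomod_scheme
    \<Rightarrow> ('m \<Rightarrow> 'n) \<Rightarrow> bool" where
  "yd_hom H M N f \<longleftrightarrow> linear_map K M N f \<and>
     (\<forall>h\<in>carrier H. \<forall>m\<in>carrier M. f (lact M h m) = lact N h (f m)) \<and>
     (\<forall>m\<in>carrier M. lcoact N (f m) = tlift (tensor H N) (lcoact M m) (\<lambda>h m'. tens H N h (f m')))"

definition yd_isomorphic ::
  "('k, 'h) hopf_data \<Rightarrow> ('k, 'h, 'm, 'y) lmodcomod_scheme \<Rightarrow> ('k, 'h, 'n, 'z) lmodcomod_scheme \<Rightarrow> bool"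
  where "yd_isomorphic H M N \<longleftrightarrow> (\<exists>f. yd_hom H M N f \<and> bij_betw f (carrier M) (carrier N))"

definition yd_unit :: "('k, 'h) hopf_data \<Rightarrow> ('k, 'h, 'k) lmodcomod" where
  "yd_unit H = \<lparr>carrier = carrier ground, mult = mult ground, one = one ground, zero = zero ground,
     add = add ground, smult = smult ground,
     lact = (\<lambda>h c. counit H h \<otimes>\<^bsub>K\<^esub> c), lcoact = (\<lambda>c. tens H ground \<one>\<^bsub>H\<^esub> c)\<rparr>"

definition yd_tensor ::
  "('k, 'h) hopf_data \<Rightarrow> ('k, 'h, 'm, 'y) lmodcomod_scheme \<Rightarrow> ('k, 'h, 'n, 'z) lmodcomod_scheme
    \<Rightarrow> ('k, 'h, ('m \<times> 'n \<Rightarrow> 'k) set) lmodcomod" where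
  "yd_tensor H M N = (let T = tensor M N in
     \<lparr>carrier = carrier T, mult = mult T, one = one T, zero = zero T, add = add T, smult = smult T,
      lact = (\<lambda>h t. tlift T t (\<lambda>m n. tlift T (comult H h) (\<lambda>h1 h2. tens M N (lact M h1 m) (lact N h2 n)))),
      lcoact = (\<lambda>t. tlift (tensor H T) t (\<lambda>m n.
        tlift (tensor H T) (lcoact M m) (\<lambda>a m0. tlift (tensor H T) (lcoact N n) (\<lambda>b n0.
          tens H T (a \<otimes>\<^bsub>H\<^esub> b) (tens M N m0 n0)))))\<rparr>)"

text \<open>A subspace \<open>W\<close> that is a submodule and a subcomodule, as an object: the coaction takes values in
  \<open>H \<otimes> W\<close>, and is determined by mapping to that of \<open>N\<close> under \<open>H \<otimes> W \<rightarrow> H \<otimes> N\<close>.\<close>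
definition sub_object ::
  "('k, 'h) hopf_data \<Rightarrow> ('k, 'h, 'n, 'z) lmodcomod_scheme \<Rightarrow> 'n set
    \<Rightarrow> ('k, 'h, 'n, 'z) lmodcomod_scheme" where
  "sub_object H N W = N\<lparr>carrier := W,
     lcoact := (\<lambda>w. THE t. t \<in> carrier (tensor H (N\<lparr>carrier := W\<rparr>)) \<and>
                  tlift (tensor H N) t (tens H N) = lcoact N w)\<rparr>"

definition quotient_object ::
  "('k, 'h) hopf_data \<Rightarrow> ('k, 'h, 'n, 'z) lmodcomod_scheme \<Rightarrow> 'n set \<Rightarrow> ('k, 'h, 'n set) lmodcomod" where
  "quotient_object H N W = (let Q = quotient_space N W in
     \<lparr>carrier = carrier Q, mult = mult Q, one = one Q, zero = zero Q, add = add Q, smult = smult Q,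
      lact = (\<lambda>h. induced N W (lact N h)),
      lcoact = (\<lambda>C. THE t. \<exists>n\<in>C. t = tlift (tensor H Q) (lcoact N n) (\<lambda>h m. tens H Q h (W +>\<^bsub>N\<^esub> m)))\<rparr>)"


subsection \<open>Nichols algebras\<close>

text \<open>Hopf algebras in the category of Yetter--Drinfeld modules. The comultiplication is
  multiplicative for the product \<open>(a \<otimes> b)(c \<otimes> d) = a (b\<^sub>-\<^sub>1 \<bullet> c) \<otimes> b\<^sub>0 d\<close> coming from the
  braiding \<open>m \<otimes> n \<mapsto> m\<^sub>-\<^sub>1 \<bullet> n \<otimes> m\<^sub>0\<close>.\<close>
definition braided_hopf_algebra :: "('k, 'h) hopf_data \<Rightarrow> ('k, 'h, 'b) braided_hopf_data \<Rightarrow> bool" where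
  "braided_hopf_algebra H B \<longleftrightarrow> yd_module H B \<and> k_algebra B \<and> k_coalgebra B (bcomult B) (bcounit B) \<and>
     yd_hom H (yd_tensor H B B) B (\<lambda>t. tlift B t (mult B)) \<and>
     yd_hom H (yd_unit H) B (\<lambda>c. c \<odot>\<^bsub>B\<^esub> \<one>\<^bsub>B\<^esub>) \<and>
     yd_hom H B (yd_tensor H B B) (bcomult B) \<and>
     yd_hom H B (yd_unit H) (bcounit B) \<and>
     (\<forall>x\<in>carrier B. \<forall>y\<in>carrier B.
        bcomult B (x \<otimes>\<^bsub>B\<^esub> y) =
          tlift (tensor B B) (bcomult B x) (\<lambda>a b. tlift (tensor B B) (bcomult B y) (\<lambda>c d.
            tlift (tensor B B) (lcoact B b) (\<lambda>h b0.
              tens B B (a \<otimes>\<^bsub>B\<^esub> lact B h c) (b0 \<otimes>\<^bsub>B\<^esub> d)))) \<and>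
        bcounit B (x \<otimes>\<^bsub>B\<^esub> y) = bcounit B x \<otimes>\<^bsub>K\<^esub> bcounit B y) \<and>
     bcomult B \<one>\<^bsub>B\<^esub> = tens B B \<one>\<^bsub>B\<^esub> \<one>\<^bsub>B\<^esub> \<and> bcounit B \<one>\<^bsub>B\<^esub> = \<one>\<^bsub>K\<^esub> \<and>
     yd_hom H B B (bantipode B) \<and>
     (\<forall>x\<in>carrier B.
        tlift B (bcomult B x) (\<lambda>a b. bantipode B a \<otimes>\<^bsub>B\<^esub> b) = bcounit B x \<odot>\<^bsub>B\<^esub> \<one>\<^bsub>B\<^esub> \<and>
        tlift B (bcomult B x) (\<lambda>a b. a \<otimes>\<^bsub>B\<^esub> bantipode B b) = bcounit B x \<odot>\<^bsub>B\<^esub> \<one>\<^bsub>B\<^esub>)"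

definition hopf_grading ::
  "('k, 'h) hopf_data \<Rightarrow> ('k, 'h, 'b) braided_hopf_data \<Rightarrow> (nat \<Rightarrow> 'b set) \<Rightarrow> bool" where
  "hopf_grading H B G \<longleftrightarrow>
     (\<forall>n. left_submodule H B (G n) \<and> left_subcomodule H B (G n)) \<and>
     (\<forall>b\<in>carrier B. \<exists>!c. (\<forall>n. c n \<in> G n) \<and> finite {n. c n \<noteq> \<zero>\<^bsub>B\<^esub>} \<and>
        b = (\<Oplus>\<^bsub>B\<^esub>n\<in>{n. c n \<noteq> \<zero>\<^bsub>B\<^esub>}. c n)) \<and>
     \<one>\<^bsub>B\<^esub> \<in> G 0 \<and>
     (\<forall>i j. \<forall>x\<in>G i. \<forall>y\<in>G j. x \<otimes>\<^bsub>B\<^esub> y \<in> G (i + j)) \<and>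
     (\<forall>n. \<forall>x\<in>G n. bcomult B x \<in>
        module.span K (tensor B B) (\<Union>i\<le>n. {tens B B a b | a b. a \<in> G i \<and> b \<in> G (n - i)})) \<and>
     (\<forall>n>0. \<forall>x\<in>G n. bcounit B x = \<zero>\<^bsub>K\<^esub>) \<and>
     (\<forall>n. \<forall>x\<in>G n. bantipode B x \<in> G n)"

definition nichols_algebra ::
  "('k, 'h) hopf_data \<Rightarrow> ('k, 'h, 'v, 'z) lmodcomod_scheme \<Rightarrow> ('k, 'h, 'b) braided_hopf_data \<Rightarrow> bool" where
  "nichols_algebra H V B \<longleftrightarrow> braided_hopf_algebra H B \<and> (\<exists>G. hopf_grading H B G \<and>
     yd_isomorphic H (sub_object H B (G 0)) (yd_unit H) \<and>
     yd_isomorphic H (sub_object H B (G 1)) V \<and>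
     (\<forall>W. subspace K W B \<and> \<one>\<^bsub>B\<^esub> \<in> W \<and> (\<forall>x\<in>W. \<forall>y\<in>W. x \<otimes>\<^bsub>B\<^esub> y \<in> W) \<and> G 1 \<subseteq> W \<longrightarrow> W = carrier B) \<and>
     {b \<in> carrier B. bcomult B b = tens B B b \<one>\<^bsub>B\<^esub> \<oplus>\<^bsub>tensor B B\<^esub> tens B B \<one>\<^bsub>B\<^esub> b} = G 1)"


subsection \<open>Bosonisation\<close>

definition smash_mult ::
  "('k, 'h) hopf_data \<Rightarrow> ('k, 'h, 'b) braided_hopf_data
    \<Rightarrow> ('b \<times> 'h \<Rightarrow> 'k) set \<Rightarrow> ('b \<times> 'h \<Rightarrow> 'k) set \<Rightarrow> ('b \<times> 'h \<Rightarrow> 'k) set" where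
  "smash_mult H B s t =
     tlift (tensor B H) s (\<lambda>b g. tlift (tensor B H) t (\<lambda>d h. tlift (tensor B H) (comult H g) (\<lambda>g1 g2.
       tens B H (b \<otimes>\<^bsub>B\<^esub> lact B g1 d) (g2 \<otimes>\<^bsub>H\<^esub> h))))"

text \<open>The antipode is the standard one, \<open>S(b # h) = (1 # S(b\<^sub>-\<^sub>1 h)) (S\<^sub>B(b\<^sub>0) # 1)\<close>.\<close>
definition bosonisation ::
  "('k, 'h) hopf_data \<Rightarrow> ('k, 'h, 'b) braided_hopf_data \<Rightarrow> ('k, ('b \<times> 'h \<Rightarrow> 'k) set) hopf_data" where
  "bosonisation H B = (let T = tensor B H in
     \<lparr>carrier = carrier T, mult = smash_mult H B, one = tens B H \<one>\<^bsub>B\<^esub> \<one>\<^bsub>H\<^esub>, zero = zero T,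
      add = add T, smult = smult T,
      comult = (\<lambda>t. tlift (tensor T T) t (\<lambda>b g.
        tlift (tensor T T) (bcomult B b) (\<lambda>b1 b2. tlift (tensor T T) (comult H g) (\<lambda>g1 g2.
          tlift (tensor T T) (lcoact B b2) (\<lambda>a b20.
            tens T T (tens B H b1 (a \<otimes>\<^bsub>H\<^esub> g1)) (tens B H b20 g2)))))),
      counit = (\<lambda>t. tlift ground t (\<lambda>b g. bcounit B b \<otimes>\<^bsub>K\<^esub> counit H g)),
      antipode = (\<lambda>t. tlift T t (\<lambda>b h. tlift T (lcoact B b) (\<lambda>a b0.
        smash_mult H B (tens B H \<one>\<^bsub>B\<^esub> (antipode H (a \<otimes>\<^bsub>H\<^esub> h))) (tens B H (bantipode B b0) \<one>\<^bsub>H\<^esub>))))\<rparr>)"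

definition boson_incl ::
  "('k, 'h) hopf_data \<Rightarrow> ('k, 'h, 'b) braided_hopf_data \<Rightarrow> 'h \<Rightarrow> ('b \<times> 'h \<Rightarrow> 'k) set" where
  "boson_incl H B h = tens B H \<one>\<^bsub>B\<^esub> h"

definition boson_proj ::
  "('k, 'h) hopf_data \<Rightarrow> ('k, 'h, 'b) braided_hopf_data \<Rightarrow> ('b \<times> 'h \<Rightarrow> 'k) set \<Rightarrow> 'h" where
  "boson_proj H B t = tlift H t (\<lambda>b h. bcounit B b \<odot>\<^bsub>H\<^esub> h)"


subsection \<open>Bitensor products\<close>

definition cotensor ::
  "('k, 'h) hopf_data \<Rightarrow> ('k, 'h, 'x, 'y) rmodcomod_scheme \<Rightarrow> ('k, 'h, 'n, 'z) lmodcomod_scheme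
    \<Rightarrow> ('x \<times> 'n \<Rightarrow> 'k) set set" where
  "cotensor H X N = {t \<in> carrier (tensor X N).
     tlift (tensor3 X H N) t (\<lambda>x n. tlift (tensor3 X H N) (rcoact X x) (\<lambda>x' h. tens3 X H N x' h n)) =
     tlift (tensor3 X H N) t (\<lambda>x n. tlift (tensor3 X H N) (lcoact N n) (\<lambda>h n'. tens3 X H N x h n'))}"

definition balanced_rel ::
  "('k, 'h) hopf_data \<Rightarrow> ('k, 'h, 'x, 'y) rmodcomod_scheme \<Rightarrow> ('k, 'h, 'n, 'z) lmodcomod_scheme
    \<Rightarrow> ('x \<times> 'n \<Rightarrow> 'k) set set" where
  "balanced_rel H X N = module.span K (tensor X N)
     {tens X N (ract X x h) n \<ominus>\<^bsub>tensor X N\<^esub> tens X N x (lact N h n) | x h n.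
        x \<in> carrier X \<and> h \<in> carrier H \<and> n \<in> carrier N}"

definition tensor_over ::
  "('k, 'h) hopf_data \<Rightarrow> ('k, 'h, 'x, 'y) rmodcomod_scheme \<Rightarrow> ('k, 'h, 'n, 'z) lmodcomod_scheme
    \<Rightarrow> ('k, ('x \<times> 'n \<Rightarrow> 'k) set set) module" where
  "tensor_over H X N = quotient_space (tensor X N) (balanced_rel H X N)"

definition Bit ::
  "('k, 'h) hopf_data \<Rightarrow> ('k, 'h, 'x, 'y) rmodcomod_scheme \<Rightarrow> ('k, 'h, 'n, 'z) lmodcomod_scheme
    \<Rightarrow> ('k, ('x \<times> 'n \<Rightarrow> 'k) set set) module" where
  "Bit H X N = (tensor_over H X N)
     \<lparr>carrier := (\<lambda>t. balanced_rel H X N +>\<^bsub>tensor X N\<^esub> t) ` cotensor H X N\<rparr>"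

text \<open>The functoriality of \<open>Bit\<close>: the map into \<open>Bit H X' N'\<close> induced by \<open>f \<otimes> g\<close>, for
  \<open>f : X \<rightarrow> X'\<close> and \<open>g : N \<rightarrow> N'\<close>.\<close>
definition Bit_map ::
  "('k, 'h) hopf_data \<Rightarrow> ('k, 'h, 'x, 'y) rmodcomod_scheme \<Rightarrow> ('k, 'h, 'n, 'z) lmodcomod_scheme
    \<Rightarrow> ('u \<Rightarrow> 'x) \<Rightarrow> ('v \<Rightarrow> 'n) \<Rightarrow> ('u \<times> 'v \<Rightarrow> 'k) set set \<Rightarrow> ('x \<times> 'n \<Rightarrow> 'k) set set" where
  "Bit_map H X' N' f g = induced (tensor X' N') (balanced_rel H X' N')
     (\<lambda>t. tlift (tensor X' N') t (\<lambda>x n. tens X' N' (f x) (g n)))"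


subsection \<open>Inflation, restriction and the subquotient functor\<close>

definition Inf_obj ::
  "('k, 'h) hopf_data \<Rightarrow> ('k, 'h, 'b) braided_hopf_data \<Rightarrow> ('k, 'h, 'x) rmodcomod
    \<Rightarrow> ('k, ('b \<times> 'h \<Rightarrow> 'k) set, 'x) rmodcomod" where
  "Inf_obj H B X = (let A = bosonisation H B in
     \<lparr>carrier = carrier X, mult = mult X, one = one X, zero = zero X, add = add X, smult = smult X,
      ract = (\<lambda>x a. ract X x (boson_proj H B a)),
      rcoact = (\<lambda>x. tlift (tensor X A) (rcoact X x) (\<lambda>x' h. tens X A x' (boson_incl H B h)))\<rparr>)"

definition Res_obj ::
  "('k, 'h) hopf_data \<Rightarrow> ('k, 'h, 'b) braided_hopf_data \<Rightarrow> ('k, ('b \<times> 'h \<Rightarrow> 'k) set, 'n) lmodcomod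
    \<Rightarrow> ('k, 'h, 'n) lmodcomod" where
  "Res_obj H B N =
     \<lparr>carrier = carrier N, mult = mult N, one = one N, zero = zero N, add = add N, smult = smult N,
      lact = (\<lambda>h. lact N (boson_incl H B h)),
      lcoact = (\<lambda>n. tlift (tensor H N) (lcoact N n) (\<lambda>a m. tens H N (boson_proj H B a) m))\<rparr>"

definition coinvariants ::
  "('k, 'h) hopf_data \<Rightarrow> ('k, 'h, 'b) braided_hopf_data \<Rightarrow> ('k, ('b \<times> 'h \<Rightarrow> 'k) set, 'n) lmodcomod
    \<Rightarrow> 'n set" where
  "coinvariants H B N = {n \<in> carrier N.
     lcoact N n \<in> subtensor (bosonisation H B) N (boson_incl H B ` carrier H) (carrier N)}"

definition aug_image ::
  "('k, 'h) hopf_data \<Rightarrow> ('k, 'h, 'b) braided_hopf_data \<Rightarrow> ('k, ('b \<times> 'h \<Rightarrow> 'k) set, 'n) lmodcomod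
    \<Rightarrow> 'n set" where
  "aug_image H B N = module.span K N {lact N (tens B H b \<one>\<^bsub>H\<^esub>) n | b n.
     b \<in> carrier B \<and> bcounit B b = \<zero>\<^bsub>K\<^esub> \<and> n \<in> carrier N}"

definition bracket ::
  "('k, 'h) hopf_data \<Rightarrow> ('k, 'h, 'b) braided_hopf_data \<Rightarrow> ('k, ('b \<times> 'h \<Rightarrow> 'k) set, 'n) lmodcomod
    \<Rightarrow> ('k, 'h, 'n set) lmodcomod" where
  "bracket H B N = quotient_object H (sub_object H (Res_obj H B N) (coinvariants H B N))
     (coinvariants H B N \<inter> aug_image H B N)"

text \<open>For a morphism \<open>g : N \<rightarrow> N'\<close>, the induced map from \<open>bracket H B N\<close> to \<open>bracket H B N'\<close>.\<close>
definition bracket_map ::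
  "('k, 'h) hopf_data \<Rightarrow> ('k, 'h, 'b) braided_hopf_data \<Rightarrow> ('k, ('b \<times> 'h \<Rightarrow> 'k) set, 'n) lmodcomod
    \<Rightarrow> ('m \<Rightarrow> 'n) \<Rightarrow> 'm set \<Rightarrow> 'n set" where
  "bracket_map H B N' g = induced N' (coinvariants H B N' \<inter> aug_image H B N') g"

end

end

theory Submission
  imports Defs
begin

text \<open>
  Since the coaction of \<open>Inf X\<close> takes values in \<open>X \<otimes> \<iota>(H)\<close>, its cotensor product with \<open>N\<close> over \<open>A\<close> is
  \<open>X \<box>\<^sub>H N\<^sup>c\<^sup>o\<^sup>H\<close>; since it acts through \<open>\<pi>\<close>, its tensor product with \<open>N\<close> over \<open>A\<close> is
  \<open>X \<otimes>\<^sub>H (N / B\<^sup>+ N)\<close>. The map from the former to the latter factors through \<open>X \<box>\<^sub>H \<langle>N\<rangle>\<close>, and two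
  averaging arguments show that its image is that of \<open>X \<box>\<^sub>H \<langle>N\<rangle>\<close> in \<open>X \<otimes>\<^sub>H \<langle>N\<rangle>\<close>.
  If \<open>\<Lambda>\<close> is the normalised integral of \<open>H\<close>, the projector
  \<open>x \<otimes> n \<mapsto> x \<Lambda>\<^sub>1 \<otimes> S(\<Lambda>\<^sub>2) n\<close> vanishes exactly on the balancing relations; hence
  \<open>X \<otimes>\<^sub>H -\<close> preserves the injection of \<open>\<langle>N\<rangle>\<close> into \<open>N / B\<^sup>+ N\<close>. Dually, for the normalised
  cointegral \<open>\<lambda>\<close>, the projector \<open>x \<otimes> n \<mapsto> x\<^sub>0 \<otimes> \<lambda>(x\<^sub>1 S(n\<^sub>-\<^sub>1)) n\<^sub>0\<close> onto the cotensor product shows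
  that \<open>X \<box>\<^sub>H -\<close> preserves the surjection from \<open>N\<^sup>c\<^sup>o\<^sup>H\<close> to \<open>\<langle>N\<rangle>\<close>.
\<close>

text \<open>Both sides are quotients of the one space \<open>cotensor K H X M\<close>, where
  \<open>M\<close> is the space of coinvariants as an object over \<open>H\<close>; the isomorphism
  sends the class of \<open>incl_t t\<close> to the class of \<open>quot_t t\<close>. That it is
  well defined and injective is a single equivalence: \<open>incl_t t\<close> is balanced over
  \<open>A\<close> iff \<open>quot_t t\<close> is balanced over \<open>H\<close>. The integral
  serves the forward direction, the cointegral serves surjectivity. The action and the coaction of
  \<open>X\<close> are unrelated, so an averaging operator cannot be expected to respect both; the
  argument never asks the integral projector to preserve cotensors, nor the cointegral projector to
  preserve balancing relations. Both projectors rest on a Casimir-type identity,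
  \<open>integral_comult\<close> and \<open>cointegral_comult\<close>, derived from the antipode
  axioms by inserting a cancelling pair such as y2 S(y3). Exactness of tensoring with a fixed space
  is obtained by slicing tensors with functionals. A Sweedler expression is a value of
  \<open>tlift\<close>, controlled only for bilinear arguments, so each rewriting step carries
  bilinearity side conditions; \<open>lin_intro\<close> collects the rules that discharge
  them.\<close>

lemma UN_eq_const: "(\<And>u. u \<in> C \<Longrightarrow> f u = A) \<Longrightarrow> x \<in> C \<Longrightarrow> (\<Union>u\<in>C. f u) = A"
  by blast

section \<open>Vector spaces and linear maps over a field\<close>

locale linear_algebra = field K for K :: "'k ring" (structure)
begin

abbreviation vspace :: "('k, 'v, 'y) module_scheme \<Rightarrow> bool" where "vspace \<equiv> vectorspace K"
abbreviation lin :: "('k, 'v, 'y) module_scheme \<Rightarrow> ('k, 'w, 'z) module_scheme \<Rightarrow> ('v \<Rightarrow> 'w) \<Rightarrow> bool"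
  where "lin \<equiv> linear_map K"

lemma vsD:
  assumes "vspace V"
  shows "abelian_group V" "module K V"
    "\<zero>\<^bsub>V\<^esub> \<in> carrier V"
    "\<And>x y. x \<in> carrier V \<Longrightarrow> y \<in> carrier V \<Longrightarrow> x \<oplus>\<^bsub>V\<^esub> y \<in> carrier V"
    "\<And>c x. c \<in> carrier K \<Longrightarrow> x \<in> carrier V \<Longrightarrow> c \<odot>\<^bsub>V\<^esub> x \<in> carrier V"
    "\<And>x y. x \<in> carrier V \<Longrightarrow> y \<in> carrier V \<Longrightarrow> x \<ominus>\<^bsub>V\<^esub> y \<in> carrier V"
    "\<And>x. x \<in> carrier V \<Longrightarrow> \<ominus>\<^bsub>V\<^esub> x \<in> carrier V"
proof -
  interpret vectorspace K V by fact
  show "abelian_group V" "module K V" by unfold_locales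
  show "\<zero>\<^bsub>V\<^esub> \<in> carrier V"
    "\<And>x y. x \<in> carrier V \<Longrightarrow> y \<in> carrier V \<Longrightarrow> x \<oplus>\<^bsub>V\<^esub> y \<in> carrier V"
    "\<And>c x. c \<in> carrier K \<Longrightarrow> x \<in> carrier V \<Longrightarrow> c \<odot>\<^bsub>V\<^esub> x \<in> carrier V"
    "\<And>x y. x \<in> carrier V \<Longrightarrow> y \<in> carrier V \<Longrightarrow> x \<ominus>\<^bsub>V\<^esub> y \<in> carrier V"
    "\<And>x. x \<in> carrier V \<Longrightarrow> \<ominus>\<^bsub>V\<^esub> x \<in> carrier V" by auto
qed

lemma linI:
  assumes "vspace V" "vspace W" "\<And>x. x \<in> carrier V \<Longrightarrow> f x \<in> carrier W"
    "\<And>x y. x \<in> carrier V \<Longrightarrow> y \<in> carrier V \<Longrightarrow> f (x \<oplus>\<^bsub>V\<^esub> y) = f x \<oplus>\<^bsub>W\<^esub> f y"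
    "\<And>c x. c \<in> carrier K \<Longrightarrow> x \<in> carrier V \<Longrightarrow> f (c \<odot>\<^bsub>V\<^esub> x) = c \<odot>\<^bsub>W\<^esub> f x"
  shows "lin V W f"
  using assms by (auto simp: linear_map_def mod_hom_def mod_hom_axioms_def module_hom_def vectorspace.axioms)

lemma linD:
  assumes "lin V W f"
  shows "vspace V" "vspace W" "\<And>x. x \<in> carrier V \<Longrightarrow> f x \<in> carrier W"
    "\<And>x y. x \<in> carrier V \<Longrightarrow> y \<in> carrier V \<Longrightarrow> f (x \<oplus>\<^bsub>V\<^esub> y) = f x \<oplus>\<^bsub>W\<^esub> f y"
    "\<And>c x. c \<in> carrier K \<Longrightarrow> x \<in> carrier V \<Longrightarrow> f (c \<odot>\<^bsub>V\<^esub> x) = c \<odot>\<^bsub>W\<^esub> f x"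
    "f \<zero>\<^bsub>V\<^esub> = \<zero>\<^bsub>W\<^esub>"
    "\<And>x. x \<in> carrier V \<Longrightarrow> f (\<ominus>\<^bsub>V\<^esub> x) = \<ominus>\<^bsub>W\<^esub> f x"
    "\<And>x y. x \<in> carrier V \<Longrightarrow> y \<in> carrier V \<Longrightarrow> f (x \<ominus>\<^bsub>V\<^esub> y) = f x \<ominus>\<^bsub>W\<^esub> f y"
proof -
  interpret linear_map K V W f by fact
  show "vspace V" "vspace W" by unfold_locales
  show "\<And>x. x \<in> carrier V \<Longrightarrow> f x \<in> carrier W"
    "\<And>x y. x \<in> carrier V \<Longrightarrow> y \<in> carrier V \<Longrightarrow> f (x \<oplus>\<^bsub>V\<^esub> y) = f x \<oplus>\<^bsub>W\<^esub> f y"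
    "\<And>c x. c \<in> carrier K \<Longrightarrow> x \<in> carrier V \<Longrightarrow> f (c \<odot>\<^bsub>V\<^esub> x) = c \<odot>\<^bsub>W\<^esub> f x"
    "f \<zero>\<^bsub>V\<^esub> = \<zero>\<^bsub>W\<^esub>"
    "\<And>x. x \<in> carrier V \<Longrightarrow> f (\<ominus>\<^bsub>V\<^esub> x) = \<ominus>\<^bsub>W\<^esub> f x"
    "\<And>x y. x \<in> carrier V \<Longrightarrow> y \<in> carrier V \<Longrightarrow> f (x \<ominus>\<^bsub>V\<^esub> y) = f x \<ominus>\<^bsub>W\<^esub> f y"
    by auto
qed

lemma lin_cong:
  assumes "lin V W g" "\<And>x. x \<in> carrier V \<Longrightarrow> f x = g x"
  shows "lin V W f"
  using assms(2) linD[OF assms(1)] by (intro linI) (auto simp: vsD)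

lemma lin_id: "vspace V \<Longrightarrow> lin V V (\<lambda>x. x)"
  by (rule linI) auto

lemma lin_comp: "lin V U f \<Longrightarrow> lin W V g \<Longrightarrow> lin W U (\<lambda>x. f (g x))"
  by (rule linI) (auto simp: linD)

lemma vs_field_is_module: "vspace V \<longleftrightarrow> module K V"
  using field_axioms by (auto simp: vectorspace_def)

subsection \<open>Subspaces and quotients\<close>

lemma subspaceI:
  assumes "vspace V" "W \<subseteq> carrier V" "\<zero>\<^bsub>V\<^esub> \<in> W"
    "\<And>x y. x \<in> W \<Longrightarrow> y \<in> W \<Longrightarrow> x \<oplus>\<^bsub>V\<^esub> y \<in> W"
    "\<And>c x. c \<in> carrier K \<Longrightarrow> x \<in> W \<Longrightarrow> c \<odot>\<^bsub>V\<^esub> x \<in> W"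
  shows "subspace K W V"
  using assms by (auto simp: subspace_def submodule_def vs_field_is_module)

lemma subspaceD:
  assumes "subspace K W V"
  shows "vspace V" "W \<subseteq> carrier V" "\<zero>\<^bsub>V\<^esub> \<in> W" "\<And>x. x \<in> W \<Longrightarrow> x \<in> carrier V"
    "\<And>x y. x \<in> W \<Longrightarrow> y \<in> W \<Longrightarrow> x \<oplus>\<^bsub>V\<^esub> y \<in> W"
    "\<And>c x. c \<in> carrier K \<Longrightarrow> x \<in> W \<Longrightarrow> c \<odot>\<^bsub>V\<^esub> x \<in> W"
    "\<And>x. x \<in> W \<Longrightarrow> \<ominus>\<^bsub>V\<^esub> x \<in> W"
    "\<And>x y. x \<in> W \<Longrightarrow> y \<in> W \<Longrightarrow> x \<ominus>\<^bsub>V\<^esub> y \<in> W"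
proof -
  interpret S: subspace K W V by fact
  interpret M: submodule K W V by (rule S.submod)
  interpret V: vectorspace K V by (rule S.vs)
  show "vspace V" by (rule S.vs)
  show sub: "W \<subseteq> carrier V" by (rule M.subset)
  show "\<zero>\<^bsub>V\<^esub> \<in> W" "\<And>x. x \<in> W \<Longrightarrow> x \<in> carrier V"
    "\<And>x y. x \<in> W \<Longrightarrow> y \<in> W \<Longrightarrow> x \<oplus>\<^bsub>V\<^esub> y \<in> W"
    "\<And>c x. c \<in> carrier K \<Longrightarrow> x \<in> W \<Longrightarrow> c \<odot>\<^bsub>V\<^esub> x \<in> W" using sub by auto
  show n: "\<And>x. x \<in> W \<Longrightarrow> \<ominus>\<^bsub>V\<^esub> x \<in> W"
  proof -
    fix x assume x: "x \<in> W"
    then have "\<ominus> \<one> \<odot>\<^bsub>V\<^esub> x \<in> W" by (intro M.smult_closed) auto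
    moreover have "x \<in> carrier V" using x sub by auto
    ultimately show "\<ominus>\<^bsub>V\<^esub> x \<in> W" by (simp add: V.smult_minus_1)
  qed
  show "\<And>x y. x \<in> W \<Longrightarrow> y \<in> W \<Longrightarrow> x \<ominus>\<^bsub>V\<^esub> y \<in> W"
    using n by (simp add: a_minus_def)
qed

lemma subspace_carrier: "vspace V \<Longrightarrow> subspace K (carrier V) V"
  by (rule subspaceI) (auto simp: vsD)

lemma subspace_Int: "subspace K W V \<Longrightarrow> subspace K W' V \<Longrightarrow> subspace K (W \<inter> W') V"
  by (rule subspaceI) (auto simp: subspaceD)

lemma subspace_trans:
  assumes "subspace K W V" "subspace K U V" "U \<subseteq> W"
  shows "subspace K U (V\<lparr>carrier := W\<rparr>)"
  using assms vectorspace.subspace_is_vs[OF _ assms(1)]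
  by (intro subspaceI) (auto simp: subspaceD)

lemma vs_restrict: "subspace K W V \<Longrightarrow> vspace (V\<lparr>carrier := W\<rparr>)"
  by (rule vectorspace.subspace_is_vs) (auto simp: subspaceD)

lemma lin_incl: "subspace K W V \<Longrightarrow> lin (V\<lparr>carrier := W\<rparr>) V (\<lambda>x. x)"
  by (rule linI) (auto simp: subspaceD vs_restrict)

lemma span_subspace: "vspace V \<Longrightarrow> S \<subseteq> carrier V \<Longrightarrow> subspace K (module.span K V S) V"
  by (simp add: subspace_def module.span_is_submodule vs_field_is_module)

lemma span_min: "subspace K W V \<Longrightarrow> S \<subseteq> W \<Longrightarrow> module.span K V S \<subseteq> W"
  by (simp add: subspace_def module.span_is_subset vs_field_is_module)

lemma span_incl: "vspace V \<Longrightarrow> S \<subseteq> carrier V \<Longrightarrow> x \<in> S \<Longrightarrow> x \<in> module.span K V S"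
  using module.in_own_span[of K V S] by (auto simp: vs_field_is_module)

lemma subspace_kernel:
  assumes "lin V W f"
  shows "subspace K {x \<in> carrier V. f x = \<zero>\<^bsub>W\<^esub>} V"
proof -
  interpret linear_map K V W f by fact
  show ?thesis using kerT_is_subspace by (simp add: ker_def)
qed

lemma subspace_preimage:
  assumes "lin V W f" "subspace K S W"
  shows "subspace K {x \<in> carrier V. f x \<in> S} V"
  using assms by (intro subspaceI) (auto simp: subspaceD linD vsD)

lemma subspace_image:
  assumes "lin V W f" "subspace K S V"
  shows "subspace K (f ` S) W"
proof (rule subspaceI)
  note [simp] = linD[OF assms(1)] subspaceD[OF assms(2)]
  show "vspace W" "f ` S \<subseteq> carrier W" by auto
  show "\<zero>\<^bsub>W\<^esub> \<in> f ` S" by (rule image_eqI[of _ _ "\<zero>\<^bsub>V\<^esub>"]) auto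
  show "x \<oplus>\<^bsub>W\<^esub> y \<in> f ` S" if "x \<in> f ` S" "y \<in> f ` S" for x y
  proof -
    from that obtain a b where "x = f a" "y = f b" "a \<in> S" "b \<in> S" by auto
    then show ?thesis by (intro image_eqI[of _ _ "a \<oplus>\<^bsub>V\<^esub> b"]) auto
  qed
  show "c \<odot>\<^bsub>W\<^esub> x \<in> f ` S" if "c \<in> carrier K" "x \<in> f ` S" for c x
  proof -
    from that obtain a where "x = f a" "a \<in> S" by auto
    with that show ?thesis by (intro image_eqI[of _ _ "c \<odot>\<^bsub>V\<^esub> a"]) auto
  qed
qed

context
  fixes V :: "('k, 'v, 'z) module_scheme" and W
  assumes sub: "subspace K W V"
begin

interpretation V: vectorspace K V by (rule subspaceD(1)[OF sub])

lemma abelian_subgroup: "abelian_subgroup W V"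
proof (rule abelian_subgroupI3)
  have "W \<noteq> {}" using subspaceD(3)[OF sub] by blast
  then show "additive_subgroup W V"
    by (intro additive_subgroup.intro V.add.subgroupI) (auto simp: subspaceD[OF sub] a_inv_def[symmetric])
  show "abelian_group V" by (rule V.abelian_group_axioms)
qed

interpretation W: abelian_subgroup W V by (rule abelian_subgroup)

lemma coset_mem:
  assumes "x \<in> carrier V"
  shows "y \<in> W +>\<^bsub>V\<^esub> x \<longleftrightarrow> y \<in> carrier V \<and> y \<ominus>\<^bsub>V\<^esub> x \<in> W"
proof
  assume "y \<in> W +>\<^bsub>V\<^esub> x"
  then obtain w where w: "w \<in> W" "y = w \<oplus>\<^bsub>V\<^esub> x" by (auto simp: a_r_coset_def')
  moreover have "w \<oplus>\<^bsub>V\<^esub> x \<ominus>\<^bsub>V\<^esub> x = w"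
    using w assms subspaceD(4)[OF sub] by (simp add: a_minus_def V.a_assoc V.r_neg)
  ultimately show "y \<in> carrier V \<and> y \<ominus>\<^bsub>V\<^esub> x \<in> W" using assms subspaceD(4)[OF sub] by auto
next
  assume y: "y \<in> carrier V \<and> y \<ominus>\<^bsub>V\<^esub> x \<in> W"
  then have "y = (y \<ominus>\<^bsub>V\<^esub> x) \<oplus>\<^bsub>V\<^esub> x" using assms by (simp add: a_minus_def V.a_assoc V.l_neg)
  with y show "y \<in> W +>\<^bsub>V\<^esub> x" by (auto simp: a_r_coset_def')
qed

lemma coset_eq_iff:
  assumes "x \<in> carrier V" "y \<in> carrier V"
  shows "W +>\<^bsub>V\<^esub> x = W +>\<^bsub>V\<^esub> y \<longleftrightarrow> x \<ominus>\<^bsub>V\<^esub> y \<in> W"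
proof -
  have "x \<in> W +>\<^bsub>V\<^esub> x" using assms by (rule_tac W.a_rcos_self)
  moreover have "W +>\<^bsub>V\<^esub> x = W +>\<^bsub>V\<^esub> y" if "x \<in> W +>\<^bsub>V\<^esub> y"
    using that assms V.a_repr_independence[OF that _ W.a_subgroup] by simp
  ultimately show ?thesis using assms coset_mem by auto
qed

lemma carrier_quotient: "carrier (quotient_space V W) = (\<lambda>x. W +>\<^bsub>V\<^esub> x) ` carrier V"
  by (auto simp: quotient_space_def A_RCOSETS_def')

lemma add_quotient:
  "x \<in> carrier V \<Longrightarrow> y \<in> carrier V \<Longrightarrow>
    (W +>\<^bsub>V\<^esub> x) \<oplus>\<^bsub>quotient_space V W\<^esub> (W +>\<^bsub>V\<^esub> y) = W +>\<^bsub>V\<^esub> (x \<oplus>\<^bsub>V\<^esub> y)"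
  by (simp add: quotient_space_def W.a_rcos_sum)

lemma zero_quotient: "\<zero>\<^bsub>quotient_space V W\<^esub> = W +>\<^bsub>V\<^esub> \<zero>\<^bsub>V\<^esub>"
  using subspaceD(2)[OF sub] by (simp add: quotient_space_def)

lemma coset_zero_iff:
  "x \<in> carrier V \<Longrightarrow> W +>\<^bsub>V\<^esub> x = \<zero>\<^bsub>quotient_space V W\<^esub> \<longleftrightarrow> x \<in> W"
  by (simp add: zero_quotient coset_eq_iff a_minus_def V.add.inv_one[folded a_inv_def])

text \<open>Scalar multiplication on the quotient is encoded as a union of cosets of c u over all u
  in the given coset. Since c u - c x = c (u - x) lies in \<open>W\<close>, these cosets coincide
  and the union collapses to one of them.\<close>

lemma smult_quotient:
  assumes "c \<in> carrier K" "x \<in> carrier V"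
  shows "c \<odot>\<^bsub>quotient_space V W\<^esub> (W +>\<^bsub>V\<^esub> x) = W +>\<^bsub>V\<^esub> (c \<odot>\<^bsub>V\<^esub> x)"
proof -
  have "W +>\<^bsub>V\<^esub> c \<odot>\<^bsub>V\<^esub> u = W +>\<^bsub>V\<^esub> c \<odot>\<^bsub>V\<^esub> x" if "u \<in> W +>\<^bsub>V\<^esub> x" for u
  proof -
    from that assms have u: "u \<in> carrier V" "u \<ominus>\<^bsub>V\<^esub> x \<in> W" by (auto simp: coset_mem)
    have "c \<odot>\<^bsub>V\<^esub> u \<ominus>\<^bsub>V\<^esub> c \<odot>\<^bsub>V\<^esub> x = c \<odot>\<^bsub>V\<^esub> (u \<ominus>\<^bsub>V\<^esub> x)"
      using assms u by (simp add: a_minus_def V.smult_r_distr V.smult_r_minus)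
    then show ?thesis using u assms by (simp add: coset_eq_iff subspaceD[OF sub])
  qed
  moreover have "x \<in> W +>\<^bsub>V\<^esub> x" using assms by (rule_tac W.a_rcos_self)
  ultimately have "(\<Union>u\<in>W +>\<^bsub>V\<^esub> x. W +>\<^bsub>V\<^esub> c \<odot>\<^bsub>V\<^esub> u) = W +>\<^bsub>V\<^esub> c \<odot>\<^bsub>V\<^esub> x"
    by (rule UN_eq_const)
  then show ?thesis by (simp add: quotient_space_def induced_def)
qed

lemma vs_quotient: "vspace (quotient_space V W)"
proof (rule vs_criteria)
  let ?Q = "quotient_space V W"
  note q = carrier_quotient add_quotient smult_quotient zero_quotient
  show "field K" by (rule field_axioms)
  show "\<zero>\<^bsub>?Q\<^esub> \<in> carrier ?Q" by (auto simp: q)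
  show "\<forall>v\<in>carrier ?Q. \<exists>neg_v\<in>carrier ?Q. v \<oplus>\<^bsub>?Q\<^esub> neg_v = \<zero>\<^bsub>?Q\<^esub>"
  proof
    fix v assume "v \<in> carrier ?Q"
    then obtain x where "x \<in> carrier V" "v = W +>\<^bsub>V\<^esub> x" by (auto simp: q)
    then show "\<exists>neg_v\<in>carrier ?Q. v \<oplus>\<^bsub>?Q\<^esub> neg_v = \<zero>\<^bsub>?Q\<^esub>"
      by (intro bexI[of _ "W +>\<^bsub>V\<^esub> (\<ominus>\<^bsub>V\<^esub> x)"]) (auto simp: q V.r_neg)
  qed
qed (auto simp: carrier_quotient add_quotient smult_quotient zero_quotient V.a_ac
      V.smult_l_distr V.smult_r_distr V.smult_assoc1)

lemma lin_coset: "lin V (quotient_space V W) (\<lambda>x. W +>\<^bsub>V\<^esub> x)"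
  by (rule linI) (auto simp: vs_quotient carrier_quotient add_quotient smult_quotient V.vectorspace_axioms)

lemma induced_eq:
  assumes "u \<in> C" "\<And>x. x \<in> C \<Longrightarrow> f x \<in> carrier V \<and> f x \<ominus>\<^bsub>V\<^esub> f u \<in> W"
  shows "induced V W f C = W +>\<^bsub>V\<^esub> f u"
  unfolding induced_def
  by (rule UN_eq_const[OF _ assms(1)]) (use assms in \<open>auto simp: coset_eq_iff\<close>)

end

lemma coset_self: "subspace K W V \<Longrightarrow> x \<in> carrier V \<Longrightarrow> x \<in> W +>\<^bsub>V\<^esub> x"
  by (rule abelian_subgroup.a_rcos_self[OF abelian_subgroup])

text \<open>The evaluation rule for every map that the definitions build with
  \<open>induced\<close>: the action on a quotient object, \<open>bracket_map\<close> and
  \<open>Bit_map\<close>.\<close>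

lemma induced_coset:
  assumes "subspace K W V" "lin U V f" "subspace K S U" "f ` S \<subseteq> W" "x \<in> carrier U"
  shows "induced V W f (S +>\<^bsub>U\<^esub> x) = W +>\<^bsub>V\<^esub> f x"
proof (rule induced_eq[OF assms(1)])
  show "x \<in> S +>\<^bsub>U\<^esub> x" by (rule coset_self[OF assms(3,5)])
  fix y assume "y \<in> S +>\<^bsub>U\<^esub> x"
  then have y: "y \<in> carrier U" "y \<ominus>\<^bsub>U\<^esub> x \<in> S" using coset_mem[OF assms(3,5)] by auto
  then have "f (y \<ominus>\<^bsub>U\<^esub> x) \<in> W" using assms(4) by auto
  then show "f y \<in> carrier V \<and> f y \<ominus>\<^bsub>V\<^esub> f x \<in> W"
    using y assms by (auto simp: linD[OF assms(2)])
qed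

subsection \<open>Linear functionals\<close>

lemma vs_ground: "vspace (ground K)"
  by (rule vs_criteria)
     (auto simp: ground_def field_axioms a_ac m_ac l_distr r_distr intro!: bexI[of _ "\<ominus> _"] r_neg)

abbreviation functional :: "('k, 'v, 'y) module_scheme \<Rightarrow> ('v \<Rightarrow> 'k) \<Rightarrow> bool"
  where "functional V \<equiv> lin V (ground K)"

text \<open>By Zorn's lemma there is a maximal subspace containing \<open>S\<close> but not \<open>v\<close>; it is a hyperplane.\<close>

lemma separating_functional:
  assumes S: "subspace K S V" and v: "v \<in> carrier V" "v \<notin> S"
  obtains \<phi> where "functional V \<phi>" "\<And>s. s \<in> S \<Longrightarrow> \<phi> s = \<zero>" "\<phi> v = \<one>"
proof -
  interpret V: vectorspace K V by (rule subspaceD(1)[OF S])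
  let ?A = "{M. subspace K M V \<and> S \<subseteq> M \<and> v \<notin> M}"
  have "\<exists>M\<in>?A. \<forall>X\<in>?A. M \<subseteq> X \<longrightarrow> X = M"
  proof (rule subset_Zorn_nonempty)
    show "?A \<noteq> {}" using assms by auto
    fix C assume C: "C \<noteq> {}" "subset.chain ?A C"
    then have sub: "\<And>M. M \<in> C \<Longrightarrow> subspace K M V" and CA: "C \<subseteq> ?A" by (auto simp: subset.chain_def)
    have dir: "\<exists>M\<in>C. x \<in> M \<and> y \<in> M" if "x \<in> \<Union>C" "y \<in> \<Union>C" for x y
    proof -
      from that obtain M N where "M \<in> C" "N \<in> C" "x \<in> M" "y \<in> N" by auto
      moreover from this C(2) have "M \<subseteq> N \<or> N \<subseteq> M" by (auto simp: subset_chain_def)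
      ultimately show ?thesis by auto
    qed
    have "subspace K (\<Union>C) V"
    proof (rule subspaceI)
      show "vspace V" by (rule subspaceD(1)[OF S])
      show "\<Union>C \<subseteq> carrier V" using sub by (auto dest: subspaceD(4))
      show "\<zero>\<^bsub>V\<^esub> \<in> \<Union>C" using C(1) sub by (auto dest: subspaceD(3))
      show "x \<oplus>\<^bsub>V\<^esub> y \<in> \<Union>C" if "x \<in> \<Union>C" "y \<in> \<Union>C" for x y
        using dir[OF that] sub by (auto dest: subspaceD(5))
      show "c \<odot>\<^bsub>V\<^esub> x \<in> \<Union>C" if "c \<in> carrier K" "x \<in> \<Union>C" for c x
        using that sub by (auto dest: subspaceD(6))
    qed
    then show "\<Union>C \<in> ?A" using CA C(1) by auto
  qed
  then obtain M where M: "subspace K M V" "S \<subseteq> M" "v \<notin> M"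
    and max: "\<And>X. subspace K X V \<Longrightarrow> S \<subseteq> X \<Longrightarrow> v \<notin> X \<Longrightarrow> M \<subseteq> X \<Longrightarrow> X = M" by auto
  note [simp] = subspaceD[OF M(1)]
  \<comment> \<open>The subspace M + K w. If w is outside \<open>M\<close>, it is strictly larger
    than \<open>M\<close>, so maximality forces it to contain \<open>v\<close>; solving for w then
    exhibits w as a multiple of \<open>v\<close> modulo \<open>M\<close>.\<close>
  have line: "subspace K {m \<oplus>\<^bsub>V\<^esub> c \<odot>\<^bsub>V\<^esub> w |m c. m \<in> M \<and> c \<in> carrier K} V" (is "subspace K ?L V")
    if w: "w \<in> carrier V" for w
  proof (rule subspaceI)
    show "vspace V" by simp
    show "?L \<subseteq> carrier V" using w by auto
    show "\<zero>\<^bsub>V\<^esub> \<in> ?L" using w by (auto intro!: exI[of _ "\<zero>\<^bsub>V\<^esub>"] exI[of _ \<zero>])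
    show "x \<oplus>\<^bsub>V\<^esub> y \<in> ?L" if "x \<in> ?L" "y \<in> ?L" for x y
    proof -
      from that obtain m c n d where "x = m \<oplus>\<^bsub>V\<^esub> c \<odot>\<^bsub>V\<^esub> w" "y = n \<oplus>\<^bsub>V\<^esub> d \<odot>\<^bsub>V\<^esub> w"
        "m \<in> M" "n \<in> M" "c \<in> carrier K" "d \<in> carrier K" by auto
      then show ?thesis using w
        by (auto intro!: exI[of _ "m \<oplus>\<^bsub>V\<^esub> n"] exI[of _ "c \<oplus> d"] simp: V.smult_l_distr V.a_ac)
    qed
    show "c \<odot>\<^bsub>V\<^esub> x \<in> ?L" if "c \<in> carrier K" "x \<in> ?L" for c x
    proof -
      from that obtain m d where "x = m \<oplus>\<^bsub>V\<^esub> d \<odot>\<^bsub>V\<^esub> w" "m \<in> M" "d \<in> carrier K" by auto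
      then show ?thesis using w that
        by (auto intro!: exI[of _ "c \<odot>\<^bsub>V\<^esub> m"] exI[of _ "c \<otimes> d"] simp: V.smult_r_distr V.smult_assoc1)
    qed
  qed
  have dec: "\<exists>c\<in>carrier K. w \<ominus>\<^bsub>V\<^esub> c \<odot>\<^bsub>V\<^esub> v \<in> M" if w: "w \<in> carrier V" for w
  proof (cases "w \<in> M")
    case True
    then show ?thesis using v w by (intro bexI[of _ \<zero>]) (auto simp: a_minus_def)
  next
    case False
    let ?L = "{m \<oplus>\<^bsub>V\<^esub> c \<odot>\<^bsub>V\<^esub> w |m c. m \<in> M \<and> c \<in> carrier K}"
    have "M \<subseteq> ?L"
    proof
      fix m assume "m \<in> M"
      then have "m = m \<oplus>\<^bsub>V\<^esub> \<zero> \<odot>\<^bsub>V\<^esub> w" using w by simp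
      then show "m \<in> ?L" using \<open>m \<in> M\<close> by blast
    qed
    moreover have "w \<in> ?L"
    proof -
      have "w = \<zero>\<^bsub>V\<^esub> \<oplus>\<^bsub>V\<^esub> \<one> \<odot>\<^bsub>V\<^esub> w" using w by simp
      moreover have "\<zero>\<^bsub>V\<^esub> \<in> M" by simp
      ultimately show ?thesis by blast
    qed
    ultimately have "v \<in> ?L" using max[OF line[OF w]] False M(2) by blast
    then obtain m c where mc: "v = m \<oplus>\<^bsub>V\<^esub> c \<odot>\<^bsub>V\<^esub> w" "m \<in> M" "c \<in> carrier K" by auto
    then have "c \<noteq> \<zero>" using M(3) w by auto
    then have c: "inv c \<in> carrier K" "inv c \<otimes> c = \<one>" using mc(3) by (auto simp: field_Units)
    have "inv c \<odot>\<^bsub>V\<^esub> v = inv c \<odot>\<^bsub>V\<^esub> m \<oplus>\<^bsub>V\<^esub> w"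
      using mc w c by (simp add: V.smult_r_distr V.smult_assoc1[symmetric])
    then have "w \<ominus>\<^bsub>V\<^esub> inv c \<odot>\<^bsub>V\<^esub> v = \<ominus>\<^bsub>V\<^esub> (inv c \<odot>\<^bsub>V\<^esub> m)"
      using mc w c by (simp add: a_minus_def V.minus_add V.a_ac V.r_neg V.r_neg1 V.r_neg2)
    then show ?thesis using c mc by (intro bexI[of _ "inv c"]) auto
  qed
  have uniq: "c = d" if "w \<in> carrier V" "c \<in> carrier K" "d \<in> carrier K"
    "w \<ominus>\<^bsub>V\<^esub> c \<odot>\<^bsub>V\<^esub> v \<in> M" "w \<ominus>\<^bsub>V\<^esub> d \<odot>\<^bsub>V\<^esub> v \<in> M" for w c d
  proof (rule ccontr)
    assume "c \<noteq> d"
    have "(w \<ominus>\<^bsub>V\<^esub> c \<odot>\<^bsub>V\<^esub> v) \<ominus>\<^bsub>V\<^esub> (w \<ominus>\<^bsub>V\<^esub> d \<odot>\<^bsub>V\<^esub> v) = (d \<ominus> c) \<odot>\<^bsub>V\<^esub> v"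
      using that v by (simp add: a_minus_def V.minus_add V.a_ac V.smult_l_distr V.smult_l_minus V.r_neg1 V.r_neg2)
    then have m: "(d \<ominus> c) \<odot>\<^bsub>V\<^esub> v \<in> M" using that subspaceD(8)[OF M(1)] by metis
    have "d \<ominus> c \<noteq> \<zero>" using that \<open>c \<noteq> d\<close> by simp
    then have i: "inv (d \<ominus> c) \<in> carrier K" "inv (d \<ominus> c) \<otimes> (d \<ominus> c) = \<one>"
      using that by (auto simp: field_Units)
    then have "inv (d \<ominus> c) \<odot>\<^bsub>V\<^esub> ((d \<ominus> c) \<odot>\<^bsub>V\<^esub> v) = v"
      using that v by (simp add: V.smult_assoc1[symmetric])
    then show False using m i M(3) subspaceD(6)[OF M(1) i(1) m] by simp
  qed
  \<comment> \<open>The coefficient of \<open>v\<close> modulo \<open>M\<close>: it exists by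
    \<open>dec\<close>, and two candidates would put a nonzero multiple of \<open>v\<close> into
    \<open>M\<close>.\<close>
  define \<phi> where "\<phi> w = (THE c. c \<in> carrier K \<and> w \<ominus>\<^bsub>V\<^esub> c \<odot>\<^bsub>V\<^esub> v \<in> M)" for w
  have phi: "\<phi> w \<in> carrier K \<and> w \<ominus>\<^bsub>V\<^esub> \<phi> w \<odot>\<^bsub>V\<^esub> v \<in> M" if "w \<in> carrier V" for w
    unfolding \<phi>_def by (rule theI') (use dec[OF that] uniq[OF that] in blast)
  have phi_eq: "\<phi> w = c" if "w \<in> carrier V" "c \<in> carrier K" "w \<ominus>\<^bsub>V\<^esub> c \<odot>\<^bsub>V\<^esub> v \<in> M" for w c
    using phi uniq that by blast
  show thesis
  proof (rule that)
    show "functional V \<phi>"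
    proof (rule linI)
      show "\<phi> x \<in> carrier (ground K)" if "x \<in> carrier V" for x using phi[OF that] by (simp add: ground_def)
      show "\<phi> (x \<oplus>\<^bsub>V\<^esub> y) = \<phi> x \<oplus>\<^bsub>ground K\<^esub> \<phi> y" if "x \<in> carrier V" "y \<in> carrier V" for x y
      proof -
        have "(x \<oplus>\<^bsub>V\<^esub> y) \<ominus>\<^bsub>V\<^esub> (\<phi> x \<oplus> \<phi> y) \<odot>\<^bsub>V\<^esub> v
            = (x \<ominus>\<^bsub>V\<^esub> \<phi> x \<odot>\<^bsub>V\<^esub> v) \<oplus>\<^bsub>V\<^esub> (y \<ominus>\<^bsub>V\<^esub> \<phi> y \<odot>\<^bsub>V\<^esub> v)"
          using that phi v by (simp add: a_minus_def V.minus_add V.a_ac V.smult_l_distr)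
        then show ?thesis using that phi v by (simp add: ground_def) (rule phi_eq, auto)
      qed
      show "\<phi> (c \<odot>\<^bsub>V\<^esub> x) = c \<odot>\<^bsub>ground K\<^esub> \<phi> x" if "c \<in> carrier K" "x \<in> carrier V" for c x
      proof -
        have "(c \<odot>\<^bsub>V\<^esub> x) \<ominus>\<^bsub>V\<^esub> (c \<otimes> \<phi> x) \<odot>\<^bsub>V\<^esub> v = c \<odot>\<^bsub>V\<^esub> (x \<ominus>\<^bsub>V\<^esub> \<phi> x \<odot>\<^bsub>V\<^esub> v)"
          using that phi v by (simp add: a_minus_def V.smult_r_distr V.smult_assoc1 V.smult_r_minus)
        then show ?thesis using that phi v by (simp add: ground_def) (rule phi_eq, auto)
      qed
    qed (auto simp: vs_ground)
    show "\<phi> s = \<zero>" if "s \<in> S" for s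
      using that M(2) v by (intro phi_eq) (auto simp: a_minus_def)
    show "\<phi> v = \<one>"
      using v by (intro phi_eq) (auto simp: a_minus_def V.r_neg)
  qed
qed

section \<open>Free vector spaces and linear extension\<close>

abbreviation supp :: "('s \<Rightarrow> 'k) \<Rightarrow> 's set" where "supp f \<equiv> {s. f s \<noteq> \<zero>}"

text \<open>With \<beta> uncurried, this is the sum in the description that defines
  \<open>tlift\<close>, taken at one representative; evaluating \<open>tlift\<close> then only
  requires its constancy on cosets.\<close>

definition lin_ext :: "('k, 'u, 'z) module_scheme \<Rightarrow> ('s \<Rightarrow> 'u) \<Rightarrow> ('s \<Rightarrow> 'k) \<Rightarrow> 'u" where
  "lin_ext U \<beta> f = (\<Oplus>\<^bsub>U\<^esub>p\<in>supp f. f p \<odot>\<^bsub>U\<^esub> \<beta> p)"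

lemma free_spaceD:
  assumes "f \<in> carrier (free_space K S)"
  shows "f s \<in> carrier K" "finite (supp f)" "supp f \<subseteq> S"
  using assms by (auto simp: free_space_def)

lemma free_spaceI:
  assumes "\<And>s. f s \<in> carrier K" "finite T" "T \<subseteq> S" "\<And>s. s \<notin> T \<Longrightarrow> f s = \<zero>"
  shows "f \<in> carrier (free_space K S)"
proof -
  have "supp f \<subseteq> T" using assms(4) by blast
  then show ?thesis using assms(1-3) finite_subset[of "supp f" T] by (auto simp: free_space_def)
qed

lemma vs_free: "vspace (free_space K S)"
proof (rule vs_criteria)
  show "field K" by (rule field_axioms)
  let ?F = "free_space K S"
  show "\<zero>\<^bsub>?F\<^esub> \<in> carrier ?F" by (auto simp: free_space_def)
  show "\<forall>v w. v \<in> carrier ?F \<and> w \<in> carrier ?F \<longrightarrow> v \<oplus>\<^bsub>?F\<^esub> w \<in> carrier ?F"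
  proof (intro allI impI)
    fix v w assume "v \<in> carrier ?F \<and> w \<in> carrier ?F"
    then have "(\<lambda>s. v s \<oplus> w s) \<in> carrier ?F"
      by (intro free_spaceI[of _ "supp v \<union> supp w"]) (auto simp: free_spaceD dest: free_spaceD(3))
    then show "v \<oplus>\<^bsub>?F\<^esub> w \<in> carrier ?F" by (simp add: free_space_def)
  qed
  show "\<forall>v\<in>carrier ?F. \<exists>neg_v\<in>carrier ?F. v \<oplus>\<^bsub>?F\<^esub> neg_v = \<zero>\<^bsub>?F\<^esub>"
  proof
    fix v assume v: "v \<in> carrier ?F"
    show "\<exists>neg_v\<in>carrier ?F. v \<oplus>\<^bsub>?F\<^esub> neg_v = \<zero>\<^bsub>?F\<^esub>"
    proof
      show "(\<lambda>s. \<ominus> v s) \<in> carrier ?F"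
        using v by (intro free_spaceI[of _ "supp v"]) (auto simp: free_spaceD dest: free_spaceD(3))
      show "v \<oplus>\<^bsub>?F\<^esub> (\<lambda>s. \<ominus> v s) = \<zero>\<^bsub>?F\<^esub>"
        using free_spaceD(1)[OF v] by (simp add: free_space_def r_neg)
    qed
  qed
  show "\<forall>c v. c \<in> carrier K \<and> v \<in> carrier ?F \<longrightarrow> c \<odot>\<^bsub>?F\<^esub> v \<in> carrier ?F"
  proof (intro allI impI)
    fix c v assume "c \<in> carrier K \<and> v \<in> carrier ?F"
    then have "(\<lambda>s. c \<otimes> v s) \<in> carrier ?F"
      by (intro free_spaceI[of _ "supp v"]) (auto simp: free_spaceD dest: free_spaceD(3))
    then show "c \<odot>\<^bsub>?F\<^esub> v \<in> carrier ?F" by (simp add: free_space_def)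
  qed
qed (auto simp: free_space_def fun_eq_iff image_subset_iff a_ac m_ac l_distr r_distr)

lemma basis_vector_free: "s \<in> S \<Longrightarrow> basis_vector K s \<in> carrier (free_space K S)"
  by (auto simp: free_space_def basis_vector_def)

text \<open>Terms outside the support vanish, so the index set may be enlarged. This puts two
  functions with different supports over a common index set, as additivity requires.\<close>

lemma lin_ext_eq:
  assumes U: "vspace U" and f: "f \<in> carrier (free_space K S)" and \<beta>: "\<And>s. s \<in> S \<Longrightarrow> \<beta> s \<in> carrier U"
    and T: "finite T" "supp f \<subseteq> T" "T \<subseteq> S"
  shows "lin_ext U \<beta> f = (\<Oplus>\<^bsub>U\<^esub>p\<in>T. f p \<odot>\<^bsub>U\<^esub> \<beta> p)"
proof -
  interpret U: vectorspace K U by fact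
  show ?thesis unfolding lin_ext_def
    by (rule U.add.finprod_mono_neutral_cong_left)
       (use T \<beta> free_spaceD[OF f] in \<open>auto simp: subset_iff\<close>)
qed

lemma lin_lin_ext:
  assumes U: "vspace U" and \<beta>: "\<And>s. s \<in> S \<Longrightarrow> \<beta> s \<in> carrier U"
  shows "lin (free_space K S) U (lin_ext U \<beta>)"
proof (rule linI)
  interpret U: vectorspace K U by fact
  let ?F = "free_space K S"
  show "vspace ?F" by (rule vs_free)
  show "vspace U" by fact
  show "lin_ext U \<beta> f \<in> carrier U" if f: "f \<in> carrier ?F" for f
    unfolding lin_ext_def using free_spaceD[OF f] \<beta> by (intro U.finsum_closed) auto
  show "lin_ext U \<beta> (f \<oplus>\<^bsub>?F\<^esub> g) = lin_ext U \<beta> f \<oplus>\<^bsub>U\<^esub> lin_ext U \<beta> g"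
    if f: "f \<in> carrier ?F" and g: "g \<in> carrier ?F" for f g
  proof -
    note fd = free_spaceD[OF f] free_spaceD[OF g]
    have h: "f \<oplus>\<^bsub>?F\<^esub> g \<in> carrier ?F" using f g by (simp add: vsD[OF vs_free])
    let ?T = "supp f \<union> supp g"
    have T: "finite ?T" "?T \<subseteq> S" using fd by auto
    have "supp (f \<oplus>\<^bsub>?F\<^esub> g) \<subseteq> ?T" by (auto simp: free_space_def)
    then have "lin_ext U \<beta> (f \<oplus>\<^bsub>?F\<^esub> g) = (\<Oplus>\<^bsub>U\<^esub>p\<in>?T. (f p \<oplus> g p) \<odot>\<^bsub>U\<^esub> \<beta> p)"
      using lin_ext_eq[OF U h \<beta> T(1) _ T(2)] by (simp add: free_space_def)
    also have "\<dots> = (\<Oplus>\<^bsub>U\<^esub>p\<in>?T. f p \<odot>\<^bsub>U\<^esub> \<beta> p \<oplus>\<^bsub>U\<^esub> g p \<odot>\<^bsub>U\<^esub> \<beta> p)"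
      using T fd \<beta> by (intro U.finsum_cong') (auto simp: U.smult_l_distr subset_iff)
    also have "\<dots> = (\<Oplus>\<^bsub>U\<^esub>p\<in>?T. f p \<odot>\<^bsub>U\<^esub> \<beta> p) \<oplus>\<^bsub>U\<^esub> (\<Oplus>\<^bsub>U\<^esub>p\<in>?T. g p \<odot>\<^bsub>U\<^esub> \<beta> p)"
      using T fd \<beta> by (intro U.finsum_addf) (auto simp: subset_iff)
    also have "\<dots> = lin_ext U \<beta> f \<oplus>\<^bsub>U\<^esub> lin_ext U \<beta> g"
      using lin_ext_eq[OF U f \<beta> T(1) _ T(2)] lin_ext_eq[OF U g \<beta> T(1) _ T(2)] by simp
    finally show ?thesis .
  qed
  show "lin_ext U \<beta> (c \<odot>\<^bsub>?F\<^esub> f) = c \<odot>\<^bsub>U\<^esub> lin_ext U \<beta> f"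
    if c: "c \<in> carrier K" and f: "f \<in> carrier ?F" for c f
  proof -
    note fd = free_spaceD[OF f]
    have h: "c \<odot>\<^bsub>?F\<^esub> f \<in> carrier ?F" using c f by (simp add: vsD[OF vs_free])
    have "supp (c \<odot>\<^bsub>?F\<^esub> f) \<subseteq> supp f" using c by (auto simp: free_space_def)
    then have "lin_ext U \<beta> (c \<odot>\<^bsub>?F\<^esub> f) = (\<Oplus>\<^bsub>U\<^esub>p\<in>supp f. (c \<otimes> f p) \<odot>\<^bsub>U\<^esub> \<beta> p)"
      using lin_ext_eq[OF U h \<beta> fd(2) _ fd(3)] by (simp add: free_space_def)
    also have "\<dots> = (\<Oplus>\<^bsub>U\<^esub>p\<in>supp f. c \<odot>\<^bsub>U\<^esub> (f p \<odot>\<^bsub>U\<^esub> \<beta> p))"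
      using fd \<beta> c by (intro U.finsum_cong') (auto simp: U.smult_assoc1)
    also have "\<dots> = c \<odot>\<^bsub>U\<^esub> lin_ext U \<beta> f"
      unfolding lin_ext_def using fd \<beta> c by (intro U.finsum_smult_ldistr[symmetric]) auto
    finally show ?thesis .
  qed
qed

lemma lin_ext_basis:
  assumes U: "vspace U" and \<beta>: "\<beta> s \<in> carrier U"
  shows "lin_ext U \<beta> (basis_vector K s) = \<beta> s"
proof -
  interpret U: vectorspace K U by fact
  have "supp (basis_vector K s) = {s}" by (auto simp: basis_vector_def)
  then show ?thesis using \<beta> by (simp add: lin_ext_def basis_vector_def)
qed

text \<open>Induction on a finite set bounding the support: splitting off the coordinate at
  \<open>s\<close> leaves \<open>f(s := \<zero>)\<close>, whose support is smaller. The bounding set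
  may reach outside \<open>S\<close>; there the coefficient vanishes and nothing is split
  off.\<close>

lemma free_space_span:
  assumes W: "subspace K W (free_space K S)" and b: "\<And>s. s \<in> S \<Longrightarrow> basis_vector K s \<in> W"
  shows "carrier (free_space K S) \<subseteq> W"
proof
  let ?F = "free_space K S"
  have "f \<in> W" if "finite T" "f \<in> carrier ?F" "supp f \<subseteq> T" for T f
    using that
  proof (induction T arbitrary: f rule: finite_induct)
    case empty
    then have "f = \<zero>\<^bsub>?F\<^esub>" by (simp add: free_space_def fun_eq_iff)
    then show ?case by (simp add: subspaceD(3)[OF W])
  next
    case (insert s T)
    note f = free_spaceD[OF insert(4)]
    show ?case
    proof (cases "s \<in> S")
      case True
      have g: "f(s := \<zero>) \<in> carrier ?F"
        using f by (intro free_spaceI[of _ "supp f"]) auto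
      have "f(s := \<zero>) \<in> W" using insert(5) by (intro insert.IH g) auto
      moreover have "f s \<odot>\<^bsub>?F\<^esub> basis_vector K s \<in> W"
        by (rule subspaceD(6)[OF W f(1) b[OF True]])
      moreover have "f = f s \<odot>\<^bsub>?F\<^esub> basis_vector K s \<oplus>\<^bsub>?F\<^esub> f(s := \<zero>)"
        using f(1) by (simp add: free_space_def basis_vector_def fun_eq_iff)
      ultimately show ?thesis using subspaceD(5)[OF W] by metis
    next
      case False
      then have "supp f \<subseteq> T" using f(3) insert(5) by blast
      then show ?thesis by (rule insert.IH[OF insert(4)])
    qed
  qed
  then show "f \<in> W" if "f \<in> carrier ?F" for f
    using free_spaceD(2)[OF that] that by blast
qed

subsection \<open>Bilinear maps\<close>

definition bilin ::
  "('k, 'v, 'x) module_scheme \<Rightarrow> ('k, 'w, 'y) module_scheme \<Rightarrow> ('k, 'u, 'z) module_scheme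
    \<Rightarrow> ('v \<Rightarrow> 'w \<Rightarrow> 'u) \<Rightarrow> bool" where
  "bilin V W U \<beta> \<longleftrightarrow> (\<forall>x\<in>carrier V. lin W U (\<beta> x)) \<and> (\<forall>y\<in>carrier W. lin V U (\<lambda>x. \<beta> x y))"

lemma bilinI:
  "(\<And>x. x \<in> carrier V \<Longrightarrow> lin W U (\<lambda>y. \<beta> x y)) \<Longrightarrow> (\<And>y. y \<in> carrier W \<Longrightarrow> lin V U (\<lambda>x. \<beta> x y)) \<Longrightarrow> bilin V W U \<beta>"
  by (simp add: bilin_def)

lemma bilinD:
  assumes "bilin V W U \<beta>"
  shows "x \<in> carrier V \<Longrightarrow> lin W U (\<beta> x)" "y \<in> carrier W \<Longrightarrow> lin V U (\<lambda>x. \<beta> x y)"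
    "x \<in> carrier V \<Longrightarrow> y \<in> carrier W \<Longrightarrow> \<beta> x y \<in> carrier U"
  using assms by (auto simp: bilin_def linD(3))

text \<open>The clauses of \<open>bilin\<close> are vacuous over an empty carrier; the zero vector
  of \<open>V\<close> provides an argument at which linearity, and with it the two space properties,
  can be read off.\<close>

lemma bilin_vs:
  assumes "bilin V W U \<beta>" "vspace V"
  shows "vspace W" "vspace U"
  using assms linD(1,2)[OF bilinD(1)[OF assms(1)]] vsD(3)[OF assms(2)] by auto

subsection \<open>Tensor products\<close>

abbreviation tns (infixr "\<otimes>\<^sub>t" 65) where "V \<otimes>\<^sub>t W \<equiv> tensor K V W"

text \<open>Gives a name to the generating set inside \<open>tensor_rel\<close>, so that the span
  rules can be applied to it.\<close>

definition tensor_gens ::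
  "('k, 'v, 'y) module_scheme \<Rightarrow> ('k, 'w, 'z) module_scheme \<Rightarrow> ('v \<times> 'w \<Rightarrow> 'k) set" where
  "tensor_gens V W = (let F = free_space K (carrier V \<times> carrier W); e = (\<lambda>x y. basis_vector K (x, y)) in
      {e (x \<oplus>\<^bsub>V\<^esub> x') y \<ominus>\<^bsub>F\<^esub> (e x y \<oplus>\<^bsub>F\<^esub> e x' y) | x x' y.
          x \<in> carrier V \<and> x' \<in> carrier V \<and> y \<in> carrier W} \<union>
       {e x (y \<oplus>\<^bsub>W\<^esub> y') \<ominus>\<^bsub>F\<^esub> (e x y \<oplus>\<^bsub>F\<^esub> e x y') | x y y'.
          x \<in> carrier V \<and> y \<in> carrier W \<and> y' \<in> carrier W} \<union>
       {e (c \<odot>\<^bsub>V\<^esub> x) y \<ominus>\<^bsub>F\<^esub> c \<odot>\<^bsub>F\<^esub> e x y | c x y.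
          c \<in> carrier K \<and> x \<in> carrier V \<and> y \<in> carrier W} \<union>
       {e x (c \<odot>\<^bsub>W\<^esub> y) \<ominus>\<^bsub>F\<^esub> c \<odot>\<^bsub>F\<^esub> e x y | c x y.
          c \<in> carrier K \<and> x \<in> carrier V \<and> y \<in> carrier W})"

lemma tensor_rel_span:
  "tensor_rel K V W = module.span K (free_space K (carrier V \<times> carrier W)) (tensor_gens V W)"
  by (simp add: tensor_rel_def tensor_gens_def Let_def)

context
  fixes V :: "('k, 'v, 'y) module_scheme" and W :: "('k, 'w, 'z) module_scheme"
  assumes V: "vspace V" and W: "vspace W"
begin

interpretation V: vectorspace K V by (rule V)
interpretation W: vectorspace K W by (rule W)
interpretation F: vectorspace K "free_space K (carrier V \<times> carrier W)" by (rule vs_free)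

lemma tensor_gens_subset: "tensor_gens V W \<subseteq> carrier (free_space K (carrier V \<times> carrier W))"
  unfolding tensor_gens_def Let_def
  by (intro Un_least subsetI) (auto intro!: F.minus_closed F.smult_closed F.add.m_closed basis_vector_free)

lemma tensor_rel_subspace: "subspace K (tensor_rel K V W) (free_space K (carrier V \<times> carrier W))"
  unfolding tensor_rel_span by (rule span_subspace[OF vs_free tensor_gens_subset])

lemma tensor_gens_rel: "g \<in> tensor_gens V W \<Longrightarrow> g \<in> tensor_rel K V W"
  unfolding tensor_rel_span by (rule span_incl[OF vs_free tensor_gens_subset])

lemma tensor_rel_gens:
  defines "F \<equiv> free_space K (carrier V \<times> carrier W)"
  shows
  "\<lbrakk>x \<in> carrier V; x' \<in> carrier V; y \<in> carrier W\<rbrakk> \<Longrightarrow>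
    basis_vector K (x \<oplus>\<^bsub>V\<^esub> x', y) \<ominus>\<^bsub>F\<^esub> (basis_vector K (x, y) \<oplus>\<^bsub>F\<^esub> basis_vector K (x', y)) \<in> tensor_rel K V W"
  "\<lbrakk>x \<in> carrier V; y \<in> carrier W; y' \<in> carrier W\<rbrakk> \<Longrightarrow>
    basis_vector K (x, y \<oplus>\<^bsub>W\<^esub> y') \<ominus>\<^bsub>F\<^esub> (basis_vector K (x, y) \<oplus>\<^bsub>F\<^esub> basis_vector K (x, y')) \<in> tensor_rel K V W"
  "\<lbrakk>c \<in> carrier K; x \<in> carrier V; y \<in> carrier W\<rbrakk> \<Longrightarrow>
    basis_vector K (c \<odot>\<^bsub>V\<^esub> x, y) \<ominus>\<^bsub>F\<^esub> c \<odot>\<^bsub>F\<^esub> basis_vector K (x, y) \<in> tensor_rel K V W"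
  "\<lbrakk>c \<in> carrier K; x \<in> carrier V; y \<in> carrier W\<rbrakk> \<Longrightarrow>
    basis_vector K (x, c \<odot>\<^bsub>W\<^esub> y) \<ominus>\<^bsub>F\<^esub> c \<odot>\<^bsub>F\<^esub> basis_vector K (x, y) \<in> tensor_rel K V W"
  unfolding F_def by (rule tensor_gens_rel, unfold tensor_gens_def Let_def, blast)+

lemma vs_tensor: "vspace (V \<otimes>\<^sub>t W)"
  unfolding tensor_def by (rule vs_quotient[OF tensor_rel_subspace])

lemma tens_closed: "x \<in> carrier V \<Longrightarrow> y \<in> carrier W \<Longrightarrow> tens K V W x y \<in> carrier (V \<otimes>\<^sub>t W)"
  by (simp add: tens_def tensor_def carrier_quotient[OF tensor_rel_subspace] basis_vector_free)

lemma bilin_tens: "bilin V W (V \<otimes>\<^sub>t W) (tens K V W)"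
proof -
  note q = tensor_rel_subspace
  show ?thesis
    by (intro bilinI linI V W vs_tensor tens_closed; assumption?;
        simp add: tens_def tensor_def add_quotient[OF q] smult_quotient[OF q] coset_eq_iff[OF q]
          basis_vector_free tensor_rel_gens)
qed

text \<open>Each generator is sent to a defect of bilinearity of \<beta>, hence to zero, and the
  kernel of a linear map is a subspace, so it contains the whole span.\<close>

lemma lin_ext_tensor_rel:
  assumes \<beta>: "bilin V W U \<beta>" and f: "f \<in> tensor_rel K V W"
  shows "lin_ext U (\<lambda>p. \<beta> (fst p) (snd p)) f = \<zero>\<^bsub>U\<^esub>"
proof -
  let ?F = "free_space K (carrier V \<times> carrier W)"
  let ?L = "lin_ext U (\<lambda>p. \<beta> (fst p) (snd p))"
  have U: "vspace U" by (rule bilin_vs(2)[OF \<beta> V])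
  interpret U: vectorspace K U by (rule U)
  have lin: "lin ?F U ?L" by (rule lin_lin_ext[OF U]) (auto intro: bilinD(3)[OF \<beta>])
  have b: "?L (basis_vector K (x, y)) = \<beta> x y" if "x \<in> carrier V" "y \<in> carrier W" for x y
    using lin_ext_basis[OF U, of "\<lambda>p. \<beta> (fst p) (snd p)" "(x, y)"] bilinD(3)[OF \<beta>] that by simp
  have "tensor_rel K V W \<subseteq> {f \<in> carrier ?F. ?L f = \<zero>\<^bsub>U\<^esub>}"
    unfolding tensor_rel_span tensor_gens_def Let_def
    by (rule span_min[OF subspace_kernel[OF lin]])
       (auto simp: linD[OF lin] b basis_vector_free bilinD[OF \<beta>] linD(4,5)[OF bilinD(1)[OF \<beta>]]
         linD(4,5)[OF bilinD(2)[OF \<beta>]] U.r_neg a_minus_def[of U])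
  with f show ?thesis by blast
qed

text \<open>Two representatives of a tensor differ by an element of \<open>tensor_rel\<close>, on
  which the linear extension vanishes. The description in \<open>tlift\<close> is therefore of a
  unique element, given by any representative.\<close>

lemma tlift_eq:
  assumes \<beta>: "bilin V W U \<beta>" and f: "f \<in> carrier (free_space K (carrier V \<times> carrier W))"
  shows "tlift K U (tensor_rel K V W +>\<^bsub>free_space K (carrier V \<times> carrier W)\<^esub> f) \<beta>
    = lin_ext U (\<lambda>p. \<beta> (fst p) (snd p)) f"
proof -
  let ?F = "free_space K (carrier V \<times> carrier W)"
  let ?L = "lin_ext U (\<lambda>p. \<beta> (fst p) (snd p))"
  have U: "vspace U" by (rule bilin_vs(2)[OF \<beta> V])
  interpret U: vectorspace K U by (rule U)
  have lin: "lin ?F U ?L" by (rule lin_lin_ext[OF U]) (auto intro: bilinD(3)[OF \<beta>])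
  have "?L g = ?L f" if "g \<in> tensor_rel K V W +>\<^bsub>?F\<^esub> f" for g
  proof -
    have g: "g \<in> carrier ?F" "g \<ominus>\<^bsub>?F\<^esub> f \<in> tensor_rel K V W"
      using that by (auto simp: coset_mem[OF tensor_rel_subspace f])
    have "?L g \<ominus>\<^bsub>U\<^esub> ?L f = \<zero>\<^bsub>U\<^esub>" using lin_ext_tensor_rel[OF \<beta> g(2)] g f by (simp add: linD(8)[OF lin])
    then show ?thesis using f g linD(3)[OF lin] by simp
  qed
  moreover have "f \<in> tensor_rel K V W +>\<^bsub>?F\<^esub> f" by (rule coset_self[OF tensor_rel_subspace f])
  ultimately show ?thesis unfolding tlift_def lin_ext_def[symmetric]
    by (intro the_equality) blast+
qed

lemma tlift_tens [simp]:
  assumes \<beta>: "bilin V W U \<beta>" and "x \<in> carrier V" "y \<in> carrier W"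
  shows "tlift K U (tens K V W x y) \<beta> = \<beta> x y"
  unfolding tens_def
  using assms lin_ext_basis[OF bilin_vs(2)[OF \<beta> V], of "\<lambda>p. \<beta> (fst p) (snd p)" "(x, y)"]
  by (simp add: tlift_eq basis_vector_free bilinD(3)[OF \<beta>])

lemma lin_tlift:
  assumes \<beta>: "bilin V W U \<beta>"
  shows "lin (V \<otimes>\<^sub>t W) U (\<lambda>t. tlift K U t \<beta>)"
proof -
  let ?F = "free_space K (carrier V \<times> carrier W)"
  let ?L = "lin_ext U (\<lambda>p. \<beta> (fst p) (snd p))"
  note q = tensor_rel_subspace
  have U: "vspace U" by (rule bilin_vs(2)[OF \<beta> V])
  have lin: "lin ?F U ?L" by (rule lin_lin_ext[OF U]) (auto intro: bilinD(3)[OF \<beta>])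
  show ?thesis
    by (rule linI)
       (auto simp: U vs_quotient[OF q] tensor_def carrier_quotient[OF q] add_quotient[OF q] smult_quotient[OF q]
         tlift_eq[OF \<beta>] linD[OF lin])
qed

lemma tensor_span:
  assumes S: "subspace K S (V \<otimes>\<^sub>t W)" and t: "\<And>x y. x \<in> carrier V \<Longrightarrow> y \<in> carrier W \<Longrightarrow> tens K V W x y \<in> S"
    and u: "u \<in> carrier (V \<otimes>\<^sub>t W)"
  shows "u \<in> S"
proof -
  let ?F = "free_space K (carrier V \<times> carrier W)"
  let ?q = "\<lambda>f. tensor_rel K V W +>\<^bsub>?F\<^esub> f"
  have lin: "lin ?F (V \<otimes>\<^sub>t W) ?q" unfolding tensor_def by (rule lin_coset[OF tensor_rel_subspace])
  have "carrier ?F \<subseteq> {f \<in> carrier ?F. ?q f \<in> S}"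
    by (rule free_space_span[OF subspace_preimage[OF lin S]]) (use t in \<open>auto simp: basis_vector_free tens_def\<close>)
  with u show ?thesis by (auto simp: tensor_def carrier_quotient[OF tensor_rel_subspace])
qed

lemma tensor_ext:
  assumes f: "lin (V \<otimes>\<^sub>t W) U f" and g: "lin (V \<otimes>\<^sub>t W) U g"
    and eq: "\<And>x y. x \<in> carrier V \<Longrightarrow> y \<in> carrier W \<Longrightarrow> f (tens K V W x y) = g (tens K V W x y)"
    and u: "u \<in> carrier (V \<otimes>\<^sub>t W)"
  shows "f u = g u"
proof -
  have "u \<in> {u \<in> carrier (V \<otimes>\<^sub>t W). f u = g u}"
  proof (rule tensor_span[OF _ _ u])
    show "subspace K {u \<in> carrier (V \<otimes>\<^sub>t W). f u = g u} (V \<otimes>\<^sub>t W)"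
      by (rule subspaceI) (auto simp: vs_tensor linD[OF f] linD[OF g] vsD[OF vs_tensor])
  qed (use eq tens_closed in auto)
  then show ?thesis by simp
qed

text \<open>There is no case for zero or for scalar multiples: both are absorbed into pure
  tensors.\<close>

lemma tensor_induct [consumes 1, case_names tens add]:
  assumes u: "u \<in> carrier (V \<otimes>\<^sub>t W)"
    and t: "\<And>x y. x \<in> carrier V \<Longrightarrow> y \<in> carrier W \<Longrightarrow> P (tens K V W x y)"
    and a: "\<And>s t. s \<in> carrier (V \<otimes>\<^sub>t W) \<Longrightarrow> t \<in> carrier (V \<otimes>\<^sub>t W) \<Longrightarrow> P s \<Longrightarrow> P t \<Longrightarrow> P (s \<oplus>\<^bsub>V \<otimes>\<^sub>t W\<^esub> t)"
  shows "P u"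
proof -
  \<comment> \<open>\<open>P\<close> itself need not be stable under scalars, so stability is built
    in by asking for \<open>P\<close> at all scalar multiples. This makes the set a subspace to
    which \<open>tensor_span\<close> applies; the scalar 1 recovers \<open>P\<close> at the
    end.\<close>
  define S where "S = {u \<in> carrier (V \<otimes>\<^sub>t W). \<forall>c\<in>carrier K. P (c \<odot>\<^bsub>V \<otimes>\<^sub>t W\<^esub> u)}"
  interpret T: vectorspace K "V \<otimes>\<^sub>t W" by (rule vs_tensor)
  have sm: "c \<odot>\<^bsub>V \<otimes>\<^sub>t W\<^esub> tens K V W x y = tens K V W (c \<odot>\<^bsub>V\<^esub> x) y"
    if "c \<in> carrier K" "x \<in> carrier V" "y \<in> carrier W" for c x y
    using that by (simp add: linD(5)[OF bilinD(2)[OF bilin_tens]])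
  have z: "\<zero>\<^bsub>V \<otimes>\<^sub>t W\<^esub> = tens K V W \<zero>\<^bsub>V\<^esub> \<zero>\<^bsub>W\<^esub>"
    by (simp add: linD(6)[OF bilinD(2)[OF bilin_tens]])
  have "subspace K S (V \<otimes>\<^sub>t W)"
  proof (rule subspaceI)
    have "P \<zero>\<^bsub>V \<otimes>\<^sub>t W\<^esub>" using t z by simp
    then show "\<zero>\<^bsub>V \<otimes>\<^sub>t W\<^esub> \<in> S" by (simp add: S_def)
    show "x \<oplus>\<^bsub>V \<otimes>\<^sub>t W\<^esub> y \<in> S" if "x \<in> S" "y \<in> S" for x y
      using that by (auto simp: S_def T.smult_r_distr intro!: a)
    show "c \<odot>\<^bsub>V \<otimes>\<^sub>t W\<^esub> x \<in> S" if "c \<in> carrier K" "x \<in> S" for c x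
      using that by (auto simp: S_def T.smult_assoc1[symmetric])
  qed (auto simp: S_def vs_tensor)
  then have "u \<in> S" by (rule tensor_span[OF _ _ u]) (auto simp: S_def sm t tens_closed)
  then have "P (\<one> \<odot>\<^bsub>V \<otimes>\<^sub>t W\<^esub> u)" unfolding S_def using one_closed by blast
  then show ?thesis using u by simp
qed

end

end

section \<open>Rules for computing with Sweedler sums\<close>

named_theorems lin_intro

context linear_algebra
begin

declare lin_id [lin_intro] bilinI [lin_intro]

lemma lin_smult1 [lin_intro]:
  assumes "lin Z (ground K) g" "vspace V" "y \<in> carrier V"
  shows "lin Z V (\<lambda>z. g z \<odot>\<^bsub>V\<^esub> y)"
proof -
  interpret V: vectorspace K V by fact
  show ?thesis using assms linD[OF assms(1)]
    by (intro linI) (auto simp: ground_def V.smult_l_distr V.smult_assoc1)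
qed

lemma lin_smult2 [lin_intro]:
  assumes "lin Z V g" "c \<in> carrier K"
  shows "lin Z V (\<lambda>z. c \<odot>\<^bsub>V\<^esub> g z)"
proof -
  interpret V: vectorspace K V by (rule linD(2)[OF assms(1)])
  show ?thesis using assms linD[OF assms(1)]
    by (intro linI) (auto simp: V.smult_r_distr V.smult_assoc1[symmetric] m_comm)
qed

lemma lin_bilin1:
  assumes "bilin V W U \<beta>" "lin Z V g" "y \<in> carrier W"
  shows "lin Z U (\<lambda>z. \<beta> (g z) y)"
  by (rule lin_comp[OF bilinD(2)[OF assms(1,3)] assms(2)])

lemma lin_bilin2:
  assumes "bilin V W U \<beta>" "lin Z W g" "x \<in> carrier V"
  shows "lin Z U (\<lambda>z. \<beta> x (g z))"
  by (rule lin_comp[OF bilinD(1)[OF assms(1,3)] assms(2)])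

lemma lin_tens1 [lin_intro]:
  "lin Z V g \<Longrightarrow> vspace W \<Longrightarrow> y \<in> carrier W \<Longrightarrow> lin Z (V \<otimes>\<^sub>t W) (\<lambda>z. tens K V W (g z) y)"
  by (rule lin_bilin1[OF bilin_tens]) (auto dest: linD(2))

lemma lin_tens2 [lin_intro]:
  "lin Z W g \<Longrightarrow> vspace V \<Longrightarrow> x \<in> carrier V \<Longrightarrow> lin Z (V \<otimes>\<^sub>t W) (\<lambda>z. tens K V W x (g z))"
  by (rule lin_bilin2[OF bilin_tens]) (auto dest: linD(2))

lemma tlift_closed:
  assumes "t \<in> carrier (V \<otimes>\<^sub>t W)" "vspace V" "bilin V W U \<beta>"
  shows "tlift K U t \<beta> \<in> carrier U"
  using linD(3)[OF lin_tlift[OF assms(2) bilin_vs(1)[OF assms(3,2)] assms(3)] assms(1)] .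

lemma lin_tlift1:
  assumes "lin Z (V \<otimes>\<^sub>t W) g" "vspace V" "bilin V W U \<beta>"
  shows "lin Z U (\<lambda>z. tlift K U (g z) \<beta>)"
  using lin_comp[OF lin_tlift[OF assms(2) bilin_vs(1)[OF assms(3,2)] assms(3)] assms(1)] .

lemma tlift_expand:
  assumes "t \<in> carrier (V \<otimes>\<^sub>t W)" "vspace V" "vspace W"
  obtains f where "f \<in> carrier (free_space K (carrier V \<times> carrier W))"
    "t = tensor_rel K V W +>\<^bsub>free_space K (carrier V \<times> carrier W)\<^esub> f"
  using assms by (auto simp: tensor_def carrier_quotient[OF tensor_rel_subspace])

lemma lin_lin_ext_param:
  assumes f: "f \<in> carrier (free_space K S)" and l: "\<And>s. s \<in> S \<Longrightarrow> lin Z U (\<lambda>z. \<beta> z s)"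
    and Z: "vspace Z" and U: "vspace U"
  shows "lin Z U (\<lambda>z. lin_ext U (\<beta> z) f)"
proof -
  interpret U: vectorspace K U by (rule U)
  note fd = free_spaceD[OF f]
  have l: "lin Z U (\<lambda>z. \<beta> z s)" if "s \<in> supp f" for s using fd(3) that by (intro l) auto
  show ?thesis unfolding lin_ext_def
  proof (rule linI[OF Z U])
    fix x y assume xy: "x \<in> carrier Z" "y \<in> carrier Z"
    have "(\<Oplus>\<^bsub>U\<^esub>p\<in>supp f. f p \<odot>\<^bsub>U\<^esub> \<beta> (x \<oplus>\<^bsub>Z\<^esub> y) p)
        = (\<Oplus>\<^bsub>U\<^esub>p\<in>supp f. f p \<odot>\<^bsub>U\<^esub> \<beta> x p \<oplus>\<^bsub>U\<^esub> f p \<odot>\<^bsub>U\<^esub> \<beta> y p)"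
      using xy fd linD[OF l] by (intro U.finsum_cong') (auto simp: U.smult_r_distr)
    also have "\<dots> = (\<Oplus>\<^bsub>U\<^esub>p\<in>supp f. f p \<odot>\<^bsub>U\<^esub> \<beta> x p) \<oplus>\<^bsub>U\<^esub> (\<Oplus>\<^bsub>U\<^esub>p\<in>supp f. f p \<odot>\<^bsub>U\<^esub> \<beta> y p)"
      using xy fd linD[OF l] by (intro U.finsum_addf) auto
    finally show "(\<Oplus>\<^bsub>U\<^esub>p\<in>supp f. f p \<odot>\<^bsub>U\<^esub> \<beta> (x \<oplus>\<^bsub>Z\<^esub> y) p)
      = (\<Oplus>\<^bsub>U\<^esub>p\<in>supp f. f p \<odot>\<^bsub>U\<^esub> \<beta> x p) \<oplus>\<^bsub>U\<^esub> (\<Oplus>\<^bsub>U\<^esub>p\<in>supp f. f p \<odot>\<^bsub>U\<^esub> \<beta> y p)" .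
  next
    fix c x assume cx: "c \<in> carrier K" "x \<in> carrier Z"
    have "(\<Oplus>\<^bsub>U\<^esub>p\<in>supp f. f p \<odot>\<^bsub>U\<^esub> \<beta> (c \<odot>\<^bsub>Z\<^esub> x) p) = (\<Oplus>\<^bsub>U\<^esub>p\<in>supp f. c \<odot>\<^bsub>U\<^esub> (f p \<odot>\<^bsub>U\<^esub> \<beta> x p))"
      using cx fd linD[OF l] by (intro U.finsum_cong') (auto simp: U.smult_assoc1[symmetric] m_comm)
    also have "\<dots> = c \<odot>\<^bsub>U\<^esub> (\<Oplus>\<^bsub>U\<^esub>p\<in>supp f. f p \<odot>\<^bsub>U\<^esub> \<beta> x p)"
      using cx fd linD[OF l] by (intro U.finsum_smult_ldistr[symmetric]) auto
    finally show "(\<Oplus>\<^bsub>U\<^esub>p\<in>supp f. f p \<odot>\<^bsub>U\<^esub> \<beta> (c \<odot>\<^bsub>Z\<^esub> x) p) = c \<odot>\<^bsub>U\<^esub> (\<Oplus>\<^bsub>U\<^esub>p\<in>supp f. f p \<odot>\<^bsub>U\<^esub> \<beta> x p)" .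
  qed (use fd linD[OF l] in \<open>auto intro!: U.finsum_closed\<close>)
qed

text \<open>The tensor is fixed and the bilinear map varies with z. One representative of
  \<open>t\<close> serves all z at once, which turns the expression into a fixed finite combination
  of maps linear in z.\<close>

lemma lin_tlift2:
  assumes t: "t \<in> carrier (V \<otimes>\<^sub>t W)" and vs: "vspace V" "vspace W" "vspace Z" "vspace U"
    and b: "\<And>z. z \<in> carrier Z \<Longrightarrow> bilin V W U (\<beta> z)"
    and l: "\<And>x y. x \<in> carrier V \<Longrightarrow> y \<in> carrier W \<Longrightarrow> lin Z U (\<lambda>z. \<beta> z x y)"
  shows "lin Z U (\<lambda>z. tlift K U t (\<beta> z))"
proof -
  obtain f where f: "f \<in> carrier (free_space K (carrier V \<times> carrier W))"
    "t = tensor_rel K V W +>\<^bsub>free_space K (carrier V \<times> carrier W)\<^esub> f" using tlift_expand[OF t vs(1,2)] .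
  show ?thesis
  proof (rule lin_cong)
    show "tlift K U t (\<beta> z) = lin_ext U (\<lambda>p. \<beta> z (fst p) (snd p)) f" if "z \<in> carrier Z" for z
      unfolding f(2) by (rule tlift_eq[OF vs(1,2) b[OF that] f(1)])
    show "lin Z U (\<lambda>z. lin_ext U (\<lambda>p. \<beta> z (fst p) (snd p)) f)"
      by (rule lin_lin_ext_param[OF f(1) _ vs(3,4)]) (auto intro: l)
  qed
qed

text \<open>Rewriting under a Sweedler sum. Only \<beta>' has to be shown bilinear, since agreement
  on the carriers transfers this to \<beta>; both sides are then linear in the tensor and agree on
  pure tensors.\<close>

lemma tlift_cong:
  assumes t: "t \<in> carrier (V \<otimes>\<^sub>t W)" and vs: "vspace V" and b: "bilin V W U \<beta>'"
    and eq: "\<And>x y. x \<in> carrier V \<Longrightarrow> y \<in> carrier W \<Longrightarrow> \<beta> x y = \<beta>' x y"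
  shows "tlift K U t \<beta> = tlift K U t \<beta>'"
proof -
  note W = bilin_vs[OF b vs]
  have b': "bilin V W U \<beta>"
    by (intro bilinI lin_cong[OF bilinD(1)[OF b]] lin_cong[OF bilinD(2)[OF b]]) (simp_all add: eq)
  show ?thesis
    by (rule tensor_ext[OF vs W(1) lin_tlift[OF vs W(1) b'] lin_tlift[OF vs W(1) b] _ t])
       (simp add: tlift_tens[OF vs W(1)] b b' eq)
qed

text \<open>Both sides are linear in \<open>t\<close>, so pure tensors suffice. This pushes a linear
  map through a Sweedler sum; nested sums are flattened by taking \<open>f\<close> to be itself a
  \<open>tlift\<close>.\<close>

lemma lin_of_tlift:
  assumes f: "lin U U' f" and t: "t \<in> carrier (V \<otimes>\<^sub>t W)" and vs: "vspace V" and b: "bilin V W U \<beta>"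
  shows "f (tlift K U t \<beta>) = tlift K U' t (\<lambda>x y. f (\<beta> x y))"
proof -
  note W = bilin_vs[OF b vs]
  have b': "bilin V W U' (\<lambda>x y. f (\<beta> x y))"
    by (intro bilinI lin_comp[OF f] bilinD(1)[OF b] bilinD(2)[OF b])
  show ?thesis
    by (rule tensor_ext[OF vs W(1) lin_comp[OF f lin_tlift[OF vs W(1) b]] lin_tlift[OF vs W(1) b'] _ t])
       (simp add: tlift_tens[OF vs W(1)] b b')
qed

lemma tlift_tlift:
  assumes t: "t \<in> carrier (V \<otimes>\<^sub>t W)" and vs: "vspace V" and b: "bilin V W (V' \<otimes>\<^sub>t W') \<beta>"
    and V': "vspace V'" and c: "bilin V' W' U \<gamma>"
  shows "tlift K U (tlift K (V' \<otimes>\<^sub>t W') t \<beta>) \<gamma> = tlift K U t (\<lambda>x y. tlift K U (\<beta> x y) \<gamma>)"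
  by (rule lin_of_tlift[OF lin_tlift[OF V' bilin_vs(1)[OF c V'] c] t vs b])

lemma tlift_tens_id:
  assumes "vspace V" "vspace W" "t \<in> carrier (V \<otimes>\<^sub>t W)"
  shows "tlift K (V \<otimes>\<^sub>t W) t (tens K V W) = t"
  by (rule tensor_ext[OF assms(1,2) lin_tlift[OF assms(1,2) bilin_tens[OF assms(1,2)]]
        lin_id[OF vs_tensor[OF assms(1,2)]] _ assms(3)])
     (simp add: tlift_tens[OF assms(1,2)] bilin_tens[OF assms(1,2)])

text \<open>Fubini for two independent Sweedler sums: with \<open>t\<close> fixed both sides are
  linear in \<open>s\<close>, so \<open>s\<close> may be taken to be a pure tensor, where the sum
  over \<open>s\<close> is a single term.\<close>

lemma tlift_swap:
  assumes s: "s \<in> carrier (V \<otimes>\<^sub>t W)" and t: "t \<in> carrier (V' \<otimes>\<^sub>t W')"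
    and vs: "vspace V" "vspace W" "vspace V'" "vspace W'" "vspace U"
    and b: "\<And>c d. c \<in> carrier V' \<Longrightarrow> d \<in> carrier W' \<Longrightarrow> bilin V W U (\<lambda>a b. \<gamma> a b c d)"
    and c: "\<And>a b. a \<in> carrier V \<Longrightarrow> b \<in> carrier W \<Longrightarrow> bilin V' W' U (\<gamma> a b)"
  shows "tlift K U s (\<lambda>a b. tlift K U t (\<gamma> a b)) = tlift K U t (\<lambda>c d. tlift K U s (\<lambda>a b. \<gamma> a b c d))"
proof -
  have b1: "bilin V W U (\<lambda>a b. tlift K U t (\<gamma> a b))"
    by (intro bilinI lin_tlift2[OF t vs(3,4)] vs c bilinD(1)[OF b] bilinD(2)[OF b])
  show ?thesis
  proof (rule tensor_ext[OF vs(1,2) lin_tlift[OF vs(1,2) b1] _ _ s])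
    show "lin (V \<otimes>\<^sub>t W) U (\<lambda>s. tlift K U t (\<lambda>c d. tlift K U s (\<lambda>a b. \<gamma> a b c d)))"
    proof (rule lin_tlift2[OF t vs(3,4) vs_tensor[OF vs(1,2)] vs(5)])
      show "bilin V' W' U (\<lambda>c d. tlift K U s (\<lambda>a b. \<gamma> a b c d))" if "s \<in> carrier (V \<otimes>\<^sub>t W)" for s
        by (intro bilinI lin_tlift2[OF that vs(1,2)] vs b bilinD(1)[OF c] bilinD(2)[OF c])
    qed (rule lin_tlift[OF vs(1,2) b])
    fix x y assume xy: "x \<in> carrier V" "y \<in> carrier W"
    have "tlift K U t (\<lambda>c d. tlift K U (tens K V W x y) (\<lambda>a b. \<gamma> a b c d)) = tlift K U t (\<gamma> x y)"
      by (rule tlift_cong[OF t vs(3) c[OF xy]]) (simp add: tlift_tens[OF vs(1,2) b] xy)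
    then show "tlift K U (tens K V W x y) (\<lambda>a b. tlift K U t (\<gamma> a b))
      = tlift K U t (\<lambda>c d. tlift K U (tens K V W x y) (\<lambda>a b. \<gamma> a b c d))"
      using xy by (simp add: tlift_tens[OF vs(1,2) b1])
  qed
qed

subsection \<open>Tensor products of linear maps and of subspaces\<close>

abbreviation (input) tmap ::
  "('k, 'v, 'x) module_scheme \<Rightarrow> ('k, 'w, 'y) module_scheme \<Rightarrow> ('a \<Rightarrow> 'v) \<Rightarrow> ('b \<Rightarrow> 'w)
    \<Rightarrow> ('a \<times> 'b \<Rightarrow> 'k) set \<Rightarrow> ('v \<times> 'w \<Rightarrow> 'k) set"
  where "tmap V' W' f g t \<equiv> tlift K (V' \<otimes>\<^sub>t W') t (\<lambda>x y. tens K V' W' (f x) (g y))"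

lemma bilin_tmap: "lin V V' f \<Longrightarrow> lin W W' g \<Longrightarrow> bilin V W (V' \<otimes>\<^sub>t W') (\<lambda>x y. tens K V' W' (f x) (g y))"
  by (intro lin_intro) (auto dest: linD)

lemma lin_tmap: "lin V V' f \<Longrightarrow> lin W W' g \<Longrightarrow> lin (V \<otimes>\<^sub>t W) (V' \<otimes>\<^sub>t W') (tmap V' W' f g)"
  by (rule lin_tlift[OF _ _ bilin_tmap]) (auto dest: linD)

lemma tmap_tens:
  "lin V V' f \<Longrightarrow> lin W W' g \<Longrightarrow> x \<in> carrier V \<Longrightarrow> y \<in> carrier W \<Longrightarrow>
    tmap V' W' f g (tens K V W x y) = tens K V' W' (f x) (g y)"
  by (subst tlift_tens[OF _ _ bilin_tmap]) (auto dest: linD)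

lemma subtensor_subspace:
  assumes "vspace V" "vspace W" "A \<subseteq> carrier V" "B \<subseteq> carrier W"
  shows "subspace K (subtensor K V W A B) (V \<otimes>\<^sub>t W)"
  unfolding subtensor_def
  by (rule span_subspace[OF vs_tensor[OF assms(1,2)]]) (use assms tens_closed[OF assms(1,2)] in blast)

lemma subtensor_tens:
  assumes "vspace V" "vspace W" "A \<subseteq> carrier V" "B \<subseteq> carrier W" "a \<in> A" "b \<in> B"
  shows "tens K V W a b \<in> subtensor K V W A B"
  unfolding subtensor_def
  by (rule span_incl[OF vs_tensor[OF assms(1,2)]]) (use assms tens_closed[OF assms(1,2)] in blast)+

lemma subtensor_min:
  assumes "subspace K S (V \<otimes>\<^sub>t W)" "\<And>a b. a \<in> A \<Longrightarrow> b \<in> B \<Longrightarrow> tens K V W a b \<in> S"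
  shows "subtensor K V W A B \<subseteq> S"
  unfolding subtensor_def by (rule span_min[OF assms(1)]) (use assms(2) in blast)

lemma subtensor_mono:
  assumes "vspace V" "vspace W" "A \<subseteq> A'" "B \<subseteq> B'" "A' \<subseteq> carrier V" "B' \<subseteq> carrier W"
  shows "subtensor K V W A B \<subseteq> subtensor K V W A' B'"
  by (rule subtensor_min[OF subtensor_subspace[OF assms(1,2,5,6)]], rule subtensor_tens[OF assms(1,2,5,6)])
     (use assms in blast)+

text \<open>The map \<phi> \<otimes> id followed by scalar multiplication. Slicing by all
  functionals replaces the choice of a basis of the left factor.\<close>

abbreviation slice :: "('k, 'w, 'y) module_scheme \<Rightarrow> ('v \<Rightarrow> 'k) \<Rightarrow> ('v \<times> 'w \<Rightarrow> 'k) set \<Rightarrow> 'w"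
  where "slice W \<phi> t \<equiv> tlift K W t (\<lambda>x y. \<phi> x \<odot>\<^bsub>W\<^esub> y)"

lemma functional_closed: "functional V \<phi> \<Longrightarrow> x \<in> carrier V \<Longrightarrow> \<phi> x \<in> carrier K"
  using linD(3)[of V "ground K" \<phi>] by (simp add: ground_def)

lemma bilin_slice:
  assumes "functional V \<phi>" "vspace W"
  shows "bilin V W W (\<lambda>x y. \<phi> x \<odot>\<^bsub>W\<^esub> y)"
  by (intro lin_intro assms functional_closed[OF assms(1)])

lemma lin_slice: "functional V \<phi> \<Longrightarrow> vspace W \<Longrightarrow> lin (V \<otimes>\<^sub>t W) W (slice W \<phi>)"
  by (rule lin_tlift[OF _ _ bilin_slice]) (auto dest: linD)

lemma slice_tens:
  "functional V \<phi> \<Longrightarrow> vspace W \<Longrightarrow> x \<in> carrier V \<Longrightarrow> y \<in> carrier W \<Longrightarrow> slice W \<phi> (tens K V W x y) = \<phi> x \<odot>\<^bsub>W\<^esub> y"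
  by (subst tlift_tens[OF _ _ bilin_slice]) (auto dest: linD)

lemma slice_subtensor:
  assumes "functional V \<phi>" "subspace K S W" "t \<in> subtensor K V W (carrier V) S"
  shows "slice W \<phi> t \<in> S"
proof -
  have W: "vspace W" and V: "vspace V" using assms by (auto simp: subspaceD dest: linD)
  have "subtensor K V W (carrier V) S \<subseteq> {t \<in> carrier (V \<otimes>\<^sub>t W). slice W \<phi> t \<in> S}"
    by (rule subtensor_min[OF subspace_preimage[OF lin_slice[OF assms(1) W] assms(2)]])
       (auto simp: slice_tens[OF assms(1) W] subspaceD[OF assms(2)] tens_closed[OF V W] functional_closed[OF assms(1)])
  with assms(3) show ?thesis by blast
qed

text \<open>A pure tensor has one left factor and a sum unites two finite sets of them. This
  provides the finite set on which \<open>subtensor_slices\<close> runs its induction.\<close>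

lemma finite_subtensor:
  assumes V: "vspace V" and W: "vspace W" and t: "t \<in> carrier (V \<otimes>\<^sub>t W)"
  obtains A where "finite A" "A \<subseteq> carrier V" "t \<in> subtensor K V W A (carrier W)"
proof -
  have "\<exists>A. finite A \<and> A \<subseteq> carrier V \<and> t \<in> subtensor K V W A (carrier W)"
    using t
  proof (induction t rule: tensor_induct[OF V W, consumes 1, case_names tens add])
    case (tens x y)
    then show ?case using subtensor_tens[OF V W, of "{x}" "carrier W" x y] by (intro exI[of _ "{x}"]) auto
  next
    case (add s t)
    then obtain A A' where A: "finite A" "A \<subseteq> carrier V" "s \<in> subtensor K V W A (carrier W)"
      "finite A'" "A' \<subseteq> carrier V" "t \<in> subtensor K V W A' (carrier W)" by blast
    let ?S = "subtensor K V W (A \<union> A') (carrier W)"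
    have "s \<in> ?S" "t \<in> ?S"
      using A subtensor_mono[OF V W, of A "A \<union> A'" "carrier W" "carrier W"]
        subtensor_mono[OF V W, of A' "A \<union> A'" "carrier W" "carrier W"] by auto
    moreover have "subspace K ?S (V \<otimes>\<^sub>t W)" using A by (intro subtensor_subspace[OF V W]) auto
    ultimately show ?case using A by (intro exI[of _ "A \<union> A'"]) (auto simp: subspaceD)
  qed
  with that show thesis by blast
qed

text \<open>The tensors a \<otimes> y + s, with s supported on \<open>A\<close>, already form a
  subspace because a \<otimes> y is linear in y; that subspace contains all generators. It is used
  to strip off one left factor at a time.\<close>

lemma subtensor_insert:
  assumes V: "vspace V" and W: "vspace W" and A: "insert a A \<subseteq> carrier V"
    and t: "t \<in> subtensor K V W (insert a A) (carrier W)"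
  obtains y s where "y \<in> carrier W" "s \<in> subtensor K V W A (carrier W)" "t = tens K V W a y \<oplus>\<^bsub>V \<otimes>\<^sub>t W\<^esub> s"
proof -
  interpret W: vectorspace K W by fact
  interpret T: vectorspace K "V \<otimes>\<^sub>t W" by (rule vs_tensor[OF V W])
  let ?S = "subtensor K V W A (carrier W)"
  have S: "subspace K ?S (V \<otimes>\<^sub>t W)" using A by (intro subtensor_subspace[OF V W]) auto
  note [simp] = subspaceD[OF S]
  have a: "a \<in> carrier V" using A by auto
  note l = bilinD(1)[OF bilin_tens[OF V W] a]
  let ?R = "{tens K V W a y \<oplus>\<^bsub>V \<otimes>\<^sub>t W\<^esub> s | y s. y \<in> carrier W \<and> s \<in> ?S}"
  have R: "subspace K ?R (V \<otimes>\<^sub>t W)"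
  proof (rule subspaceI)
    show "vspace (V \<otimes>\<^sub>t W)" by (rule vs_tensor[OF V W])
    show "?R \<subseteq> carrier (V \<otimes>\<^sub>t W)" using a by (auto simp: tens_closed[OF V W])
    show "\<zero>\<^bsub>V \<otimes>\<^sub>t W\<^esub> \<in> ?R"
      by (auto intro!: exI[of _ "\<zero>\<^bsub>W\<^esub>"] exI[of _ "\<zero>\<^bsub>V \<otimes>\<^sub>t W\<^esub>"] simp: linD(6)[OF l])
    show "x \<oplus>\<^bsub>V \<otimes>\<^sub>t W\<^esub> y \<in> ?R" if x: "x \<in> ?R" and y: "y \<in> ?R" for x y
    proof -
      from x obtain y1 s1 where 1: "x = tens K V W a y1 \<oplus>\<^bsub>V \<otimes>\<^sub>t W\<^esub> s1" "y1 \<in> carrier W" "s1 \<in> ?S" by auto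
      from y obtain y2 s2 where 2: "y = tens K V W a y2 \<oplus>\<^bsub>V \<otimes>\<^sub>t W\<^esub> s2" "y2 \<in> carrier W" "s2 \<in> ?S" by auto
      show ?thesis using 1 2 a
        by (auto intro!: exI[of _ "y1 \<oplus>\<^bsub>W\<^esub> y2"] exI[of _ "s1 \<oplus>\<^bsub>V \<otimes>\<^sub>t W\<^esub> s2"]
          simp: linD(4)[OF l] T.a_ac tens_closed[OF V W])
    qed
    show "c \<odot>\<^bsub>V \<otimes>\<^sub>t W\<^esub> x \<in> ?R" if c: "c \<in> carrier K" and x: "x \<in> ?R" for c x
    proof -
      from x obtain y1 s1 where 1: "x = tens K V W a y1 \<oplus>\<^bsub>V \<otimes>\<^sub>t W\<^esub> s1" "y1 \<in> carrier W" "s1 \<in> ?S" by auto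
      show ?thesis using 1 a c
        by (auto intro!: exI[of _ "c \<odot>\<^bsub>W\<^esub> y1"] exI[of _ "c \<odot>\<^bsub>V \<otimes>\<^sub>t W\<^esub> s1"]
          simp: linD(5)[OF l] T.smult_r_distr tens_closed[OF V W])
    qed
  qed
  have "subtensor K V W (insert a A) (carrier W) \<subseteq> ?R"
  proof (rule subtensor_min[OF R])
    fix a' b assume ab: "a' \<in> insert a A" "b \<in> carrier W"
    show "tens K V W a' b \<in> ?R"
    proof (cases "a' = a")
      case True
      then show ?thesis using ab a
        by (auto intro!: exI[of _ b] exI[of _ "\<zero>\<^bsub>V \<otimes>\<^sub>t W\<^esub>"] simp: tens_closed[OF V W])
    next
      case False
      then have "tens K V W a' b \<in> ?S" using ab A by (intro subtensor_tens[OF V W]) auto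
      then show ?thesis
        by (auto intro!: exI[of _ "\<zero>\<^bsub>W\<^esub>"] exI[of _ "tens K V W a' b"] simp: linD(6)[OF l])
    qed
  qed
  with t that show thesis by blast
qed

theorem subtensor_slices:
  assumes V: "vspace V" and S: "subspace K S W" and t: "t \<in> carrier (V \<otimes>\<^sub>t W)"
    and sl: "\<And>\<phi>. functional V \<phi> \<Longrightarrow> slice W \<phi> t \<in> S"
  shows "t \<in> subtensor K V W (carrier V) S"
proof -
  have W: "vspace W" by (rule subspaceD(1)[OF S])
  interpret W: vectorspace K W by (rule W)
  have VS: "subspace K (subtensor K V W (carrier V) S) (V \<otimes>\<^sub>t W)"
    by (rule subtensor_subspace[OF V W]) (auto simp: subspaceD[OF S])
  obtain A where "finite A" "A \<subseteq> carrier V" "t \<in> subtensor K V W A (carrier W)"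
    using finite_subtensor[OF V W t] .
  then show ?thesis using sl
  proof (induction A arbitrary: t rule: finite_induct)
    case empty
    then have "t = \<zero>\<^bsub>V \<otimes>\<^sub>t W\<^esub>"
      using subtensor_min[of "{\<zero>\<^bsub>V \<otimes>\<^sub>t W\<^esub>}" V W "{}" "carrier W"] vs_tensor[OF V W]
      by (auto simp: subspace_def submodule_def vs_field_is_module abelian_group.axioms vsD
          module.smult_r_null abelian_monoid.l_zero[OF abelian_group.axioms(1)[OF vsD(1)]])
    then show ?case by (simp add: subspaceD[OF VS])
  next
    case (insert a A)
    have A: "A \<subseteq> carrier V" and a: "a \<in> carrier V" using insert.prems(1) by auto
    obtain y s where ys: "y \<in> carrier W" "s \<in> subtensor K V W A (carrier W)" "t = tens K V W a y \<oplus>\<^bsub>V \<otimes>\<^sub>t W\<^esub> s"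
      using subtensor_insert[OF V W insert.prems(1,2)] .
    have TA: "subspace K (subtensor K V W A (carrier W)) (V \<otimes>\<^sub>t W)"
      by (rule subtensor_subspace[OF V W A]) auto
    have s: "s \<in> carrier (V \<otimes>\<^sub>t W)" by (rule subspaceD(4)[OF TA ys(2)])
    have span: "subspace K (module.span K V A) V" by (rule span_subspace[OF V A])
    show ?case
    proof (cases "a \<in> module.span K V A")
      case True
      have "module.span K V A \<subseteq> {x \<in> carrier V. tens K V W x y \<in> subtensor K V W A (carrier W)}"
        by (rule span_min[OF subspace_preimage[OF bilinD(2)[OF bilin_tens[OF V W] ys(1)] TA]])
           (use A ys in \<open>auto intro!: subtensor_tens[OF V W]\<close>)
      then have "t \<in> subtensor K V W A (carrier W)" using True ys by (auto simp: subspaceD[OF TA])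
      then show ?thesis by (rule insert.IH[OF A _ insert.prems(3)])
    next
      case False
      \<comment> \<open>The functional kills every left factor of \<open>s\<close> and is 1 at
        \<open>a\<close>, so slicing \<open>t\<close> by it returns exactly
        \<open>y\<close>.\<close>
      obtain \<phi> where phi: "functional V \<phi>" "\<And>x. x \<in> module.span K V A \<Longrightarrow> \<phi> x = \<zero>" "\<phi> a = \<one>"
        by (rule separating_functional[OF span a False]) blast
      have "subtensor K V W A (carrier W) \<subseteq> {t \<in> carrier (V \<otimes>\<^sub>t W). slice W \<phi> t = \<zero>\<^bsub>W\<^esub>}"
        by (rule subtensor_min[OF subspace_kernel[OF lin_slice[OF phi(1) W]]])
           (use A span_incl[OF V A] in \<open>auto simp: slice_tens[OF phi(1) W] phi(2) tens_closed[OF V W] subset_iff\<close>)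
      then have "slice W \<phi> t = y"
        using ys a s phi(3) by (auto simp: linD(4)[OF lin_slice[OF phi(1) W]] slice_tens[OF phi(1) W] tens_closed[OF V W])
      then have y: "y \<in> S" using insert.prems(3)[OF phi(1)] by simp
      \<comment> \<open>The hypothesis on slices passes from \<open>t\<close> to \<open>s\<close>:
        the slice of the removed term is a multiple of \<open>y\<close>, which is now known to lie
        in \<open>S\<close>.\<close>
      have "slice W \<psi> s \<in> S" if psi: "functional V \<psi>" for \<psi>
      proof -
        let ?ay = "\<psi> a \<odot>\<^bsub>W\<^esub> y"
        have ay: "?ay \<in> S" by (rule subspaceD(6)[OF S functional_closed[OF psi a] y])
        have "slice W \<psi> t = ?ay \<oplus>\<^bsub>W\<^esub> slice W \<psi> s"
          using ys a s by (simp add: linD(4)[OF lin_slice[OF psi W]] slice_tens[OF psi W] tens_closed[OF V W])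
        then have "slice W \<psi> s = slice W \<psi> t \<ominus>\<^bsub>W\<^esub> ?ay"
          using subspaceD(4)[OF S ay] linD(3)[OF lin_slice[OF psi W] s]
          by (simp add: a_minus_def W.a_ac W.r_neg1 W.r_neg2)
        then show ?thesis using insert.prems(3)[OF psi] ay by (simp add: subspaceD(8)[OF S])
      qed
      then have "s \<in> subtensor K V W (carrier V) S" by (rule insert.IH[OF A ys(2)])
      moreover have "tens K V W a y \<in> subtensor K V W (carrier V) S"
        by (rule subtensor_tens[OF V W]) (auto simp: a y subspaceD[OF S])
      ultimately show ?thesis unfolding ys(3) by (simp add: subspaceD[OF VS])
    qed
  qed
qed

text \<open>Slicing commutes with id \<otimes> f, so membership is tested slice by slice in
  \<open>Z\<close>. This is the exactness of V \<otimes> - in the form that lets a condition on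
  second legs be pulled back along \<open>f\<close>.\<close>

lemma subtensor_preimage:
  assumes V: "vspace V" and f: "lin W Z f" and S: "subspace K S Z" and t: "t \<in> carrier (V \<otimes>\<^sub>t W)"
    and ft: "tmap V Z (\<lambda>x. x) f t \<in> subtensor K V Z (carrier V) S"
  shows "t \<in> subtensor K V W (carrier V) {y \<in> carrier W. f y \<in> S}"
proof (rule subtensor_slices[OF V subspace_preimage[OF f S] t])
  fix \<phi> assume phi: "functional V \<phi>"
  note W = linD(1)[OF f] and Z = linD(2)[OF f]
  have "f (slice W \<phi> t) = slice Z \<phi> (tmap V Z (\<lambda>x. x) f t)"
    by (rule tensor_ext[OF V W lin_comp[OF f lin_slice[OF phi W]]
          lin_comp[OF lin_slice[OF phi Z] lin_tmap[OF lin_id[OF V] f]] _ t])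
       (simp add: tmap_tens[OF lin_id[OF V] f] slice_tens[OF phi W] slice_tens[OF phi Z] linD[OF f] functional_closed[OF phi])
  then show "slice W \<phi> t \<in> {y \<in> carrier W. f y \<in> S}"
    using slice_subtensor[OF phi S ft] linD(3)[OF lin_slice[OF phi W] t] by simp
qed

text \<open>A slice of \<open>t\<close> lies in both subspaces at once. Later this makes the
  intersection of two subcomodules a subcomodule.\<close>

lemma subtensor_Int:
  assumes V: "vspace V" and S: "subspace K S W" and S': "subspace K S' W"
    and t: "t \<in> subtensor K V W (carrier V) S" "t \<in> subtensor K V W (carrier V) S'"
  shows "t \<in> subtensor K V W (carrier V) (S \<inter> S')"
proof (rule subtensor_slices[OF V subspace_Int[OF S S']])
  show "t \<in> carrier (V \<otimes>\<^sub>t W)"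
    by (rule subspaceD(4)[OF subtensor_subspace[OF V subspaceD(1)[OF S]] t(1)]) (auto simp: subspaceD[OF S])
  show "slice W \<phi> t \<in> S \<inter> S'" if "functional V \<phi>" for \<phi>
    using slice_subtensor[OF that S t(1)] slice_subtensor[OF that S' t(2)] by simp
qed

lemma vs_zero_subspace: "vspace V \<Longrightarrow> subspace K {\<zero>\<^bsub>V\<^esub>} V"
proof -
  assume V: "vspace V"
  interpret V: vectorspace K V by fact
  show ?thesis using V by (intro subspaceI) auto
qed

lemma subtensor_zero:
  assumes V: "vspace V" and W: "vspace W" and t: "t \<in> subtensor K V W (carrier V) {\<zero>\<^bsub>W\<^esub>}"
  shows "t = \<zero>\<^bsub>V \<otimes>\<^sub>t W\<^esub>"
proof -
  have "subtensor K V W (carrier V) {\<zero>\<^bsub>W\<^esub>} \<subseteq> {\<zero>\<^bsub>V \<otimes>\<^sub>t W\<^esub>}"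
    by (rule subtensor_min[OF vs_zero_subspace[OF vs_tensor[OF V W]]])
       (auto simp: linD(6)[OF bilinD(1)[OF bilin_tens[OF V W]]])
  with t show ?thesis by blast
qed

lemma tmap_kernel:
  assumes V: "vspace V" and f: "lin W Z f" and t: "t \<in> carrier (V \<otimes>\<^sub>t W)"
    and ft: "tmap V Z (\<lambda>x. x) f t = \<zero>\<^bsub>V \<otimes>\<^sub>t Z\<^esub>"
  shows "t \<in> subtensor K V W (carrier V) {y \<in> carrier W. f y = \<zero>\<^bsub>Z\<^esub>}"
proof -
  have Z: "vspace Z" by (rule linD(2)[OF f])
  have "tmap V Z (\<lambda>x. x) f t \<in> subtensor K V Z (carrier V) {\<zero>\<^bsub>Z\<^esub>}"
    unfolding ft by (rule subspaceD(3)[OF subtensor_subspace[OF V Z]]) (auto simp: vsD[OF Z])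
  from subtensor_preimage[OF V f vs_zero_subspace[OF Z] t this] show ?thesis by simp
qed

text \<open>The kernel of id \<otimes> f consists of tensors with second leg in the kernel of
  \<open>f\<close>, by \<open>tmap_kernel\<close>, and those vanish. It is the means by which
  equations are reflected along inclusions.\<close>

lemma tmap_inj:
  assumes V: "vspace V" and f: "lin W Z f" and inj: "inj_on f (carrier W)"
    and s: "s \<in> carrier (V \<otimes>\<^sub>t W)" and t: "t \<in> carrier (V \<otimes>\<^sub>t W)"
    and eq: "tmap V Z (\<lambda>x. x) f s = tmap V Z (\<lambda>x. x) f t"
  shows "s = t"
proof -
  note W = linD(1)[OF f] and Z = linD(2)[OF f]
  note l = lin_tmap[OF lin_id[OF V] f]
  interpret T: vectorspace K "V \<otimes>\<^sub>t W" by (rule vs_tensor[OF V W])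
  interpret T': vectorspace K "V \<otimes>\<^sub>t Z" by (rule vs_tensor[OF V Z])
  have st: "s \<ominus>\<^bsub>V \<otimes>\<^sub>t W\<^esub> t \<in> carrier (V \<otimes>\<^sub>t W)" using s t by auto
  have "y = \<zero>\<^bsub>W\<^esub>" if "y \<in> carrier W" "f y = \<zero>\<^bsub>Z\<^esub>" for y
    by (rule inj_onD[OF inj _ that(1) vsD(3)[OF W]]) (simp add: that linD(6)[OF f])
  then have "{y \<in> carrier W. f y = \<zero>\<^bsub>Z\<^esub>} = {\<zero>\<^bsub>W\<^esub>}"
    using linD(6)[OF f] vsD(3)[OF W] by blast
  moreover have "tmap V Z (\<lambda>x. x) f (s \<ominus>\<^bsub>V \<otimes>\<^sub>t W\<^esub> t) = \<zero>\<^bsub>V \<otimes>\<^sub>t Z\<^esub>"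
    using linD(8)[OF l s t] linD(3)[OF l t] eq by (simp add: T'.r_neg a_minus_def)
  ultimately have "s \<ominus>\<^bsub>V \<otimes>\<^sub>t W\<^esub> t = \<zero>\<^bsub>V \<otimes>\<^sub>t W\<^esub>"
    using tmap_kernel[OF V f st] by (intro subtensor_zero[OF V W]) simp
  then show ?thesis using s t by simp
qed

lemma tmap_surj:
  assumes V: "vspace V" and f: "lin W Z f" and surj: "f ` carrier W = carrier Z"
    and u: "u \<in> carrier (V \<otimes>\<^sub>t Z)"
  obtains t where "t \<in> carrier (V \<otimes>\<^sub>t W)" "u = tmap V Z (\<lambda>x. x) f t"
proof -
  note W = linD(1)[OF f] and Z = linD(2)[OF f]
  note l = lin_tmap[OF lin_id[OF V] f]
  have "u \<in> tmap V Z (\<lambda>x. x) f ` carrier (V \<otimes>\<^sub>t W)"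
  proof (rule tensor_span[OF V Z subspace_image[OF l subspace_carrier[OF vs_tensor[OF V W]]] _ u])
    fix x z assume x: "x \<in> carrier V" and "z \<in> carrier Z"
    then obtain y where y: "y \<in> carrier W" "z = f y" using surj by auto
    then show "tens K V Z x z \<in> tmap V Z (\<lambda>x. x) f ` carrier (V \<otimes>\<^sub>t W)"
      using x by (intro image_eqI[of _ _ "tens K V W x y"]) (auto simp: tmap_tens[OF lin_id[OF V] f] tens_closed[OF V W])
  qed
  with that show thesis by blast
qed

text \<open>\<open>subtensor\<close> is a subspace of V \<otimes> W, whereas tensoring with the
  restricted record is a different quotient of a different free space. The lift passes from the
  first to the second; \<open>tmap_inj\<close> makes it unique.\<close>

lemma subtensor_lift:
  assumes V: "vspace V" and S: "subspace K S W" and t: "t \<in> subtensor K V W (carrier V) S"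
  obtains t' where "t' \<in> carrier (V \<otimes>\<^sub>t (W\<lparr>carrier := S\<rparr>))" "t = tmap V W (\<lambda>x. x) (\<lambda>x. x) t'"
proof -
  note W = subspaceD(1)[OF S] and S' = vs_restrict[OF S]
  note l = lin_tmap[OF lin_id[OF V] lin_incl[OF S]]
  have "subtensor K V W (carrier V) S \<subseteq> tmap V W (\<lambda>x. x) (\<lambda>x. x) ` carrier (V \<otimes>\<^sub>t (W\<lparr>carrier := S\<rparr>))"
  proof (rule subtensor_min[OF subspace_image[OF l subspace_carrier[OF vs_tensor[OF V S']]]])
    fix x y assume "x \<in> carrier V" "y \<in> S"
    then show "tens K V W x y \<in> tmap V W (\<lambda>x. x) (\<lambda>x. x) ` carrier (V \<otimes>\<^sub>t (W\<lparr>carrier := S\<rparr>))"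
      by (intro image_eqI[of _ _ "tens K V (W\<lparr>carrier := S\<rparr>) x y"])
         (auto simp: tmap_tens[OF lin_id[OF V] lin_incl[OF S]] tens_closed[OF V S'])
  qed
  with t that show thesis by blast
qed

subsection \<open>Trilinear maps\<close>

definition trilin ::
  "('k, 'v1, 'x1) module_scheme \<Rightarrow> ('k, 'v2, 'x2) module_scheme \<Rightarrow> ('k, 'v3, 'x3) module_scheme
    \<Rightarrow> ('k, 'u, 'z) module_scheme \<Rightarrow> ('v1 \<Rightarrow> 'v2 \<Rightarrow> 'v3 \<Rightarrow> 'u) \<Rightarrow> bool" where
  "trilin V1 V2 V3 U \<gamma> \<longleftrightarrow>
     (\<forall>a\<in>carrier V1. bilin V2 V3 U (\<gamma> a)) \<and>
     (\<forall>b\<in>carrier V2. \<forall>c\<in>carrier V3. lin V1 U (\<lambda>a. \<gamma> a b c))"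

lemma trilinI [lin_intro]:
  "(\<And>a. a \<in> carrier V1 \<Longrightarrow> bilin V2 V3 U (\<lambda>b c. \<gamma> a b c)) \<Longrightarrow>
   (\<And>b c. b \<in> carrier V2 \<Longrightarrow> c \<in> carrier V3 \<Longrightarrow> lin V1 U (\<lambda>a. \<gamma> a b c)) \<Longrightarrow> trilin V1 V2 V3 U \<gamma>"
  by (simp add: trilin_def)

lemma trilinD:
  assumes "trilin V1 V2 V3 U \<gamma>"
  shows "a \<in> carrier V1 \<Longrightarrow> bilin V2 V3 U (\<gamma> a)"
    "b \<in> carrier V2 \<Longrightarrow> c \<in> carrier V3 \<Longrightarrow> lin V1 U (\<lambda>a. \<gamma> a b c)"
    "a \<in> carrier V1 \<Longrightarrow> c \<in> carrier V3 \<Longrightarrow> lin V2 U (\<lambda>b. \<gamma> a b c)"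
    "a \<in> carrier V1 \<Longrightarrow> b \<in> carrier V2 \<Longrightarrow> lin V3 U (\<lambda>c. \<gamma> a b c)"
  using assms by (auto simp: trilin_def bilinD)

lemma trilin_tens3:
  assumes "vspace V1" "vspace V2" "vspace V3"
  shows "trilin V1 V2 V3 (tensor3 K V1 V2 V3) (tens3 K V1 V2 V3)"
  unfolding tens3_def tensor3_def by (intro lin_intro assms vs_tensor tens_closed)

context
  fixes V1 :: "('k, 'v1, 'x1) module_scheme" and V2 :: "('k, 'v2, 'x2) module_scheme"
    and V3 :: "('k, 'v3, 'x3) module_scheme" and U :: "('k, 'u, 'z) module_scheme" and \<gamma>
  assumes V: "vspace V1" "vspace V2" "vspace V3" and \<gamma>: "trilin V1 V2 V3 U \<gamma>"
begin

lemma trilin_vs: "vspace U"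
  using linD(2)[OF trilinD(2)[OF \<gamma> vsD(3)[OF V(2)] vsD(3)[OF V(3)]]] .

abbreviation (input) trilift :: "('v1 \<times> ('v2 \<times> 'v3 \<Rightarrow> 'k) set \<Rightarrow> 'k) set \<Rightarrow> 'u" where
  "trilift t \<equiv> tlift K U t (\<lambda>a s. tlift K U s (\<gamma> a))"

lemma bilin_trilift: "bilin V1 (V2 \<otimes>\<^sub>t V3) U (\<lambda>a s. tlift K U s (\<gamma> a))"
  by (rule bilinI) (rule lin_tlift[OF V(2,3) trilinD(1)[OF \<gamma>]]
      lin_tlift2[OF _ V(2,3,1) trilin_vs trilinD(1)[OF \<gamma>] trilinD(2)[OF \<gamma>]]; assumption)+

lemma lin_trilift: "lin (V1 \<otimes>\<^sub>t (V2 \<otimes>\<^sub>t V3)) U trilift"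
  by (rule lin_tlift[OF V(1) vs_tensor[OF V(2,3)] bilin_trilift])

lemma trilift_tens3:
  "a \<in> carrier V1 \<Longrightarrow> b \<in> carrier V2 \<Longrightarrow> c \<in> carrier V3 \<Longrightarrow> trilift (tens3 K V1 V2 V3 a b c) = \<gamma> a b c"
  unfolding tens3_def
  by (simp add: tlift_tens[OF V(1) vs_tensor[OF V(2,3)] bilin_trilift] tens_closed[OF V(2,3)]
      tlift_tens[OF V(2,3) trilinD(1)[OF \<gamma>]])

text \<open>Coassociativity, the comodule axioms and the cotensor condition are equations in
  \<open>tensor3\<close>. Applying the linear map induced by \<gamma> to such an equation gives it
  for an arbitrary trilinear \<gamma>; this computes the side on which the first two legs come from
  expanding one element.\<close>

lemma trilift_left:
  assumes t: "t \<in> carrier (P \<otimes>\<^sub>t V3)" and f: "lin P (V1 \<otimes>\<^sub>t V2) f"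
  shows "trilift (tlift K (tensor3 K V1 V2 V3) t (\<lambda>p c. tlift K (tensor3 K V1 V2 V3) (f p) (\<lambda>a b. tens3 K V1 V2 V3 a b c)))
    = tlift K U t (\<lambda>p c. tlift K U (f p) (\<lambda>a b. \<gamma> a b c))"
proof -
  let ?T = "tensor3 K V1 V2 V3"
  note P = linD(1)[OF f]
  note l = lin_trilift[folded tensor3_def]
  have b: "bilin V1 V2 W (\<lambda>a b. g a b c)" if "c \<in> carrier V3" "trilin V1 V2 V3 W g" for c W and g :: "_ \<Rightarrow> _ \<Rightarrow> _ \<Rightarrow> 'w"
    using that by (intro bilinI trilinD)
  have b': "bilin P V3 W (\<lambda>p c. tlift K W (f p) (\<lambda>a b. g a b c))"
    if g: "trilin V1 V2 V3 W g" "vspace W" for W :: "('k, 'w, 'ww) module_scheme" and g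
    by (intro bilinI lin_tlift1[OF f V(1)] lin_tlift2[OF linD(3)[OF f] V(1,2,3)] that bilinI trilinD[OF g(1)])
  have "trilift (tlift K ?T t (\<lambda>p c. tlift K ?T (f p) (\<lambda>a b. tens3 K V1 V2 V3 a b c)))
    = tlift K U t (\<lambda>p c. trilift (tlift K ?T (f p) (\<lambda>a b. tens3 K V1 V2 V3 a b c)))"
    by (rule lin_of_tlift[OF l t P b'[OF trilin_tens3[OF V] linD(1)[OF l]]])
  also have "\<dots> = tlift K U t (\<lambda>p c. tlift K U (f p) (\<lambda>a b. \<gamma> a b c))"
  proof (rule tlift_cong[OF t P b'[OF \<gamma> trilin_vs]])
    fix p c assume p: "p \<in> carrier P" and c: "c \<in> carrier V3"
    have "trilift (tlift K ?T (f p) (\<lambda>a b. tens3 K V1 V2 V3 a b c))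
      = tlift K U (f p) (\<lambda>a b. trilift (tens3 K V1 V2 V3 a b c))"
      by (rule lin_of_tlift[OF l linD(3)[OF f p] V(1)]) (intro bilinI trilinD[OF trilin_tens3[OF V]] c)
    also have "\<dots> = tlift K U (f p) (\<lambda>a b. \<gamma> a b c)"
      by (rule tlift_cong[OF linD(3)[OF f p] V(1)])
         (intro bilinI trilinD[OF \<gamma>] c | simp add: trilift_tens3 c)+
    finally show "trilift (tlift K ?T (f p) (\<lambda>a b. tens3 K V1 V2 V3 a b c)) = tlift K U (f p) (\<lambda>a b. \<gamma> a b c)" .
  qed
  finally show ?thesis .
qed

text \<open>The counterpart of \<open>trilift_left\<close> for the side on which the last two legs
  come from expanding one element.\<close>

lemma trilift_right:
  assumes t: "t \<in> carrier (V1 \<otimes>\<^sub>t P)" and f: "lin P (V2 \<otimes>\<^sub>t V3) f"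
  shows "trilift (tlift K (tensor3 K V1 V2 V3) t (\<lambda>a p. tlift K (tensor3 K V1 V2 V3) (f p) (\<lambda>b c. tens3 K V1 V2 V3 a b c)))
    = tlift K U t (\<lambda>a p. tlift K U (f p) (\<lambda>b c. \<gamma> a b c))"
proof -
  let ?T = "tensor3 K V1 V2 V3"
  note P = linD(1)[OF f]
  note l = lin_trilift[folded tensor3_def]
  have b': "bilin V1 P W (\<lambda>a p. tlift K W (f p) (\<lambda>b c. g a b c))"
    if g: "trilin V1 V2 V3 W g" "vspace W" for W :: "('k, 'w, 'ww) module_scheme" and g
    by (intro bilinI lin_tlift1[OF f V(2)] lin_tlift2[OF linD(3)[OF f] V(2,3,1)] that bilinI trilinD[OF g(1)])
  have "trilift (tlift K ?T t (\<lambda>a p. tlift K ?T (f p) (\<lambda>b c. tens3 K V1 V2 V3 a b c)))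
    = tlift K U t (\<lambda>a p. trilift (tlift K ?T (f p) (\<lambda>b c. tens3 K V1 V2 V3 a b c)))"
    by (rule lin_of_tlift[OF l t V(1) b'[OF trilin_tens3[OF V] linD(1)[OF l]]])
  also have "\<dots> = tlift K U t (\<lambda>a p. tlift K U (f p) (\<lambda>b c. \<gamma> a b c))"
  proof (rule tlift_cong[OF t V(1) b'[OF \<gamma> trilin_vs]])
    fix a p assume p: "p \<in> carrier P" and a: "a \<in> carrier V1"
    have "trilift (tlift K ?T (f p) (\<lambda>b c. tens3 K V1 V2 V3 a b c))
      = tlift K U (f p) (\<lambda>b c. trilift (tens3 K V1 V2 V3 a b c))"
      by (rule lin_of_tlift[OF l linD(3)[OF f p] V(2)]) (intro bilinI trilinD[OF trilin_tens3[OF V]] a)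
    also have "\<dots> = tlift K U (f p) (\<lambda>b c. \<gamma> a b c)"
      by (rule tlift_cong[OF linD(3)[OF f p] V(2)]) (auto intro: bilinI trilinD[OF \<gamma>] simp: trilift_tens3 a)
    finally show "trilift (tlift K ?T (f p) (\<lambda>b c. tens3 K V1 V2 V3 a b c)) = tlift K U (f p) (\<lambda>b c. \<gamma> a b c)" .
  qed
  finally show ?thesis .
qed

end

end

subsection \<open>Hopf algebras\<close>

locale hopf = linear_algebra K for K :: "'k ring" (structure) +
  fixes H :: "('k, 'h) hopf_data"
  assumes hopf: "hopf_algebra K H"
begin

abbreviation Delta ("\<Delta>") where "\<Delta> \<equiv> comult H"
abbreviation eps ("\<epsilon>") where "\<epsilon> \<equiv> counit H"
abbreviation S where "S \<equiv> antipode H"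

lemma hopfD: "vspace H" "ring H" "k_algebra K H" "k_coalgebra K H \<Delta> \<epsilon>"
    "lin H (H \<otimes>\<^sub>t H) \<Delta>" "lin H (ground K) \<epsilon>" "lin H H S"
  using hopf by (auto simp: hopf_algebra_def k_algebra_def k_coalgebra_def)

sublocale H: ring H by (rule hopfD(2))

lemma vsH [simp]: "vspace H" by (rule hopfD(1))
lemma vs_HH [simp]: "vspace (H \<otimes>\<^sub>t H)" by (rule vs_tensor[OF vsH vsH])
declare vs_ground [simp]

lemma smult_closed_H [simp]: "c \<in> carrier K \<Longrightarrow> x \<in> carrier H \<Longrightarrow> c \<odot>\<^bsub>H\<^esub> x \<in> carrier H"
  by (rule vsD(5)[OF vsH])

lemma comult_closed [simp]: "x \<in> carrier H \<Longrightarrow> \<Delta> x \<in> carrier (H \<otimes>\<^sub>t H)"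
  by (rule linD(3)[OF hopfD(5)])

lemma counit_closed [simp]: "x \<in> carrier H \<Longrightarrow> \<epsilon> x \<in> carrier K"
  using linD(3)[OF hopfD(6)] by (simp add: ground_def)

lemma antipode_closed [simp]: "x \<in> carrier H \<Longrightarrow> S x \<in> carrier H"
  by (rule linD(3)[OF hopfD(7)])

lemmas lin_comult [lin_intro] = lin_comp[OF hopfD(5)]
lemmas lin_counit [lin_intro] = lin_comp[OF hopfD(6)]
lemmas lin_antipode [lin_intro] = lin_comp[OF hopfD(7)]

lemma mult_smult:
  assumes "c \<in> carrier K" "x \<in> carrier H" "y \<in> carrier H"
  shows "(c \<odot>\<^bsub>H\<^esub> x) \<otimes>\<^bsub>H\<^esub> y = c \<odot>\<^bsub>H\<^esub> (x \<otimes>\<^bsub>H\<^esub> y)" "x \<otimes>\<^bsub>H\<^esub> (c \<odot>\<^bsub>H\<^esub> y) = c \<odot>\<^bsub>H\<^esub> (x \<otimes>\<^bsub>H\<^esub> y)"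
  using hopfD(3) assms by (auto simp: k_algebra_def)

lemma lin_mult1 [lin_intro]: "lin Z H g \<Longrightarrow> y \<in> carrier H \<Longrightarrow> lin Z H (\<lambda>z. g z \<otimes>\<^bsub>H\<^esub> y)"
  by (rule lin_comp[of H H "\<lambda>x. x \<otimes>\<^bsub>H\<^esub> y"]) (auto intro!: linI simp: H.l_distr mult_smult)

lemma lin_mult2 [lin_intro]: "lin Z H g \<Longrightarrow> x \<in> carrier H \<Longrightarrow> lin Z H (\<lambda>z. x \<otimes>\<^bsub>H\<^esub> g z)"
  by (rule lin_comp[of H H "\<lambda>y. x \<otimes>\<^bsub>H\<^esub> y"]) (auto intro!: linI simp: H.r_distr mult_smult)

lemmas comult_lin [lin_intro] =
  lin_tlift1[OF lin_comult vsH] lin_tlift2[OF comult_closed vsH vsH] tlift_closed[OF comult_closed vsH]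
lemmas comult_cong = tlift_cong[OF comult_closed vsH]
lemmas comult_swap = tlift_swap[OF comult_closed comult_closed vsH vsH vsH vsH]
lemmas comult_apply = lin_of_tlift[OF _ comult_closed vsH]
lemmas tlift_HH = tlift_tens[OF vsH vsH]

lemma coassoc:
  assumes "trilin H H H U \<gamma>" "x \<in> carrier H"
  shows "tlift K U (\<Delta> x) (\<lambda>p c. tlift K U (\<Delta> p) (\<lambda>a b. \<gamma> a b c)) =
    tlift K U (\<Delta> x) (\<lambda>a p. tlift K U (\<Delta> p) (\<lambda>b c. \<gamma> a b c))"
  using trilift_left[OF vsH vsH vsH assms(1) comult_closed[OF assms(2)] hopfD(5)]
    trilift_right[OF vsH vsH vsH assms(1) comult_closed[OF assms(2)] hopfD(5)] hopfD(4) assms(2)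
  by (simp add: k_coalgebra_def)

lemma counit_left:
  assumes f: "lin H U f" and x: "x \<in> carrier H"
  shows "tlift K U (\<Delta> x) (\<lambda>a b. \<epsilon> a \<odot>\<^bsub>U\<^esub> f b) = f x"
proof -
  have "f (tlift K H (\<Delta> x) (\<lambda>a b. \<epsilon> a \<odot>\<^bsub>H\<^esub> b)) = tlift K U (\<Delta> x) (\<lambda>a b. f (\<epsilon> a \<odot>\<^bsub>H\<^esub> b))"
    by (rule comult_apply[OF f x]) (intro lin_intro; simp)
  also have "\<dots> = tlift K U (\<Delta> x) (\<lambda>a b. \<epsilon> a \<odot>\<^bsub>U\<^esub> f b)"
    by (rule comult_cong[OF x]) (intro lin_intro lin_comp[OF f] | simp add: linD[OF f])+
  finally show ?thesis using hopfD(4) x by (simp add: k_coalgebra_def)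
qed

lemma counit_right:
  assumes f: "lin H U f" and x: "x \<in> carrier H"
  shows "tlift K U (\<Delta> x) (\<lambda>a b. \<epsilon> b \<odot>\<^bsub>U\<^esub> f a) = f x"
proof -
  have "f (tlift K H (\<Delta> x) (\<lambda>a b. \<epsilon> b \<odot>\<^bsub>H\<^esub> a)) = tlift K U (\<Delta> x) (\<lambda>a b. f (\<epsilon> b \<odot>\<^bsub>H\<^esub> a))"
    by (rule comult_apply[OF f x]) (intro lin_intro; simp)
  also have "\<dots> = tlift K U (\<Delta> x) (\<lambda>a b. \<epsilon> b \<odot>\<^bsub>U\<^esub> f a)"
    by (rule comult_cong[OF x]) (intro lin_intro lin_comp[OF f] | simp add: linD[OF f])+
  finally show ?thesis using hopfD(4) x by (simp add: k_coalgebra_def)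
qed

lemma antipode_left:
  assumes f: "lin H U f" and x: "x \<in> carrier H"
  shows "tlift K U (\<Delta> x) (\<lambda>a b. f (S a \<otimes>\<^bsub>H\<^esub> b)) = \<epsilon> x \<odot>\<^bsub>U\<^esub> f \<one>\<^bsub>H\<^esub>"
proof -
  have "tlift K U (\<Delta> x) (\<lambda>a b. f (S a \<otimes>\<^bsub>H\<^esub> b)) = f (tlift K H (\<Delta> x) (\<lambda>a b. S a \<otimes>\<^bsub>H\<^esub> b))"
    by (rule comult_apply[OF f x, symmetric]) (intro lin_intro; simp)
  also have "tlift K H (\<Delta> x) (\<lambda>a b. S a \<otimes>\<^bsub>H\<^esub> b) = \<epsilon> x \<odot>\<^bsub>H\<^esub> \<one>\<^bsub>H\<^esub>"
    using hopf x by (simp add: hopf_algebra_def)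
  finally show ?thesis using x by (simp add: linD[OF f])
qed

lemma antipode_right:
  assumes f: "lin H U f" and x: "x \<in> carrier H"
  shows "tlift K U (\<Delta> x) (\<lambda>a b. f (a \<otimes>\<^bsub>H\<^esub> S b)) = \<epsilon> x \<odot>\<^bsub>U\<^esub> f \<one>\<^bsub>H\<^esub>"
proof -
  have "tlift K U (\<Delta> x) (\<lambda>a b. f (a \<otimes>\<^bsub>H\<^esub> S b)) = f (tlift K H (\<Delta> x) (\<lambda>a b. a \<otimes>\<^bsub>H\<^esub> S b))"
    by (rule comult_apply[OF f x, symmetric]) (intro lin_intro; simp)
  also have "tlift K H (\<Delta> x) (\<lambda>a b. a \<otimes>\<^bsub>H\<^esub> S b) = \<epsilon> x \<odot>\<^bsub>H\<^esub> \<one>\<^bsub>H\<^esub>"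
    using hopf x by (simp add: hopf_algebra_def)
  finally show ?thesis using x by (simp add: linD[OF f])
qed

lemma comult_mult:
  assumes \<gamma>: "bilin H H U \<gamma>" and x: "x \<in> carrier H" and y: "y \<in> carrier H"
  shows "tlift K U (\<Delta> (x \<otimes>\<^bsub>H\<^esub> y)) \<gamma> =
    tlift K U (\<Delta> x) (\<lambda>a b. tlift K U (\<Delta> y) (\<lambda>c d. \<gamma> (a \<otimes>\<^bsub>H\<^esub> c) (b \<otimes>\<^bsub>H\<^esub> d)))"
proof -
  let ?T = "H \<otimes>\<^sub>t H"
  note U = bilin_vs(2)[OF \<gamma> vsH]
  note l = lin_tlift[OF vsH vsH \<gamma>]
  note [lin_intro] = lin_bilin1[OF \<gamma>] lin_bilin2[OF \<gamma>]
  have "\<Delta> (x \<otimes>\<^bsub>H\<^esub> y) = tlift K ?T (\<Delta> x) (\<lambda>a b. tlift K ?T (\<Delta> y) (\<lambda>c d. tens K H H (a \<otimes>\<^bsub>H\<^esub> c) (b \<otimes>\<^bsub>H\<^esub> d)))"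
    using hopf x y by (simp add: hopf_algebra_def)
  then have "tlift K U (\<Delta> (x \<otimes>\<^bsub>H\<^esub> y)) \<gamma> = tlift K U (\<Delta> x) (\<lambda>a b.
      tlift K U (tlift K ?T (\<Delta> y) (\<lambda>c d. tens K H H (a \<otimes>\<^bsub>H\<^esub> c) (b \<otimes>\<^bsub>H\<^esub> d))) \<gamma>)"
    by (simp only:, intro comult_apply[OF l x]) (intro lin_intro; simp add: y)
  also have "\<dots> = tlift K U (\<Delta> x) (\<lambda>a b. tlift K U (\<Delta> y) (\<lambda>c d. \<gamma> (a \<otimes>\<^bsub>H\<^esub> c) (b \<otimes>\<^bsub>H\<^esub> d)))"
  proof (rule comult_cong[OF x])
    show "bilin H H U (\<lambda>a b. tlift K U (\<Delta> y) (\<lambda>c d. \<gamma> (a \<otimes>\<^bsub>H\<^esub> c) (b \<otimes>\<^bsub>H\<^esub> d)))"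
      by (intro lin_intro; simp add: y U)
    fix a b assume ab: "a \<in> carrier H" "b \<in> carrier H"
    have "tlift K U (tlift K ?T (\<Delta> y) (\<lambda>c d. tens K H H (a \<otimes>\<^bsub>H\<^esub> c) (b \<otimes>\<^bsub>H\<^esub> d))) \<gamma>
      = tlift K U (\<Delta> y) (\<lambda>c d. tlift K U (tens K H H (a \<otimes>\<^bsub>H\<^esub> c) (b \<otimes>\<^bsub>H\<^esub> d)) \<gamma>)"
      by (rule comult_apply[OF l y]) (intro lin_intro; simp add: ab)
    also have "\<dots> = tlift K U (\<Delta> y) (\<lambda>c d. \<gamma> (a \<otimes>\<^bsub>H\<^esub> c) (b \<otimes>\<^bsub>H\<^esub> d))"
      by (rule comult_cong[OF y]) (intro lin_intro | simp add: ab tlift_HH[OF \<gamma>])+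
    finally show "tlift K U (tlift K ?T (\<Delta> y) (\<lambda>c d. tens K H H (a \<otimes>\<^bsub>H\<^esub> c) (b \<otimes>\<^bsub>H\<^esub> d))) \<gamma>
      = tlift K U (\<Delta> y) (\<lambda>c d. \<gamma> (a \<otimes>\<^bsub>H\<^esub> c) (b \<otimes>\<^bsub>H\<^esub> d))" .
  qed
  finally show ?thesis .
qed

lemma counit_mult: "x \<in> carrier H \<Longrightarrow> y \<in> carrier H \<Longrightarrow> \<epsilon> (x \<otimes>\<^bsub>H\<^esub> y) = \<epsilon> x \<otimes> \<epsilon> y"
  and counit_one [simp]: "\<epsilon> \<one>\<^bsub>H\<^esub> = \<one>"
  and comult_one: "\<Delta> \<one>\<^bsub>H\<^esub> = tens K H H \<one>\<^bsub>H\<^esub> \<one>\<^bsub>H\<^esub>"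
  using hopf by (auto simp: hopf_algebra_def)

lemma antipode_one [simp]: "S \<one>\<^bsub>H\<^esub> = \<one>\<^bsub>H\<^esub>"
proof -
  have "tlift K H (tens K H H \<one>\<^bsub>H\<^esub> \<one>\<^bsub>H\<^esub>) (\<lambda>a b. S a \<otimes>\<^bsub>H\<^esub> b) = S \<one>\<^bsub>H\<^esub> \<otimes>\<^bsub>H\<^esub> \<one>\<^bsub>H\<^esub>"
    by (rule tlift_HH) (intro lin_intro | simp)+
  moreover interpret V: vectorspace K H by (rule vsH)
  have "tlift K H (\<Delta> \<one>\<^bsub>H\<^esub>) (\<lambda>a b. S a \<otimes>\<^bsub>H\<^esub> b) = \<one>\<^bsub>H\<^esub>"
    using antipode_left[OF lin_id[OF vsH], of "\<one>\<^bsub>H\<^esub>"] by simp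
  ultimately show ?thesis by (simp add: comult_one)
qed

text \<open>The identity that S(h y) = S(y) S(h) would give. Insert \<epsilon>(y) as y2 S(y3) to get
  S(h1 y1) h2 y2 S(y3); the first part is the antipode axiom for the product h y' and collapses to
  \<epsilon>(h) \<epsilon>(y'), leaving S(y).\<close>

lemma antipode_mult_cancel:
  assumes h: "h \<in> carrier H" and y: "y \<in> carrier H"
  shows "tlift K H (\<Delta> h) (\<lambda>h1 h2. S (h1 \<otimes>\<^bsub>H\<^esub> y) \<otimes>\<^bsub>H\<^esub> h2) = \<epsilon> h \<odot>\<^bsub>H\<^esub> S y"
proof -
  let ?g = "\<lambda>h1 h2 y1 y2 y3. S (h1 \<otimes>\<^bsub>H\<^esub> y1) \<otimes>\<^bsub>H\<^esub> h2 \<otimes>\<^bsub>H\<^esub> (y2 \<otimes>\<^bsub>H\<^esub> S y3)"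
  have "tlift K H (\<Delta> h) (\<lambda>h1 h2. S (h1 \<otimes>\<^bsub>H\<^esub> y) \<otimes>\<^bsub>H\<^esub> h2)
    = tlift K H (\<Delta> h) (\<lambda>h1 h2. tlift K H (\<Delta> y) (\<lambda>y' y3. tlift K H (\<Delta> y') (\<lambda>y1 y2. ?g h1 h2 y1 y2 y3)))"
  proof (rule comult_cong[OF h])
    show "bilin H H H (\<lambda>h1 h2. tlift K H (\<Delta> y) (\<lambda>y' y3. tlift K H (\<Delta> y') (\<lambda>y1 y2. ?g h1 h2 y1 y2 y3)))"
      by (intro lin_intro | simp add: y)+
    fix h1 h2 assume hh: "h1 \<in> carrier H" "h2 \<in> carrier H"
    have "tlift K H (\<Delta> y) (\<lambda>y' y3. tlift K H (\<Delta> y') (\<lambda>y1 y2. ?g h1 h2 y1 y2 y3))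
      = tlift K H (\<Delta> y) (\<lambda>y1 y'. tlift K H (\<Delta> y') (\<lambda>y2 y3. ?g h1 h2 y1 y2 y3))"
      by (rule coassoc[OF _ y]) (intro lin_intro | simp add: hh)+
    also have "\<dots> = tlift K H (\<Delta> y) (\<lambda>y1 y'. \<epsilon> y' \<odot>\<^bsub>H\<^esub> (S (h1 \<otimes>\<^bsub>H\<^esub> y1) \<otimes>\<^bsub>H\<^esub> h2))"
    proof (rule comult_cong[OF y])
      fix y1 y' assume yy: "y1 \<in> carrier H" "y' \<in> carrier H"
      show "tlift K H (\<Delta> y') (\<lambda>y2 y3. ?g h1 h2 y1 y2 y3) = \<epsilon> y' \<odot>\<^bsub>H\<^esub> (S (h1 \<otimes>\<^bsub>H\<^esub> y1) \<otimes>\<^bsub>H\<^esub> h2)"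
        by (subst antipode_right[where f = "\<lambda>z. S (h1 \<otimes>\<^bsub>H\<^esub> y1) \<otimes>\<^bsub>H\<^esub> h2 \<otimes>\<^bsub>H\<^esub> z"])
           (intro lin_intro | simp add: hh yy)+
    qed (intro lin_intro | simp add: hh)+
    also have "\<dots> = S (h1 \<otimes>\<^bsub>H\<^esub> y) \<otimes>\<^bsub>H\<^esub> h2"
      by (rule counit_right[where f = "\<lambda>y. S (h1 \<otimes>\<^bsub>H\<^esub> y) \<otimes>\<^bsub>H\<^esub> h2"]) (intro lin_intro | simp add: hh y)+
    finally show "S (h1 \<otimes>\<^bsub>H\<^esub> y) \<otimes>\<^bsub>H\<^esub> h2 =
      tlift K H (\<Delta> y) (\<lambda>y' y3. tlift K H (\<Delta> y') (\<lambda>y1 y2. ?g h1 h2 y1 y2 y3))" by simp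
  qed
  also have "\<dots> = tlift K H (\<Delta> y) (\<lambda>y' y3. tlift K H (\<Delta> h) (\<lambda>h1 h2. tlift K H (\<Delta> y') (\<lambda>y1 y2. ?g h1 h2 y1 y2 y3)))"
    by (rule comult_swap[OF h y]) (intro lin_intro | simp)+
  also have "\<dots> = tlift K H (\<Delta> y) (\<lambda>y' y3. \<epsilon> y' \<odot>\<^bsub>H\<^esub> (\<epsilon> h \<odot>\<^bsub>H\<^esub> S y3))"
  proof (rule comult_cong[OF y])
    fix y' y3 assume yy: "y' \<in> carrier H" "y3 \<in> carrier H"
    have "tlift K H (\<Delta> h) (\<lambda>h1 h2. tlift K H (\<Delta> y') (\<lambda>y1 y2. ?g h1 h2 y1 y2 y3))
      = tlift K H (\<Delta> h) (\<lambda>h1 h2. tlift K H (\<Delta> y') (\<lambda>y1 y2. (S (h1 \<otimes>\<^bsub>H\<^esub> y1) \<otimes>\<^bsub>H\<^esub> (h2 \<otimes>\<^bsub>H\<^esub> y2)) \<otimes>\<^bsub>H\<^esub> S y3))"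
      by (intro comult_cong[OF h] comult_cong[OF yy(1)]) (intro lin_intro | simp add: yy H.m_assoc)+
    also have "\<dots> = tlift K H (\<Delta> (h \<otimes>\<^bsub>H\<^esub> y')) (\<lambda>a b. (S a \<otimes>\<^bsub>H\<^esub> b) \<otimes>\<^bsub>H\<^esub> S y3)"
      by (rule comult_mult[symmetric]) (intro lin_intro | simp add: yy h)+
    also have "\<dots> = \<epsilon> (h \<otimes>\<^bsub>H\<^esub> y') \<odot>\<^bsub>H\<^esub> S y3"
      by (subst antipode_left[where f = "\<lambda>z. z \<otimes>\<^bsub>H\<^esub> S y3"]) (intro lin_intro | simp add: yy h)+
    finally show "tlift K H (\<Delta> h) (\<lambda>h1 h2. tlift K H (\<Delta> y') (\<lambda>y1 y2. ?g h1 h2 y1 y2 y3))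
      = \<epsilon> y' \<odot>\<^bsub>H\<^esub> (\<epsilon> h \<odot>\<^bsub>H\<^esub> S y3)"
      using yy h by (simp add: counit_mult m_comm flip: module.smult_assoc1[OF vsD(2)[OF vsH]])
  qed (intro lin_intro | simp add: h)+
  also have "\<dots> = \<epsilon> h \<odot>\<^bsub>H\<^esub> S y"
    by (rule counit_left[where f = "\<lambda>y. \<epsilon> h \<odot>\<^bsub>H\<^esub> S y"]) (intro lin_intro | simp add: h y)+
  finally show ?thesis .
qed

text \<open>The Casimir property of h-translates of L1 \<otimes> S(L2). Since \<epsilon>(h1) L = h1
  L, multiplicativity of the comultiplication rewrites L1 \<otimes> S(L2) h as h1 L1 \<otimes> S(h2
  L2) h3, and \<open>antipode_mult_cancel\<close> removes h2 and h3.\<close>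

lemma integral_comult:
  assumes L: "L \<in> carrier H" "\<And>h. h \<in> carrier H \<Longrightarrow> h \<otimes>\<^bsub>H\<^esub> L = \<epsilon> h \<odot>\<^bsub>H\<^esub> L"
    and \<gamma>: "bilin H H U \<gamma>" and h: "h \<in> carrier H"
  shows "tlift K U (\<Delta> L) (\<lambda>a b. \<gamma> (h \<otimes>\<^bsub>H\<^esub> a) (S b)) = tlift K U (\<Delta> L) (\<lambda>a b. \<gamma> a (S b \<otimes>\<^bsub>H\<^esub> h))"
proof -
  note U [simp] = bilin_vs(2)[OF \<gamma> vsH]
  note [lin_intro] = lin_bilin1[OF \<gamma>] lin_bilin2[OF \<gamma>]
  have [simp]: "\<gamma> x y \<in> carrier U" if "x \<in> carrier H" "y \<in> carrier H" for x y
    using that by (rule bilinD(3)[OF \<gamma>])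
  have "tlift K U (\<Delta> L) (\<lambda>a b. \<gamma> a (S b \<otimes>\<^bsub>H\<^esub> h))
    = tlift K U (\<Delta> h) (\<lambda>h' h3. \<epsilon> h' \<odot>\<^bsub>U\<^esub> tlift K U (\<Delta> L) (\<lambda>a b. \<gamma> a (S b \<otimes>\<^bsub>H\<^esub> h3)))"
    by (rule counit_left[symmetric]) (intro lin_intro | simp add: h L)+
  also have "\<dots> = tlift K U (\<Delta> h) (\<lambda>h' h3. tlift K U (\<Delta> h') (\<lambda>h1 h2. tlift K U (\<Delta> L)
      (\<lambda>a b. \<gamma> (h1 \<otimes>\<^bsub>H\<^esub> a) (S (h2 \<otimes>\<^bsub>H\<^esub> b) \<otimes>\<^bsub>H\<^esub> h3))))"
  proof (rule comult_cong[OF h])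
    fix h' h3 assume hh: "h' \<in> carrier H" "h3 \<in> carrier H"
    have b: "bilin H H U (\<lambda>a b. \<gamma> a (S b \<otimes>\<^bsub>H\<^esub> h3))" by (intro lin_intro | simp add: hh)+
    have "\<epsilon> h' \<odot>\<^bsub>U\<^esub> tlift K U (\<Delta> L) (\<lambda>a b. \<gamma> a (S b \<otimes>\<^bsub>H\<^esub> h3)) =
      tlift K U (\<Delta> (\<epsilon> h' \<odot>\<^bsub>H\<^esub> L)) (\<lambda>a b. \<gamma> a (S b \<otimes>\<^bsub>H\<^esub> h3))"
      by (rule linD(5)[symmetric, OF lin_comp[OF lin_tlift[OF vsH vsH b] hopfD(5)]]) (simp_all add: hh L)
    also have "\<dots> = tlift K U (\<Delta> h') (\<lambda>h1 h2. tlift K U (\<Delta> L)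
      (\<lambda>a b. \<gamma> (h1 \<otimes>\<^bsub>H\<^esub> a) (S (h2 \<otimes>\<^bsub>H\<^esub> b) \<otimes>\<^bsub>H\<^esub> h3)))"
      unfolding L(2)[OF hh(1), symmetric] by (rule comult_mult[OF b hh(1) L(1)])
    finally show "\<epsilon> h' \<odot>\<^bsub>U\<^esub> tlift K U (\<Delta> L) (\<lambda>a b. \<gamma> a (S b \<otimes>\<^bsub>H\<^esub> h3)) = \<dots>" .
  qed (intro lin_intro | simp add: L)+
  also have "\<dots> = tlift K U (\<Delta> h) (\<lambda>h1 h'. tlift K U (\<Delta> h') (\<lambda>h2 h3. tlift K U (\<Delta> L)
      (\<lambda>a b. \<gamma> (h1 \<otimes>\<^bsub>H\<^esub> a) (S (h2 \<otimes>\<^bsub>H\<^esub> b) \<otimes>\<^bsub>H\<^esub> h3))))"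
    by (rule coassoc[OF _ h]) (intro lin_intro | simp add: L)+
  also have "\<dots> = tlift K U (\<Delta> h) (\<lambda>h1 h'. \<epsilon> h' \<odot>\<^bsub>U\<^esub> tlift K U (\<Delta> L) (\<lambda>a b. \<gamma> (h1 \<otimes>\<^bsub>H\<^esub> a) (S b)))"
  proof (rule comult_cong[OF h])
    fix h1 h' assume hh: "h1 \<in> carrier H" "h' \<in> carrier H"
    have "tlift K U (\<Delta> h') (\<lambda>h2 h3. tlift K U (\<Delta> L) (\<lambda>a b. \<gamma> (h1 \<otimes>\<^bsub>H\<^esub> a) (S (h2 \<otimes>\<^bsub>H\<^esub> b) \<otimes>\<^bsub>H\<^esub> h3)))
      = tlift K U (\<Delta> L) (\<lambda>a b. tlift K U (\<Delta> h') (\<lambda>h2 h3. \<gamma> (h1 \<otimes>\<^bsub>H\<^esub> a) (S (h2 \<otimes>\<^bsub>H\<^esub> b) \<otimes>\<^bsub>H\<^esub> h3)))"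
      by (rule comult_swap[OF hh(2) L(1)]) (intro lin_intro | simp add: hh)+
    also have "\<dots> = tlift K U (\<Delta> L) (\<lambda>a b. \<epsilon> h' \<odot>\<^bsub>U\<^esub> \<gamma> (h1 \<otimes>\<^bsub>H\<^esub> a) (S b))"
    proof (rule comult_cong[OF L(1)])
      fix a b assume ab: "a \<in> carrier H" "b \<in> carrier H"
      have l: "lin H U (\<gamma> (h1 \<otimes>\<^bsub>H\<^esub> a))" by (rule bilinD(1)[OF \<gamma>]) (simp add: hh ab)
      have "tlift K U (\<Delta> h') (\<lambda>h2 h3. \<gamma> (h1 \<otimes>\<^bsub>H\<^esub> a) (S (h2 \<otimes>\<^bsub>H\<^esub> b) \<otimes>\<^bsub>H\<^esub> h3))
        = \<gamma> (h1 \<otimes>\<^bsub>H\<^esub> a) (tlift K H (\<Delta> h') (\<lambda>h2 h3. S (h2 \<otimes>\<^bsub>H\<^esub> b) \<otimes>\<^bsub>H\<^esub> h3))"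
        by (rule comult_apply[OF l hh(2), symmetric]) (intro lin_intro | simp add: ab)+
      then show "tlift K U (\<Delta> h') (\<lambda>h2 h3. \<gamma> (h1 \<otimes>\<^bsub>H\<^esub> a) (S (h2 \<otimes>\<^bsub>H\<^esub> b) \<otimes>\<^bsub>H\<^esub> h3)) = \<epsilon> h' \<odot>\<^bsub>U\<^esub> \<gamma> (h1 \<otimes>\<^bsub>H\<^esub> a) (S b)"
        by (simp add: antipode_mult_cancel hh ab linD(5)[OF l])
    qed (intro lin_intro | simp add: hh)+
    also have "\<dots> = \<epsilon> h' \<odot>\<^bsub>U\<^esub> tlift K U (\<Delta> L) (\<lambda>a b. \<gamma> (h1 \<otimes>\<^bsub>H\<^esub> a) (S b))"
      by (rule comult_apply[where f = "\<lambda>u. \<epsilon> h' \<odot>\<^bsub>U\<^esub> u", OF _ L(1), symmetric]) (intro lin_intro | simp add: hh)+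
    finally show "tlift K U (\<Delta> h') (\<lambda>h2 h3. tlift K U (\<Delta> L) (\<lambda>a b. \<gamma> (h1 \<otimes>\<^bsub>H\<^esub> a) (S (h2 \<otimes>\<^bsub>H\<^esub> b) \<otimes>\<^bsub>H\<^esub> h3))) = \<dots>" .
  qed (intro lin_intro | simp add: L)+
  also have "\<dots> = tlift K U (\<Delta> L) (\<lambda>a b. \<gamma> (h \<otimes>\<^bsub>H\<^esub> a) (S b))"
    by (rule counit_right) (intro lin_intro | simp add: L h)+
  finally show ?thesis by simp
qed

text \<open>The identity that the rule \<Delta>(S m) = S(m2) \<otimes> S(m1) would give. Start from
  1 \<otimes> S(m), insert \<Delta>(S(m1) m2) = \<epsilon>(m1) 1 \<otimes> 1 in front of S(m3),
  expand it as a product, and cancel the second leg of m2 against S(m3).\<close>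

lemma comult_antipode_cancel:
  assumes \<gamma>: "bilin H H U \<gamma>" and m: "m \<in> carrier H"
  shows "tlift K U (\<Delta> m) (\<lambda>m1 m2. tlift K U (\<Delta> (S m1)) (\<lambda>p q. \<gamma> (p \<otimes>\<^bsub>H\<^esub> m2) q)) = \<gamma> \<one>\<^bsub>H\<^esub> (S m)"
proof -
  note U [simp] = bilin_vs(2)[OF \<gamma> vsH]
  note [lin_intro] = lin_bilin1[OF \<gamma>] lin_bilin2[OF \<gamma>]
  have [simp]: "\<gamma> x y \<in> carrier U" if "x \<in> carrier H" "y \<in> carrier H" for x y
    using that by (rule bilinD(3)[OF \<gamma>])
  let ?k = "\<lambda>m1 m2 m3. tlift K U (\<Delta> (S m1)) (\<lambda>p q. tlift K U (\<Delta> m2) (\<lambda>a b. \<gamma> (p \<otimes>\<^bsub>H\<^esub> a) (q \<otimes>\<^bsub>H\<^esub> b \<otimes>\<^bsub>H\<^esub> S m3)))"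
  have "\<gamma> \<one>\<^bsub>H\<^esub> (S m) = tlift K U (\<Delta> m) (\<lambda>m' m3. \<epsilon> m' \<odot>\<^bsub>U\<^esub> \<gamma> \<one>\<^bsub>H\<^esub> (S m3))"
    by (rule counit_left[symmetric]) (intro lin_intro | simp add: m)+
  also have "\<dots> = tlift K U (\<Delta> m) (\<lambda>m' m3. tlift K U (\<Delta> m') (\<lambda>m1 m2. ?k m1 m2 m3))"
  proof (rule comult_cong[OF m])
    fix m' m3 assume mm: "m' \<in> carrier H" "m3 \<in> carrier H"
    have b: "bilin H H U (\<lambda>p q. \<gamma> p (q \<otimes>\<^bsub>H\<^esub> S m3))" by (intro lin_intro | simp add: mm)+
    have "\<epsilon> m' \<odot>\<^bsub>U\<^esub> \<gamma> \<one>\<^bsub>H\<^esub> (S m3) = \<epsilon> m' \<odot>\<^bsub>U\<^esub> tlift K U (\<Delta> \<one>\<^bsub>H\<^esub>) (\<lambda>p q. \<gamma> p (q \<otimes>\<^bsub>H\<^esub> S m3))"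
      by (simp add: comult_one tlift_HH[OF b] mm)
    also have "\<dots> = tlift K U (\<Delta> m') (\<lambda>m1 m2. tlift K U (\<Delta> (S m1 \<otimes>\<^bsub>H\<^esub> m2)) (\<lambda>p q. \<gamma> p (q \<otimes>\<^bsub>H\<^esub> S m3)))"
      by (rule antipode_left[symmetric]) (intro lin_intro | simp add: mm)+
    also have "\<dots> = tlift K U (\<Delta> m') (\<lambda>m1 m2. ?k m1 m2 m3)"
      by (rule comult_cong[OF mm(1)]) (intro lin_intro | simp add: mm comult_mult[OF b])+
    finally show "\<epsilon> m' \<odot>\<^bsub>U\<^esub> \<gamma> \<one>\<^bsub>H\<^esub> (S m3) = \<dots>" .
  qed (intro lin_intro | simp)+
  also have "\<dots> = tlift K U (\<Delta> m) (\<lambda>m1 m'. tlift K U (\<Delta> m') (\<lambda>m2 m3. ?k m1 m2 m3))"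
    by (rule coassoc[OF _ m]) (intro lin_intro | simp)+
  also have "\<dots> = tlift K U (\<Delta> m) (\<lambda>m1 m2. tlift K U (\<Delta> (S m1)) (\<lambda>p q. \<gamma> (p \<otimes>\<^bsub>H\<^esub> m2) q))"
  proof (rule comult_cong[OF m])
    fix m1 m' assume mm: "m1 \<in> carrier H" "m' \<in> carrier H"
    note Sm = antipode_closed[OF mm(1)]
    let ?g = "\<lambda>p q a b m3. \<gamma> (p \<otimes>\<^bsub>H\<^esub> a) (q \<otimes>\<^bsub>H\<^esub> b \<otimes>\<^bsub>H\<^esub> S m3)"
    have "tlift K U (\<Delta> m') (\<lambda>m2 m3. ?k m1 m2 m3)
      = tlift K U (\<Delta> (S m1)) (\<lambda>p q. tlift K U (\<Delta> m') (\<lambda>m2 m3. tlift K U (\<Delta> m2) (\<lambda>a b. ?g p q a b m3)))"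
      by (rule comult_swap[OF mm(2) Sm]) (intro lin_intro | simp add: mm)+
    also have "\<dots> = tlift K U (\<Delta> (S m1)) (\<lambda>p q. \<gamma> (p \<otimes>\<^bsub>H\<^esub> m') q)"
    proof (rule comult_cong[OF Sm])
      fix p q assume pq: "p \<in> carrier H" "q \<in> carrier H"
      have "tlift K U (\<Delta> m') (\<lambda>m2 m3. tlift K U (\<Delta> m2) (\<lambda>a b. ?g p q a b m3))
        = tlift K U (\<Delta> m') (\<lambda>a m3. tlift K U (\<Delta> m3) (\<lambda>b c. ?g p q a b c))"
        by (rule coassoc[OF _ mm(2)]) (intro lin_intro | simp add: pq)+
      also have "\<dots> = tlift K U (\<Delta> m') (\<lambda>a m3. \<epsilon> m3 \<odot>\<^bsub>U\<^esub> \<gamma> (p \<otimes>\<^bsub>H\<^esub> a) q)"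
      proof (rule comult_cong[OF mm(2)])
        fix a m3 assume am: "a \<in> carrier H" "m3 \<in> carrier H"
        have "tlift K U (\<Delta> m3) (\<lambda>b c. ?g p q a b c)
          = tlift K U (\<Delta> m3) (\<lambda>b c. \<gamma> (p \<otimes>\<^bsub>H\<^esub> a) (q \<otimes>\<^bsub>H\<^esub> (b \<otimes>\<^bsub>H\<^esub> S c)))"
          by (rule comult_cong[OF am(2)]) (intro lin_intro | simp add: pq am H.m_assoc)+
        also have "\<dots> = \<epsilon> m3 \<odot>\<^bsub>U\<^esub> \<gamma> (p \<otimes>\<^bsub>H\<^esub> a) (q \<otimes>\<^bsub>H\<^esub> \<one>\<^bsub>H\<^esub>)"
          by (rule antipode_right) (intro lin_intro | simp add: pq am)+
        finally show "tlift K U (\<Delta> m3) (\<lambda>b c. ?g p q a b c) = \<epsilon> m3 \<odot>\<^bsub>U\<^esub> \<gamma> (p \<otimes>\<^bsub>H\<^esub> a) q"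
          by (simp add: pq)
      qed (intro lin_intro | simp add: pq)+
      also have "\<dots> = \<gamma> (p \<otimes>\<^bsub>H\<^esub> m') q"
        by (rule counit_right) (intro lin_intro | simp add: pq mm)+
      finally show "tlift K U (\<Delta> m') (\<lambda>m2 m3. tlift K U (\<Delta> m2) (\<lambda>a b. ?g p q a b m3)) = \<gamma> (p \<otimes>\<^bsub>H\<^esub> m') q" .
    qed (intro lin_intro | simp add: mm)+
    finally show "tlift K U (\<Delta> m') (\<lambda>m2 m3. ?k m1 m2 m3) = \<dots>" .
  qed (intro lin_intro | simp)+
  finally show ?thesis by simp
qed

text \<open>Dual to \<open>integral_comult\<close>. Apply the defining property of \<open>l\<close>
  to z = x S(m1) and multiply by m2 on the right: the first leg becomes x1 S(m1)_1 m2 while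
  \<open>l\<close> sees x2 S(m1)_2, and \<open>comult_antipode_cancel\<close> turns the pair into x1
  and x2 S(m).\<close>

lemma cointegral_comult:
  assumes l: "functional H l" "\<And>h. h \<in> carrier H \<Longrightarrow> tlift K H (\<Delta> h) (\<lambda>a b. l b \<odot>\<^bsub>H\<^esub> a) = l h \<odot>\<^bsub>H\<^esub> \<one>\<^bsub>H\<^esub>"
    and x: "x \<in> carrier H" and m: "m \<in> carrier H"
  shows "tlift K H (\<Delta> x) (\<lambda>a b. l (b \<otimes>\<^bsub>H\<^esub> S m) \<odot>\<^bsub>H\<^esub> a) = tlift K H (\<Delta> m) (\<lambda>a b. l (x \<otimes>\<^bsub>H\<^esub> S a) \<odot>\<^bsub>H\<^esub> b)"
proof -
  note [lin_intro] = lin_comp[OF l(1)]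
  have [simp]: "l z \<in> carrier K" if "z \<in> carrier H" for z by (rule functional_closed[OF l(1) that])
  let ?g = "\<lambda>x1 x2 p q m2. l (x2 \<otimes>\<^bsub>H\<^esub> q) \<odot>\<^bsub>H\<^esub> (x1 \<otimes>\<^bsub>H\<^esub> (p \<otimes>\<^bsub>H\<^esub> m2))"
  have "tlift K H (\<Delta> m) (\<lambda>a b. l (x \<otimes>\<^bsub>H\<^esub> S a) \<odot>\<^bsub>H\<^esub> b)
    = tlift K H (\<Delta> m) (\<lambda>m1 m2. tlift K H (\<Delta> x) (\<lambda>x1 x2. tlift K H (\<Delta> (S m1)) (\<lambda>p q. ?g x1 x2 p q m2)))"
  proof (rule comult_cong[OF m])
    fix m1 m2 assume mm: "m1 \<in> carrier H" "m2 \<in> carrier H"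
    have z: "x \<otimes>\<^bsub>H\<^esub> S m1 \<in> carrier H" by (simp add: x mm)
    have "l (x \<otimes>\<^bsub>H\<^esub> S m1) \<odot>\<^bsub>H\<^esub> m2 = (l (x \<otimes>\<^bsub>H\<^esub> S m1) \<odot>\<^bsub>H\<^esub> \<one>\<^bsub>H\<^esub>) \<otimes>\<^bsub>H\<^esub> m2"
      by (simp add: mult_smult mm x)
    also have "\<dots> = tlift K H (\<Delta> (x \<otimes>\<^bsub>H\<^esub> S m1)) (\<lambda>a b. (l b \<odot>\<^bsub>H\<^esub> a) \<otimes>\<^bsub>H\<^esub> m2)"
      unfolding l(2)[OF z, symmetric]
      by (rule comult_apply[where f = "\<lambda>u. u \<otimes>\<^bsub>H\<^esub> m2", OF _ z]) (intro lin_intro | simp add: mm)+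
    also have "\<dots> = tlift K H (\<Delta> x) (\<lambda>x1 x2. tlift K H (\<Delta> (S m1)) (\<lambda>p q. (l (x2 \<otimes>\<^bsub>H\<^esub> q) \<odot>\<^bsub>H\<^esub> (x1 \<otimes>\<^bsub>H\<^esub> p)) \<otimes>\<^bsub>H\<^esub> m2))"
      by (rule comult_mult) (intro lin_intro | simp add: mm x)+
    also have "\<dots> = tlift K H (\<Delta> x) (\<lambda>x1 x2. tlift K H (\<Delta> (S m1)) (\<lambda>p q. ?g x1 x2 p q m2))"
      by (intro comult_cong[OF x] comult_cong[OF antipode_closed[OF mm(1)]])
         (intro lin_intro | simp add: mm mult_smult H.m_assoc)+
    finally show "l (x \<otimes>\<^bsub>H\<^esub> S m1) \<odot>\<^bsub>H\<^esub> m2 = \<dots>" .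
  qed (intro lin_intro | simp add: x)+
  also have "\<dots> = tlift K H (\<Delta> x) (\<lambda>x1 x2. tlift K H (\<Delta> m) (\<lambda>m1 m2. tlift K H (\<Delta> (S m1)) (\<lambda>p q. ?g x1 x2 p q m2)))"
    by (rule comult_swap[OF m x]) (intro lin_intro | simp)+
  also have "\<dots> = tlift K H (\<Delta> x) (\<lambda>a b. l (b \<otimes>\<^bsub>H\<^esub> S m) \<odot>\<^bsub>H\<^esub> a)"
  proof (rule comult_cong[OF x])
    fix x1 x2 assume xx: "x1 \<in> carrier H" "x2 \<in> carrier H"
    have "tlift K H (\<Delta> m) (\<lambda>m1 m2. tlift K H (\<Delta> (S m1)) (\<lambda>p q. ?g x1 x2 p q m2))
      = l (x2 \<otimes>\<^bsub>H\<^esub> S m) \<odot>\<^bsub>H\<^esub> (x1 \<otimes>\<^bsub>H\<^esub> \<one>\<^bsub>H\<^esub>)"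
      by (rule comult_antipode_cancel[where \<gamma> = "\<lambda>u v. l (x2 \<otimes>\<^bsub>H\<^esub> v) \<odot>\<^bsub>H\<^esub> (x1 \<otimes>\<^bsub>H\<^esub> u)"])
         (intro lin_intro | simp add: xx m)+
    then show "tlift K H (\<Delta> m) (\<lambda>m1 m2. tlift K H (\<Delta> (S m1)) (\<lambda>p q. ?g x1 x2 p q m2))
      = l (x2 \<otimes>\<^bsub>H\<^esub> S m) \<odot>\<^bsub>H\<^esub> x1" by (simp add: xx)
  qed (intro lin_intro | simp add: m)+
  finally show ?thesis by simp
qed

end

section \<open>Transport between records over the same space; modules, comodules and cotensor
  products\<close>

context linear_algebra
begin

text \<open>Bosonisation, inflation, restriction and the regular object all rebuild a record around
  an existing space. The records differ, often even in type, but linear algebra depends on these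
  four fields alone.\<close>

definition same_space :: "('k, 'v, 'y) module_scheme \<Rightarrow> ('k, 'v, 'z) module_scheme \<Rightarrow> bool" where
  "same_space V V' \<longleftrightarrow> carrier V' = carrier V \<and> add V' = add V \<and> zero V' = zero V \<and> smult V' = smult V"

lemma same_space_sym: "same_space V V' \<Longrightarrow> same_space V' V"
  by (simp add: same_space_def)

lemma vspace_same:
  assumes "same_space V V'" "vspace V"
  shows "vspace V'"
proof (rule vs_criteria)
  interpret V: vectorspace K V by fact
  note [simp] = assms(1)[unfolded same_space_def]
  show "field K" by (rule field_axioms)
  show "\<forall>v\<in>carrier V'. \<exists>neg_v\<in>carrier V'. v \<oplus>\<^bsub>V'\<^esub> neg_v = \<zero>\<^bsub>V'\<^esub>"
  proof
    fix v assume "v \<in> carrier V'"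
    then show "\<exists>neg_v\<in>carrier V'. v \<oplus>\<^bsub>V'\<^esub> neg_v = \<zero>\<^bsub>V'\<^esub>"
      by (intro bexI[of _ "\<ominus>\<^bsub>V\<^esub> v"]) (auto simp: V.r_neg)
  qed
  show "\<forall>v w. v \<in> carrier V' \<and> w \<in> carrier V' \<longrightarrow> v \<oplus>\<^bsub>V'\<^esub> w = w \<oplus>\<^bsub>V'\<^esub> v" by (simp add: V.a_comm)
  show "\<forall>v w x. v \<in> carrier V' \<and> w \<in> carrier V' \<and> x \<in> carrier V' \<longrightarrow>
     v \<oplus>\<^bsub>V'\<^esub> w \<oplus>\<^bsub>V'\<^esub> x = v \<oplus>\<^bsub>V'\<^esub> (w \<oplus>\<^bsub>V'\<^esub> x)" by (simp add: V.a_assoc)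
qed (simp_all add: assms(1)[unfolded same_space_def] vsD[OF assms(2)]
    module.smult_l_distr[OF vsD(2)[OF assms(2)]] module.smult_r_distr[OF vsD(2)[OF assms(2)]]
    module.smult_assoc1[OF vsD(2)[OF assms(2)]] module.smult_one[OF vsD(2)[OF assms(2)]]
    abelian_monoid.r_zero[OF abelian_group.axioms(1)[OF vsD(1)[OF assms(2)]]])

lemma lin_same:
  assumes "same_space V V'" "same_space W W'" "lin V W f"
  shows "lin V' W' f"
  using linD(3-5)[OF assms(3)] assms(1,2) vspace_same[OF assms(1) linD(1)[OF assms(3)]]
    vspace_same[OF assms(2) linD(2)[OF assms(3)]]
  by (intro linI) (auto simp: same_space_def)

lemma subspace_same:
  assumes "same_space V V'" "subspace K W V"
  shows "subspace K W V'"
  using assms(1) subspaceD[OF assms(2)] vspace_same[OF assms(1) subspaceD(1)[OF assms(2)]]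
  by (intro subspaceI) (auto simp: same_space_def)

text \<open>The definitions unfold to the same terms, so these are equalities and not isomorphisms:
  elements need no transport map between the two tensor products.\<close>

lemma tensor_same:
  assumes "same_space V V'" "same_space W W'"
  shows "tensor K V' W' = tensor K V W" "tens K V' W' = tens K V W" "subtensor K V' W' = subtensor K V W"
proof -
  have "tensor_rel K V' W' = tensor_rel K V W"
    using assms unfolding tensor_rel_def same_space_def by simp
  then show 1: "tensor K V' W' = tensor K V W" "tens K V' W' = tens K V W"
    using assms by (auto simp: tensor_def tens_def same_space_def fun_eq_iff)
  show "subtensor K V' W' = subtensor K V W" by (auto simp: subtensor_def 1 fun_eq_iff)
qed

lemma tlift_subspace:
  assumes t: "t \<in> carrier (V \<otimes>\<^sub>t W)" and V: "vspace V" and b: "bilin V W U \<beta>" and S: "subspace K S U"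
    and s: "\<And>x y. x \<in> carrier V \<Longrightarrow> y \<in> carrier W \<Longrightarrow> \<beta> x y \<in> S"
  shows "tlift K U t \<beta> \<in> S"
proof -
  note W = bilin_vs(1)[OF b V]
  have "t \<in> {t \<in> carrier (V \<otimes>\<^sub>t W). tlift K U t \<beta> \<in> S}"
    by (rule tensor_span[OF V W subspace_preimage[OF lin_tlift[OF V W b] S] _ t])
       (simp add: tlift_tens[OF V W b] s tens_closed[OF V W])
  then show ?thesis by simp
qed

lemma tlift_subtensor:
  assumes t: "t \<in> subtensor K V W A B" and V: "vspace V" and b: "bilin V W U \<beta>" and S: "subspace K S U"
    and AB: "A \<subseteq> carrier V" "B \<subseteq> carrier W"
    and s: "\<And>x y. x \<in> A \<Longrightarrow> y \<in> B \<Longrightarrow> \<beta> x y \<in> S"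
  shows "tlift K U t \<beta> \<in> S"
proof -
  note W = bilin_vs(1)[OF b V]
  have "subtensor K V W A B \<subseteq> {t \<in> carrier (V \<otimes>\<^sub>t W). tlift K U t \<beta> \<in> S}"
    by (rule subtensor_min[OF subspace_preimage[OF lin_tlift[OF V W b] S]])
       (use AB s in \<open>auto simp: tlift_tens[OF V W b] tens_closed[OF V W] subset_iff\<close>)
  with t show ?thesis by blast
qed

subsection \<open>Modules and comodules\<close>

lemma left_moduleD:
  assumes "left_module K C N"
  shows "vspace N" "h \<in> carrier C \<Longrightarrow> lin N N (lact N h)" "n \<in> carrier N \<Longrightarrow> lin C N (\<lambda>h. lact N h n)"
    "n \<in> carrier N \<Longrightarrow> lact N \<one>\<^bsub>C\<^esub> n = n"
    "g \<in> carrier C \<Longrightarrow> h \<in> carrier C \<Longrightarrow> n \<in> carrier N \<Longrightarrow> lact N (g \<otimes>\<^bsub>C\<^esub> h) n = lact N g (lact N h n)"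
    "h \<in> carrier C \<Longrightarrow> n \<in> carrier N \<Longrightarrow> lact N h n \<in> carrier N"
  using assms by (auto simp: left_module_def dest: linD(3))

lemma right_moduleD:
  assumes "right_module K C X"
  shows "vspace X" "h \<in> carrier C \<Longrightarrow> lin X X (\<lambda>x. ract X x h)" "x \<in> carrier X \<Longrightarrow> lin C X (ract X x)"
    "x \<in> carrier X \<Longrightarrow> ract X x \<one>\<^bsub>C\<^esub> = x"
    "g \<in> carrier C \<Longrightarrow> h \<in> carrier C \<Longrightarrow> x \<in> carrier X \<Longrightarrow> ract X x (g \<otimes>\<^bsub>C\<^esub> h) = ract X (ract X x g) h"
    "h \<in> carrier C \<Longrightarrow> x \<in> carrier X \<Longrightarrow> ract X x h \<in> carrier X"
  using assms by (auto simp: right_module_def dest: linD(3))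

lemma bilin_lact: "left_module K C N \<Longrightarrow> bilin C N N (lact N)"
  by (intro bilinI left_moduleD)

lemma bilin_ract: "right_module K C X \<Longrightarrow> bilin X C X (ract X)"
  by (intro bilinI right_moduleD)

lemma left_comoduleD:
  assumes "left_comodule K C N"
  shows "lin N (C \<otimes>\<^sub>t N) (lcoact N)" "vspace N" "n \<in> carrier N \<Longrightarrow> lcoact N n \<in> carrier (C \<otimes>\<^sub>t N)"
  using assms by (auto simp: left_comodule_def dest: linD)

lemma right_comoduleD:
  assumes "right_comodule K C X"
  shows "lin X (X \<otimes>\<^sub>t C) (rcoact X)" "vspace X" "x \<in> carrier X \<Longrightarrow> rcoact X x \<in> carrier (X \<otimes>\<^sub>t C)"
  using assms by (auto simp: right_comodule_def dest: linD)

text \<open>Stated for a record \<open>C\<close> with a linear comultiplication, so that it applies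
  to coactions over \<open>H\<close> and over the bosonisation alike.\<close>

lemma left_coassoc:
  assumes N: "left_comodule K C N" and C: "vspace C" "lin C (C \<otimes>\<^sub>t C) (comult C)"
    and \<gamma>: "trilin C C N U \<gamma>" and n: "n \<in> carrier N"
  shows "tlift K U (lcoact N n) (\<lambda>h m. tlift K U (comult C h) (\<lambda>h1 h2. \<gamma> h1 h2 m)) =
    tlift K U (lcoact N n) (\<lambda>h m. tlift K U (lcoact N m) (\<lambda>g m'. \<gamma> h g m'))"
  using trilift_left[OF C(1) C(1) left_comoduleD(2)[OF N] \<gamma> left_comoduleD(3)[OF N n] C(2)]
    trilift_right[OF C(1) C(1) left_comoduleD(2)[OF N] \<gamma> left_comoduleD(3)[OF N n] left_comoduleD(1)[OF N]] N n
  by (simp add: left_comodule_def)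

lemma right_coassoc:
  assumes X: "right_comodule K C X" and C: "vspace C" "lin C (C \<otimes>\<^sub>t C) (comult C)"
    and \<gamma>: "trilin X C C U \<gamma>" and x: "x \<in> carrier X"
  shows "tlift K U (rcoact X x) (\<lambda>y h. tlift K U (rcoact X y) (\<lambda>y' g. \<gamma> y' g h)) =
    tlift K U (rcoact X x) (\<lambda>y h. tlift K U (comult C h) (\<lambda>h1 h2. \<gamma> y h1 h2))"
  using trilift_left[OF right_comoduleD(2)[OF X] C(1) C(1) \<gamma> right_comoduleD(3)[OF X x] right_comoduleD(1)[OF X]]
    trilift_right[OF right_comoduleD(2)[OF X] C(1) C(1) \<gamma> right_comoduleD(3)[OF X x] C(2)] X x
  by (simp add: right_comodule_def)

lemma left_counit:
  assumes N: "left_comodule K C N" and C: "lin C (ground K) (counit C)" and f: "lin N U f" and n: "n \<in> carrier N"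
  shows "tlift K U (lcoact N n) (\<lambda>h m. counit C h \<odot>\<^bsub>U\<^esub> f m) = f n"
proof -
  note C' = linD(1)[OF C]
  have b: "bilin C N N (\<lambda>h m. counit C h \<odot>\<^bsub>N\<^esub> m)"
    by (intro lin_intro functional_closed[OF C] C left_comoduleD(2)[OF N])
  have b': "bilin C N U (\<lambda>h m. counit C h \<odot>\<^bsub>U\<^esub> f m)"
    by (intro lin_intro functional_closed[OF C] C f linD(2,3)[OF f])
  have "f (tlift K N (lcoact N n) (\<lambda>h m. counit C h \<odot>\<^bsub>N\<^esub> m)) = tlift K U (lcoact N n) (\<lambda>h m. f (counit C h \<odot>\<^bsub>N\<^esub> m))"
    by (rule lin_of_tlift[OF f left_comoduleD(3)[OF N n] C' b])
  also have "\<dots> = tlift K U (lcoact N n) (\<lambda>h m. counit C h \<odot>\<^bsub>U\<^esub> f m)"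
    by (rule tlift_cong[OF left_comoduleD(3)[OF N n] C' b']) (simp add: linD[OF f] functional_closed[OF C])
  finally show ?thesis using N n by (simp add: left_comodule_def)
qed

lemma cotensor_subspace:
  assumes X: "right_comodule K C X" and N: "left_comodule K C N" and C: "vspace C"
  shows "lin (X \<otimes>\<^sub>t N) (tensor3 K X C N)
      (\<lambda>t. tlift K (tensor3 K X C N) t (\<lambda>x n. tlift K (tensor3 K X C N) (rcoact X x) (\<lambda>x' h. tens3 K X C N x' h n)))"
      "lin (X \<otimes>\<^sub>t N) (tensor3 K X C N)
      (\<lambda>t. tlift K (tensor3 K X C N) t (\<lambda>x n. tlift K (tensor3 K X C N) (lcoact N n) (\<lambda>h n'. tens3 K X C N x h n')))"
    "subspace K (cotensor K C X N) (X \<otimes>\<^sub>t N)"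
proof -
  let ?T = "tensor3 K X C N"
  note vX = right_comoduleD(2)[OF X] and vN = left_comoduleD(2)[OF N]
  note T = trilin_tens3[OF vX C vN]
  note vT = trilin_vs[OF vX C vN T]
  show 1: "lin (X \<otimes>\<^sub>t N) ?T
      (\<lambda>t. tlift K ?T t (\<lambda>x n. tlift K ?T (rcoact X x) (\<lambda>x' h. tens3 K X C N x' h n)))"
    by (intro lin_tlift vX vN bilinI lin_tlift1[OF right_comoduleD(1)[OF X] vX]
        lin_tlift2[OF right_comoduleD(3)[OF X] vX C vN vT] trilinD[OF T])
  show 2: "lin (X \<otimes>\<^sub>t N) ?T
      (\<lambda>t. tlift K ?T t (\<lambda>x n. tlift K ?T (lcoact N n) (\<lambda>h n'. tens3 K X C N x h n')))"
    by (intro lin_tlift vX vN bilinI lin_tlift1[OF left_comoduleD(1)[OF N] C]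
        lin_tlift2[OF left_comoduleD(3)[OF N] C vN vX vT] trilinD[OF T])
  show "subspace K (cotensor K C X N) (X \<otimes>\<^sub>t N)"
    unfolding cotensor_def
    by (rule subspaceI) (auto simp: vs_tensor[OF vX vN] linD[OF 1] linD[OF 2] vsD[OF vs_tensor[OF vX vN]])
qed

lemma balanced_subspace:
  assumes X: "right_module K C X" and N: "left_module K C N"
  shows "subspace K (balanced_rel K C X N) (X \<otimes>\<^sub>t N)"
    "x \<in> carrier X \<Longrightarrow> h \<in> carrier C \<Longrightarrow> n \<in> carrier N \<Longrightarrow>
      tens K X N (ract X x h) n \<ominus>\<^bsub>X \<otimes>\<^sub>t N\<^esub> tens K X N x (lact N h n) \<in> balanced_rel K C X N"
proof -
  note vX = right_moduleD(1)[OF X] and vN = left_moduleD(1)[OF N]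
  let ?G = "{tens K X N (ract X x h) n \<ominus>\<^bsub>X \<otimes>\<^sub>t N\<^esub> tens K X N x (lact N h n) |x h n.
    x \<in> carrier X \<and> h \<in> carrier C \<and> n \<in> carrier N}"
  have G: "?G \<subseteq> carrier (X \<otimes>\<^sub>t N)"
    by (auto intro!: vsD(6)[OF vs_tensor[OF vX vN]] tens_closed[OF vX vN] right_moduleD(6)[OF X] left_moduleD(6)[OF N])
  show "subspace K (balanced_rel K C X N) (X \<otimes>\<^sub>t N)"
    unfolding balanced_rel_def by (rule span_subspace[OF vs_tensor[OF vX vN] G])
  show "tens K X N (ract X x h) n \<ominus>\<^bsub>X \<otimes>\<^sub>t N\<^esub> tens K X N x (lact N h n) \<in> balanced_rel K C X N"
    if "x \<in> carrier X" "h \<in> carrier C" "n \<in> carrier N"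
    unfolding balanced_rel_def by (rule span_incl[OF vs_tensor[OF vX vN] G]) (use that in blast)
qed

lemma balanced_min:
  assumes "subspace K S (X \<otimes>\<^sub>t N)"
    "\<And>x h n. x \<in> carrier X \<Longrightarrow> h \<in> carrier C \<Longrightarrow> n \<in> carrier N \<Longrightarrow>
      tens K X N (ract X x h) n \<ominus>\<^bsub>X \<otimes>\<^sub>t N\<^esub> tens K X N x (lact N h n) \<in> S"
  shows "balanced_rel K C X N \<subseteq> S"
  unfolding balanced_rel_def by (rule span_min[OF assms(1)]) (use assms(2) in blast)

end

section \<open>Integrals from semisimplicity, cointegrals from cosemisimplicity\<close>

context hopf
begin

text \<open>Split the augmentation ideal off the left regular module. The component u of 1 in the
  complement has counit 1, and h u - \<epsilon>(h) u lies both in the complement and in the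
  augmentation ideal, hence vanishes.\<close>

lemma integral_exists:
  assumes "semisimple K H"
  obtains L where "L \<in> carrier H" "\<epsilon> L = \<one>" "\<And>h. h \<in> carrier H \<Longrightarrow> h \<otimes>\<^bsub>H\<^esub> L = \<epsilon> h \<odot>\<^bsub>H\<^esub> L"
proof -
  interpret V: vectorspace K H by (rule vsH)
  let ?R = "regular H"
  have R: "same_space H ?R" by (simp add: same_space_def regular_def)
  let ?W = "{x \<in> carrier H. \<epsilon> x = \<zero>}"
  have W: "subspace K ?W ?R"
    using subspace_same[OF R subspace_kernel[OF hopfD(6)]] by (simp add: ground_def)
  have "left_submodule K H ?R ?W"
    using W by (auto simp: left_submodule_def regular_def counit_mult)
  then obtain U where U: "left_submodule K H ?R U" "?W \<inter> U = {\<zero>\<^bsub>?R\<^esub>}" "?W <+>\<^bsub>?R\<^esub> U = carrier ?R"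
    using assms unfolding semisimple_def semisimple_module_def by blast
  note su = subspaceD[OF conjunct1[OF U(1)[unfolded left_submodule_def]], unfolded regular_def, simplified]
  have "\<one>\<^bsub>H\<^esub> \<in> ?W <+>\<^bsub>?R\<^esub> U" unfolding U(3) by (simp add: regular_def)
  then obtain w u where wu: "w \<in> ?W" "u \<in> U" "\<one>\<^bsub>H\<^esub> = w \<oplus>\<^bsub>H\<^esub> u"
    by (auto simp: set_add_def' regular_def)
  have u: "u \<in> carrier H" using su(4)[OF wu(2)] .
  have "\<epsilon> (w \<oplus>\<^bsub>H\<^esub> u) = \<epsilon> w \<oplus> \<epsilon> u" using linD(4)[OF hopfD(6)] wu u by (simp add: ground_def)
  then have eu: "\<epsilon> u = \<one>" using wu u unfolding wu(3)[symmetric] by simp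
  show thesis
  proof (rule that[OF u eu])
    fix h assume h: "h \<in> carrier H"
    have hu: "h \<otimes>\<^bsub>H\<^esub> u \<in> U" using U(1) wu(2) h by (simp add: left_submodule_def regular_def)
    have eU: "\<epsilon> h \<odot>\<^bsub>H\<^esub> u \<in> U" using su(6)[OF counit_closed[OF h] wu(2)] .
    have d: "h \<otimes>\<^bsub>H\<^esub> u \<oplus>\<^bsub>H\<^esub> \<ominus> \<one> \<odot>\<^bsub>H\<^esub> (\<epsilon> h \<odot>\<^bsub>H\<^esub> u) \<in> U"
      by (rule su(5)[OF hu su(6)[OF _ eU]]) simp
    have "\<epsilon> (h \<otimes>\<^bsub>H\<^esub> u \<oplus>\<^bsub>H\<^esub> \<ominus> \<one> \<odot>\<^bsub>H\<^esub> (\<epsilon> h \<odot>\<^bsub>H\<^esub> u)) = \<zero>"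
      using linD(4,5)[OF hopfD(6)] h u eu by (simp add: ground_def counit_mult l_minus r_neg)
    then have "h \<otimes>\<^bsub>H\<^esub> u \<oplus>\<^bsub>H\<^esub> \<ominus> \<one> \<odot>\<^bsub>H\<^esub> (\<epsilon> h \<odot>\<^bsub>H\<^esub> u) \<in> ?W \<inter> U" using d h u by simp
    then have "h \<otimes>\<^bsub>H\<^esub> u \<oplus>\<^bsub>H\<^esub> \<ominus> \<one> \<odot>\<^bsub>H\<^esub> (\<epsilon> h \<odot>\<^bsub>H\<^esub> u) = \<zero>\<^bsub>H\<^esub>" unfolding U(2) by (simp add: regular_def)
    then have "h \<otimes>\<^bsub>H\<^esub> u \<ominus>\<^bsub>H\<^esub> (\<epsilon> h \<odot>\<^bsub>H\<^esub> u) = \<zero>\<^bsub>H\<^esub>" using h u by (simp add: V.smult_minus_1 a_minus_def)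
    then show "h \<otimes>\<^bsub>H\<^esub> u = \<epsilon> h \<odot>\<^bsub>H\<^esub> u" using h u by simp
  qed
qed

text \<open>Split the line spanned by 1 off the left regular comodule and let \<open>l\<close> be
  the projection to that line along the complement U. As \<Delta>(U) has second legs in U, both
  sides of the cointegral equation vanish on U, and they agree at 1.\<close>

lemma cointegral_exists:
  assumes "cosemisimple K H"
  obtains l where "functional H l" "l \<one>\<^bsub>H\<^esub> = \<one>"
    "\<And>h. h \<in> carrier H \<Longrightarrow> tlift K H (\<Delta> h) (\<lambda>a b. l b \<odot>\<^bsub>H\<^esub> a) = l h \<odot>\<^bsub>H\<^esub> \<one>\<^bsub>H\<^esub>"
proof -
  interpret V: vectorspace K H by (rule vsH)
  let ?R = "regular H"
  have R: "same_space H ?R" by (simp add: same_space_def regular_def)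
  note vR = vspace_same[OF R vsH]
  have sub_iff: "subtensor K H ?R = subtensor K H H"
    by (rule tensor_same(3)[OF _ R]) (simp add: same_space_def)
  note subs = subspace_same[OF same_space_sym[OF R]]
  let ?W = "{c \<odot>\<^bsub>H\<^esub> \<one>\<^bsub>H\<^esub> | c. c \<in> carrier K}"
  have W: "subspace K ?W ?R"
  proof (rule subspaceI[OF vR])
    show "?W \<subseteq> carrier ?R" by (auto simp: regular_def)
    show "\<zero>\<^bsub>?R\<^esub> \<in> ?W" by (auto simp: regular_def intro!: exI[of _ \<zero>])
    show "x \<oplus>\<^bsub>?R\<^esub> y \<in> ?W" if "x \<in> ?W" "y \<in> ?W" for x y
    proof -
      from that obtain c d where "x = c \<odot>\<^bsub>H\<^esub> \<one>\<^bsub>H\<^esub>" "y = d \<odot>\<^bsub>H\<^esub> \<one>\<^bsub>H\<^esub>" "c \<in> carrier K" "d \<in> carrier K" by auto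
      then show ?thesis by (auto simp: regular_def V.smult_l_distr intro!: exI[of _ "c \<oplus> d"])
    qed
    show "c \<odot>\<^bsub>?R\<^esub> x \<in> ?W" if "c \<in> carrier K" "x \<in> ?W" for c x
    proof -
      from that obtain d where "x = d \<odot>\<^bsub>H\<^esub> \<one>\<^bsub>H\<^esub>" "d \<in> carrier K" by auto
      then show ?thesis using that by (auto simp: regular_def V.smult_assoc1 intro!: exI[of _ "c \<otimes> d"])
    qed
  qed
  have "left_subcomodule K H ?R ?W"
    unfolding left_subcomodule_def sub_iff
  proof (intro conjI ballI W)
    fix w assume "w \<in> ?W"
    then obtain c where c: "c \<in> carrier K" "w = c \<odot>\<^bsub>H\<^esub> \<one>\<^bsub>H\<^esub>" by auto
    have "lcoact ?R w = tens K H H \<one>\<^bsub>H\<^esub> (c \<odot>\<^bsub>H\<^esub> \<one>\<^bsub>H\<^esub>)"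
      using c by (simp add: regular_def linD(5)[OF hopfD(5)] comult_one linD(5)[OF bilinD(1)[OF bilin_tens[OF vsH vsH]]])
    then show "lcoact ?R w \<in> subtensor K H H (carrier H) ?W"
      using c by (simp, intro subtensor_tens) auto
  qed
  then obtain U where U: "left_subcomodule K H ?R U" "?W \<inter> U = {\<zero>\<^bsub>?R\<^esub>}" "?W <+>\<^bsub>?R\<^esub> U = carrier ?R"
    using assms unfolding cosemisimple_def semisimple_comodule_def by blast
  have su: "subspace K U H" using U(1) subs by (simp add: left_subcomodule_def)
  \<comment> \<open>If 1 were in the complement, it would lie in the zero intersection with its own
    span, contradicting that its counit is 1.\<close>
  have one: "\<one>\<^bsub>H\<^esub> \<notin> U"
  proof
    assume "\<one>\<^bsub>H\<^esub> \<in> U"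
    moreover have "\<one>\<^bsub>H\<^esub> \<in> ?W" by (auto intro!: exI[of _ \<one>])
    ultimately have "\<one>\<^bsub>H\<^esub> = \<zero>\<^bsub>H\<^esub>" using U(2) by (auto simp: regular_def)
    then have "\<epsilon> \<one>\<^bsub>H\<^esub> = \<zero>" using linD(6)[OF hopfD(6)] by (simp add: ground_def)
    then show False by simp
  qed
  obtain l where l: "functional H l" "\<And>u. u \<in> U \<Longrightarrow> l u = \<zero>" "l \<one>\<^bsub>H\<^esub> = \<one>"
    by (rule separating_functional[OF su H.one_closed one]) blast
  note [lin_intro] = lin_comp[OF l(1)]
  have [simp]: "l z \<in> carrier K" if "z \<in> carrier H" for z by (rule functional_closed[OF l(1) that])
  have b: "bilin H H H (\<lambda>a b. l b \<odot>\<^bsub>H\<^esub> a)" by (intro lin_intro | simp)+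
  have f: "lin H H (\<lambda>h. tlift K H (\<Delta> h) (\<lambda>a b. l b \<odot>\<^bsub>H\<^esub> a))" by (intro lin_intro | simp)+
  have g: "lin H H (\<lambda>h. l h \<odot>\<^bsub>H\<^esub> \<one>\<^bsub>H\<^esub>)" by (intro lin_intro | simp)+
  show thesis
  proof (rule that[OF l(1,3)])
    fix h assume "h \<in> carrier H"
    then have "h \<in> ?W <+>\<^bsub>?R\<^esub> U" unfolding U(3) by (simp add: regular_def)
    then obtain c u where cu: "c \<in> carrier K" "u \<in> U" "h = c \<odot>\<^bsub>H\<^esub> \<one>\<^bsub>H\<^esub> \<oplus>\<^bsub>H\<^esub> u"
      by (auto simp: set_add_def' regular_def)
    have u: "u \<in> carrier H" by (rule subspaceD(4)[OF su cu(2)])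
    have "\<Delta> u \<in> subtensor K H H (carrier H) U"
      using U(1) cu(2) by (simp add: left_subcomodule_def sub_iff) (simp add: regular_def)
    then have "tlift K H (\<Delta> u) (\<lambda>a b. l b \<odot>\<^bsub>H\<^esub> a) \<in> {\<zero>\<^bsub>H\<^esub>}"
      by (rule tlift_subtensor[OF _ vsH b vs_zero_subspace[OF vsH]]) (auto simp: l subspaceD[OF su])
    then show "tlift K H (\<Delta> h) (\<lambda>a b. l b \<odot>\<^bsub>H\<^esub> a) = l h \<odot>\<^bsub>H\<^esub> \<one>\<^bsub>H\<^esub>"
      using cu u l by (simp add: linD(4,5)[OF f] linD(4,5)[OF g] comult_one tlift_HH[OF b])
  qed
qed

end

context linear_algebra
begin

lemma lcoact_lin:
  assumes N: "left_comodule K C N" and C: "vspace C"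
  shows "lin Z N g \<Longrightarrow> bilin C N U \<beta> \<Longrightarrow> lin Z U (\<lambda>z. tlift K U (lcoact N (g z)) \<beta>)"
    "n \<in> carrier N \<Longrightarrow> vspace Z \<Longrightarrow> vspace U \<Longrightarrow> (\<And>z. z \<in> carrier Z \<Longrightarrow> bilin C N U (\<lambda>a b. \<beta>' z a b)) \<Longrightarrow>
      (\<And>x y. x \<in> carrier C \<Longrightarrow> y \<in> carrier N \<Longrightarrow> lin Z U (\<lambda>z. \<beta>' z x y)) \<Longrightarrow>
      lin Z U (\<lambda>z. tlift K U (lcoact N n) (\<lambda>a b. \<beta>' z a b))"
    "n \<in> carrier N \<Longrightarrow> bilin C N U \<beta> \<Longrightarrow> tlift K U (lcoact N n) \<beta> \<in> carrier U"
  by (rule lin_tlift1[OF lin_comp[OF left_comoduleD(1)[OF N]] C]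
    lin_tlift2[OF left_comoduleD(3)[OF N] C left_comoduleD(2)[OF N]]
    tlift_closed[OF left_comoduleD(3)[OF N] C]; assumption)+

lemma rcoact_lin:
  assumes X: "right_comodule K C X" and C: "vspace C"
  shows "lin Z X g \<Longrightarrow> bilin X C U \<beta> \<Longrightarrow> lin Z U (\<lambda>z. tlift K U (rcoact X (g z)) \<beta>)"
    "n \<in> carrier X \<Longrightarrow> vspace Z \<Longrightarrow> vspace U \<Longrightarrow> (\<And>z. z \<in> carrier Z \<Longrightarrow> bilin X C U (\<lambda>a b. \<beta>' z a b)) \<Longrightarrow>
      (\<And>x y. x \<in> carrier X \<Longrightarrow> y \<in> carrier C \<Longrightarrow> lin Z U (\<lambda>z. \<beta>' z x y)) \<Longrightarrow>
      lin Z U (\<lambda>z. tlift K U (rcoact X n) (\<lambda>a b. \<beta>' z a b))"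
    "n \<in> carrier X \<Longrightarrow> bilin X C U \<beta> \<Longrightarrow> tlift K U (rcoact X n) \<beta> \<in> carrier U"
  by (rule lin_tlift1[OF lin_comp[OF right_comoduleD(1)[OF X]] right_comoduleD(2)[OF X]]
    lin_tlift2[OF right_comoduleD(3)[OF X] right_comoduleD(2)[OF X] C]
    tlift_closed[OF right_comoduleD(3)[OF X] right_comoduleD(2)[OF X]]; assumption)+

lemma cotensor_tens:
  assumes X: "right_comodule K C X" and N: "left_comodule K C N" and C: "vspace C"
    and x: "x \<in> carrier X" and n: "n \<in> carrier N"
  shows "tlift K (tensor3 K X C N) (tens K X N x n) (\<lambda>x n. tlift K (tensor3 K X C N) (rcoact X x) (\<lambda>x' h. tens3 K X C N x' h n))
      = tlift K (tensor3 K X C N) (rcoact X x) (\<lambda>x' h. tens3 K X C N x' h n)"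
    "tlift K (tensor3 K X C N) (tens K X N x n) (\<lambda>x n. tlift K (tensor3 K X C N) (lcoact N n) (\<lambda>h n'. tens3 K X C N x h n'))
      = tlift K (tensor3 K X C N) (lcoact N n) (\<lambda>h n'. tens3 K X C N x h n')"
proof -
  note vX = right_comoduleD(2)[OF X] and vN = left_comoduleD(2)[OF N]
  note T = trilin_tens3[OF vX C vN]
  note vT = trilin_vs[OF vX C vN T]
  show "tlift K (tensor3 K X C N) (tens K X N x n) (\<lambda>x n. tlift K (tensor3 K X C N) (rcoact X x) (\<lambda>x' h. tens3 K X C N x' h n))
      = tlift K (tensor3 K X C N) (rcoact X x) (\<lambda>x' h. tens3 K X C N x' h n)"
    by (rule tlift_tens[OF vX vN _ x n])
      (intro vX vN vT bilinI rcoact_lin[OF X C] lin_id trilinD[OF T]; assumption)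
  show "tlift K (tensor3 K X C N) (tens K X N x n) (\<lambda>x n. tlift K (tensor3 K X C N) (lcoact N n) (\<lambda>h n'. tens3 K X C N x h n'))
      = tlift K (tensor3 K X C N) (lcoact N n) (\<lambda>h n'. tens3 K X C N x h n')"
    by (rule tlift_tens[OF vX vN _ x n])
      (intro vX vN vT bilinI lcoact_lin[OF N C] lin_id trilinD[OF T]; assumption)
qed

end

context hopf
begin

subsection \<open>Averaging over an integral\<close>

definition average ::
  "'h \<Rightarrow> ('k, 'h, 'x, 'y) rmodcomod_scheme \<Rightarrow> ('k, 'h, 'n, 'z) lmodcomod_scheme
    \<Rightarrow> ('x \<times> 'n \<Rightarrow> 'k) set \<Rightarrow> ('x \<times> 'n \<Rightarrow> 'k) set" where
  "average L X N t = tlift K (X \<otimes>\<^sub>t N) t (\<lambda>x n.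
     tlift K (X \<otimes>\<^sub>t N) (\<Delta> L) (\<lambda>a b. tens K X N (ract X x a) (lact N (S b) n)))"

lemma average_tens:
  assumes X: "right_module K H X" and N: "left_module K H N" and L: "L \<in> carrier H"
  shows "lin (X \<otimes>\<^sub>t N) (X \<otimes>\<^sub>t N) (average L X N)"
    "x \<in> carrier X \<Longrightarrow> n \<in> carrier N \<Longrightarrow> average L X N (tens K X N x n) =
      tlift K (X \<otimes>\<^sub>t N) (\<Delta> L) (\<lambda>a b. tens K X N (ract X x a) (lact N (S b) n))"
proof -
  note [lin_intro] = lin_bilin1[OF bilin_ract[OF X]] lin_bilin2[OF bilin_ract[OF X]]
    lin_bilin1[OF bilin_lact[OF N]] lin_bilin2[OF bilin_lact[OF N]]
  note [simp] = right_moduleD(1,6)[OF X] left_moduleD(1,6)[OF N] vs_tensor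
  have b: "bilin X N (X \<otimes>\<^sub>t N) (\<lambda>x n. tlift K (X \<otimes>\<^sub>t N) (\<Delta> L) (\<lambda>a b. tens K X N (ract X x a) (lact N (S b) n)))"
    by (intro lin_intro | simp add: L)+
  show "lin (X \<otimes>\<^sub>t N) (X \<otimes>\<^sub>t N) (average L X N)"
    unfolding average_def by (rule lin_tlift[OF _ _ b]) simp_all
  show "average L X N (tens K X N x n) =
      tlift K (X \<otimes>\<^sub>t N) (\<Delta> L) (\<lambda>a b. tens K X N (ract X x a) (lact N (S b) n))"
    if "x \<in> carrier X" "n \<in> carrier N"
    unfolding average_def using that by (simp add: tlift_tens[OF _ _ b])
qed

text \<open>Moving h across the tensor sign is moving it from the left of L1 to the right of S(L2),
  which is \<open>integral_comult\<close>.\<close>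

lemma average_balanced:
  assumes X: "right_module K H X" and N: "left_module K H N"
    and L: "L \<in> carrier H" "\<And>h. h \<in> carrier H \<Longrightarrow> h \<otimes>\<^bsub>H\<^esub> L = \<epsilon> h \<odot>\<^bsub>H\<^esub> L"
    and x: "x \<in> carrier X" and h: "h \<in> carrier H" and n: "n \<in> carrier N"
  shows "average L X N (tens K X N (ract X x h) n) = average L X N (tens K X N x (lact N h n))"
proof -
  note [lin_intro] = lin_bilin1[OF bilin_ract[OF X]] lin_bilin2[OF bilin_ract[OF X]]
    lin_bilin1[OF bilin_lact[OF N]] lin_bilin2[OF bilin_lact[OF N]]
  note [simp] = right_moduleD(1,6)[OF X] left_moduleD(1,6)[OF N] vs_tensor
  have "average L X N (tens K X N (ract X x h) n)
    = tlift K (X \<otimes>\<^sub>t N) (\<Delta> L) (\<lambda>a b. tens K X N (ract X (ract X x h) a) (lact N (S b) n))"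
    using x h n by (simp add: average_tens(2)[OF X N L(1)])
  also have "\<dots> = tlift K (X \<otimes>\<^sub>t N) (\<Delta> L) (\<lambda>a b. tens K X N (ract X x (h \<otimes>\<^bsub>H\<^esub> a)) (lact N (S b) n))"
    by (rule comult_cong[OF L(1)]) (intro lin_intro | simp add: x h n right_moduleD(5)[OF X])+
  also have "\<dots> = tlift K (X \<otimes>\<^sub>t N) (\<Delta> L) (\<lambda>a b. tens K X N (ract X x a) (lact N (S b \<otimes>\<^bsub>H\<^esub> h) n))"
    by (rule integral_comult[OF L _ h]) (intro lin_intro | simp add: x h n)+
  also have "\<dots> = tlift K (X \<otimes>\<^sub>t N) (\<Delta> L) (\<lambda>a b. tens K X N (ract X x a) (lact N (S b) (lact N h n)))"
    by (rule comult_cong[OF L(1)]) (intro lin_intro | simp add: x h n left_moduleD(5)[OF N])+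
  also have "\<dots> = average L X N (tens K X N x (lact N h n))"
    using x h n by (simp add: average_tens(2)[OF X N L(1)])
  finally show ?thesis .
qed

text \<open>Modulo the balancing relations x L1 \<otimes> S(L2) n becomes x \<otimes> L1 S(L2) n,
  which is \<epsilon>(L) x \<otimes> n; this is where the normalisation of \<open>L\<close> enters.
  Consequently a tensor with zero average is itself balanced.\<close>

lemma average_congruent:
  assumes X: "right_module K H X" and N: "left_module K H N"
    and L: "L \<in> carrier H" "\<epsilon> L = \<one>" and t: "t \<in> carrier (X \<otimes>\<^sub>t N)"
  shows "average L X N t \<ominus>\<^bsub>X \<otimes>\<^sub>t N\<^esub> t \<in> balanced_rel K H X N"
proof -
  note [lin_intro] = lin_bilin1[OF bilin_ract[OF X]] lin_bilin2[OF bilin_ract[OF X]]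
    lin_bilin1[OF bilin_lact[OF N]] lin_bilin2[OF bilin_lact[OF N]]
  note [simp] = right_moduleD(1,6)[OF X] left_moduleD(1,6)[OF N] vs_tensor
  let ?Q = "quotient_space (X \<otimes>\<^sub>t N) (balanced_rel K H X N)"
  let ?q = "\<lambda>t. balanced_rel K H X N +>\<^bsub>X \<otimes>\<^sub>t N\<^esub> t"
  note B = balanced_subspace(1)[OF X N]
  note q = lin_coset[OF B]
  note l = average_tens(1)[OF X N L(1)]
  have "?q (average L X N t) = ?q t"
  proof (rule tensor_ext[OF _ _ lin_comp[OF q l] q _ t])
    fix x n assume xn: "x \<in> carrier X" "n \<in> carrier N"
    have lx: "lin N ?Q (\<lambda>m. ?q (tens K X N x m))" by (intro lin_comp[OF q] lin_intro | simp add: xn)+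
    have lx': "lin H ?Q (\<lambda>h. ?q (tens K X N x (lact N h n)))" by (intro lin_comp[OF q] lin_intro | simp add: xn)+
    interpret Q: vectorspace K ?Q by (rule vs_quotient[OF B])
    have "?q (average L X N (tens K X N x n)) =
      tlift K ?Q (\<Delta> L) (\<lambda>a b. ?q (tens K X N (ract X x a) (lact N (S b) n)))"
      unfolding average_tens(2)[OF X N L(1) xn]
      by (rule comult_apply[OF q L(1)]) (intro lin_intro | simp add: xn)+
    also have "\<dots> = tlift K ?Q (\<Delta> L) (\<lambda>a b. ?q (tens K X N x (lact N (a \<otimes>\<^bsub>H\<^esub> S b) n)))"
    proof (rule comult_cong[OF L(1)])
      fix a b assume ab: "a \<in> carrier H" "b \<in> carrier H"
      then show "?q (tens K X N (ract X x a) (lact N (S b) n)) = ?q (tens K X N x (lact N (a \<otimes>\<^bsub>H\<^esub> S b) n))"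
        using xn balanced_subspace(2)[OF X N xn(1) ab(1), of "lact N (S b) n"]
        by (simp add: left_moduleD(5)[OF N] coset_eq_iff[OF B] tens_closed)
    qed (intro lin_comp[OF q] lin_intro | simp add: xn)+
    also have "\<dots> = \<epsilon> L \<odot>\<^bsub>?Q\<^esub> ?q (tens K X N x (lact N \<one>\<^bsub>H\<^esub> n))"
      by (rule antipode_right[OF lx' L(1)])
    also have "\<dots> = ?q (tens K X N x n)"
      using linD(3)[OF lx xn(2)] by (simp add: L(2) xn left_moduleD(4)[OF N])
    finally show "?q (average L X N (tens K X N x n)) = ?q (tens K X N x n)" .
  qed simp_all
  then show ?thesis using linD(3)[OF l t] t coset_eq_iff[OF B] by simp
qed

text \<open>The operator touches the second leg only through the action of \<open>H\<close>, so it
  commutes with module maps. This links the averages on coinvariants, on the restriction of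
  \<open>N\<close> and on the subquotient.\<close>

lemma average_natural:
  assumes X: "right_module K H X" and N: "left_module K H N" and N': "left_module K H N'"
    and L: "L \<in> carrier H" and f: "lin N N' f"
    and fl: "\<And>h n. h \<in> carrier H \<Longrightarrow> n \<in> carrier N \<Longrightarrow> f (lact N h n) = lact N' h (f n)"
    and t: "t \<in> carrier (X \<otimes>\<^sub>t N)"
  shows "average L X N' (tmap X N' (\<lambda>x. x) f t) = tmap X N' (\<lambda>x. x) f (average L X N t)"
proof -
  note [lin_intro] = lin_bilin1[OF bilin_ract[OF X]] lin_bilin2[OF bilin_ract[OF X]]
    lin_bilin1[OF bilin_lact[OF N]] lin_bilin2[OF bilin_lact[OF N]]
    lin_bilin1[OF bilin_lact[OF N']] lin_bilin2[OF bilin_lact[OF N']]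
  note [simp] = right_moduleD(1,6)[OF X] left_moduleD(1,6)[OF N] left_moduleD(1,6)[OF N'] vs_tensor linD(3)[OF f]
  note l = lin_tmap[OF lin_id f, of X, simplified]
  note lt = tmap_tens[OF lin_id f, of X, simplified]
  show ?thesis
  proof (rule tensor_ext[OF _ _ lin_comp[OF average_tens(1)[OF X N' L] l] lin_comp[OF l average_tens(1)[OF X N L]] _ t])
    fix x n assume xn: "x \<in> carrier X" "n \<in> carrier N"
    have "tmap X N' (\<lambda>x. x) f (average L X N (tens K X N x n))
      = tlift K (X \<otimes>\<^sub>t N') (\<Delta> L) (\<lambda>a b. tmap X N' (\<lambda>x. x) f (tens K X N (ract X x a) (lact N (S b) n)))"
      unfolding average_tens(2)[OF X N L xn]
      by (rule comult_apply[OF l L]) (intro lin_intro | simp add: xn)+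
    also have "\<dots> = tlift K (X \<otimes>\<^sub>t N') (\<Delta> L) (\<lambda>a b. tens K X N' (ract X x a) (lact N' (S b) (f n)))"
      by (rule comult_cong[OF L]) (intro lin_intro | simp add: xn lt fl)+
    finally show "average L X N' (tmap X N' (\<lambda>x. x) f (tens K X N x n))
      = tmap X N' (\<lambda>x. x) f (average L X N (tens K X N x n))"
      using xn by (simp add: lt average_tens(2)[OF X N' L])
  qed simp_all
qed

subsection \<open>Projecting onto the cotensor product\<close>

definition coaverage ::
  "('h \<Rightarrow> 'k) \<Rightarrow> ('k, 'h, 'x, 'y) rmodcomod_scheme \<Rightarrow> ('k, 'h, 'n, 'z) lmodcomod_scheme
    \<Rightarrow> ('x \<times> 'n \<Rightarrow> 'k) set \<Rightarrow> ('x \<times> 'n \<Rightarrow> 'k) set" where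
  "coaverage l X N t = tlift K (X \<otimes>\<^sub>t N) t (\<lambda>x n.
     tlift K (X \<otimes>\<^sub>t N) (rcoact X x) (\<lambda>x0 x1. tlift K (X \<otimes>\<^sub>t N) (lcoact N n) (\<lambda>m n0.
       l (x1 \<otimes>\<^bsub>H\<^esub> S m) \<odot>\<^bsub>X \<otimes>\<^sub>t N\<^esub> tens K X N x0 n0)))"

context
  fixes l :: "'h \<Rightarrow> 'k"
  assumes l: "functional H l" "l \<one>\<^bsub>H\<^esub> = \<one>"
    "\<And>h. h \<in> carrier H \<Longrightarrow> tlift K H (\<Delta> h) (\<lambda>a b. l b \<odot>\<^bsub>H\<^esub> a) = l h \<odot>\<^bsub>H\<^esub> \<one>\<^bsub>H\<^esub>"
begin

context
  fixes X :: "('k, 'h, 'x, 'y) rmodcomod_scheme" and N :: "('k, 'h, 'n, 'z) lmodcomod_scheme"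
  assumes X: "right_comodule K H X" and N: "left_comodule K H N"
begin

lemmas coaverage_intro = lin_comp[OF l(1)] lcoact_lin[OF N vsH] rcoact_lin[OF X vsH]
lemmas coaverage_simps = left_comoduleD(2,3)[OF N] right_comoduleD(2,3)[OF X] functional_closed[OF l(1)]

lemma coaverage_bilin:
  "bilin X N (X \<otimes>\<^sub>t N) (\<lambda>x n.
     tlift K (X \<otimes>\<^sub>t N) (rcoact X x) (\<lambda>x0 x1. tlift K (X \<otimes>\<^sub>t N) (lcoact N n) (\<lambda>m n0.
       l (x1 \<otimes>\<^bsub>H\<^esub> S m) \<odot>\<^bsub>X \<otimes>\<^sub>t N\<^esub> tens K X N x0 n0)))"
  by (intro lin_intro coaverage_intro | simp add: coaverage_simps vs_tensor tens_closed vsD(5))+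

lemma coaverage_lin: "lin (X \<otimes>\<^sub>t N) (X \<otimes>\<^sub>t N) (coaverage l X N)"
  unfolding coaverage_def by (rule lin_tlift[OF _ _ coaverage_bilin]) (simp_all add: coaverage_simps)

lemma coaverage_tens:
  "x \<in> carrier X \<Longrightarrow> n \<in> carrier N \<Longrightarrow> coaverage l X N (tens K X N x n) =
     tlift K (X \<otimes>\<^sub>t N) (rcoact X x) (\<lambda>x0 x1. tlift K (X \<otimes>\<^sub>t N) (lcoact N n) (\<lambda>m n0.
       l (x1 \<otimes>\<^bsub>H\<^esub> S m) \<odot>\<^bsub>X \<otimes>\<^sub>t N\<^esub> tens K X N x0 n0))"
  unfolding coaverage_def
  by (rule tlift_tens[OF _ _ coaverage_bilin]) (simp_all add: coaverage_simps)

text \<open>On a cotensor the leg x1 may be replaced by a further leg of n, so that \<open>l\<close>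
  is applied to n_{-2} S(n_{-1}); the antipode axiom reduces this to the value of \<open>l\<close>
  at 1, which is 1 by normalisation.\<close>

lemma coaverage_cotensor_id:
  assumes t: "t \<in> cotensor K H X N"
  shows "coaverage l X N t = t"
proof -
  let ?U = "X \<otimes>\<^sub>t N"
  note vX = right_comoduleD(2)[OF X] and vN = left_comoduleD(2)[OF N]
  note [lin_intro] = coaverage_intro
  note [simp] = coaverage_simps vs_tensor tens_closed vsD(5)
  interpret U: vectorspace K ?U by simp
  \<comment> \<open>The trilinear map to which the cotensor equation is applied: coaveraging with
    the leg x1 as a free argument.\<close>
  let ?g = "\<lambda>x h n. tlift K ?U (lcoact N n) (\<lambda>m n0. l (h \<otimes>\<^bsub>H\<^esub> S m) \<odot>\<^bsub>?U\<^esub> tens K X N x n0)"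
  have g: "trilin X H N ?U ?g" by (intro lin_intro | simp)+
  have t': "t \<in> carrier ?U"
    and eq: "tlift K (tensor3 K X H N) t (\<lambda>x n. tlift K (tensor3 K X H N) (rcoact X x) (\<lambda>x' h. tens3 K X H N x' h n)) =
      tlift K (tensor3 K X H N) t (\<lambda>x n. tlift K (tensor3 K X H N) (lcoact N n) (\<lambda>h n'. tens3 K X H N x h n'))"
    using t by (auto simp: cotensor_def)
  have "coaverage l X N t = tlift K ?U t (\<lambda>x n. tlift K ?U (rcoact X x) (\<lambda>x' h. ?g x' h n))"
    by (simp add: coaverage_def)
  also have "\<dots> = tlift K ?U t (\<lambda>x n. tlift K ?U (lcoact N n) (\<lambda>h n'. ?g x h n'))"
    using trilift_left[OF vX vsH vN g t' right_comoduleD(1)[OF X]]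
      trilift_right[OF vX vsH vN g t' left_comoduleD(1)[OF N]] eq by simp
  also have "\<dots> = tlift K ?U t (tens K X N)"
  proof (rule tlift_cong[OF t' vX bilin_tens[OF vX vN]])
    fix x n assume xn: "x \<in> carrier X" "n \<in> carrier N"
    have "tlift K ?U (lcoact N n) (\<lambda>h n'. ?g x h n')
      = tlift K ?U (lcoact N n) (\<lambda>h m. tlift K ?U (\<Delta> h) (\<lambda>h1 h2. l (h1 \<otimes>\<^bsub>H\<^esub> S h2) \<odot>\<^bsub>?U\<^esub> tens K X N x m))"
      by (rule left_coassoc[OF N vsH hopfD(5) _ xn(2), symmetric]) (intro lin_intro | simp add: xn)+
    also have "\<dots> = tlift K ?U (lcoact N n) (\<lambda>h m. \<epsilon> h \<odot>\<^bsub>?U\<^esub> tens K X N x m)"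
    proof (rule tlift_cong[OF left_comoduleD(3)[OF N xn(2)] vsH])
      fix h m assume hm: "h \<in> carrier H" "m \<in> carrier N"
      have "tlift K ?U (\<Delta> h) (\<lambda>h1 h2. l (h1 \<otimes>\<^bsub>H\<^esub> S h2) \<odot>\<^bsub>?U\<^esub> tens K X N x m)
        = \<epsilon> h \<odot>\<^bsub>?U\<^esub> (l \<one>\<^bsub>H\<^esub> \<odot>\<^bsub>?U\<^esub> tens K X N x m)"
        by (rule antipode_right[where f = "\<lambda>z. l z \<odot>\<^bsub>?U\<^esub> tens K X N x m"]) (intro lin_intro | simp add: xn hm)+
      then show "tlift K ?U (\<Delta> h) (\<lambda>h1 h2. l (h1 \<otimes>\<^bsub>H\<^esub> S h2) \<odot>\<^bsub>?U\<^esub> tens K X N x m) = \<epsilon> h \<odot>\<^bsub>?U\<^esub> tens K X N x m"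
        using xn hm by (simp add: l(2))
    qed (intro lin_intro | simp add: xn)+
    also have "\<dots> = tens K X N x n"
      by (rule left_counit[OF N hopfD(6) _ xn(2)]) (intro lin_intro | simp add: xn)+
    finally show "tlift K ?U (lcoact N n) (\<lambda>h n'. ?g x h n') = tens K X N x n" .
  qed
  also have "\<dots> = t" by (rule tlift_tens_id[OF vX vN t'])
  finally show ?thesis .
qed

text \<open>Comparing the two coactions on x0 \<otimes> l(x1 S(n_{-1})) n0 leaves, in the middle
  leg, x1 l(x2 S(m)) on one side and l(x1 S(m1)) m2 on the other, with m = n_{-1}. These agree by
  \<open>cointegral_comult\<close>.\<close>

lemma coaverage_in_cotensor:
  assumes t: "t \<in> carrier (X \<otimes>\<^sub>t N)"
  shows "coaverage l X N t \<in> cotensor K H X N"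
proof -
  let ?U = "X \<otimes>\<^sub>t N" and ?T = "tensor3 K X H N" and ?t = "tens3 K X H N"
  note vX = right_comoduleD(2)[OF X] and vN = left_comoduleD(2)[OF N]
  note T = trilin_tens3[OF vX vsH vN]
  have vT: "vspace ?T" by (rule trilin_vs[OF vX vsH vN T])
  have lT1: "lin X ?T (\<lambda>z. ?t z b c)" if "b \<in> carrier H" "c \<in> carrier N" for b c
    by (rule trilinD(2)[OF T that])
  have lT2: "lin H ?T (\<lambda>z. ?t a z c)" if "a \<in> carrier X" "c \<in> carrier N" for a c
    by (rule trilinD(3)[OF T that])
  have lT3: "lin N ?T (\<lambda>z. ?t a b z)" if "a \<in> carrier X" "b \<in> carrier H" for a b
    by (rule trilinD(4)[OF T that])
  have cT: "?t a b c \<in> carrier ?T" if "a \<in> carrier X" "b \<in> carrier H" "c \<in> carrier N" for a b c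
    by (rule linD(3)[OF lT1[OF that(2,3)] that(1)])
  note [lin_intro] = coaverage_intro lT1 lT2 lT3
  note [simp] = coaverage_simps vs_tensor tens_closed vsD(5) vT cT
  let ?L = "\<lambda>t. tlift K ?T t (\<lambda>x n. tlift K ?T (rcoact X x) (\<lambda>x' h. ?t x' h n))"
  let ?R = "\<lambda>t. tlift K ?T t (\<lambda>x n. tlift K ?T (lcoact N n) (\<lambda>h n'. ?t x h n'))"
  note L = cotensor_subspace(1)[OF X N vsH] and R = cotensor_subspace(2)[OF X N vsH]
  have "?L (coaverage l X N t) = ?R (coaverage l X N t)"
  proof (rule tensor_ext[OF vX vN lin_comp[OF L coaverage_lin] lin_comp[OF R coaverage_lin] _ t])
    fix x n assume xn: "x \<in> carrier X" "n \<in> carrier N"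
    note rx = right_comoduleD(3)[OF X xn(1)] and dn = left_comoduleD(3)[OF N xn(2)]
    let ?c = "\<lambda>x1 m. l (x1 \<otimes>\<^bsub>H\<^esub> S m)"
    \<comment> \<open>The common form of both sides: x0 \<otimes> m2 \<otimes> n0 weighted by l(x1
      S(m1)), with m1 and m2 the legs of m = n_{-1}.\<close>
    let ?M = "tlift K ?T (lcoact N n) (\<lambda>m n0. tlift K ?T (rcoact X x) (\<lambda>x0 x1.
      tlift K ?T (\<Delta> m) (\<lambda>m1 m2. ?c x1 m1 \<odot>\<^bsub>?T\<^esub> ?t x0 m2 n0)))"
    \<comment> \<open>Evaluates a linear map after coaveraging from its values on pure tensors. It
      is used for both coactions, once with each of the two sides of the cotensor condition as
      \<open>F\<close>.\<close>
    have push: "F (coaverage l X N (tens K X N x n)) = tlift K ?T (rcoact X x) (\<lambda>x0 x1. tlift K ?T (lcoact N n) (\<lambda>m n0.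
        ?c x1 m \<odot>\<^bsub>?T\<^esub> G x0 n0))"
      if F: "lin ?U ?T F" and G: "\<And>x n. x \<in> carrier X \<Longrightarrow> n \<in> carrier N \<Longrightarrow> F (tens K X N x n) = G x n" for F G
    proof -
      have G1: "lin X ?T (\<lambda>x. G x n)" if "n \<in> carrier N" for n
        by (rule lin_cong[of _ _ "\<lambda>x. F (tens K X N x n)"]) (intro lin_comp[OF F] lin_intro | simp add: that G)+
      have G2: "lin N ?T (\<lambda>n. G x n)" if "x \<in> carrier X" for x
        by (rule lin_cong[of _ _ "\<lambda>n. F (tens K X N x n)"]) (intro lin_comp[OF F] lin_intro | simp add: that G)+
      have [simp]: "G a b \<in> carrier ?T" if "a \<in> carrier X" "b \<in> carrier N" for a b
        using linD(3)[OF G1] that by simp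
      note [lin_intro] = G1 G2
      have "F (coaverage l X N (tens K X N x n)) = tlift K ?T (rcoact X x) (\<lambda>x0 x1.
          F (tlift K ?U (lcoact N n) (\<lambda>m n0. ?c x1 m \<odot>\<^bsub>?U\<^esub> tens K X N x0 n0)))"
        unfolding coaverage_tens[OF xn] by (rule lin_of_tlift[OF F rx vX]) (intro lin_intro | simp add: xn)+
      also have "\<dots> = tlift K ?T (rcoact X x) (\<lambda>x0 x1. tlift K ?T (lcoact N n) (\<lambda>m n0. ?c x1 m \<odot>\<^bsub>?T\<^esub> G x0 n0))"
      proof (rule tlift_cong[OF rx vX])
        fix x0 x1 assume xx: "x0 \<in> carrier X" "x1 \<in> carrier H"
        have "F (tlift K ?U (lcoact N n) (\<lambda>m n0. ?c x1 m \<odot>\<^bsub>?U\<^esub> tens K X N x0 n0))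
          = tlift K ?T (lcoact N n) (\<lambda>m n0. F (?c x1 m \<odot>\<^bsub>?U\<^esub> tens K X N x0 n0))"
          by (rule lin_of_tlift[OF F dn vsH]) (intro lin_intro | simp add: xx)+
        also have "\<dots> = tlift K ?T (lcoact N n) (\<lambda>m n0. ?c x1 m \<odot>\<^bsub>?T\<^esub> G x0 n0)"
          by (rule tlift_cong[OF dn vsH]) (intro lin_intro | simp add: xx linD(5)[OF F] G)+
        finally show "F (tlift K ?U (lcoact N n) (\<lambda>m n0. ?c x1 m \<odot>\<^bsub>?U\<^esub> tens K X N x0 n0)) = \<dots>" .
      qed (intro lin_intro | simp add: xn)+
      finally show ?thesis .
    qed
    have in1: "?c x1 m \<odot>\<^bsub>?T\<^esub> tlift K ?T (rcoact X x0) (\<lambda>y0 y1. ?t y0 y1 n0)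
      = tlift K ?T (rcoact X x0) (\<lambda>y0 y1. ?c x1 m \<odot>\<^bsub>?T\<^esub> ?t y0 y1 n0)"
      if "x0 \<in> carrier X" "x1 \<in> carrier H" "m \<in> carrier H" "n0 \<in> carrier N" for x0 x1 m n0
      by (rule lin_of_tlift[where f = "\<lambda>u. ?c x1 m \<odot>\<^bsub>?T\<^esub> u", OF _ right_comoduleD(3)[OF X that(1)] vX])
         (intro lin_intro | simp add: that)+
    have in2: "?c x1 m \<odot>\<^bsub>?T\<^esub> tlift K ?T (lcoact N n0) (\<lambda>y0 y1. ?t x0 y0 y1)
      = tlift K ?T (lcoact N n0) (\<lambda>y0 y1. ?c x1 m \<odot>\<^bsub>?T\<^esub> ?t x0 y0 y1)"
      if "x0 \<in> carrier X" "x1 \<in> carrier H" "m \<in> carrier H" "n0 \<in> carrier N" for x0 x1 m n0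
      by (rule lin_of_tlift[where f = "\<lambda>u. ?c x1 m \<odot>\<^bsub>?T\<^esub> u", OF _ left_comoduleD(3)[OF N that(4)] vsH])
         (intro lin_intro | simp add: that)+
    have "?L (coaverage l X N (tens K X N x n)) = tlift K ?T (rcoact X x) (\<lambda>x0 x1. tlift K ?T (lcoact N n) (\<lambda>m n0.
        ?c x1 m \<odot>\<^bsub>?T\<^esub> tlift K ?T (rcoact X x0) (\<lambda>y0 y1. ?t y0 y1 n0)))"
      by (rule push[OF L cotensor_tens(1)[OF X N vsH]])
    also have "\<dots> = tlift K ?T (lcoact N n) (\<lambda>m n0. tlift K ?T (rcoact X x) (\<lambda>x0 x1. 
        ?c x1 m \<odot>\<^bsub>?T\<^esub> tlift K ?T (rcoact X x0) (\<lambda>y0 y1. ?t y0 y1 n0)))"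
      by (rule tlift_swap[OF rx dn vX vsH vsH vN]) (intro lin_intro | simp add: xn)+
    also have "\<dots> = tlift K ?T (lcoact N n) (\<lambda>m n0. tlift K ?T (rcoact X x) (\<lambda>x0 x1. 
        tlift K ?T (rcoact X x0) (\<lambda>y0 y1. ?c x1 m \<odot>\<^bsub>?T\<^esub> ?t y0 y1 n0)))"
      by (intro tlift_cong[OF dn vsH] tlift_cong[OF rx vX]) (intro lin_intro | simp add: in1 xn)+
    also have "\<dots> = ?M"
    proof (rule tlift_cong[OF dn vsH])
      fix m n0 assume mn: "m \<in> carrier H" "n0 \<in> carrier N"
      have "tlift K ?T (rcoact X x) (\<lambda>x0 x1. tlift K ?T (rcoact X x0) (\<lambda>y0 y1. ?c x1 m \<odot>\<^bsub>?T\<^esub> ?t y0 y1 n0))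
        = tlift K ?T (rcoact X x) (\<lambda>x0 x1. tlift K ?T (\<Delta> x1) (\<lambda>a b. ?c b m \<odot>\<^bsub>?T\<^esub> ?t x0 a n0))"
        by (rule right_coassoc[OF X vsH hopfD(5) _ xn(1)]) (intro lin_intro | simp add: mn)+
      also have "\<dots> = tlift K ?T (rcoact X x) (\<lambda>x0 x1. tlift K ?T (\<Delta> m) (\<lambda>m1 m2. ?c x1 m1 \<odot>\<^bsub>?T\<^esub> ?t x0 m2 n0))"
      proof (rule tlift_cong[OF rx vX])
        fix x0 x1 assume xx: "x0 \<in> carrier X" "x1 \<in> carrier H"
        note f = lT2[OF xx(1) mn(2)]
        have "tlift K ?T (\<Delta> x1) (\<lambda>a b. ?c b m \<odot>\<^bsub>?T\<^esub> ?t x0 a n0)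
          = tlift K ?T (\<Delta> x1) (\<lambda>a b. ?t x0 (?c b m \<odot>\<^bsub>H\<^esub> a) n0)"
          by (rule comult_cong[OF xx(2)]) (intro lin_comp[OF f] lin_intro | simp add: xx mn linD(5)[OF f])+
        also have "\<dots> = ?t x0 (tlift K H (\<Delta> x1) (\<lambda>a b. ?c b m \<odot>\<^bsub>H\<^esub> a)) n0"
          by (rule comult_apply[OF f xx(2), symmetric]) (intro lin_intro | simp add: mn)+
        \<comment> \<open>The cointegral identity, applied in the middle leg alone.\<close>
        also have "\<dots> = ?t x0 (tlift K H (\<Delta> m) (\<lambda>a b. ?c x1 a \<odot>\<^bsub>H\<^esub> b)) n0"
          by (simp add: cointegral_comult[OF l(1,3) xx(2) mn(1)])
        also have "\<dots> = tlift K ?T (\<Delta> m) (\<lambda>a b. ?t x0 (?c x1 a \<odot>\<^bsub>H\<^esub> b) n0)"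
          by (rule comult_apply[OF f mn(1)]) (intro lin_intro | simp add: xx)+
        also have "\<dots> = tlift K ?T (\<Delta> m) (\<lambda>m1 m2. ?c x1 m1 \<odot>\<^bsub>?T\<^esub> ?t x0 m2 n0)"
          by (rule comult_cong[OF mn(1)]) (intro lin_intro | simp add: xx mn linD(5)[OF f])+
        finally show "tlift K ?T (\<Delta> x1) (\<lambda>a b. ?c b m \<odot>\<^bsub>?T\<^esub> ?t x0 a n0) = \<dots>" .
      qed (intro lin_intro | simp add: mn)+
      finally show "tlift K ?T (rcoact X x) (\<lambda>x0 x1. tlift K ?T (rcoact X x0) (\<lambda>y0 y1. ?c x1 m \<odot>\<^bsub>?T\<^esub> ?t y0 y1 n0))
        = \<dots>" .
    qed (intro lin_intro | simp add: xn)+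
    also have "?M = tlift K ?T (rcoact X x) (\<lambda>x0 x1. tlift K ?T (lcoact N n) (\<lambda>m n0.
      tlift K ?T (\<Delta> m) (\<lambda>m1 m2. ?c x1 m1 \<odot>\<^bsub>?T\<^esub> ?t x0 m2 n0)))"
      by (rule tlift_swap[OF dn rx vsH vN vX vsH]) (intro lin_intro | simp add: xn)+
    also have "\<dots> = tlift K ?T (rcoact X x) (\<lambda>x0 x1. tlift K ?T (lcoact N n) (\<lambda>m n0.
      tlift K ?T (lcoact N n0) (\<lambda>m' n'. ?c x1 m \<odot>\<^bsub>?T\<^esub> ?t x0 m' n')))"
    proof (rule tlift_cong[OF rx vX])
      fix x0 x1 assume xx: "x0 \<in> carrier X" "x1 \<in> carrier H"
      show "tlift K ?T (lcoact N n) (\<lambda>m n0. tlift K ?T (\<Delta> m) (\<lambda>m1 m2. ?c x1 m1 \<odot>\<^bsub>?T\<^esub> ?t x0 m2 n0))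
        = tlift K ?T (lcoact N n) (\<lambda>m n0. tlift K ?T (lcoact N n0) (\<lambda>m' n'. ?c x1 m \<odot>\<^bsub>?T\<^esub> ?t x0 m' n'))"
        by (rule left_coassoc[OF N vsH hopfD(5) _ xn(2)]) (intro lin_intro | simp add: xx)+
    qed (intro lin_intro | simp add: xn)+
    also have "\<dots> = tlift K ?T (rcoact X x) (\<lambda>x0 x1. tlift K ?T (lcoact N n) (\<lambda>m n0.
        ?c x1 m \<odot>\<^bsub>?T\<^esub> tlift K ?T (lcoact N n0) (\<lambda>y0 y1. ?t x0 y0 y1)))"
      by (intro tlift_cong[OF dn vsH] tlift_cong[OF rx vX]) (intro lin_intro | simp add: in2 xn)+
    also have "\<dots> = ?R (coaverage l X N (tens K X N x n))"
      by (rule push[OF R cotensor_tens(2)[OF X N vsH], symmetric])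
    finally show "?L (coaverage l X N (tens K X N x n)) = ?R (coaverage l X N (tens K X N x n))" .
  qed
  then show ?thesis using linD(3)[OF coaverage_lin t] by (simp add: cotensor_def)
qed

end

text \<open>Colinearity of \<open>f\<close> allows the coaction of f n to be computed before or
  after applying \<open>f\<close>. A preimage of a cotensor can thus be coaveraged without losing
  its image.\<close>

lemma coaverage_natural:
  assumes X: "right_comodule K H X" and N: "left_comodule K H N" and N': "left_comodule K H N'" and f: "lin N N' f"
    and fl: "\<And>n. n \<in> carrier N \<Longrightarrow> lcoact N' (f n) = tlift K (H \<otimes>\<^sub>t N') (lcoact N n) (\<lambda>h m. tens K H N' h (f m))"
    and t: "t \<in> carrier (X \<otimes>\<^sub>t N)"
  shows "coaverage l X N' (tmap X N' (\<lambda>x. x) f t) = tmap X N' (\<lambda>x. x) f (coaverage l X N t)"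
proof -
  let ?U = "X \<otimes>\<^sub>t N" and ?U' = "X \<otimes>\<^sub>t N'"
  note vX = right_comoduleD(2)[OF X] and vN = left_comoduleD(2)[OF N] and vN' = left_comoduleD(2)[OF N']
  note [lin_intro] = lin_comp[OF l(1)] lcoact_lin[OF N vsH] lcoact_lin[OF N' vsH] rcoact_lin[OF X vsH] lin_comp[OF f]
  note [simp] = vX vN vN' functional_closed[OF l(1)] vs_tensor tens_closed vsD(5) linD(3)[OF f]
  note F = lin_tmap[OF lin_id[OF vX] f]
  note lt = tmap_tens[OF lin_id[OF vX] f]
  let ?c = "\<lambda>x1 m. l (x1 \<otimes>\<^bsub>H\<^esub> S m)"
  show ?thesis
  proof (rule tensor_ext[OF vX vN lin_comp[OF coaverage_lin[OF X N'] F] lin_comp[OF F coaverage_lin[OF X N]] _ t])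
    fix x n assume xn: "x \<in> carrier X" "n \<in> carrier N"
    note rx = right_comoduleD(3)[OF X xn(1)] and dn = left_comoduleD(3)[OF N xn(2)]
    have "tmap X N' (\<lambda>x. x) f (coaverage l X N (tens K X N x n)) = tlift K ?U' (rcoact X x) (\<lambda>x0 x1.
        tmap X N' (\<lambda>x. x) f (tlift K ?U (lcoact N n) (\<lambda>m n0. ?c x1 m \<odot>\<^bsub>?U\<^esub> tens K X N x0 n0)))"
      unfolding coaverage_tens[OF X N xn] by (rule lin_of_tlift[OF F rx vX]) (intro lin_intro | simp add: xn)+
    also have "\<dots> = tlift K ?U' (rcoact X x) (\<lambda>x0 x1. tlift K ?U' (lcoact N' (f n)) (\<lambda>m n0. ?c x1 m \<odot>\<^bsub>?U'\<^esub> tens K X N' x0 n0))"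
    proof (rule tlift_cong[OF rx vX])
      fix x0 x1 assume xx: "x0 \<in> carrier X" "x1 \<in> carrier H"
      have b: "bilin H N' ?U' (\<lambda>m n0. ?c x1 m \<odot>\<^bsub>?U'\<^esub> tens K X N' x0 n0)" by (intro lin_intro | simp add: xx)+
      have "tmap X N' (\<lambda>x. x) f (tlift K ?U (lcoact N n) (\<lambda>m n0. ?c x1 m \<odot>\<^bsub>?U\<^esub> tens K X N x0 n0))
        = tlift K ?U' (lcoact N n) (\<lambda>m n0. tmap X N' (\<lambda>x. x) f (?c x1 m \<odot>\<^bsub>?U\<^esub> tens K X N x0 n0))"
        by (rule lin_of_tlift[OF F dn vsH]) (intro lin_intro | simp add: xx)+
      also have "\<dots> = tlift K ?U' (lcoact N n) (\<lambda>m n0. tlift K ?U' (tens K H N' m (f n0)) (\<lambda>m n0. ?c x1 m \<odot>\<^bsub>?U'\<^esub> tens K X N' x0 n0))"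
        by (rule tlift_cong[OF dn vsH])
           (intro lin_intro lin_tlift1[OF _ vsH b] | simp add: xx linD(5)[OF F] lt tlift_tens[OF vsH vN' b])+
      also have "\<dots> = tlift K ?U' (lcoact N' (f n)) (\<lambda>m n0. ?c x1 m \<odot>\<^bsub>?U'\<^esub> tens K X N' x0 n0)"
        unfolding fl[OF xn(2)] by (rule tlift_tlift[OF dn vsH _ vsH b, symmetric]) (intro lin_intro | simp)+
      finally show "tmap X N' (\<lambda>x. x) f (tlift K ?U (lcoact N n) (\<lambda>m n0. ?c x1 m \<odot>\<^bsub>?U\<^esub> tens K X N x0 n0)) = \<dots>" .
    qed (intro lin_intro | simp add: xn)+
    finally show "coaverage l X N' (tmap X N' (\<lambda>x. x) f (tens K X N x n)) = tmap X N' (\<lambda>x. x) f (coaverage l X N (tens K X N x n))"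
      using xn by (simp add: lt coaverage_tens[OF X N'])
  qed
qed

end

end

context linear_algebra
begin

subsection \<open>Subobjects and quotients\<close>

text \<open>Two applications of \<open>tmap_inj\<close>, once for each factor tensored on the left.
  It reflects identities in triple tensor products along an injection in the last factor.\<close>

lemma trilift_inj:
  assumes V: "vspace V1" "vspace V2" and f: "lin M N f" and inj: "inj_on f (carrier M)"
    and s: "s \<in> carrier (tensor3 K V1 V2 M)" and t: "t \<in> carrier (tensor3 K V1 V2 M)"
    and eq: "tlift K (tensor3 K V1 V2 N) s (\<lambda>a s. tlift K (tensor3 K V1 V2 N) s (\<lambda>b m. tens3 K V1 V2 N a b (f m)))
      = tlift K (tensor3 K V1 V2 N) t (\<lambda>a s. tlift K (tensor3 K V1 V2 N) s (\<lambda>b m. tens3 K V1 V2 N a b (f m)))"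
  shows "s = t"
proof -
  note vN = linD(2)[OF f]
  note i = lin_id[OF V(2)]
  have e: "tlift K (tensor3 K V1 V2 N) s (\<lambda>a s. tlift K (tensor3 K V1 V2 N) s (\<lambda>b m. tens3 K V1 V2 N a b (f m)))
      = tmap V1 (V2 \<otimes>\<^sub>t N) (\<lambda>x. x) (tmap V2 N (\<lambda>x. x) f) s"
    if s: "s \<in> carrier (tensor3 K V1 V2 M)" for s
    unfolding tensor3_def tens3_def
  proof (rule tlift_cong[OF s[unfolded tensor3_def] V(1) bilin_tmap[OF lin_id[OF V(1)] lin_tmap[OF i f]]])
    fix a u assume a: "a \<in> carrier V1" and u: "u \<in> carrier (V2 \<otimes>\<^sub>t M)"
    show "tlift K (V1 \<otimes>\<^sub>t (V2 \<otimes>\<^sub>t N)) u (\<lambda>b m. tens K V1 (V2 \<otimes>\<^sub>t N) a (tens K V2 N b (f m))) =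
      tens K V1 (V2 \<otimes>\<^sub>t N) a (tmap V2 N (\<lambda>x. x) f u)"
      by (rule lin_of_tlift[OF bilinD(1)[OF bilin_tens[OF V(1) vs_tensor[OF V(2) vN]] a] u V(2) bilin_tmap[OF i f], symmetric])
  qed
  show ?thesis
  proof (rule tmap_inj[OF V(1) lin_tmap[OF i f] _ s[unfolded tensor3_def] t[unfolded tensor3_def]])
    show "inj_on (tmap V2 N (\<lambda>x. x) f) (carrier (V2 \<otimes>\<^sub>t M))"
      by (rule inj_onI) (rule tmap_inj[OF V(2) f inj])
    show "tmap V1 (V2 \<otimes>\<^sub>t N) (\<lambda>x. x) (tmap V2 N (\<lambda>x. x) f) s = tmap V1 (V2 \<otimes>\<^sub>t N) (\<lambda>x. x) (tmap V2 N (\<lambda>x. x) f) t"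
      using eq e[OF s] e[OF t] by simp
  qed
qed

context
  fixes C :: "('k, 'h) hopf_data" and M :: "('k, 'h, 'm, 'y) lmodcomod_scheme" and N :: "('k, 'h, 'n, 'z) lmodcomod_scheme"
    and f :: "'m \<Rightarrow> 'n"
  assumes C: "vspace C" "lin C (C \<otimes>\<^sub>t C) (comult C)" "lin C (ground K) (counit C)"
    and dM: "lin M (C \<otimes>\<^sub>t M) (lcoact M)" and dN: "lin N (C \<otimes>\<^sub>t N) (lcoact N)" and f: "lin M N f"
    and fl: "\<And>m. m \<in> carrier M \<Longrightarrow> lcoact N (f m) = tmap C N (\<lambda>h. h) f (lcoact M m)"
begin

abbreviation (input) tri_map :: "('h \<times> ('h \<times> 'm \<Rightarrow> 'k) set \<Rightarrow> 'k) set \<Rightarrow> ('h \<times> ('h \<times> 'n \<Rightarrow> 'k) set \<Rightarrow> 'k) set" where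
  "tri_map t \<equiv> tlift K (tensor3 K C C N) t (\<lambda>a s. tlift K (tensor3 K C C N) s (\<lambda>b m. tens3 K C C N a b (f m)))"

lemma trilin_tri_map: "trilin C C M (tensor3 K C C N) (\<lambda>a b m. tens3 K C C N a b (f m))"
proof -
  note T = trilin_tens3[OF C(1) C(1) linD(1)[OF dN]]
  show ?thesis
    by (intro trilinI bilinI lin_comp[OF trilinD(4)[OF T] f] trilinD(2,3)[OF T] linD(3)[OF f]; assumption)
qed

lemma tlift_colinear:
  assumes b: "bilin C N U \<beta>" and m: "m \<in> carrier M"
  shows "tlift K U (lcoact N (f m)) \<beta> = tlift K U (lcoact M m) (\<lambda>h m'. \<beta> h (f m'))"
proof -
  note vN = linD(1)[OF dN]
  have b': "bilin C M U (\<lambda>h m'. \<beta> h (f m'))"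
    by (intro bilinI lin_comp[OF bilinD(1)[OF b] f] bilinD(2)[OF b] linD(3)[OF f]; assumption)
  have "tlift K U (lcoact N (f m)) \<beta> = tlift K U (lcoact M m) (\<lambda>h m'. tlift K U (tens K C N h (f m')) \<beta>)"
    unfolding fl[OF m] by (rule tlift_tlift[OF linD(3)[OF dM m] C(1) bilin_tmap[OF lin_id[OF C(1)] f] C(1) b])
  also have "\<dots> = tlift K U (lcoact M m) (\<lambda>h m'. \<beta> h (f m'))"
    by (rule tlift_cong[OF linD(3)[OF dM m] C(1) b']) (simp add: tlift_tens[OF C(1) vN b] linD(3)[OF f])
  finally show ?thesis .
qed

text \<open>A colinear map carries each side of the coassociativity equation at \<open>m\<close> to
  the same side at f m. With a surjective \<open>f\<close> the axiom descends to the target, with an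
  injective \<open>f\<close> it is inherited by the source; quotient objects use the first,
  subobjects the second.\<close>

lemma coassoc_push:
  assumes m: "m \<in> carrier M"
  shows "tri_map (tlift K (tensor3 K C C M) (lcoact M m) (\<lambda>h m'. tlift K (tensor3 K C C M) (comult C h) (\<lambda>h1 h2.
          tens3 K C C M h1 h2 m')))
      = tlift K (tensor3 K C C N) (lcoact N (f m)) (\<lambda>h m'. tlift K (tensor3 K C C N) (comult C h) (\<lambda>h1 h2.
          tens3 K C C N h1 h2 m'))" (is ?left)
    "tri_map (tlift K (tensor3 K C C M) (lcoact M m) (\<lambda>h m'. tlift K (tensor3 K C C M) (lcoact M m') (\<lambda>g m''.
          tens3 K C C M h g m'')))
      = tlift K (tensor3 K C C N) (lcoact N (f m)) (\<lambda>h m'. tlift K (tensor3 K C C N) (lcoact N m') (\<lambda>g m''.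
          tens3 K C C N h g m''))" (is ?right)
proof -
  let ?T = "tensor3 K C C N"
  note vM = linD(1)[OF dM] and vN = linD(1)[OF dN]
  note T = trilin_tens3[OF C(1) C(1) vN]
  note vT = trilin_vs[OF C(1) C(1) vN T]
  note tl = trilift_left[OF C(1) C(1) vM trilin_tri_map linD(3)[OF dM m]]
    trilift_right[OF C(1) C(1) vM trilin_tri_map linD(3)[OF dM m]]
  have b1: "bilin C N ?T (\<lambda>h m'. tlift K ?T (comult C h) (\<lambda>h1 h2. tens3 K C C N h1 h2 m'))"
    by (intro bilinI lin_tlift1[OF C(2) C(1)] lin_tlift2[OF linD(3)[OF C(2)] C(1) C(1) vN vT] trilinD[OF T]; assumption)
  have b2: "bilin C N ?T (\<lambda>h m'. tlift K ?T (lcoact N m') (\<lambda>g m''. tens3 K C C N h g m''))"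
    by (intro bilinI lin_tlift1[OF dN C(1)] lin_tlift2[OF linD(3)[OF dN] C(1) vN C(1) vT] trilinD[OF T]; assumption)
  show ?left
    using tl(1)[OF C(2)] tlift_colinear[OF b1 m] by simp
  have "tri_map (tlift K (tensor3 K C C M) (lcoact M m) (\<lambda>h m'. tlift K (tensor3 K C C M) (lcoact M m') (\<lambda>g m''.
          tens3 K C C M h g m'')))
    = tlift K ?T (lcoact M m) (\<lambda>h m'. tlift K ?T (lcoact M m') (\<lambda>g m''. tens3 K C C N h g (f m'')))"
    by (rule tl(2)[OF dM])
  also have "\<dots> = tlift K ?T (lcoact M m) (\<lambda>h m'. tlift K ?T (lcoact N (f m')) (\<lambda>g m''. tens3 K C C N h g m''))"
  proof (rule tlift_cong[OF linD(3)[OF dM m] C(1)])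
    show "bilin C M ?T (\<lambda>h m'. tlift K ?T (lcoact N (f m')) (\<lambda>g m''. tens3 K C C N h g m''))"
      by (intro bilinI lin_comp[OF bilinD(1)[OF b2] f] bilinD(2)[OF b2] linD(3)[OF f]; assumption)
    fix h m' assume hm: "h \<in> carrier C" "m' \<in> carrier M"
    show "tlift K ?T (lcoact M m') (\<lambda>g m''. tens3 K C C N h g (f m'')) =
      tlift K ?T (lcoact N (f m')) (\<lambda>g m''. tens3 K C C N h g m'')"
      by (rule tlift_colinear[OF trilinD(1)[OF T hm(1)] hm(2), symmetric])
  qed
  also have "\<dots> = tlift K ?T (lcoact N (f m)) (\<lambda>h m'. tlift K ?T (lcoact N m') (\<lambda>g m''. tens3 K C C N h g m''))"
    using tlift_colinear[OF b2 m] by simp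
  finally show ?right .
qed

lemma counit_push:
  assumes m: "m \<in> carrier M"
  shows "f (tlift K M (lcoact M m) (\<lambda>h m'. counit C h \<odot>\<^bsub>M\<^esub> m')) =
    tlift K N (lcoact N (f m)) (\<lambda>h m'. counit C h \<odot>\<^bsub>N\<^esub> m')"
proof -
  note vM = linD(1)[OF dM] and vN = linD(1)[OF dN]
  note e = functional_closed[OF C(3)]
  have "f (tlift K M (lcoact M m) (\<lambda>h m'. counit C h \<odot>\<^bsub>M\<^esub> m')) = tlift K N (lcoact M m) (\<lambda>h m'. f (counit C h \<odot>\<^bsub>M\<^esub> m'))"
    by (rule lin_of_tlift[OF f linD(3)[OF dM m] C(1)]) (intro lin_intro C vM e)
  also have "\<dots> = tlift K N (lcoact M m) (\<lambda>h m'. counit C h \<odot>\<^bsub>N\<^esub> f m')"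
    by (rule tlift_cong[OF linD(3)[OF dM m] C(1)]) (intro lin_intro C f vN e linD(3)[OF f] linD(5)[OF f]; assumption)+
  also have "\<dots> = tlift K N (lcoact N (f m)) (\<lambda>h m'. counit C h \<odot>\<^bsub>N\<^esub> m')"
    by (rule tlift_colinear[symmetric, OF _ m]) (intro lin_intro C vN e)
  finally show ?thesis .
qed

lemma comodule_of_surj:
  assumes "left_comodule K C M" "f ` carrier M = carrier N"
  shows "left_comodule K C N"
  unfolding left_comodule_def
proof (intro conjI dN ballI)
  fix n assume "n \<in> carrier N"
  then obtain m where m: "m \<in> carrier M" "n = f m" using assms(2) by auto
  show "tlift K (tensor3 K C C N) (lcoact N n) (\<lambda>h m. tlift K (tensor3 K C C N) (comult C h) (\<lambda>h1 h2. tens3 K C C N h1 h2 m)) =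
     tlift K (tensor3 K C C N) (lcoact N n) (\<lambda>h m. tlift K (tensor3 K C C N) (lcoact N m) (\<lambda>g m'. tens3 K C C N h g m'))"
    using assms(1) m unfolding m(2) coassoc_push[OF m(1), symmetric] by (simp add: left_comodule_def)
  show "tlift K N (lcoact N n) (\<lambda>h m. counit C h \<odot>\<^bsub>N\<^esub> m) = n"
    using assms(1) m unfolding m(2) counit_push[OF m(1), symmetric] by (simp add: left_comodule_def)
qed

lemma comodule_of_inj:
  assumes "left_comodule K C N" "inj_on f (carrier M)"
  shows "left_comodule K C M"
  unfolding left_comodule_def
proof (intro conjI dM ballI)
  fix m assume m: "m \<in> carrier M"
  note vM = linD(1)[OF dM]
  note T = trilin_tens3[OF C(1) C(1) vM]
  note vT = trilin_vs[OF C(1) C(1) vM T]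
  note cm = linD(3)[OF dM m]
  have b1: "bilin C M (tensor3 K C C M) (\<lambda>h m'. tlift K (tensor3 K C C M) (comult C h) (\<lambda>h1 h2. tens3 K C C M h1 h2 m'))"
    by (intro bilinI lin_tlift1[OF C(2) C(1)] lin_tlift2[OF linD(3)[OF C(2)] C(1) C(1) vM vT] trilinD[OF T]; assumption)
  have b2: "bilin C M (tensor3 K C C M) (\<lambda>h m'. tlift K (tensor3 K C C M) (lcoact M m') (\<lambda>g m''. tens3 K C C M h g m''))"
    by (intro bilinI lin_tlift1[OF dM C(1)] lin_tlift2[OF linD(3)[OF dM] C(1) vM C(1) vT] trilinD[OF T]; assumption)
  show "tlift K (tensor3 K C C M) (lcoact M m) (\<lambda>h m. tlift K (tensor3 K C C M) (comult C h) (\<lambda>h1 h2. tens3 K C C M h1 h2 m)) =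
     tlift K (tensor3 K C C M) (lcoact M m) (\<lambda>h m. tlift K (tensor3 K C C M) (lcoact M m) (\<lambda>g m'. tens3 K C C M h g m'))"
    by (rule trilift_inj[OF C(1) C(1) f assms(2) tlift_closed[OF cm C(1) b1] tlift_closed[OF cm C(1) b2]])
       (use assms(1) linD(3)[OF f m] in \<open>simp add: coassoc_push[OF m] left_comodule_def\<close>)
  have "tlift K M (lcoact M m) (\<lambda>h m. counit C h \<odot>\<^bsub>M\<^esub> m) \<in> carrier M"
    by (rule tlift_closed[OF cm C(1)]) (intro lin_intro C vM functional_closed[OF C(3)])
  then show "tlift K M (lcoact M m) (\<lambda>h m. counit C h \<odot>\<^bsub>M\<^esub> m) = m"
    using counit_push[OF m] assms(1) linD(3)[OF f m] m
    by (intro inj_onD[OF assms(2)]) (simp_all add: left_comodule_def)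
qed

end

text \<open>The coaction is defined by description, so everything hinges on injectivity of H
  \<otimes> W \<rightarrow> H \<otimes> N: it gives uniqueness, and it reflects linearity and the
  comodule axioms from \<open>N\<close>.\<close>

lemma sub_object:
  assumes C: "vspace C" "lin C (C \<otimes>\<^sub>t C) (comult C)" "lin C (ground K) (counit C)" "monoid C"
    and N: "left_module K C N" "left_comodule K C N"
    and W: "left_submodule K C N W" "left_subcomodule K C N W"
  defines "M \<equiv> sub_object K C N W"
  shows "same_space (N\<lparr>carrier := W\<rparr>) M" "left_module K C M" "left_comodule K C M" "lin M N (\<lambda>x. x)"
    "\<And>w. w \<in> W \<Longrightarrow> lcoact N w = tmap C N (\<lambda>h. h) (\<lambda>m. m) (lcoact M w)"
    "lact M = lact N" "carrier M = W"
proof -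
  let ?N = "N\<lparr>carrier := W\<rparr>"
  have sub: "subspace K W N" using W by (simp add: left_submodule_def)
  note dN = left_comoduleD(1)[OF N(2)]
  show ss: "same_space ?N M" by (simp add: M_def sub_object_def same_space_def)
  have same_C: "same_space C C" by (simp add: same_space_def)
  note t1 = tensor_same[OF same_C ss]
  show lactM: "lact M = lact N" and cM: "carrier M = W" by (simp_all add: M_def sub_object_def)
  have vM: "vspace M" by (rule vspace_same[OF ss vs_restrict[OF sub]])
  show f: "lin M N (\<lambda>x. x)" by (rule lin_same[OF ss _ lin_incl[OF sub]]) (simp add: same_space_def)
  have inj: "inj_on (\<lambda>x. x) (carrier M)" by simp
  have M_ops: "add M = add N" "smult M = smult N" by (simp_all add: M_def sub_object_def)
  show "left_module K C M"
    unfolding left_module_def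
  proof (intro conjI ballI vM)
    fix h assume h: "h \<in> carrier C"
    show "lin M M (lact M h)"
      using W(1) h linD(4,5)[OF left_moduleD(2)[OF N(1) h]] subspaceD[OF sub]
      by (intro linI vM) (auto simp: cM lactM M_ops left_submodule_def)
  next
    fix n assume n: "n \<in> carrier M"
    then have n': "n \<in> carrier N" using subspaceD(4)[OF sub] by (simp add: cM)
    show "lin C M (\<lambda>h. lact M h n)"
      using W(1) n linD(4,5)[OF left_moduleD(3)[OF N(1) n']]
      by (intro linI vM C(1)) (auto simp: cM lactM M_ops left_submodule_def)
    show "lact M \<one>\<^bsub>C\<^esub> n = n" by (simp add: lactM left_moduleD(4)[OF N(1) n'])
  qed (use subspaceD(4)[OF sub] in \<open>auto simp: cM lactM left_moduleD(5)[OF N(1)]\<close>)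
  have ex: "lcoact M w \<in> carrier (C \<otimes>\<^sub>t M) \<and> tmap C N (\<lambda>h. h) (\<lambda>m. m) (lcoact M w) = lcoact N w" if w: "w \<in> W" for w
  proof -
    have "lcoact N w \<in> subtensor K C N (carrier C) W" using W(2) w by (simp add: left_subcomodule_def)
    then obtain t where t: "t \<in> carrier (C \<otimes>\<^sub>t ?N)" "lcoact N w = tmap C N (\<lambda>x. x) (\<lambda>x. x) t"
      using subtensor_lift[OF C(1) sub] by blast
    \<comment> \<open>Existence comes from the subcomodule condition through
      \<open>subtensor_lift\<close>, uniqueness from injectivity of the inclusion.\<close>
    have "\<exists>!t. t \<in> carrier (C \<otimes>\<^sub>t ?N) \<and> tlift K (C \<otimes>\<^sub>t N) t (tens K C N) = lcoact N w"
    proof (rule ex1I[of _ t])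
      show "s = t" if "s \<in> carrier (C \<otimes>\<^sub>t ?N) \<and> tlift K (C \<otimes>\<^sub>t N) s (tens K C N) = lcoact N w" for s
        using that t(2) by (intro tmap_inj[OF C(1) lin_incl[OF sub] _ _ t(1)]) auto
    qed (use t in simp)
    from theI'[OF this] show ?thesis by (simp add: M_def sub_object_def t1[unfolded M_def sub_object_def])
  qed
  then show fl: "lcoact N w = tmap C N (\<lambda>h. h) (\<lambda>m. m) (lcoact M w)" if "w \<in> W" for w
    using that by simp
  have dM: "lin M (C \<otimes>\<^sub>t M) (lcoact M)"
  proof (rule linI[OF vM vs_tensor[OF C(1) vM]])
    note l = lin_tmap[OF lin_id[OF C(1)] f]
    note T = vsD[OF vs_tensor[OF C(1) vM]]
    show "lcoact M x \<in> carrier (C \<otimes>\<^sub>t M)" if "x \<in> carrier M" for x using that ex by (simp add: cM)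
    show "lcoact M (x \<oplus>\<^bsub>M\<^esub> y) = lcoact M x \<oplus>\<^bsub>C \<otimes>\<^sub>t M\<^esub> lcoact M y" if xy: "x \<in> carrier M" "y \<in> carrier M" for x y
    proof (rule tmap_inj[OF C(1) f inj])
      have s: "x \<oplus>\<^bsub>M\<^esub> y \<in> W" using vsD(4)[OF vM xy] by (simp add: cM)
      show "lcoact M (x \<oplus>\<^bsub>M\<^esub> y) \<in> carrier (C \<otimes>\<^sub>t M)" using ex[OF s] by simp
      show "lcoact M x \<oplus>\<^bsub>C \<otimes>\<^sub>t M\<^esub> lcoact M y \<in> carrier (C \<otimes>\<^sub>t M)" using xy ex by (simp add: cM T)
      have "lcoact N (x \<oplus>\<^bsub>M\<^esub> y) = lcoact N x \<oplus>\<^bsub>C \<otimes>\<^sub>t N\<^esub> lcoact N y"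
        using xy subspaceD(4)[OF sub] by (simp add: M_ops cM linD(4)[OF dN])
      then show "tmap C N (\<lambda>x. x) (\<lambda>x. x) (lcoact M (x \<oplus>\<^bsub>M\<^esub> y)) = tmap C N (\<lambda>x. x) (\<lambda>x. x) (lcoact M x \<oplus>\<^bsub>C \<otimes>\<^sub>t M\<^esub> lcoact M y)"
        using ex xy s by (simp add: cM linD(4)[OF l])
    qed
    show "lcoact M (c \<odot>\<^bsub>M\<^esub> x) = c \<odot>\<^bsub>C \<otimes>\<^sub>t M\<^esub> lcoact M x" if cx: "c \<in> carrier K" "x \<in> carrier M" for c x
    proof (rule tmap_inj[OF C(1) f inj])
      have s: "c \<odot>\<^bsub>M\<^esub> x \<in> W" using vsD(5)[OF vM cx] by (simp add: cM)
      show "lcoact M (c \<odot>\<^bsub>M\<^esub> x) \<in> carrier (C \<otimes>\<^sub>t M)" using ex[OF s] by simp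
      show "c \<odot>\<^bsub>C \<otimes>\<^sub>t M\<^esub> lcoact M x \<in> carrier (C \<otimes>\<^sub>t M)" using cx ex by (simp add: cM T)
      have "lcoact N (c \<odot>\<^bsub>M\<^esub> x) = c \<odot>\<^bsub>C \<otimes>\<^sub>t N\<^esub> lcoact N x"
        using cx subspaceD(4)[OF sub] by (simp add: M_ops cM linD(5)[OF dN])
      then show "tmap C N (\<lambda>x. x) (\<lambda>x. x) (lcoact M (c \<odot>\<^bsub>M\<^esub> x)) = tmap C N (\<lambda>x. x) (\<lambda>x. x) (c \<odot>\<^bsub>C \<otimes>\<^sub>t M\<^esub> lcoact M x)"
        using ex cx s by (simp add: cM linD(5)[OF l])
    qed
  qed
  show "left_comodule K C M"
    by (rule comodule_of_inj[OF C(1-3) dM dN f _ N(2) inj]) (simp add: fl cM)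
qed

text \<open>The submodule and subcomodule conditions on \<open>W\<close> make the induced action and
  coaction independent of the representative; the axioms then descend along the surjective quotient
  map.\<close>

lemma quotient_object:
  assumes C: "vspace C" "lin C (C \<otimes>\<^sub>t C) (comult C)" "lin C (ground K) (counit C)" "monoid C"
    and N: "left_module K C N" "left_comodule K C N"
    and W: "left_submodule K C N W" "left_subcomodule K C N W"
  defines "Q \<equiv> quotient_object K C N W"
  shows "same_space (quotient_space N W) Q" "left_module K C Q" "left_comodule K C Q" "lin N Q (\<lambda>x. W +>\<^bsub>N\<^esub> x)"
    "\<And>n. n \<in> carrier N \<Longrightarrow> lcoact Q (W +>\<^bsub>N\<^esub> n) = tmap C Q (\<lambda>h. h) (\<lambda>m. W +>\<^bsub>N\<^esub> m) (lcoact N n)"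
    "\<And>h n. h \<in> carrier C \<Longrightarrow> n \<in> carrier N \<Longrightarrow> lact Q h (W +>\<^bsub>N\<^esub> n) = W +>\<^bsub>N\<^esub> lact N h n"
    "carrier Q = (\<lambda>x. W +>\<^bsub>N\<^esub> x) ` carrier N"
proof -
  let ?Q = "quotient_space N W"
  let ?q = "\<lambda>x. W +>\<^bsub>N\<^esub> x"
  have sub: "subspace K W N" using W by (simp add: left_submodule_def)
  note vN = left_moduleD(1)[OF N(1)] and dN = left_comoduleD(1)[OF N(2)]
  show ss: "same_space ?Q Q" by (simp add: Q_def quotient_object_def same_space_def Let_def)
  have same_C: "same_space C C" and same_N: "same_space N N" by (simp_all add: same_space_def)
  note t1 = tensor_same[OF same_C ss]
  have vQ: "vspace Q" by (rule vspace_same[OF ss vs_quotient[OF sub]])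
  show q: "lin N Q ?q" by (rule lin_same[OF same_N ss lin_coset[OF sub]])
  show cQ: "carrier Q = ?q ` carrier N" using ss carrier_quotient[OF sub] by (simp add: same_space_def)
  have Wl: "lact N h ` W \<subseteq> W" if "h \<in> carrier C" for h using W(1) that by (auto simp: left_submodule_def)
  show lactQ: "lact Q h (?q n) = ?q (lact N h n)" if "h \<in> carrier C" "n \<in> carrier N" for h n
    using induced_coset[OF sub left_moduleD(2)[OF N(1) that(1)] sub Wl[OF that(1)] that(2)]
    by (simp add: Q_def quotient_object_def Let_def)
  have l: "lin (C \<otimes>\<^sub>t N) (C \<otimes>\<^sub>t Q) (tmap C Q (\<lambda>h. h) ?q)" by (rule lin_tmap[OF lin_id[OF C(1)] q])
  show coQ: "lcoact Q (?q n) = tmap C Q (\<lambda>h. h) ?q (lcoact N n)" if n: "n \<in> carrier N" for n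
  proof -
    \<comment> \<open>The difference of two representatives lies in \<open>W\<close>, so its
      coaction has second legs in \<open>W\<close> and is killed by the projection. The description
      in the quotient coaction thus has a unique solution.\<close>
    have eq: "tmap C Q (\<lambda>h. h) ?q (lcoact N m) = tmap C Q (\<lambda>h. h) ?q (lcoact N n)" if m: "m \<in> ?q n" for m
    proof -
      have m': "m \<in> carrier N" "m \<ominus>\<^bsub>N\<^esub> n \<in> W" using m by (auto simp: coset_mem[OF sub n])
      interpret T: vectorspace K "C \<otimes>\<^sub>t Q" by (rule vs_tensor[OF C(1) vQ])
      have "lcoact N (m \<ominus>\<^bsub>N\<^esub> n) \<in> subtensor K C N (carrier C) W" using W(2) m'(2) by (simp add: left_subcomodule_def)
      then have "tmap C Q (\<lambda>h. h) ?q (lcoact N (m \<ominus>\<^bsub>N\<^esub> n)) \<in> {\<zero>\<^bsub>C \<otimes>\<^sub>t Q\<^esub>}"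
      proof (rule tlift_subtensor[OF _ C(1) bilin_tmap[OF lin_id[OF C(1)] q] vs_zero_subspace[OF vs_tensor[OF C(1) vQ]]])
        fix x y assume xy: "x \<in> carrier C" "y \<in> W"
        then have "?q y = \<zero>\<^bsub>Q\<^esub>" using coset_zero_iff[OF sub, of y] subspaceD(4)[OF sub] ss by (simp add: same_space_def)
        then show "tens K C Q x (?q y) \<in> {\<zero>\<^bsub>C \<otimes>\<^sub>t Q\<^esub>}" using linD(6)[OF bilinD(1)[OF bilin_tens[OF C(1) vQ] xy(1)]] by simp
      qed (auto simp: subspaceD[OF sub])
      then have "tmap C Q (\<lambda>h. h) ?q (lcoact N m) \<ominus>\<^bsub>C \<otimes>\<^sub>t Q\<^esub> tmap C Q (\<lambda>h. h) ?q (lcoact N n) = \<zero>\<^bsub>C \<otimes>\<^sub>t Q\<^esub>"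
        using m' n by (simp add: linD(8)[OF dN] linD(8)[OF l] linD(3)[OF dN])
      then show ?thesis using linD(3)[OF l] linD(3)[OF dN] m' n by simp
    qed
    have "(THE t. \<exists>m\<in>?q n. t = tmap C Q (\<lambda>h. h) ?q (lcoact N m)) = tmap C Q (\<lambda>h. h) ?q (lcoact N n)"
      by (rule the_equality) (use coset_self[OF sub n] eq in blast)+
    then show ?thesis by (simp add: Q_def quotient_object_def Let_def t1[unfolded Q_def quotient_object_def Let_def])
  qed
  show "left_module K C Q"
    unfolding left_module_def
  proof (intro conjI ballI vQ)
    fix h assume h: "h \<in> carrier C"
    note lh = left_moduleD(2)[OF N(1) h]
    show "lin Q Q (lact Q h)"
    proof (rule linI[OF vQ vQ])
      show "lact Q h x \<in> carrier Q" if "x \<in> carrier Q" for x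
        using that h left_moduleD(6)[OF N(1)] by (auto simp: cQ lactQ)
      show "lact Q h (x \<oplus>\<^bsub>Q\<^esub> y) = lact Q h x \<oplus>\<^bsub>Q\<^esub> lact Q h y" if "x \<in> carrier Q" "y \<in> carrier Q" for x y
      proof -
        from that obtain a b where "a \<in> carrier N" "b \<in> carrier N" "x = ?q a" "y = ?q b" by (auto simp: cQ)
        then show ?thesis using h by (simp add: lactQ vsD[OF vN] left_moduleD(6)[OF N(1)] linD(4)[OF lh] flip: linD(4)[OF q])
      qed
      show "lact Q h (c \<odot>\<^bsub>Q\<^esub> x) = c \<odot>\<^bsub>Q\<^esub> lact Q h x" if "c \<in> carrier K" "x \<in> carrier Q" for c x
      proof -
        from that obtain a where "a \<in> carrier N" "x = ?q a" by (auto simp: cQ)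
        then show ?thesis using h that by (simp add: lactQ vsD[OF vN] left_moduleD(6)[OF N(1)] linD(5)[OF lh] flip: linD(5)[OF q])
      qed
    qed
  next
    fix n assume "n \<in> carrier Q"
    then obtain a where a: "a \<in> carrier N" "n = ?q a" by (auto simp: cQ)
    show "lin C Q (\<lambda>h. lact Q h n)"
      by (rule lin_cong[OF lin_comp[OF q left_moduleD(3)[OF N(1) a(1)]]]) (simp add: a lactQ)
    show "lact Q \<one>\<^bsub>C\<^esub> n = n"
      using a by (simp add: lactQ monoid.one_closed[OF C(4)] left_moduleD(4)[OF N(1)])
  next
    fix g h n assume gh: "g \<in> carrier C" "h \<in> carrier C" and "n \<in> carrier Q"
    then obtain a where a: "a \<in> carrier N" "n = ?q a" by (auto simp: cQ)
    show "lact Q (g \<otimes>\<^bsub>C\<^esub> h) n = lact Q g (lact Q h n)"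
      using a gh by (simp add: lactQ monoid.m_closed[OF C(4)] left_moduleD(5,6)[OF N(1)])
  qed
  have dQ: "lin Q (C \<otimes>\<^sub>t Q) (lcoact Q)"
  proof (rule linI[OF vQ vs_tensor[OF C(1) vQ]])
    show "lcoact Q x \<in> carrier (C \<otimes>\<^sub>t Q)" if "x \<in> carrier Q" for x
      using that linD(3)[OF l] linD(3)[OF dN] by (auto simp: cQ coQ)
    show "lcoact Q (x \<oplus>\<^bsub>Q\<^esub> y) = lcoact Q x \<oplus>\<^bsub>C \<otimes>\<^sub>t Q\<^esub> lcoact Q y" if "x \<in> carrier Q" "y \<in> carrier Q" for x y
    proof -
      from that obtain a b where "a \<in> carrier N" "b \<in> carrier N" "x = ?q a" "y = ?q b" by (auto simp: cQ)
      then show ?thesis by (simp add: coQ vsD[OF vN] linD(3,4)[OF dN] linD(4)[OF l] flip: linD(4)[OF q])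
    qed
    show "lcoact Q (c \<odot>\<^bsub>Q\<^esub> x) = c \<odot>\<^bsub>C \<otimes>\<^sub>t Q\<^esub> lcoact Q x" if "c \<in> carrier K" "x \<in> carrier Q" for c x
    proof -
      from that obtain a where "a \<in> carrier N" "x = ?q a" by (auto simp: cQ)
      then show ?thesis using that by (simp add: coQ vsD[OF vN] linD(3,5)[OF dN] linD(5)[OF l] flip: linD(5)[OF q])
    qed
  qed
  show "left_comodule K C Q"
    by (rule comodule_of_surj[OF C(1-3) dN dQ q coQ N(2) cQ[symmetric]])
qed

end

subsection \<open>The bosonisation\<close>

lemma (in linear_algebra) yd_homD:
  assumes "yd_hom K C M N f"
  shows "lin M N f" "h \<in> carrier C \<Longrightarrow> m \<in> carrier M \<Longrightarrow> f (lact M h m) = lact N h (f m)"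
    "m \<in> carrier M \<Longrightarrow> lcoact N (f m) = tmap C N (\<lambda>h. h) f (lcoact M m)"
  using assms by (auto simp: yd_hom_def)

locale boson = hopf K H for K :: "'k ring" (structure) and H :: "('k, 'h) hopf_data" +
  fixes B :: "('k, 'h, 'b) braided_hopf_data"
  assumes braided: "braided_hopf_algebra K H B"
begin

abbreviation A where "A \<equiv> bosonisation K H B"
abbreviation T where "T \<equiv> B \<otimes>\<^sub>t H"
abbreviation incl ("\<iota>") where "\<iota> \<equiv> boson_incl K H B"
abbreviation proj ("\<pi>") where "\<pi> \<equiv> boson_proj K H B"
abbreviation epsB ("\<epsilon>\<^sub>B") where "\<epsilon>\<^sub>B \<equiv> bcounit B"

lemma braidedD: "yd_module K H B" "k_algebra K B" "k_coalgebra K B (bcomult B) (bcounit B)"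
    "yd_hom K H (yd_unit K H) B (\<lambda>c. c \<odot>\<^bsub>B\<^esub> \<one>\<^bsub>B\<^esub>)" "yd_hom K H B (yd_unit K H) \<epsilon>\<^sub>B"
    "\<And>x y. x \<in> carrier B \<Longrightarrow> y \<in> carrier B \<Longrightarrow> \<epsilon>\<^sub>B (x \<otimes>\<^bsub>B\<^esub> y) = \<epsilon>\<^sub>B x \<otimes> \<epsilon>\<^sub>B y"
    "bcomult B \<one>\<^bsub>B\<^esub> = tens K B B \<one>\<^bsub>B\<^esub> \<one>\<^bsub>B\<^esub>" "\<epsilon>\<^sub>B \<one>\<^bsub>B\<^esub> = \<one>" "yd_hom K H B B (bantipode B)"
    "\<And>x. x \<in> carrier B \<Longrightarrow> tlift K B (bcomult B x) (\<lambda>a b. bantipode B a \<otimes>\<^bsub>B\<^esub> b) = \<epsilon>\<^sub>B x \<odot>\<^bsub>B\<^esub> \<one>\<^bsub>B\<^esub>"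
  using braided by (simp_all add: braided_hopf_algebra_def)

lemma Bmod: "left_module K H B" and Bcomod: "left_comodule K H B"
  using braidedD(1) by (auto simp: yd_module_def)

lemma Bring: "ring B" and vsB [simp]: "vspace B"
  using braidedD(2) by (auto simp: k_algebra_def)

sublocale B: ring B by (rule Bring)

lemma vsT [simp]: "vspace T" by (rule vs_tensor[OF vsB vsH])

text \<open>Bosonisation replaces only the multiplicative and Hopf fields of \<open>T\<close>.
  Linear computations take place over \<open>T\<close>, where the tensor rules apply literally, and
  are carried over to \<open>A\<close>.\<close>

lemma same_A: "same_space T A" by (simp add: same_space_def bosonisation_def Let_def)

lemma vsA [simp]: "vspace A" by (rule vspace_same[OF same_A vsT])

lemma A_simps: "carrier A = carrier T" "mult A = smash_mult K H B" "one A = tens K B H \<one>\<^bsub>B\<^esub> \<one>\<^bsub>H\<^esub>"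
  "zero A = zero T" "add A = add T" "smult A = smult T"
  "counit A = (\<lambda>t. tlift K (ground K) t (\<lambda>b g. \<epsilon>\<^sub>B b \<otimes> \<epsilon> g))"
  by (simp_all add: bosonisation_def Let_def)

lemma AA: "A \<otimes>\<^sub>t A = T \<otimes>\<^sub>t T" "tens K A A = tens K T T"
  by (rule tensor_same[OF same_A same_A])+

lemma lin_A_iff: "lin A W f \<longleftrightarrow> lin T W f" "lin Z A g \<longleftrightarrow> lin Z T g"
proof -
  have W: "same_space W W" and Z: "same_space Z Z" by (simp_all add: same_space_def)
  show "lin A W f \<longleftrightarrow> lin T W f"
    using lin_same[OF same_A W] lin_same[OF same_space_sym[OF same_A] W] by blast
  show "lin Z A g \<longleftrightarrow> lin Z T g"
    using lin_same[OF Z same_A] lin_same[OF Z same_space_sym[OF same_A]] by blast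
qed

lemma bilin_A_iff: "bilin A A W f \<longleftrightarrow> bilin T T W f" "bilin A V W g \<longleftrightarrow> bilin T V W g" "bilin V A W h \<longleftrightarrow> bilin V T W h"
  by (simp_all add: bilin_def lin_A_iff A_simps)

lemma mult_smult_B:
  assumes "c \<in> carrier K" "x \<in> carrier B" "y \<in> carrier B"
  shows "(c \<odot>\<^bsub>B\<^esub> x) \<otimes>\<^bsub>B\<^esub> y = c \<odot>\<^bsub>B\<^esub> (x \<otimes>\<^bsub>B\<^esub> y)" "x \<otimes>\<^bsub>B\<^esub> (c \<odot>\<^bsub>B\<^esub> y) = c \<odot>\<^bsub>B\<^esub> (x \<otimes>\<^bsub>B\<^esub> y)"
  using braidedD(2) assms by (auto simp: k_algebra_def)

lemma smult_closed_B [simp]: "c \<in> carrier K \<Longrightarrow> x \<in> carrier B \<Longrightarrow> c \<odot>\<^bsub>B\<^esub> x \<in> carrier B"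
  by (rule vsD(5)[OF vsB])

lemma lin_multB1 [lin_intro]: "lin Z B g \<Longrightarrow> y \<in> carrier B \<Longrightarrow> lin Z B (\<lambda>z. g z \<otimes>\<^bsub>B\<^esub> y)"
  by (rule lin_comp[of B B "\<lambda>x. x \<otimes>\<^bsub>B\<^esub> y"]) (auto intro!: linI simp: B.l_distr mult_smult_B)

lemma lin_multB2 [lin_intro]: "lin Z B g \<Longrightarrow> x \<in> carrier B \<Longrightarrow> lin Z B (\<lambda>z. x \<otimes>\<^bsub>B\<^esub> g z)"
  by (rule lin_comp[of B B "\<lambda>y. x \<otimes>\<^bsub>B\<^esub> y"]) (auto intro!: linI simp: B.r_distr mult_smult_B)

lemma lin_bcomult: "lin B (B \<otimes>\<^sub>t B) (bcomult B)"
  using braidedD(3) by (simp add: k_coalgebra_def)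

lemma lin_bcounit: "functional B \<epsilon>\<^sub>B"
  using braidedD(3) by (simp add: k_coalgebra_def)

lemma lin_bantipode: "lin B B (bantipode B)"
  using braidedD(9) by (simp add: yd_hom_def)

lemma epsB_closed [simp]: "b \<in> carrier B \<Longrightarrow> \<epsilon>\<^sub>B b \<in> carrier K"
  by (rule functional_closed[OF lin_bcounit])

lemma bcomult_closed [simp]: "b \<in> carrier B \<Longrightarrow> bcomult B b \<in> carrier (B \<otimes>\<^sub>t B)"
  by (rule linD(3)[OF lin_bcomult])

lemmas B_lin [lin_intro] = lin_comp[OF lin_bcounit] lin_comp[OF lin_bantipode]
  lin_tlift1[OF lin_comp[OF lin_bcomult] vsB] lin_tlift2[OF bcomult_closed vsB vsB] tlift_closed[OF bcomult_closed vsB]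
  lin_bilin1[OF bilin_lact[OF Bmod]] lin_bilin2[OF bilin_lact[OF Bmod]] lcoact_lin[OF Bcomod vsH]

lemmas B_simps [simp] = left_moduleD(6)[OF Bmod] left_comoduleD(3)[OF Bcomod] linD(3)[OF lin_bantipode]
lemmas bcomult_cong = tlift_cong[OF bcomult_closed vsB]
lemmas bcoact_cong = tlift_cong[OF left_comoduleD(3)[OF Bcomod] vsH]

lemma tens_T [simp]: "b \<in> carrier B \<Longrightarrow> h \<in> carrier H \<Longrightarrow> tens K B H b h \<in> carrier T"
  by (rule tens_closed[OF vsB vsH])

lemma bcounit_left:
  assumes f: "lin B U f" and x: "x \<in> carrier B"
  shows "tlift K U (bcomult B x) (\<lambda>a b. \<epsilon>\<^sub>B a \<odot>\<^bsub>U\<^esub> f b) = f x"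
proof -
  have "f (tlift K B (bcomult B x) (\<lambda>a b. \<epsilon>\<^sub>B a \<odot>\<^bsub>B\<^esub> b)) = tlift K U (bcomult B x) (\<lambda>a b. f (\<epsilon>\<^sub>B a \<odot>\<^bsub>B\<^esub> b))"
    by (rule lin_of_tlift[OF f bcomult_closed[OF x] vsB]) (intro lin_intro | simp)+
  also have "\<dots> = tlift K U (bcomult B x) (\<lambda>a b. \<epsilon>\<^sub>B a \<odot>\<^bsub>U\<^esub> f b)"
    by (rule bcomult_cong[OF x]) (intro lin_intro lin_comp[OF f] | simp add: linD[OF f])+
  finally show ?thesis using braidedD(3) x by (simp add: k_coalgebra_def)
qed

lemma bcounit_right:
  assumes f: "lin B U f" and x: "x \<in> carrier B"
  shows "tlift K U (bcomult B x) (\<lambda>a b. \<epsilon>\<^sub>B b \<odot>\<^bsub>U\<^esub> f a) = f x"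
proof -
  have "f (tlift K B (bcomult B x) (\<lambda>a b. \<epsilon>\<^sub>B b \<odot>\<^bsub>B\<^esub> a)) = tlift K U (bcomult B x) (\<lambda>a b. f (\<epsilon>\<^sub>B b \<odot>\<^bsub>B\<^esub> a))"
    by (rule lin_of_tlift[OF f bcomult_closed[OF x] vsB]) (intro lin_intro | simp)+
  also have "\<dots> = tlift K U (bcomult B x) (\<lambda>a b. \<epsilon>\<^sub>B b \<odot>\<^bsub>U\<^esub> f a)"
    by (rule bcomult_cong[OF x]) (intro lin_intro lin_comp[OF f] | simp add: linD[OF f])+
  finally show ?thesis using braidedD(3) x by (simp add: k_coalgebra_def)
qed

lemma unit_space: "same_space (ground K) (yd_unit K H)"
  by (simp add: same_space_def yd_unit_def)

lemma ground_simps [simp]: "carrier (ground K) = carrier K" "smult (ground K) = mult K"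
  by (simp_all add: ground_def)

lemma unit_simps: "carrier (yd_unit K H) = carrier K" "lact (yd_unit K H) h c = \<epsilon> h \<otimes> c"
  "lcoact (yd_unit K H) c = tens K H (ground K) \<one>\<^bsub>H\<^esub> c"
  by (simp_all add: yd_unit_def)

lemma tensor_unit: "tensor K H (yd_unit K H) = tensor K H (ground K)" "tens K H (yd_unit K H) = tens K H (ground K)"
  by (rule tensor_same[OF _ unit_space]; simp add: same_space_def)+

lemma lact_one_B:
  assumes h: "h \<in> carrier H"
  shows "lact B h \<one>\<^bsub>B\<^esub> = \<epsilon> h \<odot>\<^bsub>B\<^esub> \<one>\<^bsub>B\<^esub>"
proof -
  interpret V: vectorspace K B by (rule vsB)
  have "lact (yd_unit K H) h \<one> \<odot>\<^bsub>B\<^esub> \<one>\<^bsub>B\<^esub> = lact B h (\<one> \<odot>\<^bsub>B\<^esub> \<one>\<^bsub>B\<^esub>)"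
    by (rule yd_homD(2)[OF braidedD(4) h]) (simp add: unit_simps)
  then show ?thesis using h by (simp add: unit_simps)
qed

lemma coact_one_B: "lcoact B \<one>\<^bsub>B\<^esub> = tens K H B \<one>\<^bsub>H\<^esub> \<one>\<^bsub>B\<^esub>"
proof -
  interpret V: vectorspace K B by (rule vsB)
  have "lcoact B (\<one> \<odot>\<^bsub>B\<^esub> \<one>\<^bsub>B\<^esub>) = tlift K (H \<otimes>\<^sub>t B) (lcoact (yd_unit K H) \<one>) (\<lambda>h m. tens K H B h (m \<odot>\<^bsub>B\<^esub> \<one>\<^bsub>B\<^esub>))"
    by (rule yd_homD(3)[OF braidedD(4)]) (simp add: unit_simps)
  also have "\<dots> = tens K H B \<one>\<^bsub>H\<^esub> (\<one> \<odot>\<^bsub>B\<^esub> \<one>\<^bsub>B\<^esub>)"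
    unfolding unit_simps by (rule tlift_tens[OF vsH vs_ground]) (intro lin_intro | simp)+
  finally show ?thesis by simp
qed

lemma epsB_lact: "h \<in> carrier H \<Longrightarrow> b \<in> carrier B \<Longrightarrow> \<epsilon>\<^sub>B (lact B h b) = \<epsilon> h \<otimes> \<epsilon>\<^sub>B b"
  using yd_homD(2)[OF braidedD(5)] by (simp add: unit_simps)

lemma epsB_coact: "b \<in> carrier B \<Longrightarrow> tmap H (ground K) (\<lambda>h. h) \<epsilon>\<^sub>B (lcoact B b) = tens K H (ground K) \<one>\<^bsub>H\<^esub> (\<epsilon>\<^sub>B b)"
  using yd_homD(3)[OF braidedD(5)] by (simp add: unit_simps tensor_unit)

text \<open>The counit of \<open>B\<close> is a map of comodules to the trivial object, so b_{-1}
  \<epsilon>(b_0) = \<epsilon>(b) 1.\<close>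

lemma coact_epsB:
  assumes f: "lin H U f" and b: "b \<in> carrier B"
  shows "tlift K U (lcoact B b) (\<lambda>h b0. \<epsilon>\<^sub>B b0 \<odot>\<^bsub>U\<^esub> f h) = \<epsilon>\<^sub>B b \<odot>\<^bsub>U\<^esub> f \<one>\<^bsub>H\<^esub>"
proof -
  have g: "bilin H (ground K) U (\<lambda>h c. c \<odot>\<^bsub>U\<^esub> f h)"
    by (intro bilinI lin_intro lin_comp[OF f] f linD(2,3)[OF f] vs_ground | simp)+
  have "tlift K U (tmap H (ground K) (\<lambda>h. h) \<epsilon>\<^sub>B (lcoact B b)) (\<lambda>h c. c \<odot>\<^bsub>U\<^esub> f h)
    = tlift K U (lcoact B b) (\<lambda>h b0. tlift K U (tens K H (ground K) h (\<epsilon>\<^sub>B b0)) (\<lambda>h c. c \<odot>\<^bsub>U\<^esub> f h))"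
    by (rule tlift_tlift[OF left_comoduleD(3)[OF Bcomod b] vsH _ vsH g]) (intro lin_intro | simp)+
  also have "\<dots> = tlift K U (lcoact B b) (\<lambda>h b0. \<epsilon>\<^sub>B b0 \<odot>\<^bsub>U\<^esub> f h)"
    by (rule bcoact_cong[OF b])
       (intro lin_intro lin_comp[OF f] f linD(2,3)[OF f] | simp add: tlift_tens[OF vsH vs_ground g])+
  finally show ?thesis using b unfolding epsB_coact[OF b] by (simp add: tlift_tens[OF vsH vs_ground g])
qed

lemma bantipode_one [simp]: "bantipode B \<one>\<^bsub>B\<^esub> = \<one>\<^bsub>B\<^esub>"
proof -
  interpret V: vectorspace K B by (rule vsB)
  have "tlift K B (tens K B B \<one>\<^bsub>B\<^esub> \<one>\<^bsub>B\<^esub>) (\<lambda>a b. bantipode B a \<otimes>\<^bsub>B\<^esub> b) = bantipode B \<one>\<^bsub>B\<^esub> \<otimes>\<^bsub>B\<^esub> \<one>\<^bsub>B\<^esub>"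
    by (rule tlift_tens[OF vsB vsB]) (intro lin_intro | simp)+
  then show ?thesis using braidedD(10)[OF B.one_closed] by (simp add: braidedD(7,8))
qed

text \<open>Apply the multiplicative counit to S(b1) b2 = \<epsilon>(b) 1 and absorb \<epsilon>(b2)
  by counitality.\<close>

lemma epsB_antipode: "b \<in> carrier B \<Longrightarrow> \<epsilon>\<^sub>B (bantipode B b) = \<epsilon>\<^sub>B b"
proof -
  assume b: "b \<in> carrier B"
  have "\<epsilon>\<^sub>B (tlift K B (bcomult B b) (\<lambda>a b. bantipode B a \<otimes>\<^bsub>B\<^esub> b)) =
    tlift K (ground K) (bcomult B b) (\<lambda>a b. \<epsilon>\<^sub>B (bantipode B a \<otimes>\<^bsub>B\<^esub> b))"
    by (rule lin_of_tlift[OF lin_bcounit bcomult_closed[OF b] vsB]) (intro lin_intro | simp)+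
  also have "\<dots> = tlift K (ground K) (bcomult B b) (\<lambda>a b. \<epsilon>\<^sub>B b \<odot>\<^bsub>ground K\<^esub> \<epsilon>\<^sub>B (bantipode B a))"
    by (rule bcomult_cong[OF b]) (intro lin_intro | simp add: braidedD(6) m_comm)+
  also have "\<dots> = \<epsilon>\<^sub>B (bantipode B b)"
    by (rule bcounit_right[OF _ b]) (intro lin_intro | simp)+
  finally show ?thesis using b by (simp add: braidedD(10) linD(5)[OF lin_bcounit] braidedD(8))
qed

subsection \<open>Structure maps of the bosonisation\<close>

lemma smash_bilin:
  "b \<in> carrier B \<Longrightarrow> g \<in> carrier H \<Longrightarrow> bilin B H T (\<lambda>d h. tlift K T (\<Delta> g) (\<lambda>g1 g2. tens K B H (b \<otimes>\<^bsub>B\<^esub> lact B g1 d) (g2 \<otimes>\<^bsub>H\<^esub> h)))"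
  "t \<in> carrier T \<Longrightarrow> bilin B H T (\<lambda>b g. tlift K T t (\<lambda>d h. tlift K T (\<Delta> g) (\<lambda>g1 g2. tens K B H (b \<otimes>\<^bsub>B\<^esub> lact B g1 d) (g2 \<otimes>\<^bsub>H\<^esub> h))))"
proof -
  show 1: "bilin B H T (\<lambda>d h. tlift K T (\<Delta> g) (\<lambda>g1 g2. tens K B H (b \<otimes>\<^bsub>B\<^esub> lact B g1 d) (g2 \<otimes>\<^bsub>H\<^esub> h)))"
    if "b \<in> carrier B" "g \<in> carrier H" for b g
    by (intro lin_intro | simp add: that)+
  show "bilin B H T (\<lambda>b g. tlift K T t (\<lambda>d h. tlift K T (\<Delta> g) (\<lambda>g1 g2. tens K B H (b \<otimes>\<^bsub>B\<^esub> lact B g1 d) (g2 \<otimes>\<^bsub>H\<^esub> h))))"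
    if "t \<in> carrier T" for t
    by (intro bilinI lin_tlift2[OF that vsB vsH] vsB vsH vsT 1; (intro lin_intro | simp)+)
qed

lemma bilin_smash: "bilin T T T (smash_mult K H B)"
  unfolding smash_mult_def
proof (rule bilinI)
  fix s assume s: "s \<in> carrier T"
  show "lin T T (\<lambda>t. tlift K T s (\<lambda>b g. tlift K T t (\<lambda>d h. tlift K T (\<Delta> g) (\<lambda>g1 g2. tens K B H (b \<otimes>\<^bsub>B\<^esub> lact B g1 d) (g2 \<otimes>\<^bsub>H\<^esub> h)))))"
    by (intro lin_tlift2[OF s vsB vsH] vsT smash_bilin lin_tlift[OF vsB vsH])
qed (rule lin_tlift[OF vsB vsH smash_bilin(2)])

lemma smash_tens:
  assumes "b \<in> carrier B" "g \<in> carrier H" "d \<in> carrier B" "h \<in> carrier H"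
  shows "smash_mult K H B (tens K B H b g) (tens K B H d h) =
    tlift K T (\<Delta> g) (\<lambda>g1 g2. tens K B H (b \<otimes>\<^bsub>B\<^esub> lact B g1 d) (g2 \<otimes>\<^bsub>H\<^esub> h))"
  unfolding smash_mult_def
  using assms by (simp add: tlift_tens[OF vsB vsH smash_bilin(2)] tlift_tens[OF vsB vsH smash_bilin(1)])

lemma lin_incl: "lin H T \<iota>"
  unfolding boson_incl_def by (intro lin_intro | simp)+

lemma incl_closed [simp]: "h \<in> carrier H \<Longrightarrow> \<iota> h \<in> carrier T"
  by (simp add: boson_incl_def)

lemma proj_bilin: "bilin B H H (\<lambda>b h. \<epsilon>\<^sub>B b \<odot>\<^bsub>H\<^esub> h)"
  by (intro lin_intro | simp)+

lemma lin_proj: "lin T H \<pi>"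
  unfolding boson_proj_def by (rule lin_tlift[OF vsB vsH proj_bilin])

lemma proj_tens: "b \<in> carrier B \<Longrightarrow> h \<in> carrier H \<Longrightarrow> \<pi> (tens K B H b h) = \<epsilon>\<^sub>B b \<odot>\<^bsub>H\<^esub> h"
  unfolding boson_proj_def by (simp add: tlift_tens[OF vsB vsH proj_bilin])

lemma proj_closed [simp]: "t \<in> carrier T \<Longrightarrow> \<pi> t \<in> carrier H"
  by (rule linD(3)[OF lin_proj])

lemma proj_incl [simp]: "h \<in> carrier H \<Longrightarrow> \<pi> (\<iota> h) = h"
  using module.smult_one[OF vsD(2)[OF vsH]] by (simp add: boson_incl_def proj_tens braidedD(8))

lemmas smash_intro [lin_intro] = lin_bilin1[OF bilin_smash] lin_bilin2[OF bilin_smash] lin_comp[OF lin_incl] lin_comp[OF lin_proj]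

lemma smash_closed [simp]: "s \<in> carrier T \<Longrightarrow> t \<in> carrier T \<Longrightarrow> smash_mult K H B s t \<in> carrier T"
  by (rule bilinD(3)[OF bilin_smash])

text \<open>The unit of \<open>B\<close> is invariant, so g1 acts on it through the counit and only
  g2 survives.\<close>

lemma incl_mult:
  assumes "g \<in> carrier H" "h \<in> carrier H"
  shows "smash_mult K H B (\<iota> g) (\<iota> h) = \<iota> (g \<otimes>\<^bsub>H\<^esub> h)"
proof -
  have "smash_mult K H B (\<iota> g) (\<iota> h) = tlift K T (\<Delta> g) (\<lambda>g1 g2. tens K B H (\<one>\<^bsub>B\<^esub> \<otimes>\<^bsub>B\<^esub> lact B g1 \<one>\<^bsub>B\<^esub>) (g2 \<otimes>\<^bsub>H\<^esub> h))"
    using assms by (simp add: boson_incl_def smash_tens)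
  also have "\<dots> = tlift K T (\<Delta> g) (\<lambda>g1 g2. \<epsilon> g1 \<odot>\<^bsub>T\<^esub> tens K B H \<one>\<^bsub>B\<^esub> (g2 \<otimes>\<^bsub>H\<^esub> h))"
    by (rule comult_cong[OF assms(1)])
       (intro lin_intro | simp add: assms lact_one_B linD(5)[OF bilinD(2)[OF bilin_tens[OF vsB vsH]]])+
  also have "\<dots> = \<iota> (g \<otimes>\<^bsub>H\<^esub> h)"
    unfolding boson_incl_def by (rule counit_left[OF _ assms(1)]) (intro lin_intro | simp add: assms)+
  finally show ?thesis .
qed

text \<open>Every pure tensor is a product (b # 1)(1 # h). Actions of the bosonisation are analysed
  through this factorisation into a part from \<open>B\<close> and a part from
  \<open>H\<close>.\<close>

lemma tens_factor:
  assumes "b \<in> carrier B" "h \<in> carrier H"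
  shows "smash_mult K H B (tens K B H b \<one>\<^bsub>H\<^esub>) (\<iota> h) = tens K B H b h"
proof -
  interpret V: vectorspace K B by (rule vsB)
  have "tlift K T (tens K H H \<one>\<^bsub>H\<^esub> \<one>\<^bsub>H\<^esub>) (\<lambda>g1 g2. tens K B H (b \<otimes>\<^bsub>B\<^esub> lact B g1 \<one>\<^bsub>B\<^esub>) (g2 \<otimes>\<^bsub>H\<^esub> h))
    = tens K B H (b \<otimes>\<^bsub>B\<^esub> lact B \<one>\<^bsub>H\<^esub> \<one>\<^bsub>B\<^esub>) (\<one>\<^bsub>H\<^esub> \<otimes>\<^bsub>H\<^esub> h)"
    by (rule tlift_HH) (intro lin_intro | simp add: assms)+
  then show ?thesis using assms by (simp add: boson_incl_def smash_tens comult_one lact_one_B)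
qed

text \<open>The commutation rule of the smash product, (1 # h)(b # 1) = (h1 b # 1)(1 # h2), which
  moves elements of \<open>B\<close> to the front.\<close>

lemma incl_tens:
  assumes "b \<in> carrier B" "h \<in> carrier H"
  shows "smash_mult K H B (\<iota> h) (tens K B H b \<one>\<^bsub>H\<^esub>) =
    tlift K T (\<Delta> h) (\<lambda>h1 h2. smash_mult K H B (tens K B H (lact B h1 b) \<one>\<^bsub>H\<^esub>) (\<iota> h2))"
proof -
  have "smash_mult K H B (\<iota> h) (tens K B H b \<one>\<^bsub>H\<^esub>)
    = tlift K T (\<Delta> h) (\<lambda>h1 h2. tens K B H (\<one>\<^bsub>B\<^esub> \<otimes>\<^bsub>B\<^esub> lact B h1 b) (h2 \<otimes>\<^bsub>H\<^esub> \<one>\<^bsub>H\<^esub>))"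
    using assms by (simp add: boson_incl_def smash_tens)
  also have "\<dots> = tlift K T (\<Delta> h) (\<lambda>h1 h2. smash_mult K H B (tens K B H (lact B h1 b) \<one>\<^bsub>H\<^esub>) (\<iota> h2))"
    by (rule comult_cong[OF assms(2)]) (intro lin_intro | simp add: assms tens_factor)+
  finally show ?thesis .
qed

lemma proj_mult:
  assumes "s \<in> carrier T" "t \<in> carrier T"
  shows "\<pi> (smash_mult K H B s t) = \<pi> s \<otimes>\<^bsub>H\<^esub> \<pi> t"
proof (rule tensor_ext[OF vsB vsH _ _ _ assms(1)])
  show "lin T H (\<lambda>s. \<pi> (smash_mult K H B s t))" "lin T H (\<lambda>s. \<pi> s \<otimes>\<^bsub>H\<^esub> \<pi> t)"
    by (intro lin_intro | simp add: assms)+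
  fix b g assume bg: "b \<in> carrier B" "g \<in> carrier H"
  show "\<pi> (smash_mult K H B (tens K B H b g) t) = \<pi> (tens K B H b g) \<otimes>\<^bsub>H\<^esub> \<pi> t"
  proof (rule tensor_ext[OF vsB vsH _ _ _ assms(2)])
    show "lin T H (\<lambda>t. \<pi> (smash_mult K H B (tens K B H b g) t))" "lin T H (\<lambda>t. \<pi> (tens K B H b g) \<otimes>\<^bsub>H\<^esub> \<pi> t)"
      by (intro lin_intro | simp add: bg)+
    fix d h assume dh: "d \<in> carrier B" "h \<in> carrier H"
    interpret V: vectorspace K H by (rule vsH)
    have "\<pi> (smash_mult K H B (tens K B H b g) (tens K B H d h))
      = tlift K H (\<Delta> g) (\<lambda>g1 g2. \<pi> (tens K B H (b \<otimes>\<^bsub>B\<^esub> lact B g1 d) (g2 \<otimes>\<^bsub>H\<^esub> h)))"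
      unfolding smash_tens[OF bg dh] by (rule comult_apply[OF lin_proj bg(2)]) (intro lin_intro | simp add: bg dh)+
    also have "\<dots> = tlift K H (\<Delta> g) (\<lambda>g1 g2. \<epsilon> g1 \<odot>\<^bsub>H\<^esub> ((\<epsilon>\<^sub>B b \<otimes> \<epsilon>\<^sub>B d) \<odot>\<^bsub>H\<^esub> (g2 \<otimes>\<^bsub>H\<^esub> h)))"
      by (rule comult_cong[OF bg(2)])
         (intro lin_intro | simp add: bg dh proj_tens braidedD(6) epsB_lact m_ac flip: V.smult_assoc1)+
    also have "\<dots> = (\<epsilon>\<^sub>B b \<otimes> \<epsilon>\<^sub>B d) \<odot>\<^bsub>H\<^esub> (g \<otimes>\<^bsub>H\<^esub> h)"
      by (rule counit_left[OF _ bg(2)]) (intro lin_intro | simp add: bg dh)+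
    finally show "\<pi> (smash_mult K H B (tens K B H b g) (tens K B H d h)) = \<pi> (tens K B H b g) \<otimes>\<^bsub>H\<^esub> \<pi> (tens K B H d h)"
      using bg dh by (simp add: proj_tens mult_smult m_comm flip: V.smult_assoc1)
  qed
qed

lemma comultA_def: "comult A t = tlift K (T \<otimes>\<^sub>t T) t (\<lambda>b g.
    tlift K (T \<otimes>\<^sub>t T) (bcomult B b) (\<lambda>b1 b2. tlift K (T \<otimes>\<^sub>t T) (\<Delta> g) (\<lambda>g1 g2.
      tlift K (T \<otimes>\<^sub>t T) (lcoact B b2) (\<lambda>a b20. tens K T T (tens K B H b1 (a \<otimes>\<^bsub>H\<^esub> g1)) (tens K B H b20 g2)))))"
  by (simp add: bosonisation_def Let_def)

lemma vsTT [simp]: "vspace (T \<otimes>\<^sub>t T)" by (rule vs_tensor[OF vsT vsT])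

lemma comultA_bilin: "bilin B H (T \<otimes>\<^sub>t T) (\<lambda>b g.
    tlift K (T \<otimes>\<^sub>t T) (bcomult B b) (\<lambda>b1 b2. tlift K (T \<otimes>\<^sub>t T) (\<Delta> g) (\<lambda>g1 g2.
      tlift K (T \<otimes>\<^sub>t T) (lcoact B b2) (\<lambda>a b20. tens K T T (tens K B H b1 (a \<otimes>\<^bsub>H\<^esub> g1)) (tens K B H b20 g2)))))"
  by (intro lin_intro | simp)+

lemma lin_comultA: "lin T (T \<otimes>\<^sub>t T) (comult A)"
  unfolding comultA_def by (rule lin_tlift[OF vsB vsH comultA_bilin])

lemma comultA_closed [simp]: "t \<in> carrier T \<Longrightarrow> comult A t \<in> carrier (T \<otimes>\<^sub>t T)"
  by (rule linD(3)[OF lin_comultA])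

lemmas comultA_intro [lin_intro] = lin_tlift1[OF lin_comp[OF lin_comultA] vsT]
  lin_tlift2[OF comultA_closed vsT vsT] tlift_closed[OF comultA_closed vsT]

lemma comultA_apply:
  assumes \<beta>: "bilin T T U \<beta>" and b: "b \<in> carrier B" and g: "g \<in> carrier H"
  shows "tlift K U (comult A (tens K B H b g)) \<beta> =
    tlift K U (bcomult B b) (\<lambda>b1 b2. tlift K U (\<Delta> g) (\<lambda>g1 g2.
      tlift K U (lcoact B b2) (\<lambda>a b20. \<beta> (tens K B H b1 (a \<otimes>\<^bsub>H\<^esub> g1)) (tens K B H b20 g2))))"
proof -
  let ?F = "\<lambda>t. tlift K U t \<beta>" and ?TT = "T \<otimes>\<^sub>t T"
  let ?t = "\<lambda>b1 g1 g2 a b20. tens K T T (tens K B H b1 (a \<otimes>\<^bsub>H\<^esub> g1)) (tens K B H b20 g2)"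
  note F = lin_tlift[OF vsT vsT \<beta>]
  note [simp] = linD(2)[OF F]
  note [lin_intro] = lin_bilin1[OF \<beta>] lin_bilin2[OF \<beta>]
  have "?F (comult A (tens K B H b g)) = ?F (tlift K ?TT (bcomult B b) (\<lambda>b1 b2. tlift K ?TT (\<Delta> g) (\<lambda>g1 g2.
      tlift K ?TT (lcoact B b2) (\<lambda>a b20. ?t b1 g1 g2 a b20))))"
    unfolding comultA_def using b g by (simp add: tlift_tens[OF vsB vsH comultA_bilin])
  also have "\<dots> = tlift K U (bcomult B b) (\<lambda>b1 b2. ?F (tlift K ?TT (\<Delta> g) (\<lambda>g1 g2.
      tlift K ?TT (lcoact B b2) (\<lambda>a b20. ?t b1 g1 g2 a b20))))"
    by (rule lin_of_tlift[OF F bcomult_closed[OF b] vsB]) (intro lin_intro | simp add: g)+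
  also have "\<dots> = tlift K U (bcomult B b) (\<lambda>b1 b2. tlift K U (\<Delta> g) (\<lambda>g1 g2.
      tlift K U (lcoact B b2) (\<lambda>a b20. \<beta> (tens K B H b1 (a \<otimes>\<^bsub>H\<^esub> g1)) (tens K B H b20 g2))))"
  proof (rule bcomult_cong[OF b])
    fix b1 b2 assume bb: "b1 \<in> carrier B" "b2 \<in> carrier B"
    have "?F (tlift K ?TT (\<Delta> g) (\<lambda>g1 g2. tlift K ?TT (lcoact B b2) (\<lambda>a b20. ?t b1 g1 g2 a b20)))
      = tlift K U (\<Delta> g) (\<lambda>g1 g2. ?F (tlift K ?TT (lcoact B b2) (\<lambda>a b20. ?t b1 g1 g2 a b20)))"
      by (rule lin_of_tlift[OF F comult_closed[OF g] vsH]) (intro lin_intro | simp add: bb)+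
    also have "\<dots> = tlift K U (\<Delta> g) (\<lambda>g1 g2.
      tlift K U (lcoact B b2) (\<lambda>a b20. \<beta> (tens K B H b1 (a \<otimes>\<^bsub>H\<^esub> g1)) (tens K B H b20 g2)))"
    proof (rule comult_cong[OF g])
      fix g1 g2 assume gg: "g1 \<in> carrier H" "g2 \<in> carrier H"
      have "?F (tlift K ?TT (lcoact B b2) (\<lambda>a b20. ?t b1 g1 g2 a b20))
        = tlift K U (lcoact B b2) (\<lambda>a b20. ?F (?t b1 g1 g2 a b20))"
        by (rule lin_of_tlift[OF F left_comoduleD(3)[OF Bcomod bb(2)] vsH]) (intro lin_intro | simp add: bb gg)+
      also have "\<dots> = tlift K U (lcoact B b2) (\<lambda>a b20. \<beta> (tens K B H b1 (a \<otimes>\<^bsub>H\<^esub> g1)) (tens K B H b20 g2))"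
        by (rule bcoact_cong[OF bb(2)]) (intro lin_intro | simp add: bb gg tlift_tens[OF vsT vsT \<beta>])+
      finally show "?F (tlift K ?TT (lcoact B b2) (\<lambda>a b20. ?t b1 g1 g2 a b20)) = \<dots>" .
    qed (intro lin_intro | simp add: bb)+
    finally show "?F (tlift K ?TT (\<Delta> g) (\<lambda>g1 g2. tlift K ?TT (lcoact B b2) (\<lambda>a b20. ?t b1 g1 g2 a b20))) = \<dots>" .
  qed (intro lin_intro | simp add: g)+
  finally show ?thesis .
qed

text \<open>The unit of \<open>B\<close> is grouplike and coinvariant, so the comultiplication of 1
  # h sees only h. In this form: \<iota> is a map of coalgebras.\<close>

lemma comultA_incl:
  assumes \<beta>: "bilin T T U \<beta>" and h: "h \<in> carrier H"
  shows "tlift K U (comult A (\<iota> h)) \<beta> = tlift K U (\<Delta> h) (\<lambda>h1 h2. \<beta> (\<iota> h1) (\<iota> h2))"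
proof -
  note [simp] = bilin_vs(2)[OF \<beta> vsT]
  note [lin_intro] = lin_bilin1[OF \<beta>] lin_bilin2[OF \<beta>]
  have "tlift K U (comult A (\<iota> h)) \<beta> = tlift K U (tens K B B \<one>\<^bsub>B\<^esub> \<one>\<^bsub>B\<^esub>) (\<lambda>b1 b2. tlift K U (\<Delta> h) (\<lambda>g1 g2.
      tlift K U (lcoact B b2) (\<lambda>a b20. \<beta> (tens K B H b1 (a \<otimes>\<^bsub>H\<^esub> g1)) (tens K B H b20 g2))))"
    unfolding boson_incl_def using h by (simp add: comultA_apply[OF \<beta>] braidedD(7))
  also have "\<dots> = tlift K U (\<Delta> h) (\<lambda>g1 g2.
      tlift K U (tens K H B \<one>\<^bsub>H\<^esub> \<one>\<^bsub>B\<^esub>) (\<lambda>a b20. \<beta> (tens K B H \<one>\<^bsub>B\<^esub> (a \<otimes>\<^bsub>H\<^esub> g1)) (tens K B H b20 g2)))"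
    unfolding coact_one_B[symmetric] by (rule tlift_tens[OF vsB vsB]) (intro lin_intro | simp add: h)+
  also have "\<dots> = tlift K U (\<Delta> h) (\<lambda>h1 h2. \<beta> (\<iota> h1) (\<iota> h2))"
  proof (rule comult_cong[OF h])
    fix g1 g2 assume gg: "g1 \<in> carrier H" "g2 \<in> carrier H"
    have "tlift K U (tens K H B \<one>\<^bsub>H\<^esub> \<one>\<^bsub>B\<^esub>) (\<lambda>a b20. \<beta> (tens K B H \<one>\<^bsub>B\<^esub> (a \<otimes>\<^bsub>H\<^esub> g1)) (tens K B H b20 g2))
      = \<beta> (tens K B H \<one>\<^bsub>B\<^esub> (\<one>\<^bsub>H\<^esub> \<otimes>\<^bsub>H\<^esub> g1)) (tens K B H \<one>\<^bsub>B\<^esub> g2)"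
      by (rule tlift_tens[OF vsH vsB]) (intro lin_intro | simp add: gg)+
    then show "tlift K U (tens K H B \<one>\<^bsub>H\<^esub> \<one>\<^bsub>B\<^esub>) (\<lambda>a b20. \<beta> (tens K B H \<one>\<^bsub>B\<^esub> (a \<otimes>\<^bsub>H\<^esub> g1)) (tens K B H b20 g2))
      = \<beta> (\<iota> g1) (\<iota> g2)" using gg by (simp add: boson_incl_def)
  qed (intro lin_intro | simp)+
  finally show ?thesis .
qed

lemma comultA_tens_one:
  assumes \<beta>: "bilin T T U \<beta>" and b: "b \<in> carrier B"
  shows "tlift K U (comult A (tens K B H b \<one>\<^bsub>H\<^esub>)) \<beta> =
    tlift K U (bcomult B b) (\<lambda>b1 b2. tlift K U (lcoact B b2) (\<lambda>a b20. \<beta> (tens K B H b1 a) (tens K B H b20 \<one>\<^bsub>H\<^esub>)))"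
proof -
  note [simp] = bilin_vs(2)[OF \<beta> vsT]
  note [lin_intro] = lin_bilin1[OF \<beta>] lin_bilin2[OF \<beta>]
  have [simp]: "\<beta> x y \<in> carrier U" if "x \<in> carrier T" "y \<in> carrier T" for x y
    using that by (rule bilinD(3)[OF \<beta>])
  show ?thesis
    unfolding comultA_apply[OF \<beta> b H.one_closed] comult_one
  proof (rule bcomult_cong[OF b])
    fix b1 b2 assume bb: "b1 \<in> carrier B" "b2 \<in> carrier B"
    have "tlift K U (tens K H H \<one>\<^bsub>H\<^esub> \<one>\<^bsub>H\<^esub>) (\<lambda>g1 g2. tlift K U (lcoact B b2) (\<lambda>a b20. \<beta> (tens K B H b1 (a \<otimes>\<^bsub>H\<^esub> g1)) (tens K B H b20 g2)))
      = tlift K U (lcoact B b2) (\<lambda>a b20. \<beta> (tens K B H b1 (a \<otimes>\<^bsub>H\<^esub> \<one>\<^bsub>H\<^esub>)) (tens K B H b20 \<one>\<^bsub>H\<^esub>))"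
      by (rule tlift_HH) (intro lin_intro | simp add: bb)+
    also have "\<dots> = tlift K U (lcoact B b2) (\<lambda>a b20. \<beta> (tens K B H b1 a) (tens K B H b20 \<one>\<^bsub>H\<^esub>))"
      by (rule bcoact_cong[OF bb(2)]) (intro lin_intro | simp add: bb)+
    finally show "tlift K U (tens K H H \<one>\<^bsub>H\<^esub> \<one>\<^bsub>H\<^esub>) (\<lambda>g1 g2. tlift K U (lcoact B b2) (\<lambda>a b20. \<beta> (tens K B H b1 (a \<otimes>\<^bsub>H\<^esub> g1)) (tens K B H b20 g2)))
      = \<dots>" .
  qed (intro lin_intro | simp)+
qed

lemma lin_smultU: "bilin V W U \<beta> \<Longrightarrow> x \<in> carrier V \<Longrightarrow> y \<in> carrier W \<Longrightarrow> c \<in> carrier K \<Longrightarrow> \<beta> (c \<odot>\<^bsub>V\<^esub> x) y = c \<odot>\<^bsub>U\<^esub> \<beta> x y"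
  "bilin V W U \<beta> \<Longrightarrow> x \<in> carrier V \<Longrightarrow> y \<in> carrier W \<Longrightarrow> c \<in> carrier K \<Longrightarrow> \<beta> x (c \<odot>\<^bsub>W\<^esub> y) = c \<odot>\<^bsub>U\<^esub> \<beta> x y"
  by (rule linD(5)[OF bilinD(2)] linD(5)[OF bilinD(1)]; assumption)+

text \<open>Projecting the second leg of (b1 # b2_{-1}) \<otimes> (b2_0 # 1) leaves a counit on
  b2_0, which collapses the coaction and then b2. This expresses that b # 1 is coinvariant for the
  right coaction of \<open>H\<close> through \<pi>.\<close>

lemma comultA_proj_right:
  assumes \<beta>: "bilin T H U \<beta>" and b: "b \<in> carrier B"
  shows "tlift K U (comult A (tens K B H b \<one>\<^bsub>H\<^esub>)) (\<lambda>s t. \<beta> s (\<pi> t)) = \<beta> (tens K B H b \<one>\<^bsub>H\<^esub>) \<one>\<^bsub>H\<^esub>"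
proof -
  note [simp] = bilin_vs(2)[OF \<beta> vsT]
  note [lin_intro] = lin_bilin1[OF \<beta>] lin_bilin2[OF \<beta>]
  have [simp]: "\<beta> x y \<in> carrier U" if "x \<in> carrier T" "y \<in> carrier H" for x y
    using that by (rule bilinD(3)[OF \<beta>])
  have "tlift K U (comult A (tens K B H b \<one>\<^bsub>H\<^esub>)) (\<lambda>s t. \<beta> s (\<pi> t)) = 
    tlift K U (bcomult B b) (\<lambda>b1 b2. tlift K U (lcoact B b2) (\<lambda>a b20. \<beta> (tens K B H b1 a) (\<pi> (tens K B H b20 \<one>\<^bsub>H\<^esub>))))"
    by (rule comultA_tens_one[OF _ b]) (intro lin_intro | simp)+
  also have "\<dots> = tlift K U (bcomult B b) (\<lambda>b1 b2. \<epsilon>\<^sub>B b2 \<odot>\<^bsub>U\<^esub> \<beta> (tens K B H b1 \<one>\<^bsub>H\<^esub>) \<one>\<^bsub>H\<^esub>)"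
  proof (rule bcomult_cong[OF b])
    fix b1 b2 assume bb: "b1 \<in> carrier B" "b2 \<in> carrier B"
    have "tlift K U (lcoact B b2) (\<lambda>a b20. \<beta> (tens K B H b1 a) (\<pi> (tens K B H b20 \<one>\<^bsub>H\<^esub>)))
      = tlift K U (lcoact B b2) (\<lambda>a b20. \<epsilon>\<^sub>B b20 \<odot>\<^bsub>U\<^esub> \<beta> (tens K B H b1 a) \<one>\<^bsub>H\<^esub>)"
      by (rule bcoact_cong[OF bb(2)]) (intro lin_intro | simp add: bb proj_tens lin_smultU(2)[OF \<beta>])+
    also have "\<dots> = \<epsilon>\<^sub>B b2 \<odot>\<^bsub>U\<^esub> \<beta> (tens K B H b1 \<one>\<^bsub>H\<^esub>) \<one>\<^bsub>H\<^esub>"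
      by (rule coact_epsB[OF _ bb(2)]) (intro lin_intro | simp add: bb)+
    finally show "tlift K U (lcoact B b2) (\<lambda>a b20. \<beta> (tens K B H b1 a) (\<pi> (tens K B H b20 \<one>\<^bsub>H\<^esub>))) = \<dots>" .
  qed (intro lin_intro | simp)+
  also have "\<dots> = \<beta> (tens K B H b \<one>\<^bsub>H\<^esub>) \<one>\<^bsub>H\<^esub>"
    by (rule bcounit_right[OF _ b]) (intro lin_intro | simp)+
  finally show ?thesis .
qed

text \<open>Projecting the first leg of (b1 # b2_{-1}) \<otimes> (b2_0 # 1) leaves a counit on b1;
  what remains is the \<open>H\<close>-coaction of b.\<close>

lemma comultA_proj_left:
  assumes \<beta>: "bilin H T U \<beta>" and b: "b \<in> carrier B"
  shows "tlift K U (comult A (tens K B H b \<one>\<^bsub>H\<^esub>)) (\<lambda>s t. \<beta> (\<pi> s) t) =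
    tlift K U (lcoact B b) (\<lambda>a b0. \<beta> a (tens K B H b0 \<one>\<^bsub>H\<^esub>))"
proof -
  note [simp] = bilin_vs(2)[OF \<beta> vsH]
  note [lin_intro] = lin_bilin1[OF \<beta>] lin_bilin2[OF \<beta>]
  have [simp]: "\<beta> x y \<in> carrier U" if "x \<in> carrier H" "y \<in> carrier T" for x y
    using that by (rule bilinD(3)[OF \<beta>])
  have "tlift K U (comult A (tens K B H b \<one>\<^bsub>H\<^esub>)) (\<lambda>s t. \<beta> (\<pi> s) t) = 
    tlift K U (bcomult B b) (\<lambda>b1 b2. tlift K U (lcoact B b2) (\<lambda>a b20. \<beta> (\<pi> (tens K B H b1 a)) (tens K B H b20 \<one>\<^bsub>H\<^esub>)))"
    by (rule comultA_tens_one[OF _ b]) (intro lin_intro | simp)+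
  also have "\<dots> = tlift K U (bcomult B b) (\<lambda>b1 b2. \<epsilon>\<^sub>B b1 \<odot>\<^bsub>U\<^esub> tlift K U (lcoact B b2) (\<lambda>a b20. \<beta> a (tens K B H b20 \<one>\<^bsub>H\<^esub>)))"
  proof (rule bcomult_cong[OF b])
    fix b1 b2 assume bb: "b1 \<in> carrier B" "b2 \<in> carrier B"
    have "tlift K U (lcoact B b2) (\<lambda>a b20. \<beta> (\<pi> (tens K B H b1 a)) (tens K B H b20 \<one>\<^bsub>H\<^esub>))
      = tlift K U (lcoact B b2) (\<lambda>a b20. \<epsilon>\<^sub>B b1 \<odot>\<^bsub>U\<^esub> \<beta> a (tens K B H b20 \<one>\<^bsub>H\<^esub>))"
      by (rule bcoact_cong[OF bb(2)]) (intro lin_intro | simp add: bb proj_tens lin_smultU(1)[OF \<beta>])+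
    also have "\<dots> = \<epsilon>\<^sub>B b1 \<odot>\<^bsub>U\<^esub> tlift K U (lcoact B b2) (\<lambda>a b20. \<beta> a (tens K B H b20 \<one>\<^bsub>H\<^esub>))"
      by (rule lin_of_tlift[where f = "\<lambda>u. \<epsilon>\<^sub>B b1 \<odot>\<^bsub>U\<^esub> u", OF _ left_comoduleD(3)[OF Bcomod bb(2)] vsH, symmetric])
         (intro lin_intro | simp add: bb)+
    finally show "tlift K U (lcoact B b2) (\<lambda>a b20. \<beta> (\<pi> (tens K B H b1 a)) (tens K B H b20 \<one>\<^bsub>H\<^esub>)) = \<dots>" .
  qed (intro lin_intro | simp)+
  also have "\<dots> = tlift K U (lcoact B b) (\<lambda>a b20. \<beta> a (tens K B H b20 \<one>\<^bsub>H\<^esub>))"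
    by (rule bcounit_left[OF _ b]) (intro lin_intro | simp)+
  finally show ?thesis .
qed

text \<open>After projecting both legs, only counits of b1 and b2_0 remain, which absorb the
  coaction and the comultiplication of \<open>B\<close>. In this form: \<pi> is a map of coalgebras,
  as needed to restrict coactions along it.\<close>

lemma comultA_proj:
  assumes \<beta>: "bilin H H U \<beta>" and t: "t \<in> carrier T"
  shows "tlift K U (comult A t) (\<lambda>s u. \<beta> (\<pi> s) (\<pi> u)) = tlift K U (\<Delta> (\<pi> t)) \<beta>"
proof -
  note [simp] = bilin_vs(2)[OF \<beta> vsH]
  note [lin_intro] = lin_bilin1[OF \<beta>] lin_bilin2[OF \<beta>]
  have [simp]: "\<beta> x y \<in> carrier U" if "x \<in> carrier H" "y \<in> carrier H" for x y
    using that by (rule bilinD(3)[OF \<beta>])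
  interpret U: vectorspace K U by simp
  show ?thesis
  proof (rule tensor_ext[OF vsB vsH _ _ _ t])
    show "lin T U (\<lambda>t. tlift K U (comult A t) (\<lambda>s u. \<beta> (\<pi> s) (\<pi> u)))" by (intro lin_intro | simp)+
    show "lin T U (\<lambda>t. tlift K U (\<Delta> (\<pi> t)) \<beta>)" by (rule lin_tlift1[OF lin_comp[OF hopfD(5) lin_proj] vsH \<beta>])
    fix b g assume bg: "b \<in> carrier B" "g \<in> carrier H"
    have lg: "lin H U (\<lambda>g. tlift K U (\<Delta> g) \<beta>)" by (rule lin_tlift1[OF hopfD(5) vsH \<beta>])
    have [simp]: "tlift K U (\<Delta> g) \<beta> \<in> carrier U" by (rule linD(3)[OF lg bg(2)])
    have "tlift K U (comult A (tens K B H b g)) (\<lambda>s u. \<beta> (\<pi> s) (\<pi> u)) = tlift K U (bcomult B b) (\<lambda>b1 b2. tlift K U (\<Delta> g) (\<lambda>g1 g2.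
      tlift K U (lcoact B b2) (\<lambda>a b20. \<beta> (\<pi> (tens K B H b1 (a \<otimes>\<^bsub>H\<^esub> g1))) (\<pi> (tens K B H b20 g2)))))"
      by (rule comultA_apply[OF _ bg]) (intro lin_intro | simp)+
    also have "\<dots> = tlift K U (bcomult B b) (\<lambda>b1 b2. \<epsilon>\<^sub>B b2 \<odot>\<^bsub>U\<^esub> (\<epsilon>\<^sub>B b1 \<odot>\<^bsub>U\<^esub> tlift K U (\<Delta> g) \<beta>))"
    proof (rule bcomult_cong[OF bg(1)])
      fix b1 b2 assume bb: "b1 \<in> carrier B" "b2 \<in> carrier B"
      have "tlift K U (\<Delta> g) (\<lambda>g1 g2. tlift K U (lcoact B b2) (\<lambda>a b20. \<beta> (\<pi> (tens K B H b1 (a \<otimes>\<^bsub>H\<^esub> g1))) (\<pi> (tens K B H b20 g2))))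
        = tlift K U (\<Delta> g) (\<lambda>g1 g2. \<epsilon>\<^sub>B b2 \<odot>\<^bsub>U\<^esub> (\<epsilon>\<^sub>B b1 \<odot>\<^bsub>U\<^esub> \<beta> g1 g2))"
      proof (rule comult_cong[OF bg(2)])
        fix g1 g2 assume gg: "g1 \<in> carrier H" "g2 \<in> carrier H"
        have "tlift K U (lcoact B b2) (\<lambda>a b20. \<beta> (\<pi> (tens K B H b1 (a \<otimes>\<^bsub>H\<^esub> g1))) (\<pi> (tens K B H b20 g2)))
          = tlift K U (lcoact B b2) (\<lambda>a b20. \<epsilon>\<^sub>B b20 \<odot>\<^bsub>U\<^esub> (\<epsilon>\<^sub>B b1 \<odot>\<^bsub>U\<^esub> \<beta> (a \<otimes>\<^bsub>H\<^esub> g1) g2))"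
          by (rule bcoact_cong[OF bb(2)]) (intro lin_intro | simp add: bb gg proj_tens lin_smultU[OF \<beta>] m_comm flip: U.smult_assoc1)+
        also have "\<dots> = \<epsilon>\<^sub>B b2 \<odot>\<^bsub>U\<^esub> (\<epsilon>\<^sub>B b1 \<odot>\<^bsub>U\<^esub> \<beta> (\<one>\<^bsub>H\<^esub> \<otimes>\<^bsub>H\<^esub> g1) g2)"
          by (rule coact_epsB[OF _ bb(2)]) (intro lin_intro | simp add: bb gg)+
        finally show "tlift K U (lcoact B b2) (\<lambda>a b20. \<beta> (\<pi> (tens K B H b1 (a \<otimes>\<^bsub>H\<^esub> g1))) (\<pi> (tens K B H b20 g2)))
          = \<epsilon>\<^sub>B b2 \<odot>\<^bsub>U\<^esub> (\<epsilon>\<^sub>B b1 \<odot>\<^bsub>U\<^esub> \<beta> g1 g2)" using gg by simp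
      qed (intro lin_intro | simp add: bb)+
      also have "\<dots> = \<epsilon>\<^sub>B b2 \<odot>\<^bsub>U\<^esub> (\<epsilon>\<^sub>B b1 \<odot>\<^bsub>U\<^esub> tlift K U (\<Delta> g) \<beta>)"
        by (rule comult_apply[where f = "\<lambda>u. \<epsilon>\<^sub>B b2 \<odot>\<^bsub>U\<^esub> (\<epsilon>\<^sub>B b1 \<odot>\<^bsub>U\<^esub> u)", OF _ bg(2) \<beta>, symmetric])
           (intro lin_intro | simp add: bb)+
      finally show "tlift K U (\<Delta> g) (\<lambda>g1 g2. tlift K U (lcoact B b2) (\<lambda>a b20. \<beta> (\<pi> (tens K B H b1 (a \<otimes>\<^bsub>H\<^esub> g1))) (\<pi> (tens K B H b20 g2))))
        = \<dots>" .
    qed (intro lin_intro | simp add: bg)+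
    also have "\<dots> = \<epsilon>\<^sub>B b \<odot>\<^bsub>U\<^esub> tlift K U (\<Delta> g) \<beta>"
      by (rule bcounit_right[OF _ bg(1)]) (intro lin_intro | simp add: bg)+
    also have "\<dots> = tlift K U (\<Delta> (\<pi> (tens K B H b g))) \<beta>"
      using bg by (simp add: proj_tens linD(5)[OF lg])
    finally show "tlift K U (comult A (tens K B H b g)) (\<lambda>s u. \<beta> (\<pi> s) (\<pi> u)) = tlift K U (\<Delta> (\<pi> (tens K B H b g))) \<beta>" .
  qed
qed

lemma counitA:
  assumes "t \<in> carrier T"
  shows "counit A t = \<epsilon> (\<pi> t)"
proof -
  have b: "bilin B H (ground K) (\<lambda>b g. \<epsilon>\<^sub>B b \<odot>\<^bsub>ground K\<^esub> \<epsilon> g)" by (intro lin_intro | simp)+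
  show ?thesis
    unfolding A_simps
    by (rule tensor_ext[OF vsB vsH lin_tlift[OF vsB vsH b[simplified]] lin_comp[OF hopfD(6) lin_proj] _ assms])
       (simp add: tlift_tens[OF vsB vsH b[simplified]] proj_tens linD(5)[OF hopfD(6)])
qed

lemma lin_counitA: "lin A (ground K) (counit A)"
  unfolding lin_A_iff by (rule lin_cong[OF lin_comp[OF hopfD(6) lin_proj]]) (simp add: counitA)

lemma lin_comultA': "lin A (A \<otimes>\<^sub>t A) (comult A)"
  unfolding lin_A_iff AA by (rule lin_comultA)

lemma antipodeA_def: "antipode A t = tlift K T t (\<lambda>b h. tlift K T (lcoact B b) (\<lambda>a b0.
        smash_mult K H B (\<iota> (S (a \<otimes>\<^bsub>H\<^esub> h))) (tens K B H (bantipode B b0) \<one>\<^bsub>H\<^esub>)))"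
  by (simp add: bosonisation_def Let_def boson_incl_def)

lemma antipodeA_bilin: "bilin B H T (\<lambda>b h. tlift K T (lcoact B b) (\<lambda>a b0.
        smash_mult K H B (\<iota> (S (a \<otimes>\<^bsub>H\<^esub> h))) (tens K B H (bantipode B b0) \<one>\<^bsub>H\<^esub>)))"
  by (intro lin_intro | simp)+

lemma lin_antipodeA: "lin T T (antipode A)"
  unfolding antipodeA_def by (rule lin_tlift[OF vsB vsH antipodeA_bilin])

lemma antipodeA_closed [simp]: "t \<in> carrier T \<Longrightarrow> antipode A t \<in> carrier T"
  by (rule linD(3)[OF lin_antipodeA])

declare lin_comp[OF lin_antipodeA, lin_intro]

lemma antipodeA_tens:
  "b \<in> carrier B \<Longrightarrow> h \<in> carrier H \<Longrightarrow> antipode A (tens K B H b h) = tlift K T (lcoact B b) (\<lambda>a b0.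
        smash_mult K H B (\<iota> (S (a \<otimes>\<^bsub>H\<^esub> h))) (tens K B H (bantipode B b0) \<one>\<^bsub>H\<^esub>))"
  unfolding antipodeA_def by (simp add: tlift_tens[OF vsB vsH antipodeA_bilin])

lemma antipodeA_incl:
  assumes h: "h \<in> carrier H"
  shows "antipode A (\<iota> h) = \<iota> (S h)"
proof -
  have "antipode A (\<iota> h) = tlift K T (tens K H B \<one>\<^bsub>H\<^esub> \<one>\<^bsub>B\<^esub>) (\<lambda>a b0.
        smash_mult K H B (\<iota> (S (a \<otimes>\<^bsub>H\<^esub> h))) (tens K B H (bantipode B b0) \<one>\<^bsub>H\<^esub>))"
    using h antipodeA_tens[OF B.one_closed h] by (simp add: boson_incl_def coact_one_B)
  also have "\<dots> = smash_mult K H B (\<iota> (S (\<one>\<^bsub>H\<^esub> \<otimes>\<^bsub>H\<^esub> h))) (tens K B H (bantipode B \<one>\<^bsub>B\<^esub>) \<one>\<^bsub>H\<^esub>)"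
    by (rule tlift_tens[OF vsH vsB]) (intro lin_intro | simp add: h)+
  finally show ?thesis
    using h incl_mult[of "S h" "\<one>\<^bsub>H\<^esub>"] by (simp add: boson_incl_def)
qed

text \<open>In the defining formula b_0 enters only through its counit after projection, and
  \<open>coact_epsB\<close> removes b_{-1}. The antipode of \<open>A\<close> appears in the
  Yetter-Drinfeld condition for \<open>N\<close>, so it has to be understood under \<pi> and on the
  image of \<iota>.\<close>

lemma proj_antipodeA:
  assumes "t \<in> carrier T"
  shows "\<pi> (antipode A t) = S (\<pi> t)"
proof (rule tensor_ext[OF vsB vsH _ _ _ assms])
  show "lin T H (\<lambda>t. \<pi> (antipode A t))" "lin T H (\<lambda>t. S (\<pi> t))" by (intro lin_intro | simp)+
  fix b h assume bh: "b \<in> carrier B" "h \<in> carrier H"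
  have "\<pi> (antipode A (tens K B H b h)) = tlift K H (lcoact B b) (\<lambda>a b0.
    \<pi> (smash_mult K H B (\<iota> (S (a \<otimes>\<^bsub>H\<^esub> h))) (tens K B H (bantipode B b0) \<one>\<^bsub>H\<^esub>)))"
    unfolding antipodeA_tens[OF bh]
    by (rule lin_of_tlift[OF lin_proj left_comoduleD(3)[OF Bcomod bh(1)] vsH]) (intro lin_intro | simp add: bh)+
  also have "\<dots> = tlift K H (lcoact B b) (\<lambda>a b0. \<epsilon>\<^sub>B b0 \<odot>\<^bsub>H\<^esub> S (a \<otimes>\<^bsub>H\<^esub> h))"
    by (rule bcoact_cong[OF bh(1)]) (intro lin_intro | simp add: bh proj_mult proj_tens mult_smult epsB_antipode)+
  also have "\<dots> = \<epsilon>\<^sub>B b \<odot>\<^bsub>H\<^esub> S (\<one>\<^bsub>H\<^esub> \<otimes>\<^bsub>H\<^esub> h)"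
    by (rule coact_epsB[OF _ bh(1)]) (intro lin_intro | simp add: bh)+
  finally show "\<pi> (antipode A (tens K B H b h)) = S (\<pi> (tens K B H b h))"
    using bh by (simp add: proj_tens linD(5)[OF hopfD(7)])
qed

end

subsection \<open>Coinvariants and the augmentation image\<close>

locale boson_yd = boson K H B for K :: "'k ring" (structure) and H :: "('k, 'h) hopf_data"
    and B :: "('k, 'h, 'b) braided_hopf_data" +
  fixes N :: "('k, ('b \<times> 'h \<Rightarrow> 'k) set, 'n) lmodcomod"
  assumes yd: "yd_module K A N"
begin

abbreviation R where "R \<equiv> Res_obj K H B N"
abbreviation coinv where "coinv \<equiv> coinvariants K H B N"
abbreviation aug where "aug \<equiv> aug_image K H B N"

lemma Nmod: "left_module K A N" and Ncomod: "left_comodule K A N"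
  using yd by (auto simp: yd_module_def)

lemma vsN [simp]: "vspace N" by (rule left_moduleD(1)[OF Nmod])

lemma AN: "A \<otimes>\<^sub>t V = T \<otimes>\<^sub>t V" "tens K A V = tens K T V" "subtensor K A V = subtensor K T V"
  by (rule tensor_same[OF same_A]; simp add: same_space_def)+

lemma vsTN [simp]: "vspace (T \<otimes>\<^sub>t N)" by (rule vs_tensor[OF vsT vsN])
lemma vsHN [simp]: "vspace (H \<otimes>\<^sub>t N)" by (rule vs_tensor[OF vsH vsN])

lemma bilin_lactN: "bilin T N N (lact N)"
  using bilin_lact[OF Nmod] by (simp add: bilin_A_iff)

lemma lin_coactN: "lin N (T \<otimes>\<^sub>t N) (lcoact N)"
  using left_comoduleD(1)[OF Ncomod] by (simp add: AN)

lemma lactN_closed [simp]: "t \<in> carrier T \<Longrightarrow> n \<in> carrier N \<Longrightarrow> lact N t n \<in> carrier N"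
  by (rule bilinD(3)[OF bilin_lactN])

lemma coactN_closed [simp]: "n \<in> carrier N \<Longrightarrow> lcoact N n \<in> carrier (T \<otimes>\<^sub>t N)"
  by (rule linD(3)[OF lin_coactN])

lemmas N_intro [lin_intro] = lin_bilin1[OF bilin_lactN] lin_bilin2[OF bilin_lactN]
  lin_tlift1[OF lin_comp[OF lin_coactN] vsT] lin_tlift2[OF coactN_closed vsT vsN] tlift_closed[OF coactN_closed vsT]

lemmas coactN_cong = tlift_cong[OF coactN_closed vsT]
lemmas comultA_cong = tlift_cong[OF comultA_closed vsT]

lemma lactN_mult:
  "s \<in> carrier T \<Longrightarrow> t \<in> carrier T \<Longrightarrow> n \<in> carrier N \<Longrightarrow> lact N (smash_mult K H B s t) n = lact N s (lact N t n)"
  using left_moduleD(5)[OF Nmod] by (simp add: A_simps)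

lemma coactN_coassoc:
  assumes "trilin T T N U \<gamma>" "n \<in> carrier N"
  shows "tlift K U (lcoact N n) (\<lambda>h m. tlift K U (comult A h) (\<lambda>h1 h2. \<gamma> h1 h2 m)) =
    tlift K U (lcoact N n) (\<lambda>h m. tlift K U (lcoact N m) (\<lambda>g m'. \<gamma> h g m'))"
  using assms(1) by (intro left_coassoc[OF Ncomod vsA lin_comultA' _ assms(2)])
    (simp add: trilin_def bilin_A_iff lin_A_iff A_simps)

lemma coact_lact:
  assumes "t \<in> carrier T" "n \<in> carrier N"
  shows "lcoact N (lact N t n) = tlift K (T \<otimes>\<^sub>t N) (comult A t) (\<lambda>h1 h'. tlift K (T \<otimes>\<^sub>t N) (comult A h') (\<lambda>h2 h3.
    tlift K (T \<otimes>\<^sub>t N) (lcoact N n) (\<lambda>a m.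
      tens K T N (smash_mult K H B (smash_mult K H B h1 a) (antipode A h3)) (lact N h2 m))))"
  using yd assms by (simp add: yd_module_def A_simps AN)

lemma same_R: "same_space N R" by (simp add: same_space_def Res_obj_def)

lemma R_simps: "carrier R = carrier N" "lact R h = lact N (\<iota> h)" "a_r_coset R = a_r_coset N"
  "lcoact R n = tlift K (H \<otimes>\<^sub>t N) (lcoact N n) (\<lambda>a m. tens K H N (\<pi> a) m)"
  "add R = add N" "smult R = smult N"
  by (simp_all add: Res_obj_def a_r_coset_def r_coset_def fun_eq_iff)

lemma HR: "V \<otimes>\<^sub>t R = V \<otimes>\<^sub>t N" "tens K V R = tens K V N" "subtensor K V R = subtensor K V N"
  by (rule tensor_same[OF _ same_R]; simp add: same_space_def)+

lemma lin_R_iff: "lin R V f \<longleftrightarrow> lin N V f" "lin V R g \<longleftrightarrow> lin V N g"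
proof -
  have V: "same_space V V" by (simp add: same_space_def)
  show "lin R V f \<longleftrightarrow> lin N V f" using lin_same[OF same_R V] lin_same[OF same_space_sym[OF same_R] V] by blast
  show "lin V R g \<longleftrightarrow> lin V N g" using lin_same[OF V same_R] lin_same[OF V same_space_sym[OF same_R]] by blast
qed

lemma vsR [simp]: "vspace R" by (rule vspace_same[OF same_R vsN])

lemma coactR_apply:
  assumes \<beta>: "bilin H N U \<beta>" and n: "n \<in> carrier N"
  shows "tlift K U (lcoact R n) \<beta> = tlift K U (lcoact N n) (\<lambda>a m. \<beta> (\<pi> a) m)"
proof -
  note [lin_intro] = lin_bilin1[OF \<beta>] lin_bilin2[OF \<beta>]
  have "tlift K U (lcoact R n) \<beta> = tlift K U (lcoact N n) (\<lambda>a m. tlift K U (tens K H N (\<pi> a) m) \<beta>)"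
    unfolding R_simps by (rule tlift_tlift[OF coactN_closed[OF n] vsT _ vsH \<beta>]) (intro lin_intro | simp)+
  also have "\<dots> = tlift K U (lcoact N n) (\<lambda>a m. \<beta> (\<pi> a) m)"
    by (rule coactN_cong[OF n]) (intro lin_intro | simp add: tlift_tens[OF vsH vsN \<beta>])+
  finally show ?thesis .
qed

lemma lin_coactR: "lin N (H \<otimes>\<^sub>t N) (lcoact R)"
  unfolding R_simps by (intro lin_intro | simp)+

lemma Rmod: "left_module K H R"
  unfolding left_module_def R_simps lin_R_iff
proof (intro conjI ballI vsR)
  fix n assume n: "n \<in> carrier N"
  have "\<iota> \<one>\<^bsub>H\<^esub> = \<one>\<^bsub>A\<^esub>" by (simp add: A_simps boson_incl_def)
  then show "lact N (\<iota> \<one>\<^bsub>H\<^esub>) n = n" using left_moduleD(4)[OF Nmod n] by simp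
next
  fix g h n assume "g \<in> carrier H" "h \<in> carrier H" "n \<in> carrier N"
  then show "lact N (\<iota> (g \<otimes>\<^bsub>H\<^esub> h)) n = lact N (\<iota> g) (lact N (\<iota> h) n)"
    by (simp add: incl_mult[symmetric] lactN_mult)
qed (intro lin_intro | simp)+

text \<open>Coassociativity and counit of the coaction over \<open>A\<close>, pushed along the
  coalgebra map \<pi> through \<open>comultA_proj\<close> and \<open>counitA\<close>.\<close>

lemma Rcomod: "left_comodule K H R"
  unfolding left_comodule_def HR tensor3_def tens3_def lin_R_iff R_simps(1)
proof (intro conjI ballI lin_coactR)
  fix n assume n: "n \<in> carrier N"
  let ?U = "H \<otimes>\<^sub>t (H \<otimes>\<^sub>t N)"
  let ?t = "\<lambda>a b m. tens K H (H \<otimes>\<^sub>t N) a (tens K H N b m)"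
  note [simp] = vs_tensor tens_closed linD(3)[OF lin_coactR]
  have coR [simp]: "m \<in> carrier N \<Longrightarrow> lcoact R m \<in> carrier (H \<otimes>\<^sub>t N)" for m by (rule linD(3)[OF lin_coactR])
  note [lin_intro] = lin_tlift1[OF lin_comp[OF lin_coactR] vsH] lin_tlift2[OF coR vsH vsN]
  have "tlift K ?U (lcoact R n) (\<lambda>h m. tlift K ?U (\<Delta> h) (\<lambda>h1 h2. ?t h1 h2 m))
    = tlift K ?U (lcoact N n) (\<lambda>a m. tlift K ?U (\<Delta> (\<pi> a)) (\<lambda>h1 h2. ?t h1 h2 m))"
    by (rule coactR_apply[OF _ n]) (intro lin_intro | simp)+
  also have "\<dots> = tlift K ?U (lcoact N n) (\<lambda>a m. tlift K ?U (comult A a) (\<lambda>a1 a2. ?t (\<pi> a1) (\<pi> a2) m))"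
  proof (rule coactN_cong[OF n])
    fix a m assume am: "a \<in> carrier T" "m \<in> carrier N"
    show "tlift K ?U (\<Delta> (\<pi> a)) (\<lambda>h1 h2. ?t h1 h2 m) = tlift K ?U (comult A a) (\<lambda>a1 a2. ?t (\<pi> a1) (\<pi> a2) m)"
      by (rule comultA_proj[OF _ am(1), symmetric]) (intro lin_intro | simp add: am)+
  qed (intro lin_intro | simp)+
  also have "\<dots> = tlift K ?U (lcoact N n) (\<lambda>a m. tlift K ?U (lcoact N m) (\<lambda>a' m'. ?t (\<pi> a) (\<pi> a') m'))"
    by (rule coactN_coassoc[OF _ n]) (intro lin_intro | simp)+
  also have "\<dots> = tlift K ?U (lcoact N n) (\<lambda>a m. tlift K ?U (lcoact R m) (\<lambda>h m'. ?t (\<pi> a) h m'))"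
  proof (rule coactN_cong[OF n])
    fix a m assume am: "a \<in> carrier T" "m \<in> carrier N"
    show "tlift K ?U (lcoact N m) (\<lambda>a' m'. ?t (\<pi> a) (\<pi> a') m') = tlift K ?U (lcoact R m) (\<lambda>h m'. ?t (\<pi> a) h m')"
      by (rule coactR_apply[OF _ am(2), symmetric]) (intro lin_intro | simp add: am)+
  qed (intro lin_intro | simp)+
  also have "\<dots> = tlift K ?U (lcoact R n) (\<lambda>g m. tlift K ?U (lcoact R m) (\<lambda>h m'. ?t g h m'))"
    by (rule coactR_apply[OF _ n, symmetric]) (intro lin_intro | simp)+
  finally show "tlift K ?U (lcoact R n) (\<lambda>h m. tlift K ?U (\<Delta> h) (\<lambda>h1 h2. ?t h1 h2 m))
    = tlift K ?U (lcoact R n) (\<lambda>g m. tlift K ?U (lcoact R m) (\<lambda>h m'. ?t g h m'))" .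
  have "tlift K N (lcoact R n) (\<lambda>h m. \<epsilon> h \<odot>\<^bsub>N\<^esub> m) = tlift K N (lcoact N n) (\<lambda>a m. \<epsilon> (\<pi> a) \<odot>\<^bsub>N\<^esub> m)"
    by (rule coactR_apply[OF _ n]) (intro lin_intro | simp)+
  also have "\<dots> = tlift K N (lcoact N n) (\<lambda>a m. counit A a \<odot>\<^bsub>N\<^esub> m)"
    by (rule coactN_cong[OF n]) (intro lin_intro lin_counitA[unfolded lin_A_iff] | simp add: counitA)+
  also have "\<dots> = n" using Ncomod n by (simp add: left_comodule_def)
  finally have c: "tlift K N (lcoact R n) (\<lambda>h m. \<epsilon> h \<odot>\<^bsub>N\<^esub> m) = n" .
  \<comment> \<open>\<open>tlift\<close> takes the target record as an argument; the identity, as a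
    linear map from \<open>N\<close> to \<open>R\<close>, exchanges the one for the other.\<close>
  have "lin N R (\<lambda>x. x)" unfolding lin_R_iff by (rule lin_id[OF vsN])
  then have "tlift K R (lcoact R n) (\<lambda>h m. \<epsilon> h \<odot>\<^bsub>N\<^esub> m) = tlift K N (lcoact R n) (\<lambda>h m. \<epsilon> h \<odot>\<^bsub>N\<^esub> m)"
    by (rule lin_of_tlift[OF _ coR[OF n] vsH, symmetric]) (intro lin_intro | simp)+
  then show "tlift K R (lcoact R n) (\<lambda>h m. \<epsilon> h \<odot>\<^bsub>R\<^esub> m) = n" using c by (simp add: R_simps)
qed

subsubsection \<open>Coinvariants\<close>

lemma incl_subset: "\<iota> ` carrier H \<subseteq> carrier T" by auto

lemma HN_subspace: "subspace K (subtensor K T N (\<iota> ` carrier H) (carrier N)) (T \<otimes>\<^sub>t N)"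
  by (rule subtensor_subspace[OF vsT vsN incl_subset]) simp

lemma coinv_eq: "coinv = {n \<in> carrier N. lcoact N n \<in> subtensor K T N (\<iota> ` carrier H) (carrier N)}"
  by (simp add: coinvariants_def AN)

lemma coinv_subspace: "subspace K coinv N"
  unfolding coinv_eq by (rule subspace_preimage[OF lin_coactN HN_subspace])

lemma coinvD: "n \<in> coinv \<Longrightarrow> n \<in> carrier N" "n \<in> coinv \<Longrightarrow> lcoact N n \<in> subtensor K T N (\<iota> ` carrier H) (carrier N)"
  by (auto simp: coinv_eq)

text \<open>By the Yetter-Drinfeld condition over \<open>A\<close>, the first leg of the coaction of
  \<iota>(h) n is \<iota>(h1) n_{-1} S(\<iota>(h3)). For a coinvariant n all three factors lie in
  \<iota>(H), which is closed under products.\<close>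

lemma coinv_submodule: "left_submodule K H R coinv"
  unfolding left_submodule_def R_simps
proof (intro conjI ballI subspace_same[OF same_R coinv_subspace])
  fix h n assume h: "h \<in> carrier H" and n: "n \<in> coinv"
  note n' = coinvD[OF n]
  let ?U = "T \<otimes>\<^sub>t N" and ?S = "subtensor K T N (\<iota> ` carrier H) (carrier N)"
  let ?b = "\<lambda>h1 h2 h3. tlift K ?U (lcoact N n) (\<lambda>a m.
      tens K T N (smash_mult K H B (smash_mult K H B h1 a) (antipode A h3)) (lact N h2 m))"
  have b: "?b h1 h2 h3 \<in> carrier ?U" if "h1 \<in> carrier T" "h2 \<in> carrier T" "h3 \<in> carrier T" for h1 h2 h3
    by (intro lin_intro | simp add: that n')+
  have "lcoact N (lact N (\<iota> h) n) = tlift K ?U (comult A (\<iota> h)) (\<lambda>h1 h'. tlift K ?U (comult A h') (\<lambda>h2 h3. ?b h1 h2 h3))"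
    using h n' by (simp add: coact_lact)
  also have "\<dots> = tlift K ?U (\<Delta> h) (\<lambda>h1 h'. tlift K ?U (comult A (\<iota> h')) (\<lambda>h2 h3. ?b (\<iota> h1) h2 h3))"
    by (rule comultA_incl[OF _ h]) (intro lin_intro | simp add: n')+
  also have "\<dots> \<in> ?S"
  proof (rule tlift_subspace[OF comult_closed[OF h] vsH _ HN_subspace])
    show "bilin H H ?U (\<lambda>h1 h'. tlift K ?U (comult A (\<iota> h')) (\<lambda>h2 h3. ?b (\<iota> h1) h2 h3))"
      by (intro lin_intro | simp add: n')+
    fix h1 h' assume hh: "h1 \<in> carrier H" "h' \<in> carrier H"
    have "tlift K ?U (comult A (\<iota> h')) (\<lambda>h2 h3. ?b (\<iota> h1) h2 h3) = tlift K ?U (\<Delta> h') (\<lambda>h2 h3. ?b (\<iota> h1) (\<iota> h2) (\<iota> h3))"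
      by (rule comultA_incl[OF _ hh(2)]) (intro lin_intro | simp add: n' hh)+
    also have "\<dots> \<in> ?S"
    proof (rule tlift_subspace[OF comult_closed[OF hh(2)] vsH _ HN_subspace])
      show "bilin H H ?U (\<lambda>h2 h3. ?b (\<iota> h1) (\<iota> h2) (\<iota> h3))" by (intro lin_intro | simp add: n' hh)+
      fix h2 h3 assume h23: "h2 \<in> carrier H" "h3 \<in> carrier H"
      show "?b (\<iota> h1) (\<iota> h2) (\<iota> h3) \<in> ?S"
      proof (rule tlift_subtensor[OF n'(2) vsT _ HN_subspace incl_subset])
        show "bilin T N ?U (\<lambda>a m. tens K T N (smash_mult K H B (smash_mult K H B (\<iota> h1) a) (antipode A (\<iota> h3))) (lact N (\<iota> h2) m))"
          by (intro lin_intro | simp add: n' hh h23)+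
        fix a m assume "a \<in> \<iota> ` carrier H" "m \<in> carrier N"
        then obtain g where g: "g \<in> carrier H" "a = \<iota> g" by auto
        then show "tens K T N (smash_mult K H B (smash_mult K H B (\<iota> h1) a) (antipode A (\<iota> h3))) (lact N (\<iota> h2) m) \<in> ?S"
          using hh h23 \<open>m \<in> carrier N\<close>
          by (intro subtensor_tens[OF vsT vsN incl_subset]) (auto simp: antipodeA_incl incl_mult)
      qed simp
    qed
    finally show "tlift K ?U (comult A (\<iota> h')) (\<lambda>h2 h3. ?b (\<iota> h1) h2 h3) \<in> ?S" .
  qed
  finally show "lact N (\<iota> h) n \<in> coinv" using h n' n by (simp add: coinv_eq)
qed

text \<open>Coassociativity trades a second coaction for a comultiplication of the first leg. That
  leg lies in \<iota>(H), so after comultiplication its second part does too;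
  \<open>subtensor_preimage\<close> turns this into a statement about the module leg.\<close>

lemma coinv_coact:
  assumes n: "n \<in> coinv"
  shows "lcoact N n \<in> subtensor K T N (carrier T) coinv"
proof -
  note n' = coinvD[OF n]
  let ?S = "subtensor K T N (\<iota> ` carrier H) (carrier N)" and ?U = "T \<otimes>\<^sub>t (T \<otimes>\<^sub>t N)"
  let ?t = "\<lambda>a b m. tens K T (T \<otimes>\<^sub>t N) a (tens K T N b m)"
  note [simp] = vs_tensor tens_closed
  have S': "?S \<subseteq> carrier (T \<otimes>\<^sub>t N)" by (rule subspaceD(2)[OF HN_subspace])
  have US: "subspace K (subtensor K T (T \<otimes>\<^sub>t N) (carrier T) ?S) ?U"
    by (rule subtensor_subspace[OF vsT vsTN _ S']) simp
  have "tmap T (T \<otimes>\<^sub>t N) (\<lambda>x. x) (lcoact N) (lcoact N n)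
    = tlift K ?U (lcoact N n) (\<lambda>a m. tlift K ?U (lcoact N m) (\<lambda>b m'. ?t a b m'))"
  proof (rule coactN_cong[OF n'(1)])
    fix a m assume am: "a \<in> carrier T" "m \<in> carrier N"
    note l = bilinD(1)[OF bilin_tens[OF vsT vsTN] am(1)]
    have "tens K T (T \<otimes>\<^sub>t N) a (tlift K (T \<otimes>\<^sub>t N) (lcoact N m) (tens K T N)) = tlift K ?U (lcoact N m) (\<lambda>b m'. ?t a b m')"
      by (rule lin_of_tlift[OF l coactN_closed[OF am(2)] vsT bilin_tens[OF vsT vsN]])
    then show "tens K T (T \<otimes>\<^sub>t N) a (lcoact N m) = tlift K ?U (lcoact N m) (\<lambda>b m'. ?t a b m')"
      using tlift_tens_id[OF vsT vsN coactN_closed[OF am(2)]] by simp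
  qed (intro lin_intro | simp)+
  also have "\<dots> = tlift K ?U (lcoact N n) (\<lambda>a m. tlift K ?U (comult A a) (\<lambda>a1 a2. ?t a1 a2 m))"
    by (rule coactN_coassoc[symmetric, OF _ n'(1)]) (intro lin_intro | simp)+
  also have "\<dots> \<in> subtensor K T (T \<otimes>\<^sub>t N) (carrier T) ?S"
  proof (rule tlift_subtensor[OF n'(2) vsT _ US incl_subset])
    show "bilin T N ?U (\<lambda>a m. tlift K ?U (comult A a) (\<lambda>a1 a2. ?t a1 a2 m))" by (intro lin_intro | simp)+
    fix a m assume a: "a \<in> \<iota> ` carrier H" and m: "m \<in> carrier N"
    then obtain h where h: "h \<in> carrier H" "a = \<iota> h" by auto
    have "tlift K ?U (comult A (\<iota> h)) (\<lambda>a1 a2. ?t a1 a2 m) = tlift K ?U (\<Delta> h) (\<lambda>h1 h2. ?t (\<iota> h1) (\<iota> h2) m)"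
      by (rule comultA_incl[OF _ h(1)]) (intro lin_intro | simp add: m)+
    also have "\<dots> \<in> subtensor K T (T \<otimes>\<^sub>t N) (carrier T) ?S"
    proof (rule tlift_subspace[OF comult_closed[OF h(1)] vsH _ US])
      show "bilin H H ?U (\<lambda>h1 h2. ?t (\<iota> h1) (\<iota> h2) m)" by (intro lin_intro | simp add: m)+
    qed (intro subtensor_tens[OF vsT vsTN _ S'] subtensor_tens[OF vsT vsN incl_subset] | simp add: m)+
    finally show "tlift K ?U (comult A a) (\<lambda>a1 a2. ?t a1 a2 m) \<in> subtensor K T (T \<otimes>\<^sub>t N) (carrier T) ?S"
      unfolding h(2) .
  qed simp
  finally show ?thesis
    unfolding coinv_eq by (rule subtensor_preimage[OF vsT lin_coactN HN_subspace coactN_closed[OF n'(1)]])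
qed

lemma coinv_subcomodule: "left_subcomodule K H R coinv"
  unfolding left_subcomodule_def HR
proof (intro conjI ballI subspace_same[OF same_R coinv_subspace])
  fix n assume n: "n \<in> coinv"
  have sub: "coinv \<subseteq> carrier N" using coinvD by auto
  show "lcoact R n \<in> subtensor K H N (carrier H) coinv"
    unfolding R_simps
    by (rule tlift_subtensor[OF coinv_coact[OF n] vsT _ subtensor_subspace[OF vsH vsN _ sub] _ sub])
       (intro lin_intro subtensor_tens[OF vsH vsN _ sub] | simp)+
qed

text \<open>\<iota> after \<pi> fixes \<iota>(H) pointwise. Hence nothing is lost when the coaction
  of coinvariants is restricted to \<open>H\<close>: it can be recovered by applying
  \<iota>.\<close>

lemma coinv_incl_proj:
  assumes n: "n \<in> coinv"
  shows "tlift K (T \<otimes>\<^sub>t N) (lcoact N n) (\<lambda>a m. tens K T N (\<iota> (\<pi> a)) m) = lcoact N n"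
proof -
  let ?f = "\<lambda>t. tlift K (T \<otimes>\<^sub>t N) t (\<lambda>a m. tens K T N (\<iota> (\<pi> a)) m)"
  have b: "bilin T N (T \<otimes>\<^sub>t N) (\<lambda>a m. tens K T N (\<iota> (\<pi> a)) m)" by (intro lin_intro | simp)+
  note l = lin_tlift[OF vsT vsN b]
  have "subspace K {t \<in> carrier (T \<otimes>\<^sub>t N). ?f t = t} (T \<otimes>\<^sub>t N)"
    by (rule subspaceI) (auto simp: linD[OF l] vsD[OF vsTN])
  then have "subtensor K T N (\<iota> ` carrier H) (carrier N) \<subseteq> {t \<in> carrier (T \<otimes>\<^sub>t N). ?f t = t}"
    by (rule subtensor_min) (auto simp: tlift_tens[OF vsT vsN b] tens_closed)
  then show ?thesis using coinvD(2)[OF n] by blast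
qed

subsubsection \<open>The augmentation image\<close>

lemma aug_gens: "{lact N (tens K B H b \<one>\<^bsub>H\<^esub>) n |b n. b \<in> carrier B \<and> \<epsilon>\<^sub>B b = \<zero> \<and> n \<in> carrier N} \<subseteq> carrier N"
  by auto

lemma aug_subspace: "subspace K aug N"
  unfolding aug_image_def by (rule span_subspace[OF vsN aug_gens])

lemma aug_mem: "b \<in> carrier B \<Longrightarrow> \<epsilon>\<^sub>B b = \<zero> \<Longrightarrow> n \<in> carrier N \<Longrightarrow> lact N (tens K B H b \<one>\<^bsub>H\<^esub>) n \<in> aug"
  unfolding aug_image_def by (rule span_incl[OF vsN aug_gens]) blast

lemma aug_min:
  assumes "subspace K P N" "\<And>b n. b \<in> carrier B \<Longrightarrow> \<epsilon>\<^sub>B b = \<zero> \<Longrightarrow> n \<in> carrier N \<Longrightarrow> lact N (tens K B H b \<one>\<^bsub>H\<^esub>) n \<in> P"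
  shows "aug \<subseteq> P"
  unfolding aug_image_def by (rule span_min[OF assms(1)]) (use assms(2) in blast)

lemma aug_closed: "n \<in> aug \<Longrightarrow> n \<in> carrier N"
  by (rule subspaceD(4)[OF aug_subspace])

text \<open>The rule \<open>incl_tens\<close> turns h (b n) into (h1 b)(h2 n), and h1 b stays in the
  augmentation ideal since the counit of \<open>B\<close> is linear over \<open>H\<close>.\<close>

lemma aug_submodule: "left_submodule K H R aug"
  unfolding left_submodule_def R_simps
proof (intro conjI ballI subspace_same[OF same_R aug_subspace])
  fix h n assume h: "h \<in> carrier H" and n: "n \<in> aug"
  have l: "lin N N (lact N (\<iota> h))" by (intro lin_intro | simp add: h)+
  have "aug \<subseteq> {n \<in> carrier N. lact N (\<iota> h) n \<in> aug}"
  proof (rule aug_min[OF subspace_preimage[OF l aug_subspace]])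
    fix b n assume b: "b \<in> carrier B" "\<epsilon>\<^sub>B b = \<zero>" and n: "n \<in> carrier N"
    have f: "lin T N (\<lambda>t. lact N t n)" by (intro lin_intro | simp add: n)+
    have "lact N (\<iota> h) (lact N (tens K B H b \<one>\<^bsub>H\<^esub>) n) =
      lact N (tlift K T (\<Delta> h) (\<lambda>h1 h2. smash_mult K H B (tens K B H (lact B h1 b) \<one>\<^bsub>H\<^esub>) (\<iota> h2))) n"
      using h b n by (simp add: incl_tens flip: lactN_mult)
    also have "\<dots> = tlift K N (\<Delta> h) (\<lambda>h1 h2. lact N (smash_mult K H B (tens K B H (lact B h1 b) \<one>\<^bsub>H\<^esub>) (\<iota> h2)) n)"
      by (rule comult_apply[OF f h]) (intro lin_intro | simp add: b)+
    also have "\<dots> \<in> aug"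
    proof (rule tlift_subspace[OF comult_closed[OF h] vsH _ aug_subspace])
      show "bilin H H N (\<lambda>h1 h2. lact N (smash_mult K H B (tens K B H (lact B h1 b) \<one>\<^bsub>H\<^esub>) (\<iota> h2)) n)"
        by (intro lin_intro | simp add: b n)+
    qed (simp add: lactN_mult b n aug_mem epsB_lact)
    finally show "lact N (tens K B H b \<one>\<^bsub>H\<^esub>) n \<in> {n \<in> carrier N. lact N (\<iota> h) n \<in> aug}"
      using b n by simp
  qed
  with n show "lact N (\<iota> h) n \<in> aug" by blast
qed

text \<open>In the formula b_{-1} n_{-1} \<otimes> b_0 n_0 the conjugation of the Yetter-Drinfeld
  condition has disappeared: after applying \<pi> to the first leg, the antipode sees only \<pi> of
  the last leg of b # 1, and that is trivial. So the action of \<open>B\<close> on the restricted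
  object is colinear over \<open>H\<close>.\<close>

lemma coactR_lact:
  assumes b: "b \<in> carrier B" and n: "n \<in> carrier N"
  shows "lcoact R (lact N (tens K B H b \<one>\<^bsub>H\<^esub>) n) = tlift K (H \<otimes>\<^sub>t N) (lcoact B b) (\<lambda>g b0.
    tlift K (H \<otimes>\<^sub>t N) (lcoact N n) (\<lambda>a m. tens K H N (g \<otimes>\<^bsub>H\<^esub> \<pi> a) (lact N (tens K B H b0 \<one>\<^bsub>H\<^esub>) m)))"
proof -
  let ?U = "H \<otimes>\<^sub>t N" and ?TN = "T \<otimes>\<^sub>t N"
  let ?F = "\<lambda>t. tlift K ?U t (\<lambda>a m. tens K H N (\<pi> a) m)"
  let ?s = "\<lambda>h1 h2 h3 a m. tens K T N (smash_mult K H B (smash_mult K H B h1 a) (antipode A h3)) (lact N h2 m)"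
  let ?c = "\<lambda>g h2 k a m. tens K H N (g \<otimes>\<^bsub>H\<^esub> \<pi> a \<otimes>\<^bsub>H\<^esub> S k) (lact N h2 m)"
  let ?d = "\<lambda>g h2 k. tlift K ?U (lcoact N n) (\<lambda>a m. ?c g h2 k a m)"
  have bF: "bilin T N ?U (\<lambda>a m. tens K H N (\<pi> a) m)" by (intro lin_intro | simp)+
  note F = lin_tlift[OF vsT vsN bF]
  note bT = tens_T[OF b H.one_closed]
  have d: "?d g h k \<in> carrier ?U" if "g \<in> carrier H" "h \<in> carrier T" "k \<in> carrier H" for g h k
    by (intro lin_intro | simp add: that n)+
  have "lcoact R (lact N (tens K B H b \<one>\<^bsub>H\<^esub>) n) = ?F (tlift K ?TN (comult A (tens K B H b \<one>\<^bsub>H\<^esub>))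
      (\<lambda>h1 h'. tlift K ?TN (comult A h') (\<lambda>h2 h3. tlift K ?TN (lcoact N n) (\<lambda>a m. ?s h1 h2 h3 a m))))"
    unfolding R_simps coact_lact[OF bT n] ..
  also have "\<dots> = tlift K ?U (comult A (tens K B H b \<one>\<^bsub>H\<^esub>))
      (\<lambda>h1 h'. ?F (tlift K ?TN (comult A h') (\<lambda>h2 h3. tlift K ?TN (lcoact N n) (\<lambda>a m. ?s h1 h2 h3 a m))))"
    by (rule lin_of_tlift[OF F comultA_closed[OF bT] vsT]) (intro lin_intro | simp add: n)+
  also have "\<dots> = tlift K ?U (comult A (tens K B H b \<one>\<^bsub>H\<^esub>))
      (\<lambda>h1 h'. tlift K ?U (comult A h') (\<lambda>h2 h3. ?d (\<pi> h1) h2 (\<pi> h3)))"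
  proof (rule comultA_cong[OF bT])
    fix h1 h' assume hh: "h1 \<in> carrier T" "h' \<in> carrier T"
    have "?F (tlift K ?TN (comult A h') (\<lambda>h2 h3. tlift K ?TN (lcoact N n) (\<lambda>a m. ?s h1 h2 h3 a m)))
      = tlift K ?U (comult A h') (\<lambda>h2 h3. ?F (tlift K ?TN (lcoact N n) (\<lambda>a m. ?s h1 h2 h3 a m)))"
      by (rule lin_of_tlift[OF F comultA_closed[OF hh(2)] vsT]) (intro lin_intro | simp add: n hh)+
    also have "\<dots> = tlift K ?U (comult A h') (\<lambda>h2 h3. ?d (\<pi> h1) h2 (\<pi> h3))"
    proof (rule comultA_cong[OF hh(2)])
      fix h2 h3 assume h23: "h2 \<in> carrier T" "h3 \<in> carrier T"
      have "?F (tlift K ?TN (lcoact N n) (\<lambda>a m. ?s h1 h2 h3 a m)) = tlift K ?U (lcoact N n) (\<lambda>a m. ?F (?s h1 h2 h3 a m))"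
        by (rule lin_of_tlift[OF F coactN_closed[OF n] vsT]) (intro lin_intro | simp add: n hh h23)+
      also have "\<dots> = ?d (\<pi> h1) h2 (\<pi> h3)"
        by (rule coactN_cong[OF n])
           (intro lin_intro | simp add: n hh h23 tlift_tens[OF vsT vsN bF] proj_mult proj_antipodeA)+
      finally show "?F (tlift K ?TN (lcoact N n) (\<lambda>a m. ?s h1 h2 h3 a m)) = ?d (\<pi> h1) h2 (\<pi> h3)" .
    qed (intro lin_intro | simp add: n hh)+
    finally show "?F (tlift K ?TN (comult A h') (\<lambda>h2 h3. tlift K ?TN (lcoact N n) (\<lambda>a m. ?s h1 h2 h3 a m)))
      = tlift K ?U (comult A h') (\<lambda>h2 h3. ?d (\<pi> h1) h2 (\<pi> h3))" .
  qed (intro lin_intro | simp add: n)+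
  \<comment> \<open>The first leg of the outer comultiplication occurs only under \<pi>, so it
    becomes b_{-1}; the inner comultiplication is then taken of b_0 # 1, and its second leg again
    occurs only under \<pi>.\<close>
  also have "\<dots> = tlift K ?U (lcoact B b) (\<lambda>g b0. tlift K ?U (comult A (tens K B H b0 \<one>\<^bsub>H\<^esub>)) (\<lambda>h2 h3. ?d g h2 (\<pi> h3)))"
    by (rule comultA_proj_left[OF _ b]) (intro lin_intro | simp add: n)+
  also have "\<dots> = tlift K ?U (lcoact B b) (\<lambda>g b0.
    tlift K ?U (lcoact N n) (\<lambda>a m. tens K H N (g \<otimes>\<^bsub>H\<^esub> \<pi> a) (lact N (tens K B H b0 \<one>\<^bsub>H\<^esub>) m)))"
  proof (rule bcoact_cong[OF b])
    fix g b0 assume gb: "g \<in> carrier H" "b0 \<in> carrier B"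
    have "tlift K ?U (comult A (tens K B H b0 \<one>\<^bsub>H\<^esub>)) (\<lambda>h2 h3. ?d g h2 (\<pi> h3)) = ?d g (tens K B H b0 \<one>\<^bsub>H\<^esub>) \<one>\<^bsub>H\<^esub>"
      by (rule comultA_proj_right[OF _ gb(2)]) (intro lin_intro | simp add: n gb)+
    also have "\<dots> = tlift K ?U (lcoact N n) (\<lambda>a m. tens K H N (g \<otimes>\<^bsub>H\<^esub> \<pi> a) (lact N (tens K B H b0 \<one>\<^bsub>H\<^esub>) m))"
      by (rule coactN_cong[OF n]) (intro lin_intro | simp add: n gb)+
    finally show "tlift K ?U (comult A (tens K B H b0 \<one>\<^bsub>H\<^esub>)) (\<lambda>h2 h3. ?d g h2 (\<pi> h3)) = \<dots>" .
  qed (intro lin_intro | simp add: n)+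
  finally show ?thesis .
qed

text \<open>By \<open>coactR_lact\<close> the second leg is b_0 n_0, and b_0 remains in the kernel
  of the counit because that kernel is a subcomodule of \<open>B\<close>.\<close>

lemma aug_subcomodule: "left_subcomodule K H R aug"
  unfolding left_subcomodule_def HR
proof (intro conjI ballI subspace_same[OF same_R aug_subspace])
  fix n assume n: "n \<in> aug"
  have sub: "aug \<subseteq> carrier N" using aug_closed by auto
  let ?S = "subtensor K H N (carrier H) aug"
  have S: "subspace K ?S (H \<otimes>\<^sub>t N)" by (rule subtensor_subspace[OF vsH vsN _ sub]) simp
  have "aug \<subseteq> {n \<in> carrier N. lcoact R n \<in> ?S}"
  proof (rule aug_min[OF subspace_preimage[OF lin_coactR S]])
    fix b n assume b: "b \<in> carrier B" "\<epsilon>\<^sub>B b = \<zero>" and n: "n \<in> carrier N"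
    \<comment> \<open>Colinearity of the counit puts the coaction of b into the kernel of id
      \<otimes> \<open>\<epsilon>\<^sub>B\<close>, which \<open>tmap_kernel\<close> identifies with
      \<open>H\<close> tensored with the augmentation ideal.\<close>
    have "tmap H (ground K) (\<lambda>x. x) \<epsilon>\<^sub>B (lcoact B b) = \<zero>\<^bsub>H \<otimes>\<^sub>t ground K\<^esub>"
      unfolding epsB_coact[OF b(1)] b(2)
      using linD(6)[OF bilinD(1)[OF bilin_tens[OF vsH vs_ground] H.one_closed]] by (simp add: ground_def)
    from tmap_kernel[OF vsH lin_bcounit left_comoduleD(3)[OF Bcomod b(1)] this]
    have k: "lcoact B b \<in> subtensor K H B (carrier H) {y \<in> carrier B. \<epsilon>\<^sub>B y = \<zero>}" by (simp add: ground_def)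
    have "lcoact R (lact N (tens K B H b \<one>\<^bsub>H\<^esub>) n) \<in> ?S"
      unfolding coactR_lact[OF b(1) n]
    proof (rule tlift_subtensor[OF k vsH _ S])
      fix g b0 assume g: "g \<in> carrier H" and b0: "b0 \<in> {y \<in> carrier B. \<epsilon>\<^sub>B y = \<zero>}"
      show "tlift K (H \<otimes>\<^sub>t N) (lcoact N n) (\<lambda>a m. tens K H N (g \<otimes>\<^bsub>H\<^esub> \<pi> a) (lact N (tens K B H b0 \<one>\<^bsub>H\<^esub>) m)) \<in> ?S"
      proof (rule tlift_subspace[OF coactN_closed[OF n] vsT _ S])
        show "bilin T N (H \<otimes>\<^sub>t N) (\<lambda>a m. tens K H N (g \<otimes>\<^bsub>H\<^esub> \<pi> a) (lact N (tens K B H b0 \<one>\<^bsub>H\<^esub>) m))"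
          using b0 by (intro lin_intro | simp add: g)+
        show "tens K H N (g \<otimes>\<^bsub>H\<^esub> \<pi> a) (lact N (tens K B H b0 \<one>\<^bsub>H\<^esub>) m) \<in> ?S"
          if "a \<in> carrier T" "m \<in> carrier N" for a m
          by (rule subtensor_tens[OF vsH vsN _ sub]) (use that g b0 in \<open>auto intro: aug_mem\<close>)
      qed
    qed (intro lin_intro | simp add: n | force)+
    then show "lact N (tens K B H b \<one>\<^bsub>H\<^esub>) n \<in> {n \<in> carrier N. lcoact R n \<in> ?S}" using b n by simp
  qed
  with n show "lcoact R n \<in> ?S" by blast
qed

end

section \<open>Functoriality of cotensors and of balancing relations\<close>

context linear_algebra
begin

lemma tlift_tmap:
  assumes f: "lin X X' f" and g: "lin N N' g" and \<beta>: "bilin X' N' U \<beta>" and t: "t \<in> carrier (X \<otimes>\<^sub>t N)"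
  shows "tlift K U (tmap X' N' f g t) \<beta> = tlift K U t (\<lambda>x n. \<beta> (f x) (g n))"
proof -
  note vX = linD(1)[OF f] and vX' = linD(2)[OF f] and vN' = linD(2)[OF g]
  have b: "bilin X N U (\<lambda>x n. \<beta> (f x) (g n))"
    by (intro bilinI lin_bilin1[OF \<beta>] lin_bilin2[OF \<beta>] f g linD(3)[OF f] linD(3)[OF g])
  have "tlift K U (tmap X' N' f g t) \<beta> = tlift K U t (\<lambda>x n. tlift K U (tens K X' N' (f x) (g n)) \<beta>)"
    by (rule tlift_tlift[OF t vX bilin_tmap[OF f g] vX' \<beta>])
  also have "\<dots> = tlift K U t (\<lambda>x n. \<beta> (f x) (g n))"
    by (rule tlift_cong[OF t vX b]) (simp add: tlift_tens[OF vX' vN' \<beta>] linD(3)[OF f] linD(3)[OF g])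
  finally show ?thesis .
qed

lemma tmap_tmap:
  assumes "lin X X' f" "lin N N' g" "lin X' X'' f'" "lin N' N'' g'" "t \<in> carrier (X \<otimes>\<^sub>t N)"
  shows "tmap X'' N'' f' g' (tmap X' N' f g t) = tmap X'' N'' (\<lambda>x. f' (f x)) (\<lambda>n. g' (g n)) t"
  by (rule tlift_tmap[OF assms(1,2) bilin_tmap[OF assms(3,4)] assms(5)])

text \<open>The cotensor equation for \<open>t\<close> is applied to the trilinear map that sends x,
  h, n to f x \<otimes> h \<otimes> g n; colinearity of both maps identifies its two sides with
  those for the image.\<close>

lemma cotensor_map:
  assumes C: "vspace C"
    and X: "lin X (X \<otimes>\<^sub>t C) (rcoact X)" "lin X' (X' \<otimes>\<^sub>t C) (rcoact X')" "lin X X' f"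
      "\<And>x. x \<in> carrier X \<Longrightarrow> rcoact X' (f x) = tmap X' C f (\<lambda>h. h) (rcoact X x)"
    and N: "lin N (C \<otimes>\<^sub>t N) (lcoact N)" "lin N' (C \<otimes>\<^sub>t N') (lcoact N')" "lin N N' g"
      "\<And>n. n \<in> carrier N \<Longrightarrow> lcoact N' (g n) = tmap C N' (\<lambda>h. h) g (lcoact N n)"
    and t: "t \<in> cotensor K C X N"
  shows "tmap X' N' f g t \<in> cotensor K C X' N'"
proof -
  let ?T = "tensor3 K X' C N'" and ?t = "tens3 K X' C N'"
  note vs [simp] = linD(1)[OF X(1)] linD(1)[OF X(2)] linD(1)[OF N(1)] linD(1)[OF N(2)] C
  note T = trilin_tens3[OF vs(2) C vs(4)]
  have vT [simp]: "vspace ?T" by (rule trilin_vs[OF vs(2) C vs(4) T])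
  have t': "t \<in> carrier (X \<otimes>\<^sub>t N)" using t by (simp add: cotensor_def)
  have g: "trilin X C N ?T (\<lambda>x h n. ?t (f x) h (g n))"
    by (intro trilinI bilinI lin_comp[OF trilinD(2)[OF T] X(3)] lin_comp[OF trilinD(4)[OF T] N(3)] trilinD(3)[OF T]
        linD(3)[OF X(3)] linD(3)[OF N(3)])
  have bL: "bilin X' N' ?T (\<lambda>x n. tlift K ?T (rcoact X' x) (\<lambda>x' h. ?t x' h n))"
    by (intro bilinI lin_tlift1[OF X(2) vs(2)] lin_tlift2[OF linD(3)[OF X(2)] vs(2) C vs(4) vT] trilinD[OF T])
  have bR: "bilin X' N' ?T (\<lambda>x n. tlift K ?T (lcoact N' n) (\<lambda>h n'. ?t x h n'))"
    by (intro bilinI lin_tlift1[OF N(2) C] lin_tlift2[OF linD(3)[OF N(2)] C vs(4) vs(2) vT] trilinD[OF T])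
  have "tlift K ?T (tmap X' N' f g t) (\<lambda>x n. tlift K ?T (rcoact X' x) (\<lambda>x' h. ?t x' h n))
    = tlift K ?T t (\<lambda>x n. tlift K ?T (rcoact X' (f x)) (\<lambda>x' h. ?t x' h (g n)))"
    by (rule tlift_tmap[OF X(3) N(3) bL t'])
  also have "\<dots> = tlift K ?T t (\<lambda>x n. tlift K ?T (rcoact X x) (\<lambda>x' h. ?t (f x') h (g n)))"
  proof (rule tlift_cong[OF t' vs(1)])
    show "bilin X N ?T (\<lambda>x n. tlift K ?T (rcoact X x) (\<lambda>x' h. ?t (f x') h (g n)))"
      by (intro bilinI lin_tlift1[OF X(1) vs(1)] lin_tlift2[OF linD(3)[OF X(1)] vs(1) C vs(3) vT] trilinD[OF g])
    fix x n assume xn: "x \<in> carrier X" "n \<in> carrier N"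
    show "tlift K ?T (rcoact X' (f x)) (\<lambda>x' h. ?t x' h (g n)) = tlift K ?T (rcoact X x) (\<lambda>x' h. ?t (f x') h (g n))"
      unfolding X(4)[OF xn(1)]
      by (rule tlift_tmap[OF X(3) lin_id[OF C] _ linD(3)[OF X(1) xn(1)]])
         (intro bilinI trilinD[OF T] linD(3)[OF N(3)] xn; assumption)
  qed
  also have "\<dots> = tlift K ?T t (\<lambda>x n. tlift K ?T (lcoact N n) (\<lambda>h n'. ?t (f x) h (g n')))"
    using trilift_left[OF vs(1) C vs(3) g t' X(1)] trilift_right[OF vs(1) C vs(3) g t' N(1)] t
    by (simp add: cotensor_def)
  also have "\<dots> = tlift K ?T t (\<lambda>x n. tlift K ?T (lcoact N' (g n)) (\<lambda>h n'. ?t (f x) h n'))"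
  proof (rule tlift_cong[OF t' vs(1), symmetric])
    show "bilin X N ?T (\<lambda>x n. tlift K ?T (lcoact N n) (\<lambda>h n'. ?t (f x) h (g n')))"
      by (intro bilinI lin_tlift1[OF N(1) C] lin_tlift2[OF linD(3)[OF N(1)] C vs(3) vs(1) vT] trilinD[OF g])
    fix x n assume xn: "x \<in> carrier X" "n \<in> carrier N"
    show "tlift K ?T (lcoact N' (g n)) (\<lambda>h n'. ?t (f x) h n') = tlift K ?T (lcoact N n) (\<lambda>h n'. ?t (f x) h (g n'))"
      unfolding N(4)[OF xn(2)]
      by (rule tlift_tmap[OF lin_id[OF C] N(3) _ linD(3)[OF N(1) xn(2)]])
         (intro bilinI trilinD[OF T] linD(3)[OF X(3)] xn; assumption)
  qed
  also have "\<dots> = tlift K ?T (tmap X' N' f g t) (\<lambda>x n. tlift K ?T (lcoact N' n) (\<lambda>h n'. ?t x h n'))"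
    by (rule tlift_tmap[OF X(3) N(3) bR t', symmetric])
  finally show ?thesis using linD(3)[OF lin_tmap[OF X(3) N(3)] t'] by (simp add: cotensor_def)
qed

lemma balanced_map:
  assumes X: "right_module K C X" "right_module K C X'" "lin X X' f"
      "\<And>x h. x \<in> carrier X \<Longrightarrow> h \<in> carrier C \<Longrightarrow> f (ract X x h) = ract X' (f x) h"
    and N: "left_module K C N" "left_module K C N'" "lin N N' g"
      "\<And>h n. h \<in> carrier C \<Longrightarrow> n \<in> carrier N \<Longrightarrow> g (lact N h n) = lact N' h (g n)"
  shows "tmap X' N' f g ` balanced_rel K C X N \<subseteq> balanced_rel K C X' N'"
proof -
  note l = lin_tmap[OF X(3) N(3)] and lt = tmap_tens[OF X(3) N(3)]
  note [simp] = right_moduleD(6)[OF X(1)] left_moduleD(6)[OF N(1)] linD(3)[OF X(3)] linD(3)[OF N(3)]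
    right_moduleD(1)[OF X(1)] left_moduleD(1)[OF N(1)]
  have "balanced_rel K C X N \<subseteq> {t \<in> carrier (X \<otimes>\<^sub>t N). tmap X' N' f g t \<in> balanced_rel K C X' N'}"
  proof (rule balanced_min[OF subspace_preimage[OF l balanced_subspace(1)[OF X(2) N(2)]]])
    fix x h n assume "x \<in> carrier X" "h \<in> carrier C" "n \<in> carrier N"
    then show "tens K X N (ract X x h) n \<ominus>\<^bsub>X \<otimes>\<^sub>t N\<^esub> tens K X N x (lact N h n)
      \<in> {t \<in> carrier (X \<otimes>\<^sub>t N). tmap X' N' f g t \<in> balanced_rel K C X' N'}"
      using balanced_subspace(2)[OF X(2) N(2), of "f x" h "g n"]
      by (simp add: vsD(6)[OF vs_tensor] tens_closed linD(8)[OF l] lt X(4) N(4))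
  qed
  then show ?thesis by blast
qed

end

section \<open>The subquotient as a module and comodule over \<open>H\<close>\<close>

context boson_yd
begin

abbreviation M where "M \<equiv> sub_object K H R coinv"
abbreviation Q where "Q \<equiv> bracket K H B N"
abbreviation quot where "quot \<equiv> \<lambda>m. (coinv \<inter> aug) +>\<^bsub>N\<^esub> m"

lemmas M_facts = sub_object[OF vsH hopfD(5,6) H.monoid_axioms Rmod Rcomod coinv_submodule coinv_subcomodule]
lemmas Mmod = M_facts(2) and Mcomod = M_facts(3) and carrier_M = M_facts(7)

lemma vsM [simp]: "vspace M" by (rule left_moduleD(1)[OF Mmod])

lemma lin_M_R: "lin M R (\<lambda>x. x)" and lin_M_N: "lin M N (\<lambda>x. x)"
  using M_facts(4) by (simp_all add: lin_R_iff)

lemma M_in_N: "m \<in> carrier M \<Longrightarrow> m \<in> carrier N"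
  by (rule linD(3)[OF lin_M_N])

lemma same_M: "same_space (N\<lparr>carrier := coinv\<rparr>) M"
  using M_facts(1) by (simp add: same_space_def R_simps) (simp add: Res_obj_def)

text \<open>A coset is formed from addition alone. The quotient of the subobject therefore consists
  of the same cosets that \<open>bracket_map\<close> forms in the ambient module.\<close>

lemma coset_M: "a_r_coset M = a_r_coset N"
  by (simp add: sub_object_def Res_obj_def a_r_coset_def r_coset_def fun_eq_iff)

lemma coactM_apply:
  assumes \<beta>: "bilin H N U \<beta>" and m: "m \<in> carrier M"
  shows "tlift K U (lcoact M m) \<beta> = tlift K U (lcoact N m) (\<lambda>a m. \<beta> (\<pi> a) m)"
proof -
  have b: "bilin H R U \<beta>" using \<beta> by (simp add: bilin_def lin_R_iff R_simps)
  have "tlift K U (lcoact R m) \<beta> = tlift K U (lcoact M m) \<beta>"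
    by (rule tlift_colinear[OF vsH hopfD(5,6) left_comoduleD(1)[OF Mcomod] left_comoduleD(1)[OF Rcomod] lin_M_R _ b m])
       (simp add: M_facts(5) carrier_M)
  then show ?thesis using coactR_apply[OF \<beta> M_in_N[OF m]] by simp
qed

lemma U_submodule: "left_submodule K H M (coinv \<inter> aug)"
proof -
  have "subspace K (coinv \<inter> aug) M"
    by (rule subspace_same[OF same_M subspace_trans[OF coinv_subspace subspace_Int[OF coinv_subspace aug_subspace]]]) simp
  then show ?thesis
    using coinv_submodule aug_submodule by (simp add: left_submodule_def M_facts(6))
qed

lemma U_subspace: "subspace K (coinv \<inter> aug) N" "subspace K (coinv \<inter> aug) M"
  using subspace_Int[OF coinv_subspace aug_subspace] U_submodule by (auto simp: left_submodule_def)

text \<open>The intersection is taken inside H \<otimes> N by \<open>subtensor_Int\<close>; the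
  coaction of \<open>M\<close> takes values in a different tensor product, reached by
  \<open>subtensor_preimage\<close> along the inclusion of \<open>M\<close> into
  \<open>N\<close>.\<close>

lemma U_subcomodule: "left_subcomodule K H M (coinv \<inter> aug)"
  unfolding left_subcomodule_def
proof (intro conjI ballI U_subspace(2))
  fix u assume u: "u \<in> coinv \<inter> aug"
  have "lcoact R u \<in> subtensor K H N (carrier H) (coinv \<inter> aug)"
    using u coinv_subcomodule aug_subcomodule
    by (intro subtensor_Int[OF vsH coinv_subspace aug_subspace]) (auto simp: left_subcomodule_def HR)
  moreover have "lcoact R u = tmap H N (\<lambda>x. x) (\<lambda>x. x) (lcoact M u)" using M_facts(5)[of u] u by (simp add: HR)
  moreover have "lcoact M u \<in> carrier (H \<otimes>\<^sub>t M)"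
    using left_comoduleD(3)[OF Mcomod, of u] u by (simp add: carrier_M)
  ultimately have "lcoact M u \<in> subtensor K H M (carrier H) {y \<in> carrier M. y \<in> coinv \<inter> aug}"
    by (intro subtensor_preimage[OF vsH lin_M_N U_subspace(1)]) simp_all
  moreover have "{y \<in> carrier M. y \<in> coinv \<inter> aug} = coinv \<inter> aug" by (auto simp: carrier_M)
  ultimately show "lcoact M u \<in> subtensor K H M (carrier H) (coinv \<inter> aug)" by simp
qed

lemmas Q_facts = quotient_object[OF vsH hopfD(5,6) H.monoid_axioms Mmod Mcomod U_submodule U_subcomodule,
    folded bracket_def, unfolded coset_M]
lemmas Qmod = Q_facts(2) and Qcomod = Q_facts(3) and lin_quot = Q_facts(4)

lemma vsQ [simp]: "vspace Q" by (rule left_moduleD(1)[OF Qmod])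

lemma quot_zero: "m \<in> carrier M \<Longrightarrow> quot m = \<zero>\<^bsub>Q\<^esub> \<longleftrightarrow> m \<in> coinv \<inter> aug"
  using coset_zero_iff[OF U_subspace(2), of m] Q_facts(1) by (simp add: same_space_def coset_M)

lemma quot_surj: "quot ` carrier M = carrier Q"
  using Q_facts(7) by simp

end

subsection \<open>Inflation\<close>

locale boson_inf = boson K H B for K :: "'k ring" (structure) and H :: "('k, 'h) hopf_data"
    and B :: "('k, 'h, 'b) braided_hopf_data" +
  fixes X :: "('k, 'h, 'x) rmodcomod"
  assumes X: "right_modcomod K H X"
begin

abbreviation I where "I \<equiv> Inf_obj K H B X"

lemma Xmod: "right_module K H X" and Xcomod: "right_comodule K H X"
  using X by (auto simp: right_modcomod_def)

lemma vsX [simp]: "vspace X" by (rule right_moduleD(1)[OF Xmod])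

lemma TA: "V \<otimes>\<^sub>t A = V \<otimes>\<^sub>t T" "tens K V A = tens K V T"
  by (rule tensor_same[OF _ same_A]; simp add: same_space_def)+

lemma same_I: "same_space X I"
  by (simp add: same_space_def Inf_obj_def Let_def)

lemma I_simps: "carrier I = carrier X" "ract I = (\<lambda>x a. ract X x (\<pi> a))"
  "rcoact I x = tlift K (X \<otimes>\<^sub>t T) (rcoact X x) (\<lambda>x' h. tens K X T x' (\<iota> h))"
  by (simp_all add: Inf_obj_def Let_def TA)

lemma IV: "I \<otimes>\<^sub>t V = X \<otimes>\<^sub>t V" "tens K I V = tens K X V"
  by (rule tensor_same[OF same_I]; simp add: same_space_def)+

lemma lin_I_iff: "lin I V f \<longleftrightarrow> lin X V f" "lin V I g \<longleftrightarrow> lin V X g"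
proof -
  have V: "same_space V V" by (simp add: same_space_def)
  show "lin I V f \<longleftrightarrow> lin X V f" using lin_same[OF same_I V] lin_same[OF same_space_sym[OF same_I] V] by blast
  show "lin V I g \<longleftrightarrow> lin V X g" using lin_same[OF V same_I] lin_same[OF V same_space_sym[OF same_I]] by blast
qed

lemma vsI [simp]: "vspace I" by (rule vspace_same[OF same_I vsX])

lemmas X_intro [lin_intro] = lin_bilin1[OF bilin_ract[OF Xmod]] lin_bilin2[OF bilin_ract[OF Xmod]] rcoact_lin[OF Xcomod vsH]
lemmas X_simps [simp] = right_moduleD(6)[OF Xmod] right_comoduleD(3)[OF Xcomod]

lemma Imod: "right_module K A I"
  unfolding right_module_def I_simps lin_I_iff lin_A_iff
proof (intro conjI ballI vsI)
  fix x assume x: "x \<in> carrier X"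
  show "lin T X (\<lambda>a. ract X x (\<pi> a))" by (intro lin_intro | simp add: x)+
  have "\<pi> \<one>\<^bsub>A\<^esub> = \<one>\<^bsub>H\<^esub>" using proj_incl[OF H.one_closed] by (simp add: A_simps boson_incl_def)
  then show "ract X x (\<pi> \<one>\<^bsub>A\<^esub>) = x" using right_moduleD(4)[OF Xmod x] by simp
qed (intro lin_intro | simp add: A_simps proj_mult right_moduleD(5)[OF Xmod])+

lemma lin_rcoactI: "lin X (X \<otimes>\<^sub>t T) (rcoact I)"
  unfolding I_simps by (intro lin_intro | simp add: vs_tensor)+

lemma rcoactI_apply:
  assumes \<beta>: "bilin X T U \<beta>" and x: "x \<in> carrier X"
  shows "tlift K U (rcoact I x) \<beta> = tlift K U (rcoact X x) (\<lambda>x' h. \<beta> x' (\<iota> h))"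
  unfolding I_simps
  using tlift_tmap[OF lin_id[OF vsX] lin_incl \<beta> right_comoduleD(3)[OF Xcomod x]] .

end

section \<open>Cotensors and balancing relations over the bosonisation compared with those over
  \<open>H\<close>\<close>

locale boson_bit = boson_inf K H B X + boson_yd K H B N
  for K :: "'k ring" (structure) and H :: "('k, 'h) hopf_data" and B :: "('k, 'h, 'b) braided_hopf_data"
    and X :: "('k, 'h, 'x) rmodcomod" and N :: "('k, ('b \<times> 'h \<Rightarrow> 'k) set, 'n) lmodcomod"
begin

abbreviation incl_t where "incl_t \<equiv> tmap X N (\<lambda>x. x) (\<lambda>m. m)"
abbreviation quot_t where "quot_t \<equiv> tmap X Q (\<lambda>x. x) quot"

lemmas lin_incl_t = lin_tmap[OF lin_id[OF vsX] lin_M_N]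
lemmas lin_quot_t = lin_tmap[OF lin_id[OF vsX] lin_quot]
lemmas incl_t_tens = tmap_tens[OF lin_id[OF vsX] lin_M_N]
lemmas quot_t_tens = tmap_tens[OF lin_id[OF vsX] lin_quot]

lemma cotensor_A:
  "cotensor K A I N = {t \<in> carrier (X \<otimes>\<^sub>t N).
     tlift K (tensor3 K X T N) t (\<lambda>x n. tlift K (tensor3 K X T N) (rcoact I x) (\<lambda>x' h. tens3 K X T N x' h n)) =
     tlift K (tensor3 K X T N) t (\<lambda>x n. tlift K (tensor3 K X T N) (lcoact N n) (\<lambda>h n'. tens3 K X T N x h n'))}"
  by (simp add: cotensor_def tensor3_def tens3_def IV AN)

text \<open>The cotensor equation over \<open>H\<close> is applied to the map that inserts \<iota>
  in the middle leg. On the side of \<open>X\<close> this is the coaction of the inflation; on the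
  side of \<open>M\<close>, \<open>coinv_incl_proj\<close> restores the full coaction over
  \<open>A\<close>.\<close>

lemma incl_cotensor:
  assumes t: "t \<in> cotensor K H X M"
  shows "incl_t t \<in> cotensor K A I N"
proof -
  let ?U = "tensor3 K X T N" and ?t = "tens3 K X T N"
  note T3 = trilin_tens3[OF vsX vsT vsN]
  have vU [simp]: "vspace ?U" by (rule trilin_vs[OF vsX vsT vsN T3])
  have t': "t \<in> carrier (X \<otimes>\<^sub>t M)" using t by (simp add: cotensor_def)
  have g: "trilin X H M ?U (\<lambda>x h m. ?t x (\<iota> h) m)"
    by (intro trilinI bilinI lin_comp[OF trilinD(3)[OF T3] lin_incl] lin_comp[OF trilinD(4)[OF T3] lin_M_N] trilinD(2)[OF T3]
        incl_closed M_in_N)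
  have bL: "bilin X N ?U (\<lambda>x n. tlift K ?U (rcoact I x) (\<lambda>x' a. ?t x' a n))"
    by (intro bilinI lin_tlift1[OF lin_rcoactI vsX] lin_tlift2[OF linD(3)[OF lin_rcoactI] vsX vsT vsN vU] trilinD[OF T3])
  have bR: "bilin X N ?U (\<lambda>x n. tlift K ?U (lcoact N n) (\<lambda>a n'. ?t x a n'))"
    by (intro bilinI lin_tlift1[OF lin_coactN vsT] lin_tlift2[OF coactN_closed vsT vsN vsX vU] trilinD[OF T3])
  have "tlift K ?U (incl_t t) (\<lambda>x n. tlift K ?U (rcoact I x) (\<lambda>x' a. ?t x' a n))
    = tlift K ?U t (\<lambda>x m. tlift K ?U (rcoact I x) (\<lambda>x' a. ?t x' a m))"
    by (rule tlift_tmap[OF lin_id[OF vsX] lin_M_N bL t'])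
  also have "\<dots> = tlift K ?U t (\<lambda>x m. tlift K ?U (rcoact X x) (\<lambda>x' h. ?t x' (\<iota> h) m))"
  proof (rule tlift_cong[OF t' vsX])
    show "bilin X M ?U (\<lambda>x m. tlift K ?U (rcoact X x) (\<lambda>x' h. ?t x' (\<iota> h) m))"
      by (intro bilinI lin_tlift1[OF right_comoduleD(1)[OF Xcomod] vsX]
          lin_tlift2[OF right_comoduleD(3)[OF Xcomod] vsX vsH vsM vU] trilinD[OF g])
    show "tlift K ?U (rcoact I x) (\<lambda>x' a. ?t x' a m) = tlift K ?U (rcoact X x) (\<lambda>x' h. ?t x' (\<iota> h) m)"
      if "x \<in> carrier X" "m \<in> carrier M" for x m
      by (rule rcoactI_apply[OF _ that(1)]) (intro bilinI trilinD[OF T3] M_in_N that; assumption)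
  qed
  also have "\<dots> = tlift K ?U t (\<lambda>x m. tlift K ?U (lcoact M m) (\<lambda>h m'. ?t x (\<iota> h) m'))"
    using trilift_left[OF vsX vsH vsM g t' right_comoduleD(1)[OF Xcomod]]
      trilift_right[OF vsX vsH vsM g t' left_comoduleD(1)[OF Mcomod]] t by (simp add: cotensor_def)
  also have "\<dots> = tlift K ?U t (\<lambda>x m. tlift K ?U (lcoact N m) (\<lambda>a n. ?t x a n))"
  proof (rule tlift_cong[OF t' vsX])
    show "bilin X M ?U (\<lambda>x m. tlift K ?U (lcoact N m) (\<lambda>a n. ?t x a n))"
      by (intro bilinI lin_comp[OF bilinD(1)[OF bR] lin_M_N] bilinD(2)[OF bR] M_in_N)
    fix x m assume xm: "x \<in> carrier X" "m \<in> carrier M"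
    have b: "bilin T N ?U (\<lambda>a n. ?t x a n)" by (intro bilinI trilinD[OF T3] xm)
    have "tlift K ?U (lcoact M m) (\<lambda>h m'. ?t x (\<iota> h) m') = tlift K ?U (lcoact N m) (\<lambda>a n. ?t x (\<iota> (\<pi> a)) n)"
      by (rule coactM_apply[OF _ xm(2)])
         (intro bilinI lin_comp[OF trilinD(3)[OF T3] lin_incl] trilinD(4)[OF T3] incl_closed xm; assumption)
    also have "\<dots> = tlift K ?U (tlift K (T \<otimes>\<^sub>t N) (lcoact N m) (\<lambda>a n. tens K T N (\<iota> (\<pi> a)) n)) (\<lambda>a n. ?t x a n)"
      using tlift_tmap[OF lin_comp[OF lin_incl lin_proj] lin_id[OF vsN] b coactN_closed[OF M_in_N[OF xm(2)]]] by simp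
    also have "\<dots> = tlift K ?U (lcoact N m) (\<lambda>a n. ?t x a n)"
      using xm by (simp add: coinv_incl_proj carrier_M)
    finally show "tlift K ?U (lcoact M m) (\<lambda>h m'. ?t x (\<iota> h) m') = tlift K ?U (lcoact N m) (\<lambda>a n. ?t x a n)" .
  qed
  also have "\<dots> = tlift K ?U (incl_t t) (\<lambda>x n. tlift K ?U (lcoact N n) (\<lambda>a n'. ?t x a n'))"
    by (rule tlift_tmap[OF lin_id[OF vsX] lin_M_N bR t', symmetric])
  finally show ?thesis using linD(3)[OF lin_incl_t t'] by (simp add: cotensor_A)
qed

text \<open>The cotensor equation places (id \<otimes> \<delta>) t, with \<delta> the coaction of
  \<open>N\<close>, in X \<otimes> (\<iota>(H) \<otimes> N), and exactness of X \<otimes> - pulls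
  this back to t in X \<otimes> \<open>coinv\<close>. The equation over \<open>H\<close> for the
  lift then comes from projecting the middle leg by \<pi> and reflecting along the injection of
  \<open>M\<close> into \<open>N\<close>.\<close>

lemma cotensor_lift:
  assumes t: "t \<in> cotensor K A I N"
  obtains t' where "t' \<in> cotensor K H X M" "t = incl_t t'"
proof -
  let ?T = "tensor3 K X T N" and ?t = "tens3 K X T N"
  let ?P = "subtensor K T N (\<iota> ` carrier H) (carrier N)"
  note T3 = trilin_tens3[OF vsX vsT vsN]
  have vT3 [simp]: "vspace ?T" by (rule trilin_vs[OF vsX vsT vsN T3])
  have tc: "t \<in> carrier (X \<otimes>\<^sub>t N)"
    and eq: "tlift K ?T t (\<lambda>x n. tlift K ?T (rcoact I x) (\<lambda>x' a. ?t x' a n)) =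
      tlift K ?T t (\<lambda>x n. tlift K ?T (lcoact N n) (\<lambda>a n'. ?t x a n'))"
    using t by (auto simp: cotensor_A)
  have bL: "bilin X N ?T (\<lambda>x n. tlift K ?T (rcoact I x) (\<lambda>x' a. ?t x' a n))"
    by (intro bilinI lin_tlift1[OF lin_rcoactI vsX] lin_tlift2[OF linD(3)[OF lin_rcoactI] vsX vsT vsN vT3] trilinD[OF T3])
  have P': "?P \<subseteq> carrier (T \<otimes>\<^sub>t N)" by (rule subspaceD(2)[OF HN_subspace])
  let ?PX = "subtensor K X (T \<otimes>\<^sub>t N) (carrier X) ?P"
  have PX: "subspace K ?PX ?T"
    unfolding tensor3_def by (rule subtensor_subspace[OF vsX vsTN _ P']) simp
  have "tmap X (T \<otimes>\<^sub>t N) (\<lambda>x. x) (lcoact N) t = tlift K ?T t (\<lambda>x n. tlift K ?T (lcoact N n) (\<lambda>a n'. ?t x a n'))"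
    unfolding tensor3_def
  proof (rule tlift_cong[OF tc vsX])
    show "bilin X N (X \<otimes>\<^sub>t (T \<otimes>\<^sub>t N)) (\<lambda>x n. tlift K (X \<otimes>\<^sub>t (T \<otimes>\<^sub>t N)) (lcoact N n) (\<lambda>a n'. ?t x a n'))"
      unfolding tens3_def by (intro lin_intro | simp add: vs_tensor tens_closed)+
    fix x n assume xn: "x \<in> carrier X" "n \<in> carrier N"
    have "tens K X (T \<otimes>\<^sub>t N) x (tlift K (T \<otimes>\<^sub>t N) (lcoact N n) (tens K T N)) =
      tlift K (X \<otimes>\<^sub>t (T \<otimes>\<^sub>t N)) (lcoact N n) (\<lambda>a n'. ?t x a n')"
      unfolding tens3_def
      by (rule lin_of_tlift[OF bilinD(1)[OF bilin_tens[OF vsX vsTN] xn(1)] coactN_closed[OF xn(2)] vsT bilin_tens[OF vsT vsN]])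
    then show "tens K X (T \<otimes>\<^sub>t N) x (lcoact N n) = tlift K (X \<otimes>\<^sub>t (T \<otimes>\<^sub>t N)) (lcoact N n) (\<lambda>a n'. ?t x a n')"
      using tlift_tens_id[OF vsT vsN coactN_closed[OF xn(2)]] by simp
  qed
  also have "\<dots> \<in> ?PX"
    unfolding eq[symmetric]
  proof (rule tlift_subspace[OF tc vsX bL PX])
    fix x n assume xn: "x \<in> carrier X" "n \<in> carrier N"
    have "tlift K ?T (rcoact I x) (\<lambda>x' a. ?t x' a n) = tlift K ?T (rcoact X x) (\<lambda>x' h. ?t x' (\<iota> h) n)"
      by (rule rcoactI_apply[OF _ xn(1)]) (intro bilinI trilinD[OF T3] xn; assumption)
    also have "\<dots> \<in> ?PX"
    proof (rule tlift_subspace[OF right_comoduleD(3)[OF Xcomod xn(1)] vsX _ PX])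
      show "bilin X H ?T (\<lambda>x' h. ?t x' (\<iota> h) n)"
        by (intro bilinI lin_comp[OF trilinD(3)[OF T3] lin_incl] trilinD(2)[OF T3] incl_closed xn)
      show "?t x' (\<iota> h) n \<in> ?PX" if "x' \<in> carrier X" "h \<in> carrier H" for x' h
        unfolding tens3_def
        by (intro subtensor_tens[OF vsX vsTN _ P'] subtensor_tens[OF vsT vsN incl_subset] that imageI xn order_refl)
    qed
    finally show "tlift K ?T (rcoact I x) (\<lambda>x' a. ?t x' a n) \<in> ?PX" .
  qed
  finally have "t \<in> subtensor K X N (carrier X) coinv"
    unfolding coinv_eq by (rule subtensor_preimage[OF vsX lin_coactN HN_subspace tc])
  then obtain t' where "t' \<in> carrier (X \<otimes>\<^sub>t (N\<lparr>carrier := coinv\<rparr>))" and tt: "t = incl_t t'"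
    by (rule subtensor_lift[OF vsX coinv_subspace])
  then have t': "t' \<in> carrier (X \<otimes>\<^sub>t M)"
    using tensor_same(1)[OF _ same_M, of X X] by (simp add: same_space_def)
  let ?U = "tensor3 K X H N" and ?u = "tens3 K X H N"
  note U3 = trilin_tens3[OF vsX vsH vsN]
  have vU [simp]: "vspace ?U" by (rule trilin_vs[OF vsX vsH vsN U3])
  have gM: "trilin X H M ?U ?u"
    by (intro trilinI bilinI trilinD[OF U3] lin_comp[OF trilinD(4)[OF U3] lin_M_N] M_in_N)
  \<comment> \<open>The map that projects the middle leg; applied to the equation over
    \<open>A\<close>, it yields the one over \<open>H\<close>, still with values in X \<otimes> H
    \<otimes> N.\<close>
  have gN: "trilin X T N ?U (\<lambda>x a n. ?u x (\<pi> a) n)"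
    by (intro trilinI bilinI lin_comp[OF trilinD(3)[OF U3] lin_proj] trilinD(2,4)[OF U3] proj_closed)
  have bL': "bilin X N ?U (\<lambda>x n. tlift K ?U (rcoact I x) (\<lambda>x' a. ?u x' (\<pi> a) n))"
    by (intro bilinI lin_tlift1[OF lin_rcoactI vsX] lin_tlift2[OF linD(3)[OF lin_rcoactI] vsX vsT vsN vU] trilinD[OF gN])
  have bR': "bilin X N ?U (\<lambda>x n. tlift K ?U (lcoact N n) (\<lambda>a n'. ?u x (\<pi> a) n'))"
    by (intro bilinI lin_tlift1[OF lin_coactN vsT] lin_tlift2[OF coactN_closed vsT vsN vsX vU] trilinD[OF gN])
  have 1: "tlift K ?U t' (\<lambda>x m. tlift K ?U (rcoact X x) (\<lambda>x' h. ?u x' h m))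
    = tlift K ?U t (\<lambda>x n. tlift K ?U (rcoact I x) (\<lambda>x' a. ?u x' (\<pi> a) n))"
  proof -
    have "tlift K ?U t (\<lambda>x n. tlift K ?U (rcoact I x) (\<lambda>x' a. ?u x' (\<pi> a) n))
      = tlift K ?U t' (\<lambda>x n. tlift K ?U (rcoact I x) (\<lambda>x' a. ?u x' (\<pi> a) n))"
      unfolding tt by (rule tlift_tmap[OF lin_id[OF vsX] lin_M_N bL' t'])
    also have "\<dots> = tlift K ?U t' (\<lambda>x m. tlift K ?U (rcoact X x) (\<lambda>x' h. ?u x' h m))"
    proof (rule tlift_cong[OF t' vsX])
      show b: "bilin X M ?U (\<lambda>x m. tlift K ?U (rcoact X x) (\<lambda>x' h. ?u x' h m))"
        by (intro bilinI lin_tlift1[OF right_comoduleD(1)[OF Xcomod] vsX]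
          lin_tlift2[OF right_comoduleD(3)[OF Xcomod] vsX vsH vsM vU] trilinD[OF gM])
      fix x m assume xm: "x \<in> carrier X" "m \<in> carrier M"
      have "tlift K ?U (rcoact I x) (\<lambda>x' a. ?u x' (\<pi> a) m) = tlift K ?U (rcoact X x) (\<lambda>x' h. ?u x' (\<pi> (\<iota> h)) m)"
        by (rule rcoactI_apply[OF _ xm(1)]) (intro bilinI trilinD[OF gN] M_in_N xm; assumption)
      also have "\<dots> = tlift K ?U (rcoact X x) (\<lambda>x' h. ?u x' h m)"
        by (rule tlift_cong[OF right_comoduleD(3)[OF Xcomod xm(1)] vsX])
           (intro bilinI trilinD[OF gM] xm | simp)+
      finally show "tlift K ?U (rcoact I x) (\<lambda>x' a. ?u x' (\<pi> a) m) = tlift K ?U (rcoact X x) (\<lambda>x' h. ?u x' h m)" .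
    qed
    finally show ?thesis by simp
  qed
  have 2: "tlift K ?U t (\<lambda>x n. tlift K ?U (lcoact N n) (\<lambda>a n'. ?u x (\<pi> a) n'))
    = tlift K ?U t' (\<lambda>x m. tlift K ?U (lcoact M m) (\<lambda>h m'. ?u x h m'))"
  proof -
    have "tlift K ?U t (\<lambda>x n. tlift K ?U (lcoact N n) (\<lambda>a n'. ?u x (\<pi> a) n'))
      = tlift K ?U t' (\<lambda>x n. tlift K ?U (lcoact N n) (\<lambda>a n'. ?u x (\<pi> a) n'))"
      unfolding tt by (rule tlift_tmap[OF lin_id[OF vsX] lin_M_N bR' t'])
    also have "\<dots> = tlift K ?U t' (\<lambda>x m. tlift K ?U (lcoact M m) (\<lambda>h m'. ?u x h m'))"
    proof (rule tlift_cong[OF t' vsX])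
      show "bilin X M ?U (\<lambda>x m. tlift K ?U (lcoact M m) (\<lambda>h m'. ?u x h m'))"
        by (intro bilinI lin_tlift1[OF left_comoduleD(1)[OF Mcomod] vsH]
          lin_tlift2[OF left_comoduleD(3)[OF Mcomod] vsH vsM vsX vU] trilinD[OF gM])
      fix x m assume xm: "x \<in> carrier X" "m \<in> carrier M"
      show "tlift K ?U (lcoact N m) (\<lambda>a n'. ?u x (\<pi> a) n') = tlift K ?U (lcoact M m) (\<lambda>h m'. ?u x h m')"
        by (rule coactM_apply[OF _ xm(2), symmetric]) (intro bilinI trilinD[OF U3] xm; assumption)
    qed
    finally show ?thesis .
  qed
  have 3: "tlift K ?U t (\<lambda>x n. tlift K ?U (rcoact I x) (\<lambda>x' a. ?u x' (\<pi> a) n))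
    = tlift K ?U t (\<lambda>x n. tlift K ?U (lcoact N n) (\<lambda>a n'. ?u x (\<pi> a) n'))"
    using trilift_left[OF vsX vsT vsN gN tc lin_rcoactI] trilift_right[OF vsX vsT vsN gN tc lin_coactN] eq by simp
  note cs = cotensor_subspace[OF Xcomod Mcomod vsH]
  have "tlift K (tensor3 K X H M) t' (\<lambda>x m. tlift K (tensor3 K X H M) (rcoact X x) (\<lambda>x' h. tens3 K X H M x' h m)) =
     tlift K (tensor3 K X H M) t' (\<lambda>x m. tlift K (tensor3 K X H M) (lcoact M m) (\<lambda>h m'. tens3 K X H M x h m'))"
    by (rule trilift_inj[OF vsX vsH lin_M_N _ linD(3)[OF cs(1) t'] linD(3)[OF cs(2) t']])
       (use 1 2 3 trilift_left[OF vsX vsH vsM gM t' right_comoduleD(1)[OF Xcomod]]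
         trilift_right[OF vsX vsH vsM gM t' left_comoduleD(1)[OF Mcomod]] in simp_all)
  then have "t' \<in> cotensor K H X M" using t' by (simp add: cotensor_def)
  with tt that show thesis by blast
qed

lemma cotensor_image: "cotensor K A I N = incl_t ` cotensor K H X M"
  using incl_cotensor cotensor_lift by blast

subsubsection \<open>Balanced relations\<close>

lemma balA_subspace: "subspace K (balanced_rel K A I N) (X \<otimes>\<^sub>t N)"
  using balanced_subspace(1)[OF Imod Nmod] by (simp add: IV)

lemma balA_mem: "x \<in> carrier X \<Longrightarrow> a \<in> carrier T \<Longrightarrow> n \<in> carrier N \<Longrightarrow>
    tens K X N (ract X x (\<pi> a)) n \<ominus>\<^bsub>X \<otimes>\<^sub>t N\<^esub> tens K X N x (lact N a n) \<in> balanced_rel K A I N"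
  using balanced_subspace(2)[OF Imod Nmod, of x a n] by (simp add: I_simps A_simps IV)

lemma vsXN [simp]: "vspace (X \<otimes>\<^sub>t N)" and vsXM [simp]: "vspace (X \<otimes>\<^sub>t M)" and vsXQ [simp]: "vspace (X \<otimes>\<^sub>t Q)"
  by (rule vs_tensor; simp)+

text \<open>Averaging acts on the second leg by elements S(L2) of \<open>H\<close>, and
  \<open>aug\<close> is stable under \<open>H\<close>.\<close>

lemma average_aug:
  assumes L: "L \<in> carrier H" and x: "x \<in> carrier X" and y: "y \<in> aug"
  shows "average L X R (tens K X N x y) \<in> subtensor K X N (carrier X) aug"
proof -
  have sub: "aug \<subseteq> carrier N" using aug_closed by auto
  note y' = aug_closed[OF y]
  have P: "subspace K (subtensor K X N (carrier X) aug) (X \<otimes>\<^sub>t N)" by (rule subtensor_subspace[OF vsX vsN _ sub]) simp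
  have "average L X R (tens K X N x y) = tlift K (X \<otimes>\<^sub>t N) (\<Delta> L) (\<lambda>a b. tens K X N (ract X x a) (lact N (\<iota> (S b)) y))"
    using average_tens(2)[OF Xmod Rmod L x, of y] y' by (simp add: HR R_simps)
  also have "\<dots> \<in> subtensor K X N (carrier X) aug"
  proof (rule tlift_subspace[OF comult_closed[OF L] vsH _ P])
    show "bilin H H (X \<otimes>\<^sub>t N) (\<lambda>a b. tens K X N (ract X x a) (lact N (\<iota> (S b)) y))"
      by (intro lin_intro | simp add: x y')+
    show "tens K X N (ract X x a) (lact N (\<iota> (S b)) y) \<in> subtensor K X N (carrier X) aug"
      if "a \<in> carrier H" "b \<in> carrier H" for a b
      by (rule subtensor_tens[OF vsX vsN _ sub]) (use that x y aug_submodule in \<open>auto simp: left_submodule_def R_simps\<close>)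
  qed
  finally show ?thesis .
qed

text \<open>Balancing over \<open>A\<close> splits into balancing over \<open>H\<close>, which
  averaging kills, and relations x \<otimes> c m with c in the augmentation ideal of
  \<open>B\<close>, which it sends into X \<otimes> \<open>aug\<close>. The average is taken over
  \<open>R\<close>, since it needs the restricted action.\<close>

lemma average_balA:
  assumes L: "L \<in> carrier H" "\<And>h. h \<in> carrier H \<Longrightarrow> h \<otimes>\<^bsub>H\<^esub> L = \<epsilon> h \<odot>\<^bsub>H\<^esub> L"
    and t: "t \<in> balanced_rel K A I N"
  shows "average L X R t \<in> subtensor K X N (carrier X) aug"
proof -
  have sub: "aug \<subseteq> carrier N" using aug_closed by auto
  let ?P = "subtensor K X N (carrier X) aug"
  have P: "subspace K ?P (X \<otimes>\<^sub>t N)" by (rule subtensor_subspace[OF vsX vsN _ sub]) simp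
  have E: "lin (X \<otimes>\<^sub>t N) (X \<otimes>\<^sub>t N) (average L X R)" using average_tens(1)[OF Xmod Rmod L(1)] by (simp add: HR)
  interpret VN: vectorspace K N by (rule vsN)
  interpret VT: vectorspace K "X \<otimes>\<^sub>t N" by (rule vsXN)
  have "balanced_rel K A I N \<subseteq> {t \<in> carrier (X \<otimes>\<^sub>t N). average L X R t \<in> ?P}"
  proof (rule balanced_min; unfold IV I_simps A_simps(1))
    show "subspace K {t \<in> carrier (X \<otimes>\<^sub>t N). average L X R t \<in> ?P} (X \<otimes>\<^sub>t N)" by (rule subspace_preimage[OF E P])
    fix x a n assume x: "x \<in> carrier X" and a: "a \<in> carrier T" and n: "n \<in> carrier N"
    let ?g = "\<lambda>a. average L X R (tens K X N (ract X x (\<pi> a)) n) \<ominus>\<^bsub>X \<otimes>\<^sub>t N\<^esub> average L X R (tens K X N x (lact N a n))"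
    have l1: "lin T (X \<otimes>\<^sub>t N) (\<lambda>a. average L X R (tens K X N (ract X x (\<pi> a)) n))"
      and l2: "lin T (X \<otimes>\<^sub>t N) (\<lambda>a. average L X R (tens K X N x (lact N a n)))"
      by (intro lin_comp[OF E] lin_intro | simp add: x n)+
    have "a \<in> {a \<in> carrier T. ?g a \<in> ?P}"
      using a
    \<comment> \<open>The claim is additive in the algebra element, so elements b # h
      suffice.\<close>
    proof (induction a rule: tensor_induct[OF vsB vsH, consumes 1, case_names tens add])
      case (tens b h)
      interpret VB: vectorspace K B by (rule vsB)
      have bh: "smash_mult K H B (tens K B H b \<one>\<^bsub>H\<^esub>) (\<iota> h) = tens K B H b h" by (rule tens_factor[OF tens])
      \<comment> \<open>The augmentation part of b: subtracting the counit times 1 puts it into the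
        kernel of the counit. Acting with b # h on n and removing \<epsilon>(b) h n is acting with
        this element on h n.\<close>
      let ?m = "lact N (\<iota> h) n" and ?c = "b \<ominus>\<^bsub>B\<^esub> \<epsilon>\<^sub>B b \<odot>\<^bsub>B\<^esub> \<one>\<^bsub>B\<^esub>"
      have m: "?m \<in> carrier N" using tens n by simp
      interpret G: vectorspace K "ground K" by (rule vs_ground)
      have c1: "?c \<in> carrier B" using tens by simp
      have "\<epsilon>\<^sub>B ?c = \<epsilon>\<^sub>B b \<ominus>\<^bsub>ground K\<^esub> \<epsilon>\<^sub>B b"
        using tens by (simp add: linD(8)[OF lin_bcounit] linD(5)[OF lin_bcounit] braidedD(8))
      also have "\<dots> = \<zero>\<^bsub>ground K\<^esub>" using tens by (simp add: a_minus_def G.r_neg)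
      finally have c: "?c \<in> carrier B" "\<epsilon>\<^sub>B ?c = \<zero>" using c1 by (simp_all add: ground_def)
      have lm: "lin B N (\<lambda>b. lact N (tens K B H b \<one>\<^bsub>H\<^esub>) ?m)" by (intro lin_intro | simp add: m)+
      have one: "lact N (tens K B H \<one>\<^bsub>B\<^esub> \<one>\<^bsub>H\<^esub>) ?m = ?m" using left_moduleD(4)[OF Nmod m] by (simp add: A_simps)
      have "lact N (tens K B H ?c \<one>\<^bsub>H\<^esub>) ?m = lact N (tens K B H b h) n \<ominus>\<^bsub>N\<^esub> \<epsilon>\<^sub>B b \<odot>\<^bsub>N\<^esub> ?m"
        using tens n m one by (simp add: linD(8)[OF lm] linD(5)[OF lm] bh[symmetric] lactN_mult)
      then have y: "lact N (tens K B H b h) n \<ominus>\<^bsub>N\<^esub> \<epsilon>\<^sub>B b \<odot>\<^bsub>N\<^esub> ?m \<in> aug" using aug_mem[OF c m] by simp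
      have xh: "average L X R (tens K X N (ract X x h) n) = average L X R (tens K X N x ?m)"
        using average_balanced[OF Xmod Rmod L x tens(2), of n] n by (simp add: R_simps HR)
      note lx = lin_comp[OF E bilinD(1)[OF bilin_tens[OF vsX vsN] x]]
      have lxl: "lin X (X \<otimes>\<^sub>t N) (\<lambda>x. average L X R (tens K X N x n))"
        by (rule lin_comp[OF E bilinD(2)[OF bilin_tens[OF vsX vsN] n]])
      have "average L X R (tens K X N (ract X x (\<pi> (tens K B H b h))) n) = \<epsilon>\<^sub>B b \<odot>\<^bsub>X \<otimes>\<^sub>t N\<^esub> average L X R (tens K X N (ract X x h) n)"
        using tens x n by (simp add: proj_tens linD(5)[OF right_moduleD(3)[OF Xmod x]] linD(5)[OF lxl])
      also have "\<dots> = average L X R (tens K X N x (\<epsilon>\<^sub>B b \<odot>\<^bsub>N\<^esub> ?m))"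
        unfolding xh using linD(5)[OF lx] tens m by simp
      finally have "?g (tens K B H b h) = average L X R (tens K X N x (\<epsilon>\<^sub>B b \<odot>\<^bsub>N\<^esub> ?m \<ominus>\<^bsub>N\<^esub> lact N (tens K B H b h) n))"
        using tens m n linD(8)[OF lx] by simp
      moreover have "\<epsilon>\<^sub>B b \<odot>\<^bsub>N\<^esub> ?m \<ominus>\<^bsub>N\<^esub> lact N (tens K B H b h) n \<in> aug"
      proof -
        have "\<epsilon>\<^sub>B b \<odot>\<^bsub>N\<^esub> ?m \<ominus>\<^bsub>N\<^esub> lact N (tens K B H b h) n = \<ominus>\<^bsub>N\<^esub> (lact N (tens K B H b h) n \<ominus>\<^bsub>N\<^esub> \<epsilon>\<^sub>B b \<odot>\<^bsub>N\<^esub> ?m)"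
          using tens m n by (simp add: a_minus_def VN.minus_add VN.a_comm)
        then show ?thesis using y by (simp add: subspaceD(7)[OF aug_subspace])
      qed
      ultimately show ?case using average_aug[OF L(1) x] tens by simp
    next
      case (add s t)
      have st: "?g s \<in> ?P" "?g t \<in> ?P" using add by auto
      have "?g (s \<oplus>\<^bsub>T\<^esub> t) = ?g s \<oplus>\<^bsub>X \<otimes>\<^sub>t N\<^esub> ?g t"
        using add linD(3)[OF l1] linD(3)[OF l2]
        by (simp add: linD(4)[OF l1] linD(4)[OF l2] a_minus_def VT.minus_add VT.a_ac)
      moreover have "s \<oplus>\<^bsub>T\<^esub> t \<in> carrier T" by (rule vsD(4)[OF vsT add(1,2)])
      ultimately show ?case using subspaceD(5)[OF P st] by (simp only: mem_Collect_eq)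
    qed
    then have "?g a \<in> ?P" by simp
    then show "tens K X N (ract X x (\<pi> a)) n \<ominus>\<^bsub>X \<otimes>\<^sub>t N\<^esub> tens K X N x (lact N a n) \<in> {t \<in> carrier (X \<otimes>\<^sub>t N). average L X R t \<in> ?P}"
      using x a n by (simp add: linD(8)[OF E] tens_closed)
  qed
  with t show ?thesis by blast
qed

lemma quot_t_kernel:
  assumes t: "t \<in> carrier (X \<otimes>\<^sub>t M)"
  shows "quot_t t = \<zero>\<^bsub>X \<otimes>\<^sub>t Q\<^esub> \<longleftrightarrow> t \<in> subtensor K X M (carrier X) (coinv \<inter> aug)"
proof
  have k: "{y \<in> carrier M. quot y = \<zero>\<^bsub>Q\<^esub>} = coinv \<inter> aug" using quot_zero by (auto simp: carrier_M)
  show "quot_t t = \<zero>\<^bsub>X \<otimes>\<^sub>t Q\<^esub> \<Longrightarrow> t \<in> subtensor K X M (carrier X) (coinv \<inter> aug)"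
    using tmap_kernel[OF vsX lin_quot t] by (simp add: k)
  assume "t \<in> subtensor K X M (carrier X) (coinv \<inter> aug)"
  then have "quot_t t \<in> {\<zero>\<^bsub>X \<otimes>\<^sub>t Q\<^esub>}"
  proof (rule tlift_subtensor[OF _ vsX bilin_tmap[OF lin_id[OF vsX] lin_quot] vs_zero_subspace[OF vsXQ]])
    show "tens K X Q x (quot y) \<in> {\<zero>\<^bsub>X \<otimes>\<^sub>t Q\<^esub>}" if "x \<in> carrier X" "y \<in> coinv \<inter> aug" for x y
      using quot_zero[of y] that linD(6)[OF bilinD(1)[OF bilin_tens[OF vsX vsQ] that(1)]] by (simp add: carrier_M)
  qed (auto simp: carrier_M)
  then show "quot_t t = \<zero>\<^bsub>X \<otimes>\<^sub>t Q\<^esub>" by simp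
qed

text \<open>By \<open>average_balA\<close> and naturality the average of \<open>t\<close> has second
  legs that are coinvariant and in \<open>aug\<close>, so \<open>quot_t\<close> kills it. Thus
  \<open>quot_t t\<close> has zero average, and a tensor is congruent to its average modulo
  balancing relations.\<close>

lemma balanced_incl_quot:
  assumes L: "L \<in> carrier H" "\<epsilon> L = \<one>" "\<And>h. h \<in> carrier H \<Longrightarrow> h \<otimes>\<^bsub>H\<^esub> L = \<epsilon> h \<odot>\<^bsub>H\<^esub> L"
    and t: "t \<in> carrier (X \<otimes>\<^sub>t M)" and b: "incl_t t \<in> balanced_rel K A I N"
  shows "quot_t t \<in> balanced_rel K H X Q"
proof -
  note l = average_tens(1)[OF Xmod Mmod L(1)]
  have "average L X R (tmap X R (\<lambda>x. x) (\<lambda>m. m) t) = tmap X R (\<lambda>x. x) (\<lambda>m. m) (average L X M t)"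
    by (rule average_natural[OF Xmod Mmod Rmod L(1) lin_M_R _ t]) (simp add: M_facts(6))
  then have "incl_t (average L X M t) \<in> subtensor K X N (carrier X) aug"
    using average_balA[OF L(1,3) b] by (simp add: HR)
  then have "average L X M t \<in> subtensor K X M (carrier X) {m \<in> carrier M. m \<in> aug}"
    by (rule subtensor_preimage[OF vsX lin_M_N aug_subspace linD(3)[OF l t]])
  moreover have "{m \<in> carrier M. m \<in> aug} = coinv \<inter> aug" by (auto simp: carrier_M)
  ultimately have "quot_t (average L X M t) = \<zero>\<^bsub>X \<otimes>\<^sub>t Q\<^esub>" using quot_t_kernel[OF linD(3)[OF l t]] by simp
  moreover have "average L X Q (quot_t t) = quot_t (average L X M t)"
    by (rule average_natural[OF Xmod Mmod Qmod L(1) lin_quot _ t]) (simp add: Q_facts(6))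
  ultimately have z: "average L X Q (quot_t t) = \<zero>\<^bsub>X \<otimes>\<^sub>t Q\<^esub>" by simp
  interpret T: vectorspace K "X \<otimes>\<^sub>t Q" by (rule vsXQ)
  note qt = linD(3)[OF lin_quot_t t]
  \<comment> \<open>The congruence with the vanishing average inserted; changing the sign gives the
    claim.\<close>
  have "\<zero>\<^bsub>X \<otimes>\<^sub>t Q\<^esub> \<ominus>\<^bsub>X \<otimes>\<^sub>t Q\<^esub> quot_t t \<in> balanced_rel K H X Q"
    using average_congruent[OF Xmod Qmod L(1,2) qt] by (simp only: z)
  then have "\<ominus>\<^bsub>X \<otimes>\<^sub>t Q\<^esub> (\<zero>\<^bsub>X \<otimes>\<^sub>t Q\<^esub> \<ominus>\<^bsub>X \<otimes>\<^sub>t Q\<^esub> quot_t t) \<in> balanced_rel K H X Q"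
    by (rule subspaceD(7)[OF balanced_subspace(1)[OF Xmod Qmod]])
  then show ?thesis using qt by (simp add: a_minus_def)
qed

text \<open>Balancing relations lift along the quotient map, so \<open>t\<close> is a balanced
  \<open>s\<close> plus a tensor with second legs in \<open>coinv \<inter> aug\<close>. The image of
  \<open>s\<close> is balanced over \<open>A\<close> because \<iota>(h) acts on the inflation as h;
  the remainder is balanced because \<open>\<pi>\<close> kills the augmentation ideal of
  \<open>B\<close>.\<close>

lemma balanced_quot_incl:
  assumes t: "t \<in> carrier (X \<otimes>\<^sub>t M)" and b: "quot_t t \<in> balanced_rel K H X Q"
  shows "incl_t t \<in> balanced_rel K A I N"
proof -
  interpret TM: vectorspace K "X \<otimes>\<^sub>t M" by (rule vsXM)
  interpret TN: vectorspace K "X \<otimes>\<^sub>t N" by (rule vsXN)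
  interpret TQ: vectorspace K "X \<otimes>\<^sub>t Q" by (rule vsXQ)
  note BM = balanced_subspace[OF Xmod Mmod]
  have "balanced_rel K H X Q \<subseteq> quot_t ` balanced_rel K H X M"
  proof (rule balanced_min[OF subspace_image[OF lin_quot_t BM(1)]])
    fix x h n assume x: "x \<in> carrier X" and h: "h \<in> carrier H" and "n \<in> carrier Q"
    then obtain m where m: "m \<in> carrier M" "n = quot m" using quot_surj by auto
    have "tens K X Q (ract X x h) n \<ominus>\<^bsub>X \<otimes>\<^sub>t Q\<^esub> tens K X Q x (lact Q h n)
      = quot_t (tens K X M (ract X x h) m \<ominus>\<^bsub>X \<otimes>\<^sub>t M\<^esub> tens K X M x (lact M h m))"
      using x h m left_moduleD(6)[OF Mmod] by (simp add: linD(8)[OF lin_quot_t] tens_closed quot_t_tens Q_facts(6))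
    then show "tens K X Q (ract X x h) n \<ominus>\<^bsub>X \<otimes>\<^sub>t Q\<^esub> tens K X Q x (lact Q h n) \<in> quot_t ` balanced_rel K H X M"
      using BM(2)[OF x h m(1)] by (simp only: image_eqI)
  qed
  then obtain s where s: "s \<in> balanced_rel K H X M" "quot_t t = quot_t s" using b by auto
  have s': "s \<in> carrier (X \<otimes>\<^sub>t M)" by (rule subspaceD(4)[OF BM(1) s(1)])
  have "quot_t (t \<ominus>\<^bsub>X \<otimes>\<^sub>t M\<^esub> s) = quot_t t \<ominus>\<^bsub>X \<otimes>\<^sub>t Q\<^esub> quot_t s" by (rule linD(8)[OF lin_quot_t t s'])
  also have "\<dots> = \<zero>\<^bsub>X \<otimes>\<^sub>t Q\<^esub>" using s(2) linD(3)[OF lin_quot_t s'] by (simp add: TQ.r_neg a_minus_def)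
  finally have "quot_t (t \<ominus>\<^bsub>X \<otimes>\<^sub>t M\<^esub> s) = \<zero>\<^bsub>X \<otimes>\<^sub>t Q\<^esub>" .
  then have "t \<ominus>\<^bsub>X \<otimes>\<^sub>t M\<^esub> s \<in> subtensor K X M (carrier X) (coinv \<inter> aug)"
    using quot_t_kernel t s' by simp
  moreover have "subtensor K X M (carrier X) (coinv \<inter> aug) \<subseteq> {t \<in> carrier (X \<otimes>\<^sub>t M). incl_t t \<in> balanced_rel K A I N}"
  proof (rule subtensor_min[OF subspace_preimage[OF lin_incl_t balA_subspace]])
    fix x y assume x: "x \<in> carrier X" and y: "y \<in> coinv \<inter> aug"
    note lx = bilinD(1)[OF bilin_tens[OF vsX vsN] x]
    have "aug \<subseteq> {y \<in> carrier N. tens K X N x y \<in> balanced_rel K A I N}"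
    proof (rule aug_min[OF subspace_preimage[OF lx balA_subspace]])
      fix b n assume b: "b \<in> carrier B" "\<epsilon>\<^sub>B b = \<zero>" and n: "n \<in> carrier N"
      interpret VH: vectorspace K H by (rule vsH)
      note bT = tens_T[OF b(1) H.one_closed]
      \<comment> \<open>Since b # 1 acts as zero on the inflation, the balancing relation for it
        reduces to minus x \<otimes> b n.\<close>
      have "\<pi> (tens K B H b \<one>\<^bsub>H\<^esub>) = \<zero>\<^bsub>H\<^esub>" using b by (simp add: proj_tens)
      then have "tens K X N (ract X x (\<pi> (tens K B H b \<one>\<^bsub>H\<^esub>))) n = \<zero>\<^bsub>X \<otimes>\<^sub>t N\<^esub>"
        using linD(6)[OF right_moduleD(3)[OF Xmod x]] linD(6)[OF bilinD(2)[OF bilin_tens[OF vsX vsN] n]] by simp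
      then have "\<ominus>\<^bsub>X \<otimes>\<^sub>t N\<^esub> tens K X N x (lact N (tens K B H b \<one>\<^bsub>H\<^esub>) n) \<in> balanced_rel K A I N"
        using balA_mem[OF x bT n] tens_closed[OF vsX vsN x lactN_closed[OF bT n]] by (simp add: a_minus_def)
      then have "\<ominus>\<^bsub>X \<otimes>\<^sub>t N\<^esub> (\<ominus>\<^bsub>X \<otimes>\<^sub>t N\<^esub> tens K X N x (lact N (tens K B H b \<one>\<^bsub>H\<^esub>) n)) \<in> balanced_rel K A I N"
        by (rule subspaceD(7)[OF balA_subspace])
      then show "lact N (tens K B H b \<one>\<^bsub>H\<^esub>) n \<in> {y \<in> carrier N. tens K X N x y \<in> balanced_rel K A I N}"
        using tens_closed[OF vsX vsN x lactN_closed[OF bT n]] bT n by simp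
    qed
    then show "tens K X M x y \<in> {t \<in> carrier (X \<otimes>\<^sub>t M). incl_t t \<in> balanced_rel K A I N}"
      using x y by (auto simp: incl_t_tens carrier_M tens_closed)
  qed
  ultimately have 1: "incl_t (t \<ominus>\<^bsub>X \<otimes>\<^sub>t M\<^esub> s) \<in> balanced_rel K A I N" by blast
  have "balanced_rel K H X M \<subseteq> {t \<in> carrier (X \<otimes>\<^sub>t M). incl_t t \<in> balanced_rel K A I N}"
  proof (rule balanced_min[OF subspace_preimage[OF lin_incl_t balA_subspace]])
    fix x h m assume x: "x \<in> carrier X" and h: "h \<in> carrier H" and m: "m \<in> carrier M"
    then show "tens K X M (ract X x h) m \<ominus>\<^bsub>X \<otimes>\<^sub>t M\<^esub> tens K X M x (lact M h m)
      \<in> {t \<in> carrier (X \<otimes>\<^sub>t M). incl_t t \<in> balanced_rel K A I N}"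
      using balA_mem[OF x incl_closed[OF h] M_in_N[OF m]] left_moduleD(6)[OF Mmod]
      by (simp add: linD(8)[OF lin_incl_t] tens_closed incl_t_tens M_facts(6) R_simps)
  qed
  then have 2: "incl_t s \<in> balanced_rel K A I N" using s(1) by blast
  note it = linD(3)[OF lin_incl_t t] and sn = linD(3)[OF lin_incl_t s']
  have "incl_t t = incl_t (t \<ominus>\<^bsub>X \<otimes>\<^sub>t M\<^esub> s) \<oplus>\<^bsub>X \<otimes>\<^sub>t N\<^esub> incl_t s"
    unfolding linD(8)[OF lin_incl_t t s'] using it sn by (simp add: a_minus_def TN.a_assoc TN.l_neg)
  then show ?thesis using subspaceD(5)[OF balA_subspace 1 2] by simp
qed

lemma quot_cotensor:
  assumes t: "t \<in> cotensor K H X M"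
  shows "quot_t t \<in> cotensor K H X Q"
proof (rule cotensor_map[OF vsH right_comoduleD(1)[OF Xcomod] right_comoduleD(1)[OF Xcomod] lin_id[OF vsX] _
      left_comoduleD(1)[OF Mcomod] left_comoduleD(1)[OF Qcomod] lin_quot Q_facts(5) t])
  show "rcoact X x = tmap X H (\<lambda>x. x) (\<lambda>h. h) (rcoact X x)" if "x \<in> carrier X" for x
    using tlift_tens_id[OF vsX vsH right_comoduleD(3)[OF Xcomod that]] by simp
qed

text \<open>An arbitrary preimage of s need not be a cotensor, but its coaverage is one; naturality
  moves the coaverage to s, where it acts as the identity.\<close>

lemma cotensor_quot_lift:
  assumes l: "functional H l" "l \<one>\<^bsub>H\<^esub> = \<one>"
    "\<And>h. h \<in> carrier H \<Longrightarrow> tlift K H (\<Delta> h) (\<lambda>a b. l b \<odot>\<^bsub>H\<^esub> a) = l h \<odot>\<^bsub>H\<^esub> \<one>\<^bsub>H\<^esub>"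
    and s: "s \<in> cotensor K H X Q"
  obtains t where "t \<in> cotensor K H X M" "s = quot_t t"
proof -
  have "s \<in> carrier (X \<otimes>\<^sub>t Q)" using s by (simp add: cotensor_def)
  then obtain t where t: "t \<in> carrier (X \<otimes>\<^sub>t M)" "s = quot_t t"
    by (rule tmap_surj[OF vsX lin_quot quot_surj])
  have "quot_t (coaverage l X M t) = coaverage l X Q (quot_t t)"
    by (rule coaverage_natural[OF l Xcomod Mcomod Qcomod lin_quot Q_facts(5) t(1), symmetric])
  also have "\<dots> = s" using coaverage_cotensor_id[OF l Xcomod Qcomod s] t by simp
  finally show thesis
    using that[OF coaverage_in_cotensor[OF l Xcomod Mcomod t(1)]] by simp
qed

end

subsection \<open>The isomorphism of bitensor products\<close>

text \<open>\<open>Bit\<close> keeps the operations of the quotient and only shrinks the carrier, so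
  it is a subspace with inherited rules on cosets, valid for all tensors and not just for
  cotensors.\<close>

lemma (in linear_algebra) Bit_facts:
  assumes b: "subspace K (balanced_rel K C X N) (X \<otimes>\<^sub>t N)" and c: "subspace K (cotensor K C X N) (X \<otimes>\<^sub>t N)"
  shows "vspace (Bit K C X N)"
    "carrier (Bit K C X N) = (\<lambda>t. balanced_rel K C X N +>\<^bsub>X \<otimes>\<^sub>t N\<^esub> t) ` cotensor K C X N"
    "s \<in> carrier (X \<otimes>\<^sub>t N) \<Longrightarrow> t \<in> carrier (X \<otimes>\<^sub>t N) \<Longrightarrow>
      (balanced_rel K C X N +>\<^bsub>X \<otimes>\<^sub>t N\<^esub> s) \<oplus>\<^bsub>Bit K C X N\<^esub> (balanced_rel K C X N +>\<^bsub>X \<otimes>\<^sub>t N\<^esub> t) =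
      balanced_rel K C X N +>\<^bsub>X \<otimes>\<^sub>t N\<^esub> (s \<oplus>\<^bsub>X \<otimes>\<^sub>t N\<^esub> t)"
    "k \<in> carrier K \<Longrightarrow> t \<in> carrier (X \<otimes>\<^sub>t N) \<Longrightarrow>
      k \<odot>\<^bsub>Bit K C X N\<^esub> (balanced_rel K C X N +>\<^bsub>X \<otimes>\<^sub>t N\<^esub> t) =
      balanced_rel K C X N +>\<^bsub>X \<otimes>\<^sub>t N\<^esub> (k \<odot>\<^bsub>X \<otimes>\<^sub>t N\<^esub> t)"
  using vs_restrict[OF subspace_image[OF lin_coset[OF b] c]] add_quotient[OF b] smult_quotient[OF b]
  by (simp_all add: Bit_def tensor_over_def)

context boson_bit
begin

abbreviation proj_A where "proj_A \<equiv> \<lambda>t. balanced_rel K A I N +>\<^bsub>X \<otimes>\<^sub>t N\<^esub> t"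
abbreviation proj_H where "proj_H \<equiv> \<lambda>t. balanced_rel K H X Q +>\<^bsub>X \<otimes>\<^sub>t Q\<^esub> t"

text \<open>Given as a description over all representing cotensors, so that no choice of
  representative and no integral occurs in it; that the result is unique is
  \<open>bit_proj_eq_iff\<close>. It therefore depends on \<open>X\<close> and \<open>N\<close> as
  parameters alone once \<open>K\<close>, \<open>H\<close> and \<open>B\<close> are fixed.\<close>

definition bit_iso where
  "bit_iso u = (THE c. \<exists>t\<in>cotensor K H X M. u = proj_A (incl_t t) \<and> c = proj_H (quot_t t))"

lemma cotensor_M: "subspace K (cotensor K H X M) (X \<otimes>\<^sub>t M)"
  by (rule cotensor_subspace(3)[OF Xcomod Mcomod vsH])

lemma balH_subspace: "subspace K (balanced_rel K H X Q) (X \<otimes>\<^sub>t Q)"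
  by (rule balanced_subspace(1)[OF Xmod Qmod])

lemmas Bit_A = Bit_facts[of A I N, unfolded IV, OF balA_subspace
    subspace_image[OF lin_incl_t cotensor_M, folded cotensor_image], unfolded cotensor_image image_image]
lemmas Bit_H = Bit_facts[OF balH_subspace cotensor_subspace(3)[OF Xcomod Qcomod vsH]]

lemma bit_iso_cases:
  assumes "u \<in> carrier (Bit K A I N)"
  obtains t where "t \<in> cotensor K H X M" "t \<in> carrier (X \<otimes>\<^sub>t M)" "u = proj_A (incl_t t)"
  using assms subspaceD(4)[OF cotensor_M] by (auto simp: Bit_A(2))

context
  fixes L assumes L: "L \<in> carrier H" "\<epsilon> L = \<one>" "\<And>h. h \<in> carrier H \<Longrightarrow> h \<otimes>\<^bsub>H\<^esub> L = \<epsilon> h \<odot>\<^bsub>H\<^esub> L"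
begin

text \<open>Apply the comparison of balancing relations to the difference of the two tensors. Read
  from left to right this makes \<open>bit_iso\<close> well defined, from right to left it makes it
  injective.\<close>

lemma bit_proj_eq_iff:
  assumes t: "t \<in> carrier (X \<otimes>\<^sub>t M)" and s: "s \<in> carrier (X \<otimes>\<^sub>t M)"
  shows "proj_A (incl_t t) = proj_A (incl_t s) \<longleftrightarrow> proj_H (quot_t t) = proj_H (quot_t s)"
proof -
  interpret XM: vectorspace K "X \<otimes>\<^sub>t M" by simp
  have ts: "t \<ominus>\<^bsub>X \<otimes>\<^sub>t M\<^esub> s \<in> carrier (X \<otimes>\<^sub>t M)" using t s by simp
  have "proj_A (incl_t t) = proj_A (incl_t s) \<longleftrightarrow> incl_t (t \<ominus>\<^bsub>X \<otimes>\<^sub>t M\<^esub> s) \<in> balanced_rel K A I N"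
    using coset_eq_iff[OF balA_subspace linD(3)[OF lin_incl_t t] linD(3)[OF lin_incl_t s]]
    by (simp add: linD(8)[OF lin_incl_t t s])
  also have "\<dots> \<longleftrightarrow> quot_t (t \<ominus>\<^bsub>X \<otimes>\<^sub>t M\<^esub> s) \<in> balanced_rel K H X Q"
    using balanced_incl_quot[OF L ts] balanced_quot_incl[OF ts] by blast
  also have "\<dots> \<longleftrightarrow> proj_H (quot_t t) = proj_H (quot_t s)"
    using coset_eq_iff[OF balH_subspace linD(3)[OF lin_quot_t t] linD(3)[OF lin_quot_t s]]
    by (simp add: linD(8)[OF lin_quot_t t s])
  finally show ?thesis .
qed

lemma bit_iso_proj:
  assumes t: "t \<in> cotensor K H X M"
  shows "bit_iso (proj_A (incl_t t)) = proj_H (quot_t t)"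
  unfolding bit_iso_def
proof (rule the_equality)
  show "\<exists>s\<in>cotensor K H X M. proj_A (incl_t t) = proj_A (incl_t s) \<and> proj_H (quot_t t) = proj_H (quot_t s)"
    using t by blast
  show "c = proj_H (quot_t t)"
    if "\<exists>s\<in>cotensor K H X M. proj_A (incl_t t) = proj_A (incl_t s) \<and> c = proj_H (quot_t s)" for c
    using that bit_proj_eq_iff[OF subspaceD(4)[OF cotensor_M t] subspaceD(4)[OF cotensor_M]] by auto
qed

lemma lin_bit_iso: "lin (Bit K A I N) (Bit K H X Q) bit_iso"
proof (rule linI[OF Bit_A(1) Bit_H(1)])
  fix u assume u: "u \<in> carrier (Bit K A I N)"
  then obtain t where t: "t \<in> cotensor K H X M" "t \<in> carrier (X \<otimes>\<^sub>t M)" "u = proj_A (incl_t t)"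
    by (rule bit_iso_cases)
  then show "bit_iso u \<in> carrier (Bit K H X Q)" using quot_cotensor[OF t(1)] by (simp add: bit_iso_proj Bit_H(2))
  note i = linD(3)[OF lin_incl_t] and q = linD(3)[OF lin_quot_t]
  show "bit_iso (u \<oplus>\<^bsub>Bit K A I N\<^esub> v) = bit_iso u \<oplus>\<^bsub>Bit K H X Q\<^esub> bit_iso v"
    if "v \<in> carrier (Bit K A I N)" for v
  proof -
    from that obtain s where s: "s \<in> cotensor K H X M" "s \<in> carrier (X \<otimes>\<^sub>t M)" "v = proj_A (incl_t s)"
      by (rule bit_iso_cases)
    have "bit_iso (u \<oplus>\<^bsub>Bit K A I N\<^esub> v) = bit_iso (proj_A (incl_t (t \<oplus>\<^bsub>X \<otimes>\<^sub>t M\<^esub> s)))"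
      by (simp add: t(3) s(3) Bit_A(3) i t(2) s(2) linD(4)[OF lin_incl_t])
    also have "\<dots> = proj_H (quot_t (t \<oplus>\<^bsub>X \<otimes>\<^sub>t M\<^esub> s))"
      by (rule bit_iso_proj[OF subspaceD(5)[OF cotensor_M t(1) s(1)]])
    also have "\<dots> = bit_iso u \<oplus>\<^bsub>Bit K H X Q\<^esub> bit_iso v"
      unfolding t(3) s(3) bit_iso_proj[OF t(1)] bit_iso_proj[OF s(1)]
      by (simp add: Bit_H(3) q t(2) s(2) linD(4)[OF lin_quot_t])
    finally show ?thesis .
  qed
  show "bit_iso (k \<odot>\<^bsub>Bit K A I N\<^esub> u) = k \<odot>\<^bsub>Bit K H X Q\<^esub> bit_iso u" if k: "k \<in> carrier K" for k
  proof -
    have "bit_iso (k \<odot>\<^bsub>Bit K A I N\<^esub> u) = bit_iso (proj_A (incl_t (k \<odot>\<^bsub>X \<otimes>\<^sub>t M\<^esub> t)))"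
      by (simp add: t(3) Bit_A(4) i k t(2) linD(5)[OF lin_incl_t])
    also have "\<dots> = proj_H (quot_t (k \<odot>\<^bsub>X \<otimes>\<^sub>t M\<^esub> t))"
      by (rule bit_iso_proj[OF subspaceD(6)[OF cotensor_M k t(1)]])
    also have "\<dots> = k \<odot>\<^bsub>Bit K H X Q\<^esub> bit_iso u"
      unfolding t(3) bit_iso_proj[OF t(1)] by (simp add: Bit_H(4) q k t(2) linD(5)[OF lin_quot_t])
    finally show ?thesis .
  qed
qed

text \<open>The cointegral enters for surjectivity: a class on the right is represented by a
  cotensor over the subquotient, which lifts to a cotensor over \<open>M\<close>.\<close>

lemma bij_bit_iso:
  assumes l: "functional H l" "l \<one>\<^bsub>H\<^esub> = \<one>"
    "\<And>h. h \<in> carrier H \<Longrightarrow> tlift K H (\<Delta> h) (\<lambda>a b. l b \<odot>\<^bsub>H\<^esub> a) = l h \<odot>\<^bsub>H\<^esub> \<one>\<^bsub>H\<^esub>"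
  shows "bij_betw bit_iso (carrier (Bit K A I N)) (carrier (Bit K H X Q))"
proof (rule bij_betw_imageI)
  show "inj_on bit_iso (carrier (Bit K A I N))"
  proof (rule inj_onI)
    fix u v assume u: "u \<in> carrier (Bit K A I N)" and v: "v \<in> carrier (Bit K A I N)" and eq: "bit_iso u = bit_iso v"
    from u obtain t where t: "t \<in> cotensor K H X M" "t \<in> carrier (X \<otimes>\<^sub>t M)" "u = proj_A (incl_t t)"
      by (rule bit_iso_cases)
    from v obtain s where s: "s \<in> cotensor K H X M" "s \<in> carrier (X \<otimes>\<^sub>t M)" "v = proj_A (incl_t s)"
      by (rule bit_iso_cases)
    show "u = v" using eq bit_proj_eq_iff[OF t(2) s(2)] unfolding t(3) s(3) bit_iso_proj[OF t(1)] bit_iso_proj[OF s(1)] by simp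
  qed
  have "\<exists>u\<in>carrier (Bit K A I N). v = bit_iso u" if "v \<in> carrier (Bit K H X Q)" for v
  proof -
    from that obtain s where s: "s \<in> cotensor K H X Q" "v = proj_H s" by (auto simp: Bit_H(2))
    obtain t where t: "t \<in> cotensor K H X M" "s = quot_t t" using cotensor_quot_lift[OF l s(1)] .
    then show ?thesis using s(2) bit_iso_proj[OF t(1)] by (auto simp: Bit_A(2))
  qed
  then show "bit_iso ` carrier (Bit K A I N) = carrier (Bit K H X Q)" using linD(3)[OF lin_bit_iso] by auto
qed

end

end

section \<open>Naturality in both arguments\<close>

locale boson_bit_hom = boson_bit K H B X N + tgt: boson_bit K H B X' N'
  for K :: "'k ring" (structure) and H :: "('k, 'h) hopf_data" and B :: "('k, 'h, 'b) braided_hopf_data"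
    and X :: "('k, 'h, 'x) rmodcomod" and N :: "('k, ('b \<times> 'h \<Rightarrow> 'k) set, 'n) lmodcomod"
    and X' :: "('k, 'h, 'y) rmodcomod" and N' :: "('k, ('b \<times> 'h \<Rightarrow> 'k) set, 'm) lmodcomod" +
  fixes f :: "'x \<Rightarrow> 'y" and g :: "'n \<Rightarrow> 'm"
  assumes f: "right_modcomod_hom K H X X' f" and g: "yd_hom K A N N' g"
begin

lemma lin_f: "lin X X' f"
  and f_ract: "x \<in> carrier X \<Longrightarrow> h \<in> carrier H \<Longrightarrow> f (ract X x h) = ract X' (f x) h"
  and f_rcoact: "x \<in> carrier X \<Longrightarrow> rcoact X' (f x) = tmap X' H f (\<lambda>h. h) (rcoact X x)"
  using f by (auto simp: right_modcomod_hom_def)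

lemmas lin_g = yd_homD(1)[OF g] and g_lact = yd_homD(2)[OF g] and g_lcoact = yd_homD(3)[OF g]

lemma g_coinv: "n \<in> coinv \<Longrightarrow> g n \<in> tgt.coinv"
proof -
  assume n: "n \<in> coinv"
  note l = lin_tmap[OF lin_id[OF vsT] lin_g]
  have "subtensor K T N (\<iota> ` carrier H) (carrier N) \<subseteq>
    {t \<in> carrier (T \<otimes>\<^sub>t N). tmap T N' (\<lambda>a. a) g t \<in> subtensor K T N' (\<iota> ` carrier H) (carrier N')}"
    by (rule subtensor_min[OF subspace_preimage[OF l tgt.HN_subspace]])
       (auto simp: tens_closed tmap_tens[OF lin_id[OF vsT] lin_g] linD(3)[OF lin_g]
         intro!: subtensor_tens[OF vsT tgt.vsN incl_subset])
  then have "tmap T N' (\<lambda>a. a) g (lcoact N n) \<in> subtensor K T N' (\<iota> ` carrier H) (carrier N')"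
    using coinvD(2)[OF n] by blast
  then show ?thesis using g_lcoact[OF coinvD(1)[OF n]] linD(3)[OF lin_g coinvD(1)[OF n]]
    by (simp add: tgt.coinv_eq tgt.AN)
qed

lemma g_aug: "n \<in> aug \<Longrightarrow> g n \<in> tgt.aug"
proof -
  have "aug \<subseteq> {n \<in> carrier N. g n \<in> tgt.aug}"
  proof (rule aug_min[OF subspace_preimage[OF lin_g tgt.aug_subspace]])
    fix b n assume "b \<in> carrier B" "\<epsilon>\<^sub>B b = \<zero>" "n \<in> carrier N"
    then show "lact N (tens K B H b \<one>\<^bsub>H\<^esub>) n \<in> {n \<in> carrier N. g n \<in> tgt.aug}"
      using tgt.aug_mem[of b "g n"] by (simp add: g_lact A_simps tens_closed linD(3)[OF lin_g])
  qed
  then show "n \<in> aug \<Longrightarrow> g n \<in> tgt.aug" by blast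
qed

lemma lin_g_M: "lin M tgt.M g"
proof -
  have "lin (N\<lparr>carrier := coinv\<rparr>) (N'\<lparr>carrier := tgt.coinv\<rparr>) g"
    by (rule linI) (auto simp: vs_restrict coinv_subspace tgt.coinv_subspace g_coinv linD[OF lin_g] coinvD(1))
  then show ?thesis by (rule lin_same[OF same_M tgt.same_M])
qed

abbreviation gbar where "gbar \<equiv> bracket_map K H B N' g"

lemma gbar_quot: "m \<in> carrier N \<Longrightarrow> gbar (quot m) = tgt.quot (g m)"
  unfolding bracket_map_def
  by (rule induced_coset[OF tgt.U_subspace(1) lin_g U_subspace(1)]) (auto simp: g_coinv g_aug)

lemma lin_gbar: "lin Q tgt.Q gbar"
  and gbar_lact: "h \<in> carrier H \<Longrightarrow> x \<in> carrier Q \<Longrightarrow> gbar (lact Q h x) = lact tgt.Q h (gbar x)"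
proof -
  note q = linD[OF lin_quot] and q' = linD[OF tgt.lin_quot] and gM = linD[OF lin_g_M]
  interpret M: vectorspace K M by simp
  have gq: "gbar (quot m) = tgt.quot (g m)" if "m \<in> carrier M" for m
    by (rule gbar_quot[OF M_in_N[OF that]])
  have ex: "\<exists>m\<in>carrier M. x = quot m" if "x \<in> carrier Q" for x using that quot_surj by blast
  show "lin Q tgt.Q gbar"
  proof (rule linI[OF vsQ tgt.vsQ])
    fix x assume "x \<in> carrier Q"
    then obtain m where m: "m \<in> carrier M" "x = quot m" by (rule ex[THEN bexE])
    show "gbar x \<in> carrier tgt.Q" unfolding m(2) gq[OF m(1)] by (rule q'(3)[OF gM(3)[OF m(1)]])
    show "gbar (x \<oplus>\<^bsub>Q\<^esub> y) = gbar x \<oplus>\<^bsub>tgt.Q\<^esub> gbar y" if y: "y \<in> carrier Q" for y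
    proof -
      obtain m' where m': "m' \<in> carrier M" "y = quot m'" using ex[OF y] by (rule bexE)
      have "gbar (x \<oplus>\<^bsub>Q\<^esub> y) = gbar (quot (m \<oplus>\<^bsub>M\<^esub> m'))" by (simp only: m(2) m'(2) q(4)[OF m(1) m'(1)])
      also have "\<dots> = tgt.quot (g (m \<oplus>\<^bsub>M\<^esub> m'))" by (rule gq[OF M.a_closed[OF m(1) m'(1)]])
      also have "\<dots> = gbar x \<oplus>\<^bsub>tgt.Q\<^esub> gbar y"
        by (simp only: gM(4)[OF m(1) m'(1)] q'(4)[OF gM(3)[OF m(1)] gM(3)[OF m'(1)]] m(2) m'(2) gq[OF m(1)] gq[OF m'(1)])
      finally show ?thesis .
    qed
    show "gbar (c \<odot>\<^bsub>Q\<^esub> x) = c \<odot>\<^bsub>tgt.Q\<^esub> gbar x" if c: "c \<in> carrier K" for c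
    proof -
      have "gbar (c \<odot>\<^bsub>Q\<^esub> x) = gbar (quot (c \<odot>\<^bsub>M\<^esub> m))" by (simp only: m(2) q(5)[OF c m(1)])
      also have "\<dots> = tgt.quot (g (c \<odot>\<^bsub>M\<^esub> m))" by (rule gq[OF M.smult_closed[OF c m(1)]])
      also have "\<dots> = c \<odot>\<^bsub>tgt.Q\<^esub> gbar x"
        by (simp only: gM(5)[OF c m(1)] q'(5)[OF c gM(3)[OF m(1)]] m(2) gq[OF m(1)])
      finally show ?thesis .
    qed
  qed
  show "gbar (lact Q h x) = lact tgt.Q h (gbar x)" if h: "h \<in> carrier H" and x: "x \<in> carrier Q"
  proof -
    obtain m where m: "m \<in> carrier M" "x = quot m" using ex[OF x] by (rule bexE)
    have hm: "lact M h m \<in> carrier M" using left_moduleD(6)[OF Mmod h m(1)] .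
    have "lact Q h x = quot (lact M h m)" unfolding m(2) using Q_facts(6)[OF h m(1)] by (simp only: bracket_def coset_M)
    then have "gbar (lact Q h x) = tgt.quot (g (lact M h m))" by (simp only: gq[OF hm])
    also have "g (lact M h m) = lact tgt.M h (g m)"
      using g_lact[of "\<iota> h" m] M_in_N[OF m(1)] M_facts(6) tgt.M_facts(6) h m(1)
      by (simp add: A_simps R_simps tgt.R_simps gM(3))
    also have "tgt.quot (lact tgt.M h (g m)) = lact tgt.Q h (tgt.quot (g m))"
      using tgt.Q_facts(6)[OF h gM(3)[OF m(1)]] by (simp only: bracket_def tgt.coset_M)
    finally show ?thesis by (simp only: m(2) gq[OF m(1)])
  qed
qed

lemma hom_cotensor_A:
  assumes t: "t \<in> cotensor K A I N"
  shows "tmap X' N' f g t \<in> cotensor K A tgt.I N'"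
proof -
  have r: "rcoact tgt.I (f x) = tmap X' T f (\<lambda>a. a) (rcoact I x)" if x: "x \<in> carrier X" for x
  proof -
    have "rcoact tgt.I (f x) = tmap X' T f \<iota> (rcoact X x)"
      unfolding tgt.I_simps f_rcoact[OF x]
      by (rule tlift_tmap[OF lin_f lin_id[OF vsH] bilin_tmap[OF lin_id[OF tgt.vsX] lin_incl]]) (simp add: x)
    also have "\<dots> = tmap X' T f (\<lambda>a. a) (rcoact I x)"
      by (rule rcoactI_apply[OF bilin_tmap[OF lin_f lin_id[OF vsT]] x, symmetric])
    finally show ?thesis .
  qed
  have "tmap tgt.I N' f g t \<in> cotensor K A tgt.I N'"
    by (rule cotensor_map[OF vsA _ _ _ _ left_comoduleD(1)[OF Ncomod] left_comoduleD(1)[OF tgt.Ncomod] lin_g g_lcoact t])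
       (simp_all add: IV tgt.IV TA lin_I_iff tgt.lin_I_iff lin_rcoactI tgt.lin_rcoactI lin_f I_simps(1) r)
  then show ?thesis by (simp add: tgt.IV)
qed

text \<open>That f \<otimes> g preserves cotensors between the coinvariants is deduced from the case
  over \<open>A\<close>: its image in X' \<otimes> N' is a cotensor over \<open>A\<close>, hence
  comes from one over \<open>H\<close>, and the inclusion of tensors is injective. The other two
  equations say that f \<otimes> g is compatible with \<open>incl_t\<close> and
  \<open>quot_t\<close>.\<close>

lemma hom_cotensor_M:
  assumes t: "t \<in> cotensor K H X M"
  shows "tmap X' tgt.M f g t \<in> cotensor K H X' tgt.M"
    "tmap X' N' f g (incl_t t) = tgt.incl_t (tmap X' tgt.M f g t)"
    "tmap X' tgt.Q f gbar (quot_t t) = tgt.quot_t (tmap X' tgt.M f g t)"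
proof -
  have tc: "t \<in> carrier (X \<otimes>\<^sub>t M)" by (rule subspaceD(4)[OF cotensor_M t])
  have t'c: "tmap X' tgt.M f g t \<in> carrier (X' \<otimes>\<^sub>t tgt.M)" by (rule linD(3)[OF lin_tmap[OF lin_f lin_g_M] tc])
  show 1: "tmap X' N' f g (incl_t t) = tgt.incl_t (tmap X' tgt.M f g t)"
    unfolding tmap_tmap[OF lin_id[OF vsX] lin_M_N lin_f lin_g tc]
      tmap_tmap[OF lin_f lin_g_M lin_id[OF tgt.vsX] tgt.lin_M_N tc] ..
  \<comment> \<open>The lift over the target is some cotensor; injectivity of id \<otimes> inclusion
    identifies it with the image of \<open>t\<close>.\<close>
  obtain s where s: "s \<in> cotensor K H X' tgt.M" "tmap X' N' f g (incl_t t) = tgt.incl_t s"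
    using tgt.cotensor_lift[OF hom_cotensor_A[OF incl_cotensor[OF t]]] .
  have "tmap X' tgt.M f g t = s"
    by (rule tmap_inj[OF tgt.vsX tgt.lin_M_N _ t'c subspaceD(4)[OF tgt.cotensor_M s(1)]])
       (use 1 s(2) in auto)
  then show "tmap X' tgt.M f g t \<in> cotensor K H X' tgt.M" using s(1) by simp
  have "tmap X' tgt.Q f gbar (quot_t t) = tmap X' tgt.Q f (\<lambda>m. gbar (quot m)) t"
    by (rule tmap_tmap[OF lin_id[OF vsX] lin_quot lin_f lin_gbar tc])
  also have "\<dots> = tmap X' tgt.Q f (\<lambda>m. tgt.quot (g m)) t"
    by (rule tlift_cong[OF tc vsX bilin_tmap[OF lin_f lin_comp[OF tgt.lin_quot lin_g_M]]])
       (simp add: gbar_quot M_in_N)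
  also have "\<dots> = tgt.quot_t (tmap X' tgt.M f g t)"
    by (rule tmap_tmap[OF lin_f lin_g_M lin_id[OF tgt.vsX] tgt.lin_quot tc, symmetric])
  finally show "tmap X' tgt.Q f gbar (quot_t t) = tgt.quot_t (tmap X' tgt.M f g t)" .
qed

text \<open>If \<open>t\<close> represents the class u, then its image under f \<otimes> g
  represents the image of u, by \<open>hom_cotensor_M\<close>. Both composites are thus evaluated at
  the same cotensor over the target.\<close>

lemma bit_iso_natural:
  assumes L: "L \<in> carrier H" "\<epsilon> L = \<one>" "\<And>h. h \<in> carrier H \<Longrightarrow> h \<otimes>\<^bsub>H\<^esub> L = \<epsilon> h \<odot>\<^bsub>H\<^esub> L"
    and u: "u \<in> carrier (Bit K A I N)"
  shows "tgt.bit_iso (Bit_map K A tgt.I N' f g u) = Bit_map K H X' tgt.Q f gbar (bit_iso u)"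
proof -
  from u obtain t where t: "t \<in> cotensor K H X M" "t \<in> carrier (X \<otimes>\<^sub>t M)" "u = proj_A (incl_t t)"
    by (rule bit_iso_cases)
  let ?t = "tmap X' tgt.M f g t"
  have "tmap tgt.I N' f g ` balanced_rel K A I N \<subseteq> balanced_rel K A tgt.I N'"
    by (rule balanced_map[OF Imod tgt.Imod _ _ Nmod tgt.Nmod lin_g g_lact])
       (simp_all add: lin_I_iff tgt.lin_I_iff lin_f I_simps tgt.I_simps f_ract A_simps)
  then have A: "tmap X' N' f g ` balanced_rel K A I N \<subseteq> balanced_rel K A tgt.I N'" by (simp add: tgt.IV)
  have "Bit_map K A tgt.I N' f g u = tgt.proj_A (tmap X' N' f g (incl_t t))"
    unfolding Bit_map_def t(3) tgt.IV
    by (rule induced_coset[OF tgt.balA_subspace lin_tmap[OF lin_f lin_g] balA_subspace A linD(3)[OF lin_incl_t t(2)]])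
  then have "tgt.bit_iso (Bit_map K A tgt.I N' f g u) = tgt.proj_H (tgt.quot_t ?t)"
    by (simp add: hom_cotensor_M[OF t(1)] tgt.bit_iso_proj[OF L])
  moreover have "bit_iso u = proj_H (quot_t t)" unfolding t(3) by (rule bit_iso_proj[OF L t(1)])
  moreover have "Bit_map K H X' tgt.Q f gbar (proj_H (quot_t t)) = tgt.proj_H (tmap X' tgt.Q f gbar (quot_t t))"
    unfolding Bit_map_def
    by (rule induced_coset[OF tgt.balH_subspace lin_tmap[OF lin_f lin_gbar] balH_subspace
          balanced_map[OF Xmod tgt.Xmod lin_f f_ract Qmod tgt.Qmod lin_gbar gbar_lact] linD(3)[OF lin_quot_t t(2)]])
  ultimately show ?thesis using hom_cotensor_M(3)[OF t(1)] by simp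
qed

end

theorem theorem12:
  fixes K :: "'k ring"
    and H :: "('k, 'h) hopf_data"
    and V :: "('k, 'h, 'v) lmodcomod"
    and B :: "('k, 'h, 'b) braided_hopf_data"
    and A :: "('k, ('b \<times> 'h \<Rightarrow> 'k) set) hopf_data"
  assumes "field K"
    and "hopf_algebra K H" and "vectorspace.fin_dim K H"
    and "semisimple K H" and "cosemisimple K H"
    and "yd_module K H V"
    and "nichols_algebra K H V B" and "vectorspace.fin_dim K B"
    and "A = bosonisation K H B"
  shows "\<exists>\<Phi> :: ('k, 'h, 'x) rmodcomod \<Rightarrow> ('k, ('b \<times> 'h \<Rightarrow> 'k) set, 'n) lmodcomod
                \<Rightarrow> ('x \<times> 'n \<Rightarrow> 'k) set set \<Rightarrow> ('x \<times> 'n set \<Rightarrow> 'k) set set.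
    (\<forall>X N. right_modcomod K H X \<and> yd_module K A N \<longrightarrow>
       linear_map K (Bit K A (Inf_obj K H B X) N) (Bit K H X (bracket K H B N)) (\<Phi> X N) \<and>
       bij_betw (\<Phi> X N) (carrier (Bit K A (Inf_obj K H B X) N)) (carrier (Bit K H X (bracket K H B N)))) \<and>
    (\<forall>X X' N N' f g.
       right_modcomod K H X \<and> right_modcomod K H X' \<and> right_modcomod_hom K H X X' f \<and>
       yd_module K A N \<and> yd_module K A N' \<and> yd_hom K A N N' g \<longrightarrow>
       (\<forall>u \<in> carrier (Bit K A (Inf_obj K H B X) N).
          \<Phi> X' N' (Bit_map K A (Inf_obj K H B X') N' f g u) =
          Bit_map K H X' (bracket K H B N') f (bracket_map K H B N' g) (\<Phi> X N u)))"
proof -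
  interpret linear_algebra K by (rule linear_algebra.intro[OF assms(1)])
  interpret hopf K H by unfold_locales (rule assms(2))
  interpret boson K H B by unfold_locales (use assms(7) in \<open>simp add: nichols_algebra_def\<close>)
  obtain L where L: "L \<in> carrier H" "\<epsilon> L = \<one>\<^bsub>K\<^esub>" "\<And>h. h \<in> carrier H \<Longrightarrow> h \<otimes>\<^bsub>H\<^esub> L = \<epsilon> h \<odot>\<^bsub>H\<^esub> L"
    by (rule integral_exists[OF assms(4)]) blast
  obtain l where l: "functional H l" "l \<one>\<^bsub>H\<^esub> = \<one>\<^bsub>K\<^esub>"
    "\<And>h. h \<in> carrier H \<Longrightarrow> tlift K H (\<Delta> h) (\<lambda>a b. l b \<odot>\<^bsub>H\<^esub> a) = l h \<odot>\<^bsub>H\<^esub> \<one>\<^bsub>H\<^esub>"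
    by (rule cointegral_exists[OF assms(5)]) blast
  \<comment> \<open>The witness must not depend on the integral or the cointegral in a way that
    varies with the objects; \<open>bit_iso\<close> mentions neither. An existentially bound \<Phi>
    has a single type, so the constant is fixed at the types of \<open>X\<close> and
    \<open>N\<close>, shared by \<open>X'\<close> and \<open>N'\<close>.\<close>
  let ?\<Phi> = "boson_bit.bit_iso K H B :: ('k, 'h, 'x) rmodcomod
    \<Rightarrow> ('k, ('b \<times> 'h \<Rightarrow> 'k) set, 'n) lmodcomod \<Rightarrow> _"
  have bit: "boson_bit K H B X N" if "right_modcomod K H X" "yd_module K A N"
    for X :: "('k, 'h, 'x) rmodcomod" and N :: "('k, ('b \<times> 'h \<Rightarrow> 'k) set, 'n) lmodcomod"
    by unfold_locales (use that assms(9) in simp_all)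
  show ?thesis
  proof (intro exI[of _ ?\<Phi>] conjI allI impI ballI)
    fix X :: "('k, 'h, 'x) rmodcomod" and N :: "('k, ('b \<times> 'h \<Rightarrow> 'k) set, 'n) lmodcomod"
    assume "right_modcomod K H X \<and> yd_module K A N"
    then interpret XN: boson_bit K H B X N using bit by blast
    show "linear_map K (Bit K A (Inf_obj K H B X) N) (Bit K H X (bracket K H B N)) (?\<Phi> X N)"
      unfolding assms(9) by (rule XN.lin_bit_iso[OF L])
    show "bij_betw (?\<Phi> X N) (carrier (Bit K A (Inf_obj K H B X) N)) (carrier (Bit K H X (bracket K H B N)))"
      unfolding assms(9) by (rule XN.bij_bit_iso[OF L l])
  next
    fix X X' :: "('k, 'h, 'x) rmodcomod" and N N' :: "('k, ('b \<times> 'h \<Rightarrow> 'k) set, 'n) lmodcomod" and f g u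
    assume hyp: "right_modcomod K H X \<and> right_modcomod K H X' \<and> right_modcomod_hom K H X X' f \<and>
      yd_module K A N \<and> yd_module K A N' \<and> yd_hom K A N N' g"
      and u: "u \<in> carrier (Bit K A (Inf_obj K H B X) N)"
    interpret XN: boson_bit K H B X N using hyp bit by blast
    interpret XN': boson_bit K H B X' N' using hyp bit by blast
    interpret boson_bit_hom K H B X N X' N' f g
      by unfold_locales (use hyp assms(9) in simp_all)
    show "?\<Phi> X' N' (Bit_map K A (Inf_obj K H B X') N' f g u) =
      Bit_map K H X' (bracket K H B N') f (bracket_map K H B N' g) (?\<Phi> X N u)"
      unfolding assms(9) by (rule bit_iso_natural[OF L u[unfolded assms(9)]])
  qed
qed

end
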